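(* There exists an operator $K$ of order $-1$, in the sense that $$K:H^s(\mathbb{R}^n)\to H^{s+1}(\mathbb{R}^n)\quad\text{for } -1\le s\le 1,$$ such that $$\Pi_P(I+K)A(x,D)w=A_{PP}\,(I+K)w+R_Pw,$$ $$\Pi_S(I+K)A(x,D)w=A_{SS}\,(I+K)w+R_Sw,$$ where $R_P$ and $R_S$ are bounded maps on $L^2(\mathbb{R}^n)$. Additionally, $$K_{PP}=K_{SS}=0,\qquad K_{SP}^*=-K_{PS},$$ where $K_{QQ'}=\Pi_Q\,K\,\Pi_{Q'}$ for $Q,Q'\in\{P,S\}$ and $^*$ denotes the adjoint.
   Context: $L^2(\mathbb{R}^n)$ and $H^s(\mathbb{R}^n)$ denote the $L^2$ space and $L^2$-based Sobolev spaces of complex-valued functions or of $n$-dimensional vector-valued functions; here the operators act on vector-valued functions $w=(w_1,\dots,w_n)$. The Lamé parameter functions $\mu,\lambda$ belong to $C^{1,1}(\mathbb{R}^n)$, in that the first derivatives $\nabla\mu$ and $\nabla\lambda$ are globally bounded, Lipschitz functions on $\mathbb{R}^n$. The elasticity operator is $$(A(x,D)w)_i=\sum_{k=1}^n\Big[\partial_k\bigl(\mu(x)(\partial_kw_i+\partial_iw_k)\bigr)+\partial_i\bigl(\lambda(x)\partial_kw_k\bigr)\Big].$$ The projections $\Pi_P w=\Delta^{-1}\nabla(\mathrm{div}\,w)$ and $\Pi_S=I-\Pi_P$ are the Fourier multipliers with matrix symbols $\xi_i\xi_l/|\xi|^2$ and $\delta_{il}-\xi_i\xi_l/|\xi|^2$,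 respectively. Set $A_{PP}=\Pi_P\,A(x,D)\,\Pi_P$ and $A_{SS}=\Pi_S\,A(x,D)\,\Pi_S$.
   Formalization: Assumes in addition that |λ+μ| is bounded below by a positive constant (the claim fails for n≥2 at points where λ+μ=0 and ∇μ≠0, e.g. λ=−μ with μ=2+sin x₁), and reads C^{1,1} as including that μ and λ are themselves bounded. *)

theory Defs
  imports "HOL-Analysis.Analysis" "HOL-Library.Function_Algebras"
begin

section \<open>Schwartz functions and tempered distributions\<close>

definition pderivative :: "'n::finite \<Rightarrow> (real^'n \<Rightarrow> complex) \<Rightarrow> real^'n \<Rightarrow> complex" where
  "pderivative k f x = frechet_derivative f (at x) (axis k 1)"

definition pderivatives :: "'n::finite list \<Rightarrow> (real^'n \<Rightarrow> complex) \<Rightarrow> real^'n \<Rightarrow> complex" where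
  "pderivatives ks f = foldr pderivative ks f"

definition schwartz :: "(real^'n::finite \<Rightarrow> complex) set" where
  "schwartz = {f. \<forall>ks. pderivatives ks f differentiable_on UNIV \<and>
     (\<forall>N::nat. bounded (range (\<lambda>x. (1 + norm x) ^ N *\<^sub>R pderivatives ks f x)))}"

definition schwartz_norm :: "nat \<Rightarrow> (real^'n::finite \<Rightarrow> complex) \<Rightarrow> real" where
  "schwartz_norm N f =
     (SUP (ks, x) \<in> {ks. length ks \<le> N} \<times> UNIV. (1 + norm x) ^ N * cmod (pderivatives ks f x))"

text \<open>Distributions are functionals on all functions; the value outside \<open>schwartz\<close> is fixed
  to be 0, so that equality of distributions is plain equality, and the pointwise operations of
  \<open>Function_Algebras\<close> are the vector space operations.\<close>

type_synonym 'n distr = "(real^'n \<Rightarrow> complex) \<Rightarrow> complex"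

definition tempered :: "'n::finite distr \<Rightarrow> bool" where
  "tempered T \<longleftrightarrow>
     (\<forall>\<phi>. \<phi> \<notin> schwartz \<longrightarrow> T \<phi> = 0) \<and>
     (\<forall>\<phi>\<in>schwartz. \<forall>\<psi>\<in>schwartz. T (\<lambda>x. \<phi> x + \<psi> x) = T \<phi> + T \<psi>) \<and>
     (\<forall>c. \<forall>\<phi>\<in>schwartz. T (\<lambda>x. c * \<phi> x) = c * T \<phi>) \<and>
     (\<exists>C N. \<forall>\<phi>\<in>schwartz. cmod (T \<phi>) \<le> C * schwartz_norm N \<phi>)"

definition represents :: "(real^'n::finite \<Rightarrow> complex) \<Rightarrow> 'n distr \<Rightarrow> bool" where
  "represents f T \<longleftrightarrow> f \<in> borel_measurable lborel \<and>
     (\<forall>\<phi>\<in>schwartz. integrable lborel (\<lambda>x. f x * \<phi> x) \<and> T \<phi> = (LINT x|lborel. f x * \<phi> x))"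

definition distr_of :: "(real^'n::finite \<Rightarrow> complex) \<Rightarrow> 'n distr" where
  "distr_of f = (\<lambda>\<phi>. if \<phi> \<in> schwartz then LINT x|lborel. f x * \<phi> x else 0)"

text \<open>The density of a regular distribution; unique up to a null set.\<close>

definition density_of :: "'n::finite distr \<Rightarrow> real^'n \<Rightarrow> complex" where
  "density_of T = (SOME f. represents f T)"

definition distr_deriv :: "'n::finite \<Rightarrow> 'n distr \<Rightarrow> 'n distr" where
  "distr_deriv k T = (\<lambda>\<phi>. if \<phi> \<in> schwartz then - T (pderivative k \<phi>) else 0)"

text \<open>Multiplication by a function, meaningful for regular distributions only.\<close>

definition distr_mult :: "(real^'n::finite \<Rightarrow> real) \<Rightarrow> 'n distr \<Rightarrow> 'n distr" where
  "distr_mult m T = distr_of (\<lambda>x. complex_of_real (m x) * density_of T x)"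


section \<open>Fourier transform\<close>

definition fourier :: "(real^'n::finite \<Rightarrow> complex) \<Rightarrow> real^'n \<Rightarrow> complex" where
  "fourier f \<xi> = (LINT x|lborel. exp (- \<i> * complex_of_real (x \<bullet> \<xi>)) * f x)"

definition inv_fourier :: "(real^'n::finite \<Rightarrow> complex) \<Rightarrow> real^'n \<Rightarrow> complex" where
  "inv_fourier f x =
     (LINT \<xi>|lborel. exp (\<i> * complex_of_real (x \<bullet> \<xi>)) * f \<xi>) / (2 * complex_of_real pi) ^ CARD('n)"

definition distr_fourier :: "'n::finite distr \<Rightarrow> 'n distr" where
  "distr_fourier T = (\<lambda>\<phi>. if \<phi> \<in> schwartz then T (fourier \<phi>) else 0)"

definition distr_inv_fourier :: "'n::finite distr \<Rightarrow> 'n distr" where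
  "distr_inv_fourier T = (\<lambda>\<phi>. if \<phi> \<in> schwartz then T (inv_fourier \<phi>) else 0)"

definition fourier_density :: "'n::finite distr \<Rightarrow> real^'n \<Rightarrow> complex" where
  "fourier_density T = density_of (distr_fourier T)"


section \<open>Vector-valued $L^2$ and Sobolev spaces\<close>

definition L2 :: "('n::finite distr ^ 'n) set" where
  "L2 = {w. \<forall>i. \<exists>f. f \<in> borel_measurable lborel \<and>
     integrable lborel (\<lambda>x. (cmod (f x))\<^sup>2) \<and> w $ i = distr_of f}"

definition L2_inner :: "'n::finite distr ^ 'n \<Rightarrow> 'n distr ^ 'n \<Rightarrow> complex" where
  "L2_inner v w = (\<Sum>i\<in>UNIV. LINT x|lborel. density_of (v $ i) x * cnj (density_of (w $ i) x))"

definition L2_norm :: "'n::finite distr ^ 'n \<Rightarrow> real" where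
  "L2_norm w = sqrt (\<Sum>i\<in>UNIV. LINT x|lborel. (cmod (density_of (w $ i) x))\<^sup>2)"

definition Sobolev :: "real \<Rightarrow> ('n::finite distr ^ 'n) set" where
  "Sobolev s = {w. \<forall>i. tempered (w $ i) \<and>
     (\<exists>g. represents g (distr_fourier (w $ i)) \<and>
          integrable lborel (\<lambda>\<xi>. (1 + (norm \<xi>)\<^sup>2) powr s * (cmod (g \<xi>))\<^sup>2))}"

definition Sobolev_norm :: "real \<Rightarrow> 'n::finite distr ^ 'n \<Rightarrow> real" where
  "Sobolev_norm s w = sqrt (\<Sum>i\<in>UNIV.
     LINT \<xi>|lborel. (1 + (norm \<xi>)\<^sup>2) powr s * (cmod (fourier_density (w $ i) \<xi>))\<^sup>2)"

definition distr_scale :: "complex \<Rightarrow> 'n::finite distr ^ 'n \<Rightarrow> 'n distr ^ 'n" where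
  "distr_scale c w = (\<chi> i. (\<lambda>\<phi>. c * (w $ i) \<phi>))"

definition bounded_operator ::
  "('n::finite distr ^ 'n) set \<Rightarrow> ('n distr ^ 'n \<Rightarrow> real) \<Rightarrow>
   ('n distr ^ 'n) set \<Rightarrow> ('n distr ^ 'n \<Rightarrow> real) \<Rightarrow>
   ('n distr ^ 'n \<Rightarrow> 'n distr ^ 'n) \<Rightarrow> bool" where
  "bounded_operator X normX Y normY T \<longleftrightarrow>
     T ` X \<subseteq> Y \<and>
     (\<forall>v\<in>X. \<forall>w\<in>X. T (v + w) = T v + T w) \<and>
     (\<forall>c. \<forall>w\<in>X. T (distr_scale c w) = distr_scale c (T w)) \<and>
     (\<exists>C. \<forall>w\<in>X. normY (T w) \<le> C * normX w)"

text \<open>\<open>is_L2_adjoint S T\<close> says that \<open>S\<close> is the adjoint of \<open>T\<close>.\<close>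

definition is_L2_adjoint ::
  "('n::finite distr ^ 'n \<Rightarrow> 'n distr ^ 'n) \<Rightarrow> ('n distr ^ 'n \<Rightarrow> 'n distr ^ 'n) \<Rightarrow> bool" where
  "is_L2_adjoint S T \<longleftrightarrow>
     bounded_operator L2 L2_norm L2 L2_norm S \<and> bounded_operator L2 L2_norm L2 L2_norm T \<and>
     (\<forall>v\<in>L2. \<forall>w\<in>L2. L2_inner (T v) w = L2_inner v (S w))"


section \<open>Projections and the elasticity operator\<close>

definition fourier_multiplier ::
  "(real^'n::finite \<Rightarrow> complex^'n^'n) \<Rightarrow> 'n distr ^ 'n \<Rightarrow> 'n distr ^ 'n" where
  "fourier_multiplier m w = (\<chi> i. distr_inv_fourier
     (distr_of (\<lambda>\<xi>. (m \<xi> *v (\<chi> l. fourier_density (w $ l) \<xi>)) $ i)))"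

definition proj_P :: "'n::finite distr ^ 'n \<Rightarrow> 'n distr ^ 'n" where
  "proj_P = fourier_multiplier
     (\<lambda>\<xi>. \<chi> i l. complex_of_real (\<xi> $ i * \<xi> $ l / (norm \<xi>)\<^sup>2))"

definition proj_S :: "'n::finite distr ^ 'n \<Rightarrow> 'n distr ^ 'n" where
  "proj_S w = w - proj_P w"

definition C11 :: "(real^'n::finite \<Rightarrow> real) \<Rightarrow> bool" where
  "C11 m \<longleftrightarrow> bounded (range m) \<and>
     (\<exists>g. (\<forall>x. GDERIV m x :> g x) \<and> bounded (range g) \<and> (\<exists>L. L-lipschitz_on UNIV g))"

text \<open>Meaningful for \<open>w \<in> Sobolev 1\<close>: only then are the first derivatives of \<open>w\<close>
  guaranteed to be functions.\<close>

definition elasticity ::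
  "(real^'n::finite \<Rightarrow> real) \<Rightarrow> (real^'n \<Rightarrow> real) \<Rightarrow> 'n distr ^ 'n \<Rightarrow> 'n distr ^ 'n" where
  "elasticity mu lam w = (\<chi> i. \<Sum>k\<in>UNIV.
     distr_deriv k (distr_mult mu (distr_deriv k (w $ i) + distr_deriv i (w $ k))) +
     distr_deriv i (distr_mult lam (distr_deriv k (w $ k))))"

definition elasticity_PP ::
  "(real^'n::finite \<Rightarrow> real) \<Rightarrow> (real^'n \<Rightarrow> real) \<Rightarrow> 'n distr ^ 'n \<Rightarrow> 'n distr ^ 'n" where
  "elasticity_PP mu lam w = proj_P (elasticity mu lam (proj_P w))"

definition elasticity_SS ::
  "(real^'n::finite \<Rightarrow> real) \<Rightarrow> (real^'n \<Rightarrow> real) \<Rightarrow> 'n distr ^ 'n \<Rightarrow> 'n distr ^ 'n" where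
  "elasticity_SS mu lam w = proj_S (elasticity mu lam (proj_S w))"

end

theory Submission
  imports Defs "HOL-Probability.Sinc_Integral" "HOL-Probability.Characteristic_Functions"
begin

text \<open>The statement is proved in Fourier coordinates by Hilbert space methods. Let
  \<open>J = (1 - \<Delta>)\<^sup>-\<^sup>1\<^sup>/\<^sup>2\<close>, \<open>R\<^sub>k = \<partial>\<^sub>k J\<close> and let \<open>M\<^sub>f\<close> be the multiplication by \<open>f\<close>; all of these are
  bounded on the scalar space \<open>L\<^sup>2\<close>. A vector field in \<open>H\<^sup>s\<close> is \<open>J\<^sup>s u\<close> with a unique \<open>u \<in> L\<^sup>2\<close>
  (\<open>Sobolev_eq\<close>), and in this parametrisation the elasticity operator from \<open>H\<^sup>1\<close> to \<open>H\<^sup>-\<^sup>1\<close>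
  becomes the matrix \<open>J A J\<close> of bounded operators with entries
  \<open>\<delta>\<^sub>i\<^sub>l \<Sum>\<^sub>k R\<^sub>k \<mu> R\<^sub>k + R\<^sub>l \<mu> R\<^sub>i + R\<^sub>i \<lambda> R\<^sub>l\<close> (\<open>elasticity_Phi\<close>). An error of the form \<open>J B J\<close> with
  bounded \<open>B\<close> is an operator bounded on \<open>L\<^sup>2\<close> in the original coordinates. The whole theorem is
  thereby a statement about matrices over a ring of bounded operators.

  Decoupling. The divergence vanishes on the range of \<open>S\<close>, so one derivative always falls on
  \<open>\<mu>\<close> in the off-diagonal block, and \<open>P A S\<close> is of first order, in these
  coordinates \<open>2 P J (b R) S\<close> with \<open>b = \<nabla>\<mu>\<close> (\<open>Pm_Am_Sm\<close>). A block \<open>K = P k S\<close> has to satisfy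
  \<open>P A S + K A - A K \<approx> 0\<close>. The symbols of \<open>A\<close> on the two subspaces are \<open>-\<mu>|\<xi>|\<^sup>2\<close> and
  \<open>-(\<lambda> + 2\<mu>)|\<xi>|\<^sup>2\<close>, their difference is \<open>(\<lambda> + \<mu>)|\<xi>|\<^sup>2\<close>, and so the principal part of \<open>k\<close> is
  \<open>-2 a\<^sub>m \<partial>\<^sub>j (1 - \<Delta>)\<^sup>-\<^sup>1\<close> with \<open>a = \<nabla>\<mu> / (\<lambda> + \<mu>)\<close>; here the lower bound on \<open>|\<lambda> + \<mu>|\<close> enters
  (\<open>decoupling\<close>).

  Limited regularity. The function \<open>a\<close> is only Lipschitz, so that there is no symbol calculus at
  hand, and \<open>K\<close> should gain a derivative on \<open>H\<^sup>s\<close> for all \<open>-1 \<le> s \<le> 1\<close>. Two facts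
  replace the calculus. First, \<open>R\<^sub>k M\<^sub>f J - J M\<^sub>f R\<^sub>k = J C J\<close> with a bounded \<open>C\<close> whenever
  \<open>f\<close> is bounded and Lipschitz; this is read off from difference quotients
  (\<open>lipschitz_commutator\<close>). Second, the coefficient \<open>a\<close> has to stand on the left when \<open>K\<close>
  acts on \<open>H\<^sup>-\<^sup>1\<close> and on the right when it acts on \<open>H\<^sup>0\<close>: matrices \<open>k1\<close>, \<open>k2\<close> with
  \<open>k1 J = J k2\<close> are needed. Put \<open>k1 = -2 a R - W J\<close> and \<open>k2 = -2 R a + J W\<close>. The requirement is
  then the Lyapunov equation \<open>J\<^sup>2 W + W J\<^sup>2 = 2 (J R a - a R J)\<close>, whose right-hand side is
  \<open>J V J\<close> with a bounded \<open>V\<close> by the commutator identity (\<open>JVJ\<close>), and it has a bounded solution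
  because \<open>J\<close> is a positive multiplication operator (\<open>lyapunov\<close>). The endpoint
  \<open>s = 1\<close> uses the commutator identity once more (\<open>K1_smoothing\<close>), and
  the other exponents follow from a Heinz type interpolation, which is again a consequence of the
  Lyapunov equation (\<open>interpolation\<close>).

  Duality. \<open>A\<close> is symmetric and \<open>P\<close>, \<open>S\<close> are orthogonal projections, hence the adjoint of the
  decoupling identity is the identity for the other off-diagonal block, with \<open>K\<^sub>S\<^sub>P\<close> the negative
  adjoint of \<open>K\<^sub>P\<^sub>S\<close> (\<open>Sm_error\<close>). The sum of the two blocks is the operator \<open>K\<close>.

  The analysis underneath is elementary: completeness of \<open>L\<^sup>2\<close> and the Riesz representation, from which
  adjoints and all operators given by forms are obtained, and Fourier inversion and the Plancherel
  theorem for Schwartz functions, which extend by duality to the unitary Fourier transform.\<close>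

section \<open>Riesz representation\<close>

text \<open>The first order condition at a minimum, where \<open>d\<close> is the first variation.\<close>

lemma quadratic_nonneg_zero:
  assumes "\<And>t::real. 0 \<le> t * d + t\<^sup>2 * s"
  shows "d = 0"
proof -
  \<comment> \<open>the step \<open>t = - d e\<close> is small enough for the quadratic term to be harmless\<close>
  define e where "e = 1 / (\<bar>s\<bar> + 1)"
  have e: "0 < e" "e * s < 1" by (auto simp: e_def divide_less_eq)
  have "0 \<le> - (d\<^sup>2 * (e * (1 - e * s)))"
    using assms[of "- d * e"] by (simp add: power2_eq_square algebra_simps)
  moreover have "0 < e * (1 - e * s)" using e by simp
  ultimately have "d\<^sup>2 \<le> 0" using e by (auto simp: mult_le_0_iff)
  then show ?thesis by simp
qed

text \<open>A minimising sequence in \<open>V\<close> for \<open>|x|\<^sup>2 / 2 - f x\<close> is Cauchy by the parallelogram law, and its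
  limit in the ambient complete space represents \<open>f\<close> on \<open>V\<close>. Functionals that are defined on
  a dense subspace, such as that of the Schwartz functions, are represented in this way.\<close>

lemma riesz_subspace:
  fixes f :: "'a::{real_inner,complete_space} \<Rightarrow> real"
  assumes V: "subspace V"
    and add: "\<And>x y. x \<in> V \<Longrightarrow> y \<in> V \<Longrightarrow> f (x + y) = f x + f y"
    and scale: "\<And>c x. x \<in> V \<Longrightarrow> f (c *\<^sub>R x) = c * f x"
    and bd: "\<And>x. x \<in> V \<Longrightarrow> \<bar>f x\<bar> \<le> \<kappa> * norm x"
    and "0 \<le> \<kappa>"
  obtains z where "\<And>x. x \<in> V \<Longrightarrow> z \<bullet> x = f x" "norm z \<le> \<kappa>"
proof -
  define \<Phi> where "\<Phi> x = (norm x)\<^sup>2 / 2 - f x" for x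
  have low: "- (\<kappa>\<^sup>2 / 2) \<le> \<Phi> x" if "x \<in> V" for x
  proof -
    have "f x \<le> \<kappa> * norm x" using bd[OF that] by linarith
    moreover have "0 \<le> (\<kappa> - norm x)\<^sup>2" by simp
    ultimately show ?thesis by (simp add: \<Phi>_def power2_diff field_simps)
  qed
  define m where "m = Inf (\<Phi> ` V)"
  have V0: "0 \<in> V" using V by (simp add: subspace_0)
  have bdd: "bdd_below (\<Phi> ` V)" using low by (auto intro!: bdd_belowI2)
  have m: "m \<le> \<Phi> x" if "x \<in> V" for x
    unfolding m_def using that bdd by (auto intro: cInf_lower)
  have "\<exists>x\<in>V. \<Phi> x < m + 1 / Suc n" for n
    using cInf_lessD[of "\<Phi> ` V" "m + 1 / Suc n"] V0 by (auto simp: m_def)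
  then obtain X where XV: "\<And>n. X n \<in> V" and X: "\<And>n. \<Phi> (X n) < m + 1 / Suc n" by metis
  have par: "(norm (x - y))\<^sup>2 / 4 = \<Phi> x + \<Phi> y - 2 * \<Phi> ((1/2) *\<^sub>R (x + y))" if "x \<in> V" "y \<in> V" for x y
  proof -
    have "f ((1/2) *\<^sub>R (x + y)) = (f x + f y) / 2"
      using that by (simp only: scale subspace_add[OF V] add)
    moreover have "(norm ((1/2) *\<^sub>R (x + y)))\<^sup>2 = ((norm x)\<^sup>2 + 2 * (x \<bullet> y) + (norm y)\<^sup>2) / 4"
      by (simp only: power2_norm_eq_inner inner_scaleR_left inner_scaleR_right inner_add)
        (simp add: inner_commute field_simps)
    moreover have "(norm (x - y))\<^sup>2 = (norm x)\<^sup>2 - 2 * (x \<bullet> y) + (norm y)\<^sup>2"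
      by (simp add: power2_norm_eq_inner inner_diff inner_commute)
    ultimately show ?thesis by (simp add: \<Phi>_def)
  qed
  have dist: "(norm (X n - X k))\<^sup>2 \<le> 4 * (1 / Suc n + 1 / Suc k)" for n k
  proof -
    have "m \<le> \<Phi> ((1/2) *\<^sub>R (X n + X k))"
      by (intro m subspace_scale[OF V] subspace_add[OF V] XV)
    moreover have "N \<le> 4 * (p + q)" if "N / 4 = A + B - 2 * C" "A < m + p" "B < m + q" "m \<le> C"
      for N A B C p q :: real using that by simp
    ultimately show ?thesis using par[OF XV[of n] XV[of k]] X[of n] X[of k] by blast
  qed
  have "Cauchy X"
  proof (rule metric_CauchyI)
    fix e :: real assume "0 < e"
    then obtain N where N: "8 / e\<^sup>2 < real N" using reals_Archimedean2 by blast
    have "dist (X i) (X k) < e" if "i \<ge> N" "k \<ge> N" for i k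
    proof -
      have "0 < real N" using N \<open>0 < e\<close> by (smt (verit) divide_nonneg_nonneg zero_le_power2)
      have "1 / Suc i + 1 / Suc k < 1 / N + 1 / real N"
        using that \<open>0 < real N\<close> by (intro add_strict_mono divide_strict_left_mono) auto
      then have "4 * (1 / Suc i + 1 / Suc k) < 8 / real N" by simp
      also have "\<dots> < e\<^sup>2" using N \<open>0 < e\<close> \<open>0 < real N\<close> by (simp add: field_simps)
      finally have "(norm (X i - X k))\<^sup>2 < e\<^sup>2" using dist[of i k] by linarith
      then show ?thesis using \<open>0 < e\<close> by (simp add: dist_norm power2_less_imp_less)
    qed
    then show "\<exists>M. \<forall>m\<ge>M. \<forall>n\<ge>M. dist (X m) (X n) < e" by blast
  qed
  then obtain z where z: "X \<longlonglongrightarrow> z" using Cauchy_convergent convergent_def by blast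
  have zv: "z \<bullet> v = f v" if v: "v \<in> V" for v
  proof -
    have "0 \<le> 1 / Suc n + t * (X n \<bullet> v - f v) + t\<^sup>2 * (norm v)\<^sup>2 / 2" for t n
    proof -
      have "m \<le> \<Phi> (X n + t *\<^sub>R v)" by (intro m subspace_scale[OF V] subspace_add[OF V] XV v)
      also have "\<dots> = \<Phi> (X n) + t * (X n \<bullet> v - f v) + t\<^sup>2 * (norm v)\<^sup>2 / 2"
      proof -
        have "f (X n + t *\<^sub>R v) = f (X n) + t * f v"
          using v XV[of n] by (simp only: add scale subspace_scale[OF V])
        moreover have "(norm (X n + t *\<^sub>R v))\<^sup>2 = (norm (X n))\<^sup>2 + 2 * t * (X n \<bullet> v) + t\<^sup>2 * (norm v)\<^sup>2"
          unfolding power2_norm_eq_inner by (simp add: inner_add inner_commute power2_eq_square algebra_simps)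
        ultimately show ?thesis by (simp add: \<Phi>_def algebra_simps)
      qed
      finally show ?thesis using X[of n] by linarith
    qed
    note pos = this
    have lim: "(\<lambda>n. 1 / Suc n + t * (X n \<bullet> v - f v) + t\<^sup>2 * (norm v)\<^sup>2 / 2)
        \<longlonglongrightarrow> 0 + t * (z \<bullet> v - f v) + t\<^sup>2 * (norm v)\<^sup>2 / 2" for t
      using LIMSEQ_inverse_real_of_nat unfolding inverse_eq_divide
      by (intro tendsto_add tendsto_mult tendsto_diff tendsto_inner z tendsto_const)
    have "0 \<le> t * (z \<bullet> v - f v) + t\<^sup>2 * ((norm v)\<^sup>2 / 2)" for t
      using LIMSEQ_le_const[OF lim[of t], of 0] pos by auto
    then have "z \<bullet> v - f v = 0" by (rule quadratic_nonneg_zero)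
    then show ?thesis by simp
  qed
  have "norm z \<le> \<kappa>"
  proof -
    have "z \<bullet> X n \<le> \<kappa> * norm (X n)" for n using zv[OF XV[of n]] bd[OF XV[of n]] by linarith
    moreover have "(\<lambda>n. z \<bullet> X n) \<longlonglongrightarrow> z \<bullet> z" "(\<lambda>n. \<kappa> * norm (X n)) \<longlonglongrightarrow> \<kappa> * norm z"
      by (intro tendsto_intros z)+
    ultimately have "z \<bullet> z \<le> \<kappa> * norm z" by (intro LIMSEQ_le) auto
    then have "norm z * norm z \<le> \<kappa> * norm z" by (simp add: dot_square_norm power2_eq_square)
    then show ?thesis using \<open>0 \<le> \<kappa>\<close> by (cases "z = 0") auto
  qed
  with zv show ?thesis by (rule that)
qed

section \<open>The space of square integrable functions\<close>

definition sqint :: "('a::euclidean_space \<Rightarrow> complex) \<Rightarrow> bool" where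
  "sqint f \<longleftrightarrow> f \<in> borel_measurable lborel \<and> integrable lborel (\<lambda>x. (cmod (f x))\<^sup>2)"

lemma sqint_meas: "sqint f \<Longrightarrow> f \<in> borel_measurable borel"
  by (simp add: sqint_def)

lemma sqint_bound:
  assumes "sqint f" "g \<in> borel_measurable borel" "\<And>x. cmod (g x) \<le> c * cmod (f x)"
  shows "sqint g"
proof -
  have "integrable lborel (\<lambda>x. (cmod (g x))\<^sup>2)"
  proof (rule Bochner_Integration.integrable_bound)
    show "integrable lborel (\<lambda>x. c\<^sup>2 * (cmod (f x))\<^sup>2)"
      using assms by (simp add: sqint_def)
    show "AE x in lborel. norm ((cmod (g x))\<^sup>2) \<le> norm (c\<^sup>2 * (cmod (f x))\<^sup>2)"
      using power_mono[OF assms(3), where n=2] by (auto simp: power_mult_distrib)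
  qed (use assms in measurable)
  then show ?thesis using assms by (simp add: sqint_def)
qed

lemma sqint_cong_AE:
  assumes "sqint f" "g \<in> borel_measurable borel" "AE x in lborel. f x = g x"
  shows "sqint g"
proof -
  have "integrable lborel (\<lambda>x. (cmod (f x))\<^sup>2) \<longleftrightarrow> integrable lborel (\<lambda>x. (cmod (g x))\<^sup>2)"
    using assms by (intro integrable_cong_AE) (auto simp: sqint_def)
  then show ?thesis using assms by (simp add: sqint_def)
qed

lemma sqint_zero [simp]: "sqint (\<lambda>x. 0)" by (simp add: sqint_def)

lemma sqint_cmul [intro]: "sqint f \<Longrightarrow> sqint (\<lambda>x. c * f x)"
  by (rule sqint_bound[of f _ "cmod c"]) (auto simp: norm_mult dest: sqint_meas)

lemma sqint_add [intro]:
  assumes "sqint f" "sqint g" shows "sqint (\<lambda>x. f x + g x)"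
proof -
  have "integrable lborel (\<lambda>x. (cmod (f x + g x))\<^sup>2)"
  proof (rule Bochner_Integration.integrable_bound)
    show "integrable lborel (\<lambda>x. 2 * (cmod (f x))\<^sup>2 + 2 * (cmod (g x))\<^sup>2)"
      using assms by (auto simp: sqint_def)
    have "(cmod (f x + g x))\<^sup>2 \<le> 2 * (cmod (f x))\<^sup>2 + 2 * (cmod (g x))\<^sup>2" for x
    proof -
      have "(cmod (f x + g x))\<^sup>2 \<le> (cmod (f x) + cmod (g x))\<^sup>2"
        by (intro power_mono norm_triangle_ineq) auto
      also have "\<dots> \<le> 2 * (cmod (f x))\<^sup>2 + 2 * (cmod (g x))\<^sup>2"
        using sum_squares_bound[of "cmod (f x)" "cmod (g x)"] by (simp add: power2_sum)
      finally show ?thesis .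
    qed
    then show "AE x in lborel. norm ((cmod (f x + g x))\<^sup>2) \<le> norm (2 * (cmod (f x))\<^sup>2 + 2 * (cmod (g x))\<^sup>2)"
      by auto
  qed (use assms in \<open>auto simp: sqint_def\<close>)
  then show ?thesis using assms by (auto simp: sqint_def)
qed

lemma sqint_diff [intro]: "sqint f \<Longrightarrow> sqint g \<Longrightarrow> sqint (\<lambda>x. f x - g x)"
  using sqint_add[of f "\<lambda>x. (-1) * g x"] sqint_cmul[of g "-1"] by simp

lemma sqint_mult_integrable:
  assumes "sqint f" "sqint g" shows "integrable lborel (\<lambda>x. f x * g x)"
proof (rule Bochner_Integration.integrable_bound)
  show "integrable lborel (\<lambda>x. (cmod (f x))\<^sup>2 + (cmod (g x))\<^sup>2)"
    using assms by (auto simp: sqint_def)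
  have "cmod (f x) * cmod (g x) \<le> (cmod (f x))\<^sup>2 + (cmod (g x))\<^sup>2" for x
    using sum_squares_bound[of "cmod (f x)" "cmod (g x)"] mult_nonneg_nonneg[of "cmod (f x)" "cmod (g x)"]
    by (simp del: mult_nonneg_nonneg)
  then show "AE x in lborel. norm (f x * g x) \<le> norm ((cmod (f x))\<^sup>2 + (cmod (g x))\<^sup>2)"
    by (auto simp: norm_mult)
qed (use assms in \<open>auto simp: sqint_def\<close>)

lemma borel_measurable_cnj [measurable (raw)]:
  "f \<in> borel_measurable M \<Longrightarrow> (\<lambda>x. cnj (f x)) \<in> borel_measurable M"
  by (rule measurable_compose[OF _ borel_measurable_continuous_onI])
    (auto intro: linear_continuous_on bounded_linear_cnj)

lemma sqint_cnj [intro]: "sqint f \<Longrightarrow> sqint (\<lambda>x. cnj (f x))"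
  using sqint_meas[of f] by (intro sqint_bound[of f "\<lambda>x. cnj (f x)" 1]) auto

text \<open>Each class of functions that agree almost everywhere has a chosen measurable representative, so that
  equality in the type \<open>l2\<close> below is equality almost everywhere.\<close>

definition normal_form :: "('a::euclidean_space \<Rightarrow> complex) \<Rightarrow> 'a \<Rightarrow> complex" where
  "normal_form f = (SOME g. g \<in> borel_measurable borel \<and> (AE x in lborel. g x = f x))"

lemma normal_form:
  assumes "f \<in> borel_measurable borel"
  shows "normal_form f \<in> borel_measurable borel" "AE x in lborel. normal_form f x = f x"
proof -
  have "\<exists>g. g \<in> borel_measurable borel \<and> (AE x in lborel. g x = f x)"
    using assms by (intro exI[of _ f]) auto
  from someI_ex[OF this] show "normal_form f \<in> borel_measurable borel" "AE x in lborel. normal_form f x = f x"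
    by (auto simp: normal_form_def)
qed

lemma normal_form_cong: "AE x in lborel. f x = g x \<Longrightarrow> normal_form f = normal_form g"
proof -
  assume fg: "AE x in lborel. f x = g x"
  have "(AE x in lborel. h x = f x) \<longleftrightarrow> (AE x in lborel. h x = g x)" for h
  proof
    assume "AE x in lborel. h x = f x" then show "AE x in lborel. h x = g x" using fg by eventually_elim simp
  next
    assume "AE x in lborel. h x = g x" then show "AE x in lborel. h x = f x" using fg by eventually_elim simp
  qed
  then show ?thesis by (simp add: normal_form_def)
qed

typedef (overloaded) 'a l2 = "{f :: 'a::euclidean_space \<Rightarrow> complex. sqint f \<and> normal_form f = f}"
  morphisms fn abs_l2
proof -
  have "sqint (normal_form (\<lambda>x::'a. 0))"
  proof (rule sqint_cong_AE[OF sqint_zero])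
    show "AE x in lborel. 0 = normal_form (\<lambda>x::'a. 0) x"
      using normal_form(2)[of "\<lambda>x::'a. 0"] by (auto elim: eventually_mono)
  qed (simp add: normal_form)
  moreover have "normal_form (normal_form (\<lambda>x::'a. 0)) = normal_form (\<lambda>x::'a. 0)"
    by (rule normal_form_cong) (simp add: normal_form)
  ultimately show ?thesis by blast
qed

definition cls :: "('a::euclidean_space \<Rightarrow> complex) \<Rightarrow> 'a l2" where
  "cls f = abs_l2 (normal_form f)"

lemma sqint_fn [simp, intro]: "sqint (fn u)"
  using fn[of u] by auto

lemma fn_measurable [measurable]: "fn u \<in> borel_measurable borel"
  using sqint_fn sqint_meas by blast

lemma fn_cls: "sqint f \<Longrightarrow> AE x in lborel. fn (cls f) x = f x"
proof -
  assume f: "sqint f"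
  note n = normal_form[OF sqint_meas[OF f]]
  have "sqint (normal_form f)"
  proof (rule sqint_cong_AE[OF f n(1)])
    show "AE x in lborel. f x = normal_form f x" using n(2) by eventually_elim simp
  qed
  moreover have "normal_form (normal_form f) = normal_form f"
    by (rule normal_form_cong) (rule n)
  ultimately show ?thesis using n by (simp add: cls_def abs_l2_inverse)
qed

lemma cls_fn [simp]: "cls (fn u) = u"
  using fn[of u] by (simp add: cls_def fn_inverse)

lemma cls_cong: "AE x in lborel. f x = g x \<Longrightarrow> cls f = cls g"
  unfolding cls_def by (simp add: normal_form_cong)

lemma l2_eqI: "AE x in lborel. fn u x = fn v x \<Longrightarrow> u = v"
  by (metis cls_cong cls_fn)

instantiation l2 :: (euclidean_space) real_vector
begin
definition "0 = cls (\<lambda>x. 0)"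
definition "u + v = cls (\<lambda>x. fn u x + fn v x)"
definition "u - v = cls (\<lambda>x. fn u x - fn v x)"
definition "- u = cls (\<lambda>x. - fn u x)"
definition "r *\<^sub>R u = cls (\<lambda>x. r *\<^sub>R fn u x)"

lemma sqint_uminus: "sqint f \<Longrightarrow> sqint (\<lambda>x. - f x)"
  using sqint_cmul[of f "-1"] by simp

lemma sqint_scaleR: "sqint f \<Longrightarrow> sqint (\<lambda>x. r *\<^sub>R f x)"
  using sqint_cmul[of f "complex_of_real r"] by (simp add: scaleR_conv_of_real)

lemma fn_zero: "AE x in lborel. fn (0 :: 'a l2) x = 0"
  unfolding zero_l2_def by (intro fn_cls) simp
lemma fn_add: "AE x in lborel. fn (u + v) x = fn u x + fn v x"
  unfolding plus_l2_def by (intro fn_cls sqint_add) simp_all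
lemma fn_diff: "AE x in lborel. fn (u - v) x = fn u x - fn v x"
  unfolding minus_l2_def by (intro fn_cls sqint_diff) simp_all
lemma fn_uminus: "AE x in lborel. fn (- u) x = - fn u x"
  unfolding uminus_l2_def by (intro fn_cls sqint_uminus) simp_all
lemma fn_scaleR: "AE x in lborel. fn (r *\<^sub>R u) x = r *\<^sub>R fn u x"
  unfolding scaleR_l2_def by (intro fn_cls sqint_scaleR) simp_all

instance
proof
  fix a b :: real and u v w :: "'a l2"
  show "u + v + w = u + (v + w)"
    
    by (rule l2_eqI, use fn_add[of "u + v" w] fn_add[of u v] fn_add[of u "v + w"] fn_add[of v w] in eventually_elim, simp)
  show "u + v = v + u" by (simp add: plus_l2_def add.commute)
  show "0 + u = u" by (rule l2_eqI, use fn_add[of 0 u] fn_zero in eventually_elim, simp)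
  show "- u + u = 0" 
    by (rule l2_eqI, use fn_add[of "-u" u] fn_zero fn_uminus[of u] in eventually_elim, simp)
  show "u - v = u + - v" 
    by (rule l2_eqI, use fn_add[of u "-v"] fn_diff[of u v] fn_uminus[of v] in eventually_elim, simp)
  show "a *\<^sub>R (u + v) = a *\<^sub>R u + a *\<^sub>R v"
    
    by (rule l2_eqI, use fn_add[of u v] fn_scaleR[of a "u + v"] fn_scaleR[of a u] fn_scaleR[of a v] fn_add[of "a *\<^sub>R u" "a *\<^sub>R v"] in eventually_elim, simp add: algebra_simps)
  show "(a + b) *\<^sub>R u = a *\<^sub>R u + b *\<^sub>R u"
    
    by (rule l2_eqI, use fn_scaleR[of "a + b" u] fn_scaleR[of a u] fn_scaleR[of b u] fn_add[of "a *\<^sub>R u" "b *\<^sub>R u"] in eventually_elim, simp add: algebra_simps)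
  show "a *\<^sub>R b *\<^sub>R u = (a * b) *\<^sub>R u"
    
    by (rule l2_eqI, use fn_scaleR[of "a * b" u] fn_scaleR[of a "b *\<^sub>R u"] fn_scaleR[of b u] in eventually_elim, simp)
  show "1 *\<^sub>R u = u" 
    by (rule l2_eqI, use fn_scaleR[of 1 u] in eventually_elim, simp)
qed
end

lemma cls_add: "sqint f \<Longrightarrow> sqint g \<Longrightarrow> cls (\<lambda>x. f x + g x) = cls f + cls g"
proof -
  assume f: "sqint f" and g: "sqint g"
  show ?thesis unfolding plus_l2_def
    by (rule cls_cong, use fn_cls[OF f] fn_cls[OF g] in eventually_elim, simp)
qed

lemma sqint_inner_integrable: "sqint f \<Longrightarrow> sqint g \<Longrightarrow> integrable lborel (\<lambda>x. f x \<bullet> g x)"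
proof -
  assume "sqint f" "sqint g"
  then have "integrable lborel (\<lambda>x. Re (f x * cnj (g x)))"
    by (intro integrable_Re sqint_mult_integrable sqint_cnj)
  then show ?thesis by (simp add: inner_complex_def)
qed

instantiation l2 :: (euclidean_space) real_inner
begin
definition "inner u v = (LINT x|lborel. fn u x \<bullet> fn v x)"
definition "norm u = sqrt (inner u (u :: 'a l2))"
definition "sgn u = u /\<^sub>R norm (u :: 'a l2)"
definition "dist u v = norm (u - v :: 'a l2)"
definition [code del]: "uniformity = (INF e\<in>{0 <..}. principal {(x::'a l2, y). dist x y < e})"
definition [code del]: "open (U :: 'a l2 set) \<longleftrightarrow> (\<forall>x\<in>U. eventually (\<lambda>(x', y). x' = x \<longrightarrow> y \<in> U) uniformity)"

instance
proof
  fix r :: real and u v w :: "'a l2"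
  show "inner u v = inner v u" by (simp add: inner_l2_def inner_commute)
  have "inner (u + v) w = (LINT x|lborel. fn u x \<bullet> fn w x + fn v x \<bullet> fn w x)"
    unfolding inner_l2_def
    by (rule integral_cong_AE, measurable, use fn_add[of u v] in eventually_elim, simp add: inner_add_left)
  then show "inner (u + v) w = inner u w + inner v w"
    by (simp add: inner_l2_def sqint_inner_integrable)
  have "inner (r *\<^sub>R u) v = (LINT x|lborel. r * (fn u x \<bullet> fn v x))"
    unfolding inner_l2_def
    by (rule integral_cong_AE, measurable, use fn_scaleR[of r u] in eventually_elim, simp)
  then show "inner (r *\<^sub>R u) v = r * inner u v"
    by (simp add: inner_l2_def)
  show "0 \<le> inner u u" by (simp add: inner_l2_def)
  have "inner u u = 0 \<longleftrightarrow> (AE x in lborel. fn u x \<bullet> fn u x = 0)"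
    unfolding inner_l2_def by (intro integral_nonneg_eq_0_iff_AE sqint_inner_integrable) auto
  also have "\<dots> \<longleftrightarrow> u = 0"
  proof
    assume "AE x in lborel. fn u x \<bullet> fn u x = 0"
    then have "AE x in lborel. fn u x = fn 0 x" using fn_zero[where 'a='a] by eventually_elim simp
    then show "u = 0" by (rule l2_eqI)
  next
    assume "u = 0" then show "AE x in lborel. fn u x \<bullet> fn u x = 0"
      using fn_zero[where 'a='a] by auto
  qed
  finally show "inner u u = 0 \<longleftrightarrow> u = 0" .
  show "norm u = sqrt (inner u u)" by (fact norm_l2_def)
  show "dist u v = norm (u - v)" by (fact dist_l2_def)
  show "sgn u = u /\<^sub>R norm u" by (fact sgn_l2_def)
  show "uniformity = (INF e\<in>{0 <..}. principal {(x::'a l2, y). dist x y < e})" by (fact uniformity_l2_def)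
  show "open U \<longleftrightarrow> (\<forall>x\<in>U. eventually (\<lambda>(x', y). x' = x \<longrightarrow> y \<in> U) uniformity)" for U :: "'a l2 set"
    by (fact open_l2_def)
qed
end

lemma norm_l2_sq: "(norm u)\<^sup>2 = (LINT x|lborel. (cmod (fn u x))\<^sup>2)"
  by (simp only: power2_norm_eq_inner inner_l2_def)

lemma nn_norm_l2: "(\<integral>\<^sup>+x. ennreal ((cmod (fn u x))\<^sup>2) \<partial>lborel) = ennreal ((norm u)\<^sup>2)"
  unfolding norm_l2_sq using sqint_fn[of u] by (intro nn_integral_eq_integral) (auto simp: sqint_def)

lemma norm_cls_sq: "sqint f \<Longrightarrow> (norm (cls f))\<^sup>2 = (LINT x|lborel. (cmod (f x))\<^sup>2)"
proof -
  assume f: "sqint f"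
  note [measurable] = sqint_meas[OF f]
  show ?thesis unfolding norm_l2_sq
    by (rule integral_cong_AE, measurable, use fn_cls[OF f] in eventually_elim, simp)
qed

lemma AE_nn_integral_finite_ennreal:
  assumes "h \<in> borel_measurable M" "(\<integral>\<^sup>+x. h x \<partial>M) < \<infinity>"
  shows "AE x in M. h x < \<infinity>"
  using nn_integral_PInf_AE[OF assms(1)] assms(2) by (auto simp: less_top)

text \<open>The Riesz-Fischer theorem. Along a subsequence \<open>g\<close> of representatives with rapidly decreasing
  increments the sum \<open>\<Sum>\<^sub>k 2\<^sup>k |g\<^sub>k\<^sub>+\<^sub>1 - g\<^sub>k|\<^sup>2\<close> is integrable, hence finite almost everywhere, which
  makes \<open>g\<close> converge almost everywhere; the limit in norm is identified by Fatou's lemma.\<close>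

instance l2 :: (euclidean_space) complete_space
proof
  fix X :: "nat \<Rightarrow> 'a l2"
  assume X: "Cauchy X"
  have "\<exists>N. \<forall>m\<ge>N. \<forall>n\<ge>N. norm (X m - X n) < (1/2)^k" for k
    using X[THEN CauchyD, of "(1/2)^k"] by simp
  then obtain N where N: "\<And>k m n. m \<ge> N k \<Longrightarrow> n \<ge> N k \<Longrightarrow> norm (X m - X n) < (1/2)^k" by metis
  \<comment> \<open>the sum makes the subsequence strictly increasing and keeps it above every \<open>N k\<close>\<close>
  define q where "q k = (\<Sum>i\<le>k. N i) + k" for k
  have qN: "q k \<ge> N k" for k unfolding q_def by (intro trans_le_add1 member_le_sum) auto
  have "strict_mono q" unfolding strict_mono_Suc_iff q_def by simp
  have qmono: "q j \<ge> N k" if "j \<ge> k" for j k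
    using qN[of k] strict_mono_less_eq[OF \<open>strict_mono q\<close>, of k j] that by linarith
  define g where "g k = fn (X (q k))" for k
  have [measurable]: "g k \<in> borel_measurable borel" for k by (simp add: g_def)
  have gd: "(\<integral>\<^sup>+x. ennreal ((cmod (g m x - g k x))\<^sup>2) \<partial>lborel) = ennreal ((norm (X (q m) - X (q k)))\<^sup>2)" for m k
    unfolding nn_norm_l2[symmetric] g_def using fn_diff[of "X (q m)" "X (q k)"]
    by (intro nn_integral_cong_AE) auto
  define h where "h x = (\<Sum>k. ennreal (2^k * (cmod (g (Suc k) x - g k x))\<^sup>2))" for x
  have "(\<integral>\<^sup>+x. h x \<partial>lborel) = (\<Sum>k. \<integral>\<^sup>+x. ennreal (2^k * (cmod (g (Suc k) x - g k x))\<^sup>2) \<partial>lborel)"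
    unfolding h_def by (intro nn_integral_suminf) measurable
  also have "\<dots> \<le> (\<Sum>k. ennreal ((1/2)^k))"
  proof (intro suminf_le allI)
    fix k
    have "(norm (X (q (Suc k)) - X (q k)))\<^sup>2 \<le> ((1/2)^k)\<^sup>2"
      by (intro power_mono less_imp_le[OF N] qmono) auto
    then have "2^k * (norm (X (q (Suc k)) - X (q k)))\<^sup>2 \<le> 2^k * ((1/2)^k)\<^sup>2" by simp
    also have "\<dots> = (1/2)^k" by (simp add: power2_eq_square power_divide)
    finally have b: "2^k * (norm (X (q (Suc k)) - X (q k)))\<^sup>2 \<le> (1/2)^k" .
    have "(\<integral>\<^sup>+x. ennreal (2^k * (cmod (g (Suc k) x - g k x))\<^sup>2) \<partial>lborel)
        = ennreal (2^k) * (\<integral>\<^sup>+x. ennreal ((cmod (g (Suc k) x - g k x))\<^sup>2) \<partial>lborel)"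
      by (subst nn_integral_cmult[symmetric]) (auto simp: ennreal_mult)
    also have "\<dots> = ennreal (2^k * (norm (X (q (Suc k)) - X (q k)))\<^sup>2)"
      unfolding gd by (simp add: ennreal_mult)
    finally show "(\<integral>\<^sup>+x. ennreal (2^k * (cmod (g (Suc k) x - g k x))\<^sup>2) \<partial>lborel) \<le> ennreal ((1/2)^k)"
      using b by (simp add: ennreal_leI)
  qed auto
  also have "\<dots> < \<infinity>"
    using summable_geometric[of "1/2::real"] by (subst suminf_ennreal2) auto
  finally have "AE x in lborel. h x < \<infinity>"
    by (intro AE_nn_integral_finite_ennreal) (auto simp: h_def)
  moreover have "convergent (\<lambda>k. g k x)" if hx: "h x < \<infinity>" for x
  proof -
    have "summable (\<lambda>k. 2^k * (cmod (g (Suc k) x - g k x))\<^sup>2)"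
      using hx unfolding h_def by (intro summable_suminf_not_top) auto
    from summable_add[OF this, of "\<lambda>k. (1/2)^k"]
    have s: "summable (\<lambda>k. 2^k * (cmod (g (Suc k) x - g k x))\<^sup>2 + (1/2)^k)"
      by (simp add: summable_geometric)
    have "cmod (g (Suc k) x - g k x) \<le> 2^k * (cmod (g (Suc k) x - g k x))\<^sup>2 + (1/2)^k" for k
    proof -
      define c where "c = cmod (g (Suc k) x - g k x)"
      have "0 \<le> c" "(0::real) < 2^k" by (auto simp: c_def)
      have "c \<le> 2^k * c\<^sup>2 + (1/2)^k"
      proof (cases "c \<le> (1/2)^k")
        case False
        then have "1 \<le> 2^k * c" by (simp add: power_divide field_simps)
        then have "c * 1 \<le> c * (2^k * c)" using \<open>0 \<le> c\<close> by (intro mult_left_mono)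
        then have "c \<le> 2^k * c\<^sup>2" by (simp add: power2_eq_square algebra_simps)
        then show ?thesis by (simp add: add_increasing2)
      qed (simp add: add_increasing)
      then show ?thesis by (simp add: c_def)
    qed
    then have "summable (\<lambda>k. g (Suc k) x - g k x)"
      by (intro summable_comparison_test'[OF s, of 0]) auto
    then have "convergent (\<lambda>n. \<Sum>k<n. g (Suc k) x - g k x)"
      by (simp add: summable_iff_convergent)
    then show ?thesis
      by (simp only: sum_lessThan_telescope[where f="\<lambda>k. g k x"] convergent_diff_const_right_iff)
  qed
  ultimately have conv: "AE x in lborel. convergent (\<lambda>k. g k x)" by auto
  define G where "G x = lim (\<lambda>k. g k x)" for x
  have [measurable]: "G \<in> borel_measurable borel" unfolding G_def by (rule borel_measurable_lim_metric) simp
  \<comment> \<open>Fatou's lemma bounds the distance from the pointwise limit\<close>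
  have fat: "(\<integral>\<^sup>+x. ennreal ((cmod (G x - g k x))\<^sup>2) \<partial>lborel) \<le> ennreal (((1/2)^k)\<^sup>2)" for k
  proof -
    have "(\<integral>\<^sup>+x. ennreal ((cmod (G x - g k x))\<^sup>2) \<partial>lborel)
       = (\<integral>\<^sup>+x. liminf (\<lambda>m. ennreal ((cmod (g m x - g k x))\<^sup>2)) \<partial>lborel)"
    proof (rule nn_integral_cong_AE, use conv in eventually_elim)
      fix x assume "convergent (\<lambda>k. g k x)"
      then have "(\<lambda>m. g m x) \<longlonglongrightarrow> G x" by (simp add: G_def convergent_LIMSEQ_iff)
      then have "(\<lambda>m. ennreal ((cmod (g m x - g k x))\<^sup>2)) \<longlonglongrightarrow> ennreal ((cmod (G x - g k x))\<^sup>2)"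
        by (intro tendsto_ennrealI tendsto_intros)
      then show "ennreal ((cmod (G x - g k x))\<^sup>2) = liminf (\<lambda>m. ennreal ((cmod (g m x - g k x))\<^sup>2))"
        by (rule lim_imp_Liminf[OF sequentially_bot, symmetric])
    qed
    also have "\<dots> \<le> liminf (\<lambda>m. \<integral>\<^sup>+x. ennreal ((cmod (g m x - g k x))\<^sup>2) \<partial>lborel)"
      by (intro nn_integral_liminf) measurable
    also have "\<dots> \<le> ennreal (((1/2)^k)\<^sup>2)"
    proof (rule Liminf_le)
      show "\<forall>\<^sub>F m in sequentially. (\<integral>\<^sup>+x. ennreal ((cmod (g m x - g k x))\<^sup>2) \<partial>lborel) \<le> ennreal (((1/2)^k)\<^sup>2)"
        using eventually_ge_at_top[of k]
      proof eventually_elim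
        case (elim m)
        show ?case unfolding gd using elim
          by (intro ennreal_leI power_mono less_imp_le[OF N] qmono) auto
      qed
    qed simp
    finally show ?thesis .
  qed
  have sq: "sqint (\<lambda>x. G x - g k x)" for k
  proof -
    have "integrable lborel (\<lambda>x. (cmod (G x - g k x))\<^sup>2)"
      using fat[of k] by (intro integrableI_nonneg) (auto simp: less_top[symmetric] top_unique)
    then show ?thesis by (simp add: sqint_def)
  qed
  have "sqint G" using sqint_add[OF sq[of 0], of "g 0"] by (simp add: g_def)
  have "norm (X (q k) - cls G) \<le> (1/2)^k" for k
  proof -
    have "AE x in lborel. fn (cls G - X (q k)) x = G x - g k x"
      using fn_diff[of "cls G" "X (q k)"] fn_cls[OF \<open>sqint G\<close>] unfolding g_def by eventually_elim simp
    then have "(\<integral>\<^sup>+x. ennreal ((cmod (fn (cls G - X (q k)) x))\<^sup>2) \<partial>lborel) \<le> ennreal (((1/2)^k)\<^sup>2)"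
      using fat[of k] by (subst nn_integral_cong_AE[where v="\<lambda>x. ennreal ((cmod (G x - g k x))\<^sup>2)"]) auto
    then have "(norm (cls G - X (q k)))\<^sup>2 \<le> ((1/2)^k)\<^sup>2"
      unfolding nn_norm_l2 by (simp add: ennreal_le_iff)
    then have "norm (cls G - X (q k)) \<le> (1/2)^k" by (rule power2_le_imp_le) simp
    then show ?thesis by (simp only: norm_minus_commute)
  qed
  then have "(\<lambda>k. X (q k)) \<longlonglongrightarrow> cls G"
    by - (rule LIM_zero_cancel, rule Lim_null_comparison[OF _ LIMSEQ_power_zero[of "1/2::real"]], auto)
  then have "X \<longlonglongrightarrow> cls G"
    by (intro Cauchy_converges_subseq[OF X \<open>strict_mono q\<close>]) (simp add: o_def)
  then show "convergent X" by (auto simp: convergent_def)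
qed

section \<open>Multipliers\<close>

definition bmult :: "('a::euclidean_space \<Rightarrow> complex) \<Rightarrow> bool" where
  "bmult m \<longleftrightarrow> m \<in> borel_measurable borel \<and> bounded (range m)"

lemma bmultI: "m \<in> borel_measurable borel \<Longrightarrow> (\<And>x. cmod (m x) \<le> c) \<Longrightarrow> bmult m"
  by (auto simp: bmult_def intro: boundedI)

lemma bmultE:
  assumes "bmult m" obtains c where "0 \<le> c" "\<And>x. cmod (m x) \<le> c"
  using assms unfolding bmult_def bounded_iff by (metis UNIV_I image_eqI norm_ge_zero order_trans)

lemma bmult_meas: "bmult m \<Longrightarrow> m \<in> borel_measurable borel"
  by (simp add: bmult_def)

lemma bmult_const [simp, intro]: "bmult (\<lambda>x. c)"
  by (rule bmultI[of _ "cmod c"]) auto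

lemma bmult_mult [intro]:
  assumes "bmult m" "bmult k" shows "bmult (\<lambda>x. m x * k x)"
proof -
  obtain c where "0 \<le> c" "\<And>x. cmod (m x) \<le> c" using assms(1) bmultE by blast
  moreover obtain d where "0 \<le> d" "\<And>x. cmod (k x) \<le> d" using assms(2) bmultE by blast
  ultimately show ?thesis
    using bmult_meas[OF assms(1)] bmult_meas[OF assms(2)] by (intro bmultI[of _ "c * d"]) (auto simp: norm_mult intro: mult_mono)
qed

lemma bmult_add [intro]:
  assumes "bmult m" "bmult k" shows "bmult (\<lambda>x. m x + k x)"
proof -
  obtain c where "0 \<le> c" "\<And>x. cmod (m x) \<le> c" using assms(1) bmultE by blast
  moreover obtain d where "0 \<le> d" "\<And>x. cmod (k x) \<le> d" using assms(2) bmultE by blast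
  ultimately show ?thesis
    using bmult_meas[OF assms(1)] bmult_meas[OF assms(2)] by (intro bmultI[of _ "c + d"]) (auto intro: norm_triangle_mono)
qed

lemma bmult_cnj [intro]:
  assumes "bmult m" shows "bmult (\<lambda>x. cnj (m x))"
proof -
  obtain c where "0 \<le> c" "\<And>x. cmod (m x) \<le> c" using assms bmultE by blast
  then show ?thesis using bmult_meas[OF assms]
    by (intro bmultI[of _ c] borel_measurable_cnj) auto
qed

lemma bmult_diff [intro]: "bmult m \<Longrightarrow> bmult k \<Longrightarrow> bmult (\<lambda>x. m x - k x)"
  using bmult_add[of m "\<lambda>x. (-1) * k x"] bmult_mult[of "\<lambda>x. -1" k] by simp

lemma bmult_uminus [intro]: "bmult m \<Longrightarrow> bmult (\<lambda>x. - m x)"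
  using bmult_mult[of "\<lambda>x. -1" m] by simp

lemma bmult_power [intro]: "bmult m \<Longrightarrow> bmult (\<lambda>x. m x ^ n)"
  by (induction n) (auto intro: bmult_mult)

lemma sqint_bmult:
  assumes "bmult m" "sqint f" shows "sqint (\<lambda>x. m x * f x)"
proof -
  obtain c where c: "0 \<le> c" "\<And>x. cmod (m x) \<le> c" using assms(1) bmultE by blast
  note [measurable] = bmult_meas[OF assms(1)] sqint_meas[OF assms(2)]
  show ?thesis
    by (rule sqint_bound[OF assms(2), of _ c], measurable) (simp add: norm_mult mult_right_mono c)
qed

definition mul :: "('a::euclidean_space \<Rightarrow> complex) \<Rightarrow> 'a l2 \<Rightarrow> 'a l2" where
  "mul m u = cls (\<lambda>x. m x * fn u x)"

lemma fn_mul: "bmult m \<Longrightarrow> AE x in lborel. fn (mul m u) x = m x * fn u x"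
  unfolding mul_def by (rule fn_cls[OF sqint_bmult]) auto

lemma mul_mul:
  assumes "bmult m" "bmult k" shows "mul m (mul k u) = mul (\<lambda>x. m x * k x) u"
  by (rule l2_eqI, use fn_mul[OF assms(1), of "mul k u"] fn_mul[OF assms(2), of u]
      fn_mul[OF bmult_mult[OF assms], of u] in eventually_elim, simp)

lemma mul_add: assumes "bmult m" shows "mul m (u + v) = mul m u + mul m v"
  by (rule l2_eqI, use fn_mul[OF assms, of "u + v"] fn_mul[OF assms, of u] fn_mul[OF assms, of v]
      fn_add[of u v] fn_add[of "mul m u" "mul m v"] in eventually_elim, simp add: distrib_left)

lemma mul_scaleR: assumes "bmult m" shows "mul m (r *\<^sub>R u) = r *\<^sub>R mul m u"
  by (rule l2_eqI, use fn_mul[OF assms, of "r *\<^sub>R u"] fn_mul[OF assms, of u]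
      fn_scaleR[of r u] fn_scaleR[of r "mul m u"] in eventually_elim, simp)

lemma mul_one [simp]: "mul (\<lambda>x. 1) u = u"
  by (simp add: mul_def)

lemma mul_minus_one: "mul (\<lambda>x. - 1) u = - u"
  by (rule l2_eqI, use fn_mul[OF bmult_const, of "-1" u] fn_uminus[of u] in eventually_elim, simp)

lemma mul_sum_multipliers:
  assumes "bmult m" "bmult k" shows "mul (\<lambda>x. m x + k x) u = mul m u + mul k u"
  by (rule l2_eqI, use fn_mul[OF assms(1), of u] fn_mul[OF assms(2), of u] fn_mul[OF bmult_add[OF assms], of u]
      fn_add[of "mul m u" "mul k u"] in eventually_elim, simp add: distrib_right)

lemma norm_mul_le:
  assumes "bmult m" "\<And>x. cmod (m x) \<le> c" "0 \<le> c" shows "norm (mul m u) \<le> c * norm u"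
proof -
  note [measurable] = bmult_meas[OF assms(1)]
  have "(norm (mul m u))\<^sup>2 = (LINT x|lborel. (cmod (m x * fn u x))\<^sup>2)"
    unfolding norm_l2_sq by (rule integral_cong_AE, measurable, use fn_mul[OF assms(1), of u] in eventually_elim, simp)
  also have "\<dots> \<le> (LINT x|lborel. c\<^sup>2 * (cmod (fn u x))\<^sup>2)"
  proof (rule integral_mono)
    show "integrable lborel (\<lambda>x. (cmod (m x * fn u x))\<^sup>2)"
      using sqint_bmult[OF assms(1) sqint_fn[of u]] by (simp add: sqint_def)
    show "integrable lborel (\<lambda>x. c\<^sup>2 * (cmod (fn u x))\<^sup>2)"
      using sqint_fn[of u] by (simp add: sqint_def)
    show "(cmod (m x * fn u x))\<^sup>2 \<le> c\<^sup>2 * (cmod (fn u x))\<^sup>2" for x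
      using assms(2)[of x] by (simp add: norm_mult power_mult_distrib mult_right_mono power_mono)
  qed
  also have "\<dots> = (c * norm u)\<^sup>2" by (simp add: norm_l2_sq power_mult_distrib)
  finally show ?thesis by (rule power2_le_imp_le) (simp add: assms(3))
qed

lemma bounded_linear_mul: assumes "bmult m" shows "bounded_linear (mul m)"
proof -
  obtain c where c: "0 \<le> c" "\<And>x. cmod (m x) \<le> c" using bmultE[OF assms] by blast
  show ?thesis
    by (rule bounded_linear_intro[where K=c])
      (use norm_mul_le[OF assms c(2) c(1)] in \<open>simp_all add: mul_add mul_scaleR assms mult.commute\<close>)
qed

lemma inner_mul:
  assumes "bmult m" shows "mul m u \<bullet> v = u \<bullet> mul (\<lambda>x. cnj (m x)) v"
proof -
  note [measurable] = bmult_meas[OF assms]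
  have "AE x in lborel. fn (mul m u) x \<bullet> fn v x = fn u x \<bullet> fn (mul (\<lambda>x. cnj (m x)) v) x"
    using fn_mul[OF assms, of u] fn_mul[OF bmult_cnj[OF assms], of v]
    by eventually_elim (simp add: inner_complex_def algebra_simps)
  then show ?thesis unfolding inner_l2_def by (intro integral_cong_AE) simp_all
qed

text \<open>The type \<open>l2\<close> is a real inner product space. Its complex structure is carried by this map: complex
  linear means commuting with it, and the imaginary part of the complex inner product of
  \<open>u\<close> and \<open>v\<close> is \<open>u \<bullet> imul v\<close>.\<close>

abbreviation imul :: "'a::euclidean_space l2 \<Rightarrow> 'a l2" where "imul \<equiv> mul (\<lambda>x. \<i>)"

lemma imul_imul [simp]: "imul (imul u) = - u"
  by (simp add: mul_mul mul_minus_one)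

lemma imul_inner: "imul u \<bullet> v = - (u \<bullet> imul v)"
proof -
  have "mul (\<lambda>x. cnj \<i>) v = - imul v"
    by (rule l2_eqI, use fn_mul[OF bmult_const, of "cnj \<i>" v] fn_uminus[of "imul v"] fn_mul[OF bmult_const, of \<i> v]
        in eventually_elim, simp)
  then show ?thesis by (simp add: inner_mul)
qed

lemma imul_uminus [simp]: "imul (- u) = - imul u"
  using mul_scaleR[OF bmult_const, of \<i> "-1" u] by simp

section \<open>The ring of bounded operators\<close>

typedef (overloaded) 'a bop = "{T :: 'a::euclidean_space l2 \<Rightarrow> 'a l2. bounded_linear T \<and> (\<forall>u. T (imul u) = imul (T u))}"
  morphisms ap abs_bop
  by (rule exI[of _ "\<lambda>u. u"]) (simp add: bounded_linear_ident)

setup_lifting type_definition_bop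

lemma bounded_linear_ap: "bounded_linear (ap T)" using ap[of T] by simp
lemma ap_imul: "ap T (imul u) = imul (ap T u)" using ap[of T] by simp

lemma ap_add: "ap T (u + v) = ap T u + ap T v"
  and ap_diff: "ap T (u - v) = ap T u - ap T v"
  and ap_scaleR: "ap T (r *\<^sub>R u) = r *\<^sub>R ap T u"
  and ap_uminus: "ap T (- u) = - ap T u"
  and ap_zero [simp]: "ap T 0 = 0"
  using bounded_linear_ap[of T, THEN bounded_linear.linear]
  by (simp_all add: linear_add linear_diff linear_scale linear_neg linear_0)

lemma ap_bound: obtains c where "0 \<le> c" "\<And>u. norm (ap T u) \<le> c * norm u"
  using bounded_linear.nonneg_bounded[OF bounded_linear_ap[of T]] by (metis mult.commute)

lemma bop_eqI: "(\<And>u. ap S u = ap T u) \<Longrightarrow> S = T"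
  by (metis ap_inject ext)

lemma inner_eqI: "(\<And>v. u \<bullet> v = w \<bullet> v) \<Longrightarrow> u = (w :: 'a::real_inner)"
  by (metis inner_diff_left inner_eq_zero_iff right_minus_eq)

lemma bop_eq_innerI: "(\<And>u v. ap S u \<bullet> v = ap T u \<bullet> v) \<Longrightarrow> S = T"
  by (rule bop_eqI, rule inner_eqI)

instantiation bop :: (euclidean_space) ring_1
begin

lift_definition zero_bop :: "'a bop" is "\<lambda>u. 0"
  by (simp add: mul_def) (simp add: mul_scaleR[of _ 0, simplified] bounded_linear_zero flip: mul_def)
lift_definition one_bop :: "'a bop" is "\<lambda>u. u" by (simp add: bounded_linear_ident)
lift_definition plus_bop :: "'a bop \<Rightarrow> 'a bop \<Rightarrow> 'a bop" is "\<lambda>S T u. S u + T u"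
  by (simp add: bounded_linear_add mul_add)
lift_definition uminus_bop :: "'a bop \<Rightarrow> 'a bop" is "\<lambda>S u. - S u"
  by (simp add: bounded_linear_minus)
lift_definition minus_bop :: "'a bop \<Rightarrow> 'a bop \<Rightarrow> 'a bop" is "\<lambda>S T u. S u - T u"
proof -
  fix S T :: "'a l2 \<Rightarrow> 'a l2"
  assume *: "bounded_linear S \<and> (\<forall>u. S (imul u) = imul (S u))" "bounded_linear T \<and> (\<forall>u. T (imul u) = imul (T u))"
  have "imul (a - b) = imul a - imul b" for a b :: "'a l2"
    using mul_add[OF bmult_const, of \<i> a "- b"] by simp
  then show "bounded_linear (\<lambda>u. S u - T u) \<and> (\<forall>u. S (imul u) - T (imul u) = imul (S u - T u))"
    using * by (simp add: bounded_linear_sub)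
qed
lift_definition times_bop :: "'a bop \<Rightarrow> 'a bop \<Rightarrow> 'a bop" is "\<lambda>S T u. S (T u)"
  by (simp add: bounded_linear_compose)

text \<open>Needed for \<open>0 \<noteq> 1\<close> in the ring of operators.\<close>

lemma one_neq_zero_l2: "\<exists>u :: 'a l2. u \<noteq> 0"
proof -
  have s: "sqint (\<lambda>x::'a. complex_of_real (indicator (cbox 0 One) x))"
  proof -
    have "(\<lambda>x::'a. (cmod (complex_of_real (indicator (cbox 0 One) x)))\<^sup>2) = indicator (cbox 0 One)"
      by (auto simp: indicator_def)
    then show ?thesis by (simp add: sqint_def)
  qed
  have "cls (\<lambda>x::'a. complex_of_real (indicator (cbox 0 One) x)) \<noteq> 0"
  proof
    assume "cls (\<lambda>x::'a. complex_of_real (indicator (cbox 0 One) x)) = 0"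
    then have "(norm (cls (\<lambda>x::'a. complex_of_real (indicator (cbox 0 One) x))))\<^sup>2 = 0" by simp
    moreover have "(\<lambda>x::'a. (cmod (complex_of_real (indicator (cbox 0 One) x)))\<^sup>2) = indicator (cbox 0 One)"
      by (auto simp: indicator_def)
    ultimately show False unfolding norm_cls_sq[OF s] by (simp add: measure_def)
  qed
  then show ?thesis by blast
qed

instance
proof
  fix a b c :: "'a bop"
  show "a * b * c = a * (b * c)" by transfer simp
  show "a + b + c = a + (b + c)" by transfer (simp add: add.assoc)
  show "a + b = b + a" by transfer (simp add: add.commute)
  show "0 + a = a" by transfer simp
  show "- a + a = 0" by transfer simp
  show "a - b = a + - b" by transfer simp
  show "(a + b) * c = a * c + b * c" by transfer simp
  show "a * (b + c) = a * b + a * c"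
    by transfer (simp add: linear_add bounded_linear.linear)
  show "1 * a = a" by transfer simp
  show "a * 1 = a" by transfer simp
  show "(0 :: 'a bop) \<noteq> 1"
    by transfer (metis one_neq_zero_l2)
qed
end

lemma ap_plus [simp]: "ap (S + T) u = ap S u + ap T u" by transfer simp
lemma ap_minus [simp]: "ap (S - T) u = ap S u - ap T u" by transfer simp
lemma ap_neg [simp]: "ap (- S) u = - ap S u" by transfer simp
lemma ap_times [simp]: "ap (S * T) u = ap S (ap T u)" by transfer simp
lemma ap_one [simp]: "ap 1 u = u" by transfer simp
lemma ap_0 [simp]: "ap 0 u = 0" by transfer simp
lemma ap_sum: "ap (sum f I) u = (\<Sum>i\<in>I. ap (f i) u)"
  by (induction I rule: infinite_finite_induct) auto

text \<open>The second argument of the form may be restricted to a total subspace \<open>V\<close>, such as the range of an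
  injective multiplication or the Schwartz functions; condition \<open>b_i\<close> makes the operator complex linear.
  The last conclusion bounds single values of \<open>T\<close> by bounds that are not proportional to the norm of
  \<open>u\<close>.\<close>

lemma bop_of_form:
  fixes b :: "'a::euclidean_space l2 \<Rightarrow> 'a l2 \<Rightarrow> real"
  assumes V: "subspace V" and total: "\<And>z. (\<And>v. v \<in> V \<Longrightarrow> z \<bullet> v = 0) \<Longrightarrow> z = 0"
    and iV: "\<And>v. v \<in> V \<Longrightarrow> imul v \<in> V"
    and b_add_left: "\<And>u u' v. v \<in> V \<Longrightarrow> b (u + u') v = b u v + b u' v"
    and b_scale_left: "\<And>r u v. v \<in> V \<Longrightarrow> b (r *\<^sub>R u) v = r * b u v"
    and b_add: "\<And>u v v'. v \<in> V \<Longrightarrow> v' \<in> V \<Longrightarrow> b u (v + v') = b u v + b u v'"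
    and b_scale: "\<And>r u v. v \<in> V \<Longrightarrow> b u (r *\<^sub>R v) = r * b u v"
    and b_i: "\<And>u v. v \<in> V \<Longrightarrow> b (imul u) (imul v) = b u v"
    and "0 \<le> c" and bd: "\<And>u v. v \<in> V \<Longrightarrow> \<bar>b u v\<bar> \<le> c * norm u * norm v"
  obtains T where "\<And>u v. v \<in> V \<Longrightarrow> ap T u \<bullet> v = b u v"
    "\<And>u. norm (ap T u) \<le> c * norm u"
    "\<And>u \<kappa>. 0 \<le> \<kappa> \<Longrightarrow> (\<And>v. v \<in> V \<Longrightarrow> \<bar>b u v\<bar> \<le> \<kappa> * norm v) \<Longrightarrow> norm (ap T u) \<le> \<kappa>"
proof -
  have ex: "\<exists>z. (\<forall>v\<in>V. z \<bullet> v = b u v) \<and> norm z \<le> \<kappa>"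
    if "0 \<le> \<kappa>" "\<And>v. v \<in> V \<Longrightarrow> \<bar>b u v\<bar> \<le> \<kappa> * norm v" for u \<kappa>
    using riesz_subspace[OF V b_add[of _ _ u] b_scale[of _ u] that(2) that(1)] by metis
  have uniq: "z = z'" if "\<And>v. v \<in> V \<Longrightarrow> z \<bullet> v = z' \<bullet> v" for z z'
    using total[of "z - z'"] that by (simp add: inner_diff_left)
  have "\<exists>z. \<forall>v\<in>V. z \<bullet> v = b u v" for u
    using ex[of "c * norm u" u] bd \<open>0 \<le> c\<close> by auto
  then obtain F where F: "\<And>u v. v \<in> V \<Longrightarrow> F u \<bullet> v = b u v" by metis
  have F_bound: "norm (F u) \<le> \<kappa>"
    if "0 \<le> \<kappa>" "\<And>v. v \<in> V \<Longrightarrow> \<bar>b u v\<bar> \<le> \<kappa> * norm v" for u \<kappa>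
    using ex[OF that] uniq F by metis
  have F_norm: "norm (F u) \<le> c * norm u" for u
    using F_bound[of "c * norm u" u] bd \<open>0 \<le> c\<close> by auto
  have "bounded_linear F"
  proof (rule bounded_linear_intro[where K=c])
    show "F (u + v) = F u + F v" for u v
      by (rule uniq) (simp add: F inner_add_left b_add_left)
    show "F (r *\<^sub>R u) = r *\<^sub>R F u" for r u
      by (rule uniq) (simp add: F b_scale_left)
    show "norm (F u) \<le> norm u * c" for u using F_norm[of u] by (simp add: mult.commute)
  qed
  moreover have "F (imul u) = imul (F u)" for u
  proof (rule uniq)
    fix v assume v: "v \<in> V"
    \<comment> \<open>since \<open>imul\<close> is skew, \<open>b_i\<close> is applied to \<open>- imul v\<close>\<close>
    have "- imul v \<in> V" using subspace_neg[OF V iV[OF v]] .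
    then have "b (imul u) v = b u (- imul v)"
      using b_i[of "- imul v" u] by simp
    then show "F (imul u) \<bullet> v = imul (F u) \<bullet> v"
      using F[OF v] F[OF \<open>- imul v \<in> V\<close>] by (simp add: imul_inner)
  qed
  ultimately have "ap (abs_bop F) = F" by (simp add: abs_bop_inverse)
  with F F_norm F_bound show ?thesis by (intro that[of "abs_bop F"]) auto
qed

lemma bop_of_bounded_form:
  fixes b :: "'a::euclidean_space l2 \<Rightarrow> 'a l2 \<Rightarrow> real"
  assumes "\<And>u u' v. b (u + u') v = b u v + b u' v" "\<And>r u v. b (r *\<^sub>R u) v = r * b u v"
    and "\<And>u v v'. b u (v + v') = b u v + b u v'" "\<And>r u v. b u (r *\<^sub>R v) = r * b u v"
    and "\<And>u v. b (imul u) (imul v) = b u v"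
    and "0 \<le> c" and "\<And>u v. \<bar>b u v\<bar> \<le> c * norm u * norm v"
  obtains T where "\<And>u v. ap T u \<bullet> v = b u v" "\<And>u. norm (ap T u) \<le> c * norm u"
proof (rule bop_of_form[where V=UNIV and b=b and c=c])
  show "z = 0" if "\<And>v. v \<in> UNIV \<Longrightarrow> z \<bullet> v = 0" for z :: "'a l2"
    using that[of z] by simp
  fix T assume T: "\<And>u v. v \<in> UNIV \<Longrightarrow> ap T u \<bullet> v = b u v" "\<And>u. norm (ap T u) \<le> c * norm u"
  show thesis by (rule that[of T]) (use T in auto)
qed (use assms in auto)

text \<open>The adjoint is characterised by \<open>adj\<close> below; the real and the complex adjoint of a complex linear
  operator coincide.\<close>

definition adj :: "'a::euclidean_space bop \<Rightarrow> 'a bop" where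
  "adj T = (SOME S. \<forall>u v. ap S u \<bullet> v = u \<bullet> ap T v)"

lemma imul_inner_imul: "imul u \<bullet> imul v = u \<bullet> v"
  by (simp add: imul_inner)

lemma adj: "ap (adj T) u \<bullet> v = u \<bullet> ap T v"
proof -
  obtain c where c: "0 \<le> c" "\<And>u. norm (ap T u) \<le> c * norm u" using ap_bound[of T] by blast
  have "\<exists>S. \<forall>u v. ap S u \<bullet> v = u \<bullet> ap T v"
  proof (rule bop_of_bounded_form[where b="\<lambda>u v. u \<bullet> ap T v" and c=c])
    fix u v
    have "\<bar>u \<bullet> ap T v\<bar> \<le> norm u * norm (ap T v)" by (rule Cauchy_Schwarz_ineq2)
    also have "\<dots> \<le> norm u * (c * norm v)" by (intro mult_left_mono c) simp
    finally show "\<bar>u \<bullet> ap T v\<bar> \<le> c * norm u * norm v" by (simp add: algebra_simps)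
    show "imul u \<bullet> ap T (imul v) = u \<bullet> ap T v"
      unfolding ap_imul by (rule imul_inner_imul)
  qed (use c in \<open>auto simp: inner_add ap_add ap_scaleR\<close>)
  then have "\<forall>u v. ap (adj T) u \<bullet> v = u \<bullet> ap T v"
    unfolding adj_def by (rule someI_ex)
  then show ?thesis by blast
qed

lemma adj': "u \<bullet> ap (adj T) v = ap T u \<bullet> v"
  by (metis adj inner_commute)

lemma adj_unique: "(\<And>u v. ap S u \<bullet> v = u \<bullet> ap T v) \<Longrightarrow> adj T = S"
  by (rule bop_eq_innerI) (simp add: adj)

lemma adj_adj [simp]: "adj (adj T) = T"
  by (rule adj_unique) (simp add: adj')

lemma adj_times: "adj (S * T) = adj T * adj S"
  by (rule adj_unique) (simp add: adj)

lemma adj_plus: "adj (S + T) = adj S + adj T"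
  by (rule adj_unique) (simp add: adj inner_add)

lemma adj_uminus: "adj (- S) = - adj S"
  by (rule adj_unique) (simp add: adj)

lemma adj_minus: "adj (S - T) = adj S - adj T"
  by (rule adj_unique) (simp add: adj inner_diff)

lemma adj_zero [simp]: "adj 0 = 0" and adj_one [simp]: "adj 1 = 1"
  by (rule adj_unique, simp)+

lemma adj_sum: "adj (sum f I) = (\<Sum>i\<in>I. adj (f i))"
  by (induction I rule: infinite_finite_induct) (auto simp: adj_plus)

section \<open>Multiplication operators\<close>

text \<open>The multiplication operator of a bounded measurable symbol; other symbols are sent to \<open>0\<close>.\<close>

lift_definition mop :: "('a::euclidean_space \<Rightarrow> complex) \<Rightarrow> 'a bop" is "\<lambda>m. mul (if bmult m then m else (\<lambda>x. 0))"
proof -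
  fix m :: "'a \<Rightarrow> complex"
  let ?k = "if bmult m then m else (\<lambda>x. 0)"
  have k: "bmult ?k" by simp
  have "mul ?k (imul u) = imul (mul ?k u)" for u
    unfolding mul_mul[OF k bmult_const] mul_mul[OF bmult_const k] by (simp add: mult.commute)
  then show "bounded_linear (mul ?k) \<and> (\<forall>u. mul ?k (imul u) = imul (mul ?k u))"
    using bounded_linear_mul[OF k] by simp
qed

lemma ap_mop: "bmult m \<Longrightarrow> ap (mop m) u = mul m u" by transfer simp

lemma mop_times: "bmult m \<Longrightarrow> bmult k \<Longrightarrow> mop m * mop k = mop (\<lambda>x. m x * k x)"
  by (rule bop_eqI) (simp add: ap_mop mul_mul bmult_mult)

lemma mop_commute: "bmult m \<Longrightarrow> bmult k \<Longrightarrow> mop m * mop k = mop k * mop m"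
  by (simp add: mop_times mult.commute)

lemma mop_plus: "bmult m \<Longrightarrow> bmult k \<Longrightarrow> mop m + mop k = mop (\<lambda>x. m x + k x)"
  by (rule bop_eqI) (simp add: ap_mop mul_sum_multipliers bmult_add)

lemma mop_one: "mop (\<lambda>x. 1) = 1"
  by (rule bop_eqI) (simp add: ap_mop)

lemma mop_zero: "mop (\<lambda>x. 0) = 0"
  by (rule bop_eqI) (use mul_scaleR[OF bmult_const, of 1 0] in \<open>simp add: ap_mop mul_def zero_l2_def\<close>)

lemma mop_uminus: assumes "bmult m" shows "- mop m = mop (\<lambda>x. - m x)"
proof -
  have "mop m + mop (\<lambda>x. (-1) * m x) = 0"
    using assms by (subst mop_plus) (auto simp: mop_zero)
  then show ?thesis by (simp add: minus_unique)
qed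

lemma mop_minus: "bmult m \<Longrightarrow> bmult k \<Longrightarrow> mop m - mop k = mop (\<lambda>x. m x - k x)"
proof -
  assume m: "bmult m" "bmult k"
  then have "bmult (\<lambda>x. - k x)" by auto
  then show ?thesis using m by (simp only: diff_conv_add_uminus mop_uminus mop_plus)
qed

lemma mop_sum:
  assumes "\<And>i. bmult (m i)" "finite I"
  shows "bmult (\<lambda>x. \<Sum>i\<in>I. m i x)" "(\<Sum>i\<in>I. mop (m i)) = mop (\<lambda>x. \<Sum>i\<in>I. m i x)"
proof -
  have "bmult (\<lambda>x. \<Sum>i\<in>I. m i x) \<and> (\<Sum>i\<in>I. mop (m i)) = mop (\<lambda>x. \<Sum>i\<in>I. m i x)"
    using assms(2) by (induction I rule: finite_induct) (auto simp: mop_zero mop_plus assms(1) bmult_add)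
  then show "bmult (\<lambda>x. \<Sum>i\<in>I. m i x)" "(\<Sum>i\<in>I. mop (m i)) = mop (\<lambda>x. \<Sum>i\<in>I. m i x)" by auto
qed

lemma mop_cong_AE:
  assumes "bmult m" "bmult k" "AE x in lborel. m x = k x" shows "mop m = mop k"
proof (rule bop_eqI)
  fix u
  have "mul m u = mul k u"
    by (rule l2_eqI, use fn_mul[OF assms(1), of u] fn_mul[OF assms(2), of u] assms(3) in eventually_elim, simp)
  then show "ap (mop m) u = ap (mop k) u" by (simp add: ap_mop assms)
qed

lemma adj_mop: "bmult m \<Longrightarrow> adj (mop m) = mop (\<lambda>x. cnj (m x))"
  by (rule adj_unique) (simp add: ap_mop bmult_cnj inner_mul)

text \<open>Bounded pointwise convergence of symbols gives strong convergence of the operators, by dominated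
  convergence.\<close>

lemma mop_tendsto:
  assumes m: "\<And>n. bmult (m n)" "\<And>n x. cmod (m n x) \<le> c" and k: "bmult k"
    and lim: "\<And>x. (\<lambda>n. m n x) \<longlonglongrightarrow> k x"
  shows "(\<lambda>n. ap (mop (m n)) u) \<longlonglongrightarrow> ap (mop k) u"
proof -
  note [measurable] = bmult_meas[OF m(1)] bmult_meas[OF k]
  have "(norm (ap (mop (m n)) u - ap (mop k) u))\<^sup>2 = (LINT x|lborel. (cmod (m n x - k x))\<^sup>2 * (cmod (fn u x))\<^sup>2)" for n
    unfolding norm_l2_sq ap_mop[OF m(1)] ap_mop[OF k]
    by (rule integral_cong_AE, measurable, use fn_diff[of "mul (m n) u" "mul k u"] fn_mul[OF m(1), of n u] fn_mul[OF k, of u]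
        in eventually_elim) (simp add: left_diff_distrib[symmetric] norm_mult power_mult_distrib)
  moreover have "(\<lambda>n. LINT x|lborel. (cmod (m n x - k x))\<^sup>2 * (cmod (fn u x))\<^sup>2) \<longlonglongrightarrow> (LINT x|(lborel :: 'a measure). 0)"
  proof (rule integral_dominated_convergence[where w="\<lambda>x. (2 * c)\<^sup>2 * (cmod (fn u x))\<^sup>2"])
    show "integrable lborel (\<lambda>x. (2 * c)\<^sup>2 * (cmod (fn u x))\<^sup>2)"
      using sqint_fn[of u] by (simp add: sqint_def)
    have "(\<lambda>n. (cmod (m n x - k x))\<^sup>2 * (cmod (fn u x))\<^sup>2) \<longlonglongrightarrow> (cmod (k x - k x))\<^sup>2 * (cmod (fn u x))\<^sup>2" for x
      by (intro tendsto_intros lim)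
    then show "AE x in lborel. (\<lambda>n. (cmod (m n x - k x))\<^sup>2 * (cmod (fn u x))\<^sup>2) \<longlonglongrightarrow> 0" by simp
    fix n
    have "(cmod (m n x - k x))\<^sup>2 \<le> (2 * c)\<^sup>2" for x
    proof -
      have "cmod (k x) \<le> c"
        using LIMSEQ_le_const2[OF tendsto_norm[OF lim[of x]]] m(2) by blast
      then have "cmod (m n x - k x) \<le> 2 * c"
        using norm_triangle_ineq4[of "m n x" "k x"] m(2)[of n x] by linarith
      then show ?thesis by (intro power_mono) auto
    qed
    then show "AE x in lborel. norm ((cmod (m n x - k x))\<^sup>2 * (cmod (fn u x))\<^sup>2) \<le> (2 * c)\<^sup>2 * (cmod (fn u x))\<^sup>2"
      by (intro AE_I2) (simp add: mult_right_mono)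
  qed measurable
  ultimately have "(\<lambda>n. (norm (ap (mop (m n)) u - ap (mop k) u))\<^sup>2) \<longlonglongrightarrow> 0" by simp
  from tendsto_real_sqrt[OF this]
  have "(\<lambda>n. norm (ap (mop (m n)) u - ap (mop k) u)) \<longlonglongrightarrow> 0" by simp
  then show ?thesis by (simp add: LIM_zero_cancel tendsto_norm_zero_iff)
qed

section \<open>Lyapunov equation and interpolation\<close>

abbreviation rop :: "('a::euclidean_space \<Rightarrow> real) \<Rightarrow> 'a bop" where
  "rop m \<equiv> mop (\<lambda>x. complex_of_real (m x))"

abbreviation rmult :: "('a::euclidean_space \<Rightarrow> real) \<Rightarrow> bool" where
  "rmult m \<equiv> bmult (\<lambda>x. complex_of_real (m x))"

lemma rmultI: "m \<in> borel_measurable borel \<Longrightarrow> (\<And>x. \<bar>m x\<bar> \<le> c) \<Longrightarrow> rmult m"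
  by (rule bmultI[of _ c]) auto

lemma rop_times: "rmult m \<Longrightarrow> rmult k \<Longrightarrow> rop m * rop k = rop (\<lambda>x. m x * k x)"
  by (simp add: mop_times)

lemma rop_plus: "rmult m \<Longrightarrow> rmult k \<Longrightarrow> rop m + rop k = rop (\<lambda>x. m x + k x)"
  by (simp add: mop_plus)

lemma rop_minus: "rmult m \<Longrightarrow> rmult k \<Longrightarrow> rop m - rop k = rop (\<lambda>x. m x - k x)"
  by (simp add: mop_minus)

lemma rop_one: "rop (\<lambda>x. 1) = 1"
  by (simp add: mop_one)

lemma rop_inner: "rmult m \<Longrightarrow> ap (rop m) u \<bullet> v = u \<bullet> ap (rop m) v"
  by (simp add: ap_mop inner_mul)

lemma rop_norm: "rmult m \<Longrightarrow> (\<And>x. \<bar>m x\<bar> \<le> c) \<Longrightarrow> 0 \<le> c \<Longrightarrow> norm (ap (rop m) u) \<le> c * norm u"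
  by (simp add: ap_mop norm_mul_le)

lemma rmult_intros:
  "rmult m \<Longrightarrow> rmult k \<Longrightarrow> rmult (\<lambda>x. m x * k x)"
  "rmult m \<Longrightarrow> rmult k \<Longrightarrow> rmult (\<lambda>x. m x + k x)"
  "rmult m \<Longrightarrow> rmult k \<Longrightarrow> rmult (\<lambda>x. m x - k x)"
  "rmult m \<Longrightarrow> rmult (\<lambda>x. m x ^ n)"
  "rmult (\<lambda>x. c)"
  using bmult_mult[of "\<lambda>x. complex_of_real (m x)" "\<lambda>x. complex_of_real (k x)"]
    bmult_add[of "\<lambda>x. complex_of_real (m x)" "\<lambda>x. complex_of_real (k x)"]
    bmult_diff[of "\<lambda>x. complex_of_real (m x)" "\<lambda>x. complex_of_real (k x)"]
    bmult_power[of "\<lambda>x. complex_of_real (m x)" n] by auto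

lemma rop_inject:
  assumes "rmult j" "\<And>x. j x \<noteq> 0" "ap (rop j) u = 0" shows "u = 0"
proof -
  have "AE x in lborel. fn (mul (\<lambda>x. complex_of_real (j x)) u) x = complex_of_real (j x) * fn u x"
    by (rule fn_mul[OF assms(1)])
  moreover have "mul (\<lambda>x. complex_of_real (j x)) u = 0"
    using assms by (simp add: ap_mop)
  ultimately have "AE x in lborel. fn (0 :: 'a l2) x = complex_of_real (j x) * fn u x" by simp
  then have "AE x in lborel. fn u x = fn 0 x"
    using fn_zero[where 'a='a] by eventually_elim (use assms(2) in simp)
  then show ?thesis by (rule l2_eqI)
qed

lemma rop_cancel_left:
  assumes "rmult j" "\<And>x. j x \<noteq> 0" "rop j * X = 0" shows "X = 0"
proof (rule bop_eqI)
  fix u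
  have "ap (rop j) (ap X u) = 0" using assms(3) by (metis ap_times ap_0)
  then show "ap X u = ap 0 u" using rop_inject[OF assms(1,2)] by simp
qed

lemma rop_cancel_right:
  assumes "rmult j" "\<And>x. j x \<noteq> 0" "X * rop j = 0" shows "X = 0"
proof -
  have "rop j * adj X = adj (X * rop j)"
    by (simp add: adj_times adj_mop[OF assms(1)])
  then have "rop j * adj X = 0" using assms(3) by simp
  then have "adj X = 0" using rop_cancel_left[OF assms(1,2)] by blast
  then show ?thesis by (metis adj_adj adj_zero)
qed

text \<open>A factorisation lemma of Douglas type: the form \<open>\<langle>T u, j\<^sup>-\<^sup>1 v\<rangle>\<close> on the dense range of the
  multiplication by \<open>j\<close> is bounded, and \<open>Z\<close> is the operator that represents it.\<close>

lemma factor_left: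
  fixes T :: "'a::euclidean_space bop"
  assumes j: "rmult j" "\<And>x. j x \<noteq> 0"
    and k: "\<And>u. 0 \<le> \<kappa> u" "0 \<le> c" "\<And>u. \<kappa> u \<le> c * norm u"
    and bd: "\<And>u v. \<bar>ap T u \<bullet> v\<bar> \<le> \<kappa> u * norm (ap (rop j) v)"
  obtains Z where "T = rop j * Z" "\<And>u. norm (ap Z u) \<le> \<kappa> u"
proof -
  define V where "V = range (ap (rop j))"
  have inj: "inj (ap (rop j))"
    by (rule injI) (metis rop_inject[OF j] ap_diff right_minus_eq)
  define b where "b u v = ap T u \<bullet> inv (ap (rop j)) v" for u v
  have b: "b u (ap (rop j) v) = ap T u \<bullet> v" for u v
    by (simp add: b_def inv_f_f[OF inj])
  obtain Z where Z: "\<And>u v. v \<in> V \<Longrightarrow> ap Z u \<bullet> v = b u v"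
    "\<And>u \<kappa>. 0 \<le> \<kappa> \<Longrightarrow> (\<And>v. v \<in> V \<Longrightarrow> \<bar>b u v\<bar> \<le> \<kappa> * norm v) \<Longrightarrow> norm (ap Z u) \<le> \<kappa>"
  proof (rule bop_of_form[where V=V and b=b and c=c])
    show "subspace V" unfolding V_def
      by (rule linear_subspace_image[OF _ subspace_UNIV]) (rule bounded_linear.linear[OF bounded_linear_ap])
    show "z = 0" if "\<And>v. v \<in> V \<Longrightarrow> z \<bullet> v = 0" for z
    proof -
      have "ap (rop j) z \<bullet> v = 0" for v
        using that[of "ap (rop j) v"] by (simp add: rop_inner[OF j(1)] V_def)
      then have "ap (rop j) z = 0" by (metis inner_eq_zero_iff)
      then show ?thesis by (rule rop_inject[OF j])
    qed
    show "imul v \<in> V" if "v \<in> V" for v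
      using that unfolding V_def by (auto simp flip: ap_imul)
    show "b (u + u') v = b u v + b u' v" if "v \<in> V" for u u' v
      using that by (auto simp: V_def b ap_add inner_add)
    show "b (r *\<^sub>R u) v = r * b u v" if "v \<in> V" for r u v
      using that by (auto simp: V_def b ap_scaleR)
    show "b u (v + v') = b u v + b u v'" if "v \<in> V" "v' \<in> V" for u v v'
      using that by (auto simp: V_def b inner_add simp flip: ap_add)
    show "b u (r *\<^sub>R v) = r * b u v" if "v \<in> V" for r u v
      using that by (auto simp: V_def b simp flip: ap_scaleR)
    show "b (imul u) (imul v) = b u v" if "v \<in> V" for u v
      using that by (auto simp: V_def b simp flip: ap_imul) (simp add: ap_imul imul_inner_imul)
    show "0 \<le> c" by fact
    show "\<bar>b u v\<bar> \<le> c * norm u * norm v" if v: "v \<in> V" for u v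
    proof -
      have "\<bar>b u v\<bar> \<le> \<kappa> u * norm v" using bd[of u] v by (auto simp: V_def b)
      also have "\<dots> \<le> c * norm u * norm v" by (intro mult_right_mono k) simp
      finally show ?thesis .
    qed
  qed blast
  show thesis
  proof (rule that)
    show "T = rop j * Z"
    proof (rule bop_eq_innerI)
      fix u v
      have "ap Z u \<bullet> ap (rop j) v = ap T u \<bullet> v" by (subst Z(1)) (auto simp: V_def b)
      then show "ap T u \<bullet> v = ap (rop j * Z) u \<bullet> v" by (simp add: rop_inner[OF j(1)])
    qed
    show "norm (ap Z u) \<le> \<kappa> u" for u
      by (rule Z(2)) (use k bd in \<open>auto simp: V_def b\<close>)
  qed
qed

text \<open>The bounded operators of the form \<open>J C J\<close>, the admissible errors, are recognised by their
  quadratic form.\<close>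

lemma factor_both:
  fixes T :: "'a::euclidean_space bop"
  assumes j: "rmult j" "\<And>x. j x \<noteq> 0" and "0 \<le> c"
    and bd: "\<And>u v. \<bar>ap T u \<bullet> v\<bar> \<le> c * norm (ap (rop j) u) * norm (ap (rop j) v)"
  obtains C where "T = rop j * C * rop j" "\<And>u. norm (ap C u) \<le> c * norm u"
proof -
  obtain d where d: "0 \<le> d" "\<And>u. norm (ap (rop j) u) \<le> d * norm u" using ap_bound[of "rop j"] by blast
  obtain Z where Z: "T = rop j * Z" "\<And>u. norm (ap Z u) \<le> c * norm (ap (rop j) u)"
  proof (rule factor_left[where T=T and \<kappa>="\<lambda>u. c * norm (ap (rop j) u)" and c="c * d" and j=j])
    show "c * norm (ap (rop j) u) \<le> c * d * norm u" for u
      using mult_left_mono[OF d(2)[of u] \<open>0 \<le> c\<close>] by (simp add: mult.assoc)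
  qed (use assms d in auto)
  obtain C where C: "adj Z = rop j * C" "\<And>u. norm (ap C u) \<le> c * norm u"
  proof (rule factor_left[where T="adj Z" and \<kappa>="\<lambda>u. c * norm u" and c=c and j=j])
    show "\<bar>ap (adj Z) u \<bullet> v\<bar> \<le> c * norm u * norm (ap (rop j) v)" for u v
    proof -
      have "\<bar>ap (adj Z) u \<bullet> v\<bar> \<le> norm u * norm (ap Z v)" unfolding adj by (rule Cauchy_Schwarz_ineq2)
      also have "\<dots> \<le> norm u * (c * norm (ap (rop j) v))" by (intro mult_left_mono Z) simp
      finally show ?thesis by (simp add: algebra_simps)
    qed
  qed (use assms in auto)
  have "Z = adj C * rop j"
    using arg_cong[OF C(1), of adj] by (simp add: adj_times adj_mop[OF j(1)])
  moreover have "norm (ap (adj C) u) \<le> c * norm u" for u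
  proof -
    have "(norm (ap (adj C) u))\<^sup>2 = u \<bullet> ap C (ap (adj C) u)"
      by (simp add: power2_norm_eq_inner adj)
    also have "\<dots> \<le> norm u * (c * norm (ap (adj C) u))"
      using Cauchy_Schwarz_ineq2[of u "ap C (ap (adj C) u)"] mult_left_mono[OF C(2)[of "ap (adj C) u"], of "norm u"] by simp
    finally have "norm (ap (adj C) u) * norm (ap (adj C) u) \<le> (c * norm u) * norm (ap (adj C) u)"
      by (simp add: power2_eq_square algebra_simps)
    then show ?thesis using \<open>0 \<le> c\<close> by (cases "ap (adj C) u = 0") auto
  qed
  ultimately show ?thesis using Z(1) by (intro that[of "adj C"]) (auto simp: mult.assoc)
qed

text \<open>The multiplication operator \<open>J\<close> by \<open>0 < j \<le> 1\<close> is injective with a possibly unbounded inverse.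
  The Cayley transform \<open>x = (1 - j\<^sup>2) / (1 + j\<^sup>2)\<close> takes values in \<open>[0, 1)\<close> and turns the
  Lyapunov equation \<open>J\<^sup>2 W + W J\<^sup>2 = J V J\<close> into \<open>2 (W - X W X) = D V D\<close>, where
  \<open>D = J (1 + X)\<close> satisfies \<open>D\<^sup>2 = 1 - X\<^sup>2\<close>. The latter is solved by a geometric series.\<close>

locale cayley =
  fixes j :: "'a::euclidean_space \<Rightarrow> real"
  assumes j_meas [measurable]: "j \<in> borel_measurable borel" and j_pos: "\<And>x. 0 < j x" and j_le: "\<And>x. j x \<le> 1"
begin

definition "J = rop j"
definition "cx x = (1 - (j x)\<^sup>2) / (1 + (j x)\<^sup>2)"
definition "X = rop cx"
definition "Y = rop (\<lambda>x. 1 + cx x)"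
definition "D = rop (\<lambda>x. j x * (1 + cx x))"

lemma rmult_j: "rmult j"
proof (rule rmultI[OF j_meas])
  show "\<bar>j x\<bar> \<le> 1" for x using j_pos[of x] j_le[of x] by simp
qed

lemma j_nz: "j x \<noteq> 0" using j_pos[of x] by simp

lemma cx: "0 \<le> cx x" "cx x < 1"
proof -
  have "(j x)\<^sup>2 \<le> 1" "0 < (j x)\<^sup>2" using j_le[of x] j_pos[of x] by (auto simp: power_le_one)
  moreover have "0 < 1 + (j x)\<^sup>2" using \<open>0 < (j x)\<^sup>2\<close> by linarith
  ultimately show "0 \<le> cx x" "cx x < 1" by (simp_all add: cx_def)
qed

lemma rmult_cx: "rmult cx"
proof (rule rmultI)
  show "cx \<in> borel_measurable borel" unfolding cx_def by measurable
  show "\<bar>cx x\<bar> \<le> 1" for x using cx[of x] by simp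
qed

lemmas rm = rmult_cx rmult_j rmult_intros

lemma cx_eq: "(j x)\<^sup>2 * (1 + cx x) = 1 - cx x"
proof -
  have "0 < 1 + (j x)\<^sup>2" by (simp add: add_pos_nonneg)
  then show ?thesis by (simp add: cx_def field_simps)
qed

lemma Y_eq: "Y = 1 + X"
  unfolding Y_def X_def rop_one[symmetric] by (rule rop_plus[symmetric]) (intro rm)+

lemma JJY: "J * J * Y = 1 - X" and YJJ: "Y * J * J = 1 - X"
proof -
  have "J * J * Y = rop (\<lambda>x. j x * j x * (1 + cx x))"
    unfolding J_def Y_def by (simp only: rop_times rm)
  also have "\<dots> = rop (\<lambda>x. 1 - cx x)"
    using cx_eq by (simp only: power2_eq_square)
  also have "\<dots> = 1 - X"
    unfolding X_def rop_one[symmetric] by (rule rop_minus[symmetric]) (intro rm)+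
  finally show "J * J * Y = 1 - X" .
  moreover have "Y * J * J = J * J * Y"
    unfolding J_def Y_def by (simp only: rop_times rm) (simp add: mult_ac)
  ultimately show "Y * J * J = 1 - X" by simp
qed

lemma D_eq: "D = J * Y" "D = Y * J"
  unfolding D_def J_def Y_def by (simp_all only: rop_times rm) (simp add: mult_ac)

lemma D_D: "D * D = 1 - X * X"
proof -
  have "D * D = (Y * J) * (J * Y)" by (metis D_eq)
  also have "\<dots> = Y * (J * J * Y)" by (simp only: mult.assoc)
  finally show ?thesis unfolding JJY by (simp add: Y_eq algebra_simps)
qed

lemma D_inner: "ap D u \<bullet> v = u \<bullet> ap D v"
  unfolding D_def by (rule rop_inner) (intro rm)

lemma X_inner: "ap X u \<bullet> v = u \<bullet> ap X v"
  unfolding X_def by (rule rop_inner) (intro rm)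

lemma Y_cancel: "Y * A * Y = Y * B * Y \<Longrightarrow> A = B"
proof -
  assume "Y * A * Y = Y * B * Y"
  then have *: "Y * ((A - B) * Y) = 0" by (simp add: algebra_simps)
  have nz: "1 + cx x \<noteq> 0" for x using cx[of x] by simp
  have "(A - B) * Y = 0" using * unfolding Y_def
    by (rule rop_cancel_left[rotated 2]) (auto intro!: rm nz)
  then have "A - B = 0" unfolding Y_def
    by (rule rop_cancel_right[rotated 2]) (auto intro!: rm nz)
  then show "A = B" by simp
qed

lemma D_norm: "(norm (ap D u))\<^sup>2 = (norm u)\<^sup>2 - (norm (ap X u))\<^sup>2"
proof -
  have "(norm (ap D u))\<^sup>2 = u \<bullet> ap (D * D) u"
    by (simp add: power2_norm_eq_inner D_inner)
  also have "\<dots> = u \<bullet> u - u \<bullet> ap X (ap X u)" by (simp add: D_D inner_diff)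
  also have "\<dots> = (norm u)\<^sup>2 - (norm (ap X u))\<^sup>2"
    by (simp add: power2_norm_eq_inner X_inner)
  finally show ?thesis .
qed

definition "e i u = ap D (ap (X ^ i) u)"

text \<open>The sum telescopes because \<open>D\<^sup>2 = 1 - X\<^sup>2\<close>.\<close>

lemma e_sum: "(\<Sum>i<n. (norm (e i u))\<^sup>2) \<le> (norm u)\<^sup>2"
proof -
  have "(\<Sum>i<n. (norm (e i u))\<^sup>2) = (norm u)\<^sup>2 - (norm (ap (X ^ n) u))\<^sup>2"
    by (induction n) (auto simp: e_def D_norm)
  then show ?thesis by simp
qed

lemma e_shift: "e i (ap X u) = e (Suc i) u"
  by (simp add: e_def power_Suc2 del: power_Suc)

text \<open>The solution is \<open>W = 1/2 \<Sum>\<^sub>i X\<^sup>i D V D X\<^sup>i\<close>. The series need not converge in norm, since \<open>X\<close> may have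
  norm \<open>1\<close>, but it converges absolutely as a form by the Cauchy-Schwarz inequality and \<open>e_sum\<close>. The
  constant \<open>C / 2\<close> is sharp for \<open>V = 1\<close>, and \<open>midpoint_bound\<close> depends on it.\<close>

lemma lyapunov:
  assumes "0 \<le> C" and V: "\<And>u. norm (ap V u) \<le> C * norm u"
  obtains W where "J * J * W + W * J * J = J * V * J" "\<And>u. norm (ap W u) \<le> C / 2 * norm u"
proof -
  define \<beta> where "\<beta> i u v = ap V (e i u) \<bullet> e i v" for i u v
  have fin: "(\<Sum>i<n. \<bar>\<beta> i u v\<bar>) \<le> C * norm u * norm v" for n u v
  proof -
    have "(\<Sum>i<n. \<bar>\<beta> i u v\<bar>) \<le> (\<Sum>i<n. C * (\<bar>norm (e i u)\<bar> * \<bar>norm (e i v)\<bar>))"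
    proof (rule sum_mono)
      fix i
      have "\<bar>\<beta> i u v\<bar> \<le> norm (ap V (e i u)) * norm (e i v)" unfolding \<beta>_def by (rule Cauchy_Schwarz_ineq2)
      also have "\<dots> \<le> C * norm (e i u) * norm (e i v)" by (intro mult_right_mono V) simp
      finally show "\<bar>\<beta> i u v\<bar> \<le> C * (\<bar>norm (e i u)\<bar> * \<bar>norm (e i v)\<bar>)" by simp
    qed
    also have "\<dots> = C * (\<Sum>i<n. \<bar>norm (e i u)\<bar> * \<bar>norm (e i v)\<bar>)" by (simp add: sum_distrib_left)
    also have "\<dots> \<le> C * (L2_set (\<lambda>i. norm (e i u)) {..<n} * L2_set (\<lambda>i. norm (e i v)) {..<n})"
      by (intro mult_left_mono L2_set_mult_ineq \<open>0 \<le> C\<close>)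
    also have "\<dots> \<le> C * (norm u * norm v)"
      unfolding L2_set_def
      by (intro mult_left_mono mult_mono \<open>0 \<le> C\<close> real_le_lsqrt[OF norm_ge_zero e_sum] norm_ge_zero real_sqrt_ge_zero sum_nonneg) auto
    finally show ?thesis by (simp add: mult.assoc)
  qed
  have summ: "summable (\<lambda>i. \<beta> i u v)" for u v
    by (rule summable_norm_cancel, rule summableI_nonneg_bounded[where x="C * norm u * norm v"]) (use fin in auto)
  define b where "b u v = (\<Sum>i. \<beta> i u v) / 2" for u v
  have e_lin: "e i (u + v) = e i u + e i v" "e i (r *\<^sub>R u) = r *\<^sub>R e i u" "e i (imul u) = imul (e i u)" for i u v r
    by (simp_all add: e_def ap_add ap_scaleR ap_imul)
  obtain W where W: "\<And>u v. ap W u \<bullet> v = b u v" "\<And>u. norm (ap W u) \<le> C / 2 * norm u"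
  proof (rule bop_of_bounded_form[where b=b and c="C/2"])
    show "b (u + u') v = b u v + b u' v" for u u' v
      using suminf_add[OF summ[of u v] summ[of u' v]]
      by (simp add: b_def \<beta>_def e_lin ap_add inner_add field_simps)
    show "b u (v + v') = b u v + b u v'" for u v v'
      using suminf_add[OF summ[of u v] summ[of u v']]
      by (simp add: b_def \<beta>_def e_lin ap_add inner_add field_simps)
    show "b (r *\<^sub>R u) v = r * b u v" for r u v
      using suminf_mult[OF summ[of u v], of r] by (simp add: b_def \<beta>_def e_lin ap_scaleR)
    show "b u (r *\<^sub>R v) = r * b u v" for r u v
      using suminf_mult[OF summ[of u v], of r] by (simp add: b_def \<beta>_def e_lin ap_scaleR)
    show "b (imul u) (imul v) = b u v" for u v
      by (simp add: b_def \<beta>_def e_lin ap_imul imul_inner_imul)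
    show "0 \<le> C / 2" using \<open>0 \<le> C\<close> by simp
    show "\<bar>b u v\<bar> \<le> C / 2 * norm u * norm v" for u v
    proof -
      have s: "summable (\<lambda>i. \<bar>\<beta> i u v\<bar>)"
        by (rule summableI_nonneg_bounded[where x="C * norm u * norm v"]) (use fin in auto)
      have "\<bar>\<Sum>i. \<beta> i u v\<bar> \<le> (\<Sum>i. \<bar>\<beta> i u v\<bar>)" by (rule summable_rabs[OF s])
      also have "\<dots> \<le> C * norm u * norm v" by (rule suminf_le_const[OF s fin])
      finally show ?thesis by (simp add: b_def)
    qed
  qed blast
  have "W + W - (X * W * X + X * W * X) = D * V * D"
  proof (rule bop_eq_innerI)
    fix u v
    have "ap X (ap W (ap X u)) \<bullet> v = b (ap X u) (ap X v)"
      by (simp add: X_inner W(1))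
    \<comment> \<open>applying \<open>X\<close> on both sides shifts the series by one index\<close>
    moreover have "b (ap X u) (ap X v) = b u v - \<beta> 0 u v / 2"
      using suminf_split_head[OF summ[of u v]] by (simp add: b_def \<beta>_def e_shift)
    moreover have "\<beta> 0 u v = ap (D * V * D) u \<bullet> v"
      by (simp add: \<beta>_def e_def D_inner)
    ultimately show "ap (W + W - (X * W * X + X * W * X)) u \<bullet> v = ap (D * V * D) u \<bullet> v"
      by (simp add: inner_add inner_diff W(1))
  qed
  moreover have "Y * (J * J * W + W * J * J) * Y = (1 - X) * W * (1 + X) + (1 + X) * W * (1 - X)"
  proof -
    have "Y * (J * J * W + W * J * J) * Y = (Y * J * J) * W * Y + Y * W * (J * J * Y)"
      by (simp add: algebra_simps)
    then show ?thesis unfolding JJY YJJ by (simp only: Y_eq)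
  qed
  moreover have "Y * (J * V * J) * Y = D * V * D"
  proof -
    have "Y * (J * V * J) * Y = (Y * J) * V * (J * Y)" by (simp only: mult.assoc)
    then show ?thesis by (simp only: D_eq[symmetric])
  qed
  ultimately have "Y * (J * J * W + W * J * J) * Y = Y * (J * V * J) * Y"
    by (simp add: algebra_simps)
  then have "J * J * W + W * J * J = J * V * J" by (rule Y_cancel)
  with W(2) show thesis using that by blast
qed

text \<open>A solution of the homogeneous equation satisfies \<open>T = X\<^sup>n T X\<^sup>n\<close> for all \<open>n\<close>, and \<open>X\<^sup>n\<close> tends
  strongly to \<open>0\<close>.\<close>

lemma lyapunov_unique:
  assumes "J * J * T + T * J * J = 0" shows "T = 0"
proof -
  have "Y * (J * J * T + T * J * J) * Y = (Y * J * J) * T * Y + Y * T * (J * J * Y)"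
    by (simp add: algebra_simps)
  then have "0 = (1 - X) * T * (1 + X) + (1 + X) * T * (1 - X)"
    unfolding JJY YJJ assms by (simp add: Y_eq)
  then have "T + T = X * T * X + X * T * X" by (simp add: algebra_simps)
  then have two: "2 *\<^sub>R ap T u = 2 *\<^sub>R ap (X * T * X) u" for u
    by (metis ap_plus scaleR_2)
  have TX: "T = X * T * X"
  proof (rule bop_eqI)
    show "ap T u = ap (X * T * X) u" for u
      using two[of u] by (simp only: scaleR_cancel_left) (metis zero_neq_numeral)
  qed
  have TXn: "T = X ^ n * T * X ^ n" for n
  proof (induction n)
    case (Suc n)
    have "(X ^ n * X) * T * (X * X ^ n) = X ^ n * (X * T * X) * X ^ n"
      by (simp only: mult.assoc)
    also have "\<dots> = T" by (simp only: TX[symmetric] Suc[symmetric])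
    finally show ?case by (simp only: power_Suc2[symmetric] power_Suc[symmetric])
  qed simp
  have Xn: "X ^ n = rop (\<lambda>x. cx x ^ n)" for n
    by (induction n) (simp_all add: mop_one X_def mop_times rmult_cx bmult_power)
  have lim: "(\<lambda>n. ap (X ^ n) u) \<longlonglongrightarrow> 0" for u
  proof -
    have "(\<lambda>n. ap (mop (\<lambda>x. complex_of_real (cx x ^ n))) u) \<longlonglongrightarrow> ap (mop (\<lambda>x. 0)) u"
    proof (rule mop_tendsto[where c=1])
      show "rmult (\<lambda>x. cx x ^ n)" for n by (intro rm)
      show "cmod (complex_of_real (cx x ^ n)) \<le> 1" for n x
        using cx[of x] by (simp add: norm_power power_le_one)
      have "(\<lambda>n. cx x ^ n) \<longlonglongrightarrow> 0" for x using cx[of x] by (intro LIMSEQ_power_zero) simp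
      then show "(\<lambda>n. complex_of_real (cx x ^ n)) \<longlonglongrightarrow> 0" for x
        using tendsto_of_real[where 'a=complex] by fastforce
    qed simp
    then show ?thesis by (simp add: Xn mop_zero)
  qed
  show ?thesis
  proof (rule bop_eq_innerI)
    fix u v
    have "ap T u \<bullet> v = ap T (ap (X ^ n) u) \<bullet> ap (X ^ n) v" for n
    proof -
      have "ap T u \<bullet> v = ap (X ^ n * T * X ^ n) u \<bullet> v" by (simp only: TXn[of n, symmetric])
      moreover have "ap (X ^ n) w \<bullet> v = w \<bullet> ap (X ^ n) v" for w
        unfolding Xn by (rule rop_inner) (intro rm)
      ultimately show ?thesis by simp
    qed
    moreover have "(\<lambda>n. ap T (ap (X ^ n) u) \<bullet> ap (X ^ n) v) \<longlonglongrightarrow> ap T 0 \<bullet> 0"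
      by (intro tendsto_inner lim bounded_linear.tendsto[OF bounded_linear_ap])
    ultimately have "(\<lambda>n::nat. ap T u \<bullet> v) \<longlonglongrightarrow> 0" by simp
    then show "ap T u \<bullet> v = ap 0 u \<bullet> v" by (simp add: LIMSEQ_const_iff)
  qed
qed

definition "Jp t = rop (\<lambda>x. j x powr t)"

lemma powr_j: "0 < j x powr t" "0 \<le> t \<Longrightarrow> j x powr t \<le> 1"
  using j_pos[of x] j_le[of x] by (auto intro: powr_le1)

lemma rmult_powr: "0 \<le> t \<Longrightarrow> rmult (\<lambda>x. j x powr t)"
  using powr_j by (intro rmultI[of _ 1]) (auto simp: abs_of_pos)

lemma Jp_add: "0 \<le> s \<Longrightarrow> 0 \<le> t \<Longrightarrow> Jp s * Jp t = Jp (s + t)"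
  unfolding Jp_def by (subst rop_times) (auto simp: rmult_powr powr_add)

lemma Jp_0 [simp]: "Jp 0 = 1"
  using j_nz by (simp add: Jp_def mop_one)

lemma Jp_inner: "0 \<le> t \<Longrightarrow> ap (Jp t) u \<bullet> v = u \<bullet> ap (Jp t) v"
  unfolding Jp_def by (rule rop_inner) (rule rmult_powr)

lemma Jp_cancel: "0 \<le> t \<Longrightarrow> Jp t * A = Jp t * B \<Longrightarrow> A = B"
proof -
  assume t: "0 \<le> t" and "Jp t * A = Jp t * B"
  then have "Jp t * (A - B) = 0" by (simp add: right_diff_distrib)
  moreover have "j x powr t \<noteq> 0" for x using powr_j(1)[of x t] by simp
  ultimately have "A - B = 0" unfolding Jp_def by (rule rop_cancel_left[OF rmult_powr[OF t], rotated])
  then show ?thesis by simp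
qed

lemma factor_Jp:
  assumes "0 \<le> t" "0 \<le> C" and bd: "\<And>u v. \<bar>ap T (ap (Jp t) u) \<bullet> v\<bar> \<le> C * norm u * norm (ap (Jp t) v)"
  obtains Z where "T * Jp t = Jp t * Z" "\<And>u. norm (ap Z u) \<le> C * norm u"
proof (rule factor_left[where T="T * Jp t" and j="\<lambda>x. j x powr t" and \<kappa>="\<lambda>u. C * norm u" and c=C])
  show "rmult (\<lambda>x. j x powr t)" by (rule rmult_powr) fact
  show "j x powr t \<noteq> 0" for x using powr_j(1)[of x t] by simp
  show "\<bar>ap (T * Jp t) u \<bullet> v\<bar> \<le> C * norm u * norm (ap (rop (\<lambda>x. j x powr t)) v)" for u v
    using bd[of u v] by (simp add: Jp_def)
  fix Z assume "T * Jp t = rop (\<lambda>x. j x powr t) * Z" "\<And>u. norm (ap Z u) \<le> C * norm u"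
  then show thesis by (intro that[of Z]) (auto simp: Jp_def)
qed (use \<open>0 \<le> C\<close> in auto)

lemma bound_Jp:
  assumes "0 \<le> t" "T * Jp t = Jp t * Z" and Z: "\<And>u. norm (ap Z u) \<le> C * norm u"
  shows "\<bar>ap T (ap (Jp t) u) \<bullet> v\<bar> \<le> C * norm u * norm (ap (Jp t) v)"
proof -
  have "ap T (ap (Jp t) u) = ap (Jp t) (ap Z u)" using assms(2) by (metis ap_times)
  then have "ap T (ap (Jp t) u) \<bullet> v = ap Z u \<bullet> ap (Jp t) v" by (simp add: Jp_inner \<open>0 \<le> t\<close>)
  also have "\<bar>\<dots>\<bar> \<le> norm (ap Z u) * norm (ap (Jp t) v)" by (rule Cauchy_Schwarz_ineq2)
  also have "\<dots> \<le> C * norm u * norm (ap (Jp t) v)" by (intro mult_right_mono Z) simp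
  finally show ?thesis .
qed

text \<open>If \<open>T J\<^sup>s = J\<^sup>s Z\<^sub>s\<close> and \<open>T J\<^sup>t = J\<^sup>t Z\<^sub>t\<close>, then at the midpoint \<open>T\<close> is intertwined with the
  solution \<open>W\<close> of the Lyapunov equation for \<open>J\<^sup>d\<close>, \<open>d = (t - s) / 2\<close>, and right-hand side
  \<open>Z\<^sub>s + Z\<^sub>t\<close>. Since \<open>W\<close> is bounded by half the bound of \<open>Z\<^sub>s + Z\<^sub>t\<close>, the constant \<open>C\<close> is
  inherited, and the argument can be iterated.\<close>

lemma midpoint_bound:
  assumes st: "0 \<le> s" "s \<le> t" and "0 \<le> C"
    and s: "\<And>u v. \<bar>ap T (ap (Jp s) u) \<bullet> v\<bar> \<le> C * norm u * norm (ap (Jp s) v)"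
    and t: "\<And>u v. \<bar>ap T (ap (Jp t) u) \<bullet> v\<bar> \<le> C * norm u * norm (ap (Jp t) v)"
  shows "\<bar>ap T (ap (Jp ((s + t) / 2)) u) \<bullet> v\<bar> \<le> C * norm u * norm (ap (Jp ((s + t) / 2)) v)"
proof -
  \<comment> \<open>half the distance, so that the midpoint is reached from both ends by \<open>Jp d\<close>\<close>
  define d where "d = (t - s) / 2"
  have d: "0 \<le> d" "s + d = (s + t) / 2" "(s + d) + d = t" using st by (auto simp: d_def field_simps)
  obtain Zs where Zs: "T * Jp s = Jp s * Zs" "\<And>u. norm (ap Zs u) \<le> C * norm u"
    using factor_Jp[OF st(1) \<open>0 \<le> C\<close> s] by blast
  have "0 \<le> t" using st by simp
  obtain Zt where Zt: "T * Jp t = Jp t * Zt" "\<And>u. norm (ap Zt u) \<le> C * norm u"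
    using factor_Jp[OF \<open>0 \<le> t\<close> \<open>0 \<le> C\<close> t] by blast
  interpret d: cayley "\<lambda>x. j x powr d"
    by unfold_locales (use powr_j d in auto)
  have dJ: "d.J = Jp d" by (simp add: d.J_def Jp_def)
  have Jt: "Jp t = Jp s * Jp d * Jp d" using Jp_add st d by simp
  have Js: "Jp ((s + t) / 2) = Jp s * Jp d" using Jp_add[OF st(1) d(1)] d by simp
  have swap: "Zs * Jp d * Jp d = Jp d * Jp d * Zt"
  proof (rule Jp_cancel[OF st(1)])
    have "Jp s * (Zs * Jp d * Jp d) = (Jp s * Zs) * Jp d * Jp d" by (simp only: mult.assoc)
    also have "\<dots> = T * Jp t" by (simp only: Zs(1)[symmetric] Jt mult.assoc)
    also have "\<dots> = Jp s * (Jp d * Jp d * Zt)" by (simp only: Zt(1)) (simp only: Jt mult.assoc)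
    finally show "Jp s * (Zs * Jp d * Jp d) = Jp s * (Jp d * Jp d * Zt)" .
  qed
  have bd: "norm (ap (Zs + Zt) u) \<le> (2 * C) * norm u" for u
    using norm_triangle_ineq[of "ap Zs u" "ap Zt u"] Zs(2)[of u] Zt(2)[of u] by (simp add: algebra_simps)
  have "0 \<le> 2 * C" using \<open>0 \<le> C\<close> by simp
  obtain W where W: "Jp d * Jp d * W + W * Jp d * Jp d = Jp d * (Zs + Zt) * Jp d"
      and W_norm: "\<And>u. norm (ap W u) \<le> 2 * C / 2 * norm u"
    using d.lyapunov[OF \<open>0 \<le> 2 * C\<close> bd] unfolding dJ by blast
  have "Jp d * W - Zs * Jp d = 0"
  proof (rule d.lyapunov_unique, unfold dJ)
    have "Jp d * Jp d * (Jp d * W - Zs * Jp d) + (Jp d * W - Zs * Jp d) * Jp d * Jp d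
      = Jp d * (Jp d * Jp d * W + W * Jp d * Jp d) - Jp d * Jp d * Zs * Jp d - (Zs * Jp d * Jp d) * Jp d"
      by (simp add: algebra_simps)
    then show "Jp d * Jp d * (Jp d * W - Zs * Jp d) + (Jp d * W - Zs * Jp d) * Jp d * Jp d = 0"
      unfolding W swap by (simp add: algebra_simps)
  qed
  then have "T * Jp ((s + t) / 2) = Jp ((s + t) / 2) * W"
    unfolding Js by (metis Zs(1) eq_iff_diff_eq_0 mult.assoc)
  then show ?thesis using st W_norm by (intro bound_Jp) auto
qed

lemma Jp_tendsto:
  assumes "\<And>n. 0 \<le> s n" "s \<longlonglongrightarrow> t" shows "(\<lambda>n. ap (Jp (s n)) u) \<longlonglongrightarrow> ap (Jp t) u"
  unfolding Jp_def
proof (rule mop_tendsto[where c=1])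
  have "0 \<le> t" using LIMSEQ_le_const[OF assms(2)] assms(1) by blast
  then show "rmult (\<lambda>x. j x powr t)" by (rule rmult_powr)
  show "rmult (\<lambda>x. j x powr s n)" for n by (rule rmult_powr) (rule assms)
  show "cmod (complex_of_real (j x powr s n)) \<le> 1" for n x
    using powr_j(1)[of x "s n"] powr_j(2)[OF assms(1)[of n], of x] by simp
  show "(\<lambda>n. complex_of_real (j x powr s n)) \<longlonglongrightarrow> complex_of_real (j x powr t)" for x
    using j_nz[of x] by (intro tendsto_of_real tendsto_powr assms tendsto_const) auto
qed

text \<open>The exponents at which \<open>T\<close> is bounded with the same constant \<open>C\<close> form a closed set which contains
  \<open>0\<close> and \<open>2\<close> and the midpoints of its elements, hence the whole interval between them.\<close>

lemma interpolation:
  assumes TX: "T * (J * J) = J * J * X'" and t: "0 \<le> t" "t \<le> 2"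
  obtains Z where "T * Jp t = Jp t * Z"
proof -
  obtain C1 where C1: "0 \<le> C1" "\<And>u. norm (ap T u) \<le> C1 * norm u" using ap_bound[of T] by blast
  obtain C2 where C2: "0 \<le> C2" "\<And>u. norm (ap X' u) \<le> C2 * norm u" using ap_bound[of X'] by blast
  define C where "C = max C1 C2"
  have C: "0 \<le> C" "norm (ap T u) \<le> C * norm u" "norm (ap X' u) \<le> C * norm u" for u
    using C1 C2 mult_right_mono[of C1 C "norm u"] mult_right_mono[of C2 C "norm u"]
    by (auto simp: C_def intro: order_trans)
  define A where "A = {s. 0 \<le> s \<and> s \<le> 2 \<and> (\<forall>u v. \<bar>ap T (ap (Jp s) u) \<bullet> v\<bar> \<le> C * norm u * norm (ap (Jp s) v))}"
  have J2: "J * J = Jp 2"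
  proof -
    have "j x powr 2 = j x * j x" for x using j_pos[of x] by (simp add: powr_numeral power2_eq_square)
    then show ?thesis unfolding Jp_def J_def by (simp only: rop_times[OF rmult_j rmult_j])
  qed
  have "0 \<in> A" unfolding A_def using bound_Jp[of 0 T T C] C by auto
  have "2 \<in> A" unfolding A_def using bound_Jp[of 2 T X' C] C TX J2 by auto
  have "closed A"
  proof (unfold closed_sequential_limits, intro allI impI)
    fix s l assume s: "(\<forall>n. s n \<in> A) \<and> s \<longlonglongrightarrow> l"
    then have s0: "0 \<le> s n" and s2: "s n \<le> 2"
      and sb: "\<bar>ap T (ap (Jp (s n)) u) \<bullet> v\<bar> \<le> C * norm u * norm (ap (Jp (s n)) v)" for n u v
      by (auto simp: A_def)
    note lim = Jp_tendsto[OF s0 conjunct2[OF s]]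
    have "\<bar>ap T (ap (Jp l) u) \<bullet> v\<bar> \<le> C * norm u * norm (ap (Jp l) v)" for u v
    proof (rule LIMSEQ_le)
      show "(\<lambda>n. \<bar>ap T (ap (Jp (s n)) u) \<bullet> v\<bar>) \<longlonglongrightarrow> \<bar>ap T (ap (Jp l) u) \<bullet> v\<bar>"
        by (intro tendsto_rabs tendsto_inner tendsto_const bounded_linear.tendsto[OF bounded_linear_ap] lim)
      show "(\<lambda>n. C * norm u * norm (ap (Jp (s n)) v)) \<longlonglongrightarrow> C * norm u * norm (ap (Jp l) v)"
        by (intro tendsto_mult tendsto_norm tendsto_const lim)
    qed (use sb in auto)
    moreover have "0 \<le> l" "l \<le> 2"
      using LIMSEQ_le_const[OF conjunct2[OF s]] LIMSEQ_le_const2[OF conjunct2[OF s]] s0 s2 by blast+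
    ultimately show "l \<in> A" by (simp add: A_def)
  qed
  have mid: "(a + b) / 2 \<in> A" if "a \<in> A" "b \<in> A" "a \<le> b" for a b
    using that midpoint_bound[of a b C T] C(1) by (auto simp: A_def)
  have "t \<in> A"
  proof (rule ccontr)
    assume "t \<notin> A"
    \<comment> \<open>the gap of \<open>A\<close> around \<open>t\<close>, whose midpoint lies in \<open>A\<close>\<close>
    define a where "a = Sup (A \<inter> {..t})"
    define b where "b = Inf (A \<inter> {t..})"
    have "a \<in> A \<inter> {..t}" unfolding a_def
      using \<open>0 \<in> A\<close> t \<open>closed A\<close> by (intro closed_contains_Sup) (auto intro: bdd_aboveI)
    moreover have "b \<in> A \<inter> {t..}" unfolding b_def
      using \<open>2 \<in> A\<close> t \<open>closed A\<close> by (intro closed_contains_Inf) (auto intro: bdd_belowI)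
    ultimately have ab: "a \<in> A" "b \<in> A" "a < t" "t < b" using \<open>t \<notin> A\<close> by (auto simp: less_le)
    then have m: "(a + b) / 2 \<in> A" by (intro mid) auto
    show False
    proof (cases "(a + b) / 2 \<le> t")
      case True
      then have "(a + b) / 2 \<le> a" unfolding a_def using m
        by (intro cSup_upper) (auto simp: a_def intro: bdd_aboveI)
      then show False using ab by simp
    next
      case False
      then have "b \<le> (a + b) / 2" unfolding b_def using m
        by (intro cInf_lower) (auto simp: b_def intro: bdd_belowI)
      then show False using ab by simp
    qed
  qed
  then show thesis using factor_Jp[OF t(1) C(1)] that unfolding A_def by blast
qed

end

section \<open>Schwartz functions\<close>

lemma pderivatives_Nil [simp]: "pderivatives [] f = f"
  and pderivatives_Cons: "pderivatives (k # ks) f = pderivative k (pderivatives ks f)"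
  and pderivatives_snoc: "pderivatives (ks @ [k]) f = pderivatives ks (pderivative k f)"
  by (simp_all add: pderivatives_def)

definition rapid :: "(real^'n::finite \<Rightarrow> complex) \<Rightarrow> bool" where
  "rapid f \<longleftrightarrow> (\<forall>N::nat. \<exists>C. \<forall>x. (1 + norm x) ^ N * cmod (f x) \<le> C)"

lemma rapid_iff: "rapid f \<longleftrightarrow> (\<forall>N::nat. bounded (range (\<lambda>x. (1 + norm x) ^ N *\<^sub>R f x)))"
  by (simp add: rapid_def bounded_iff)

lemma schwartz_iff: "f \<in> schwartz \<longleftrightarrow> (\<forall>ks. (\<forall>x. pderivatives ks f differentiable (at x)) \<and> rapid (pderivatives ks f))"
  by (simp add: schwartz_def rapid_iff differentiable_on_def)

lemma schwartz_differentiable: "f \<in> schwartz \<Longrightarrow> f differentiable (at x)"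
  using pderivatives_Nil by (metis schwartz_iff)

lemma schwartz_rapid: "f \<in> schwartz \<Longrightarrow> rapid f"
  using pderivatives_Nil by (metis schwartz_iff)

lemma schwartz_pderivative: "f \<in> schwartz \<Longrightarrow> pderivative k f \<in> schwartz"
  by (simp add: schwartz_iff flip: pderivatives_snoc)

text \<open>Closure properties of the Schwartz class are proved by exhibiting a class of rapidly decreasing
  differentiable functions that is closed under partial derivatives.\<close>

lemma schwartz_coinduct:
  assumes "f \<in> C" "\<And>g x. g \<in> C \<Longrightarrow> g differentiable (at x)" "\<And>g. g \<in> C \<Longrightarrow> rapid g"
    and "\<And>g k. g \<in> C \<Longrightarrow> pderivative k g \<in> C"
  shows "f \<in> schwartz"
proof -
  have "pderivatives ks f \<in> C" for ks
    by (induction ks) (auto simp: assms pderivatives_Cons)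
  then show ?thesis using assms by (auto simp: schwartz_iff)
qed

lemma schwartz_continuous: "f \<in> schwartz \<Longrightarrow> continuous_on UNIV f"
  by (meson continuous_at_imp_continuous_on differentiable_imp_continuous_within schwartz_differentiable)

lemma schwartz_measurable: "f \<in> schwartz \<Longrightarrow> f \<in> borel_measurable borel"
  by (intro borel_measurable_continuous_onI schwartz_continuous)

lemma pderivative_eq: "(f has_derivative f') (at x) \<Longrightarrow> pderivative k f x = f' (axis k 1)"
  unfolding pderivative_def by (metis frechet_derivative_at)

lemma has_derivative_schwartz: "f \<in> schwartz \<Longrightarrow> (f has_derivative frechet_derivative f (at x)) (at x)"
  using schwartz_differentiable frechet_derivative_works by blast

lemma schwartz_derivative_at:
  assumes "f \<in> schwartz"
  obtains f' where "(f has_derivative f') (at x)" "\<And>k. f' (axis k 1) = pderivative k f x"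
  using has_derivative_schwartz[OF assms, of x] pderivative_eq by metis

lemma rapid_add: assumes "rapid f" "rapid g" shows "rapid (\<lambda>x. f x + g x)"
  unfolding rapid_def
proof
  fix N
  obtain C D where "\<And>x. (1 + norm x) ^ N * cmod (f x) \<le> C" "\<And>x. (1 + norm x) ^ N * cmod (g x) \<le> D"
    using assms unfolding rapid_def by metis
  then have "(1 + norm x) ^ N * cmod (f x + g x) \<le> C + D" for x
    using mult_left_mono[OF norm_triangle_ineq[of "f x" "g x"], of "(1 + norm x) ^ N"]
    by (smt (verit) distrib_left norm_ge_zero zero_le_power)
  then show "\<exists>C. \<forall>x. (1 + norm x) ^ N * cmod (f x + g x) \<le> C" by blast
qed

lemma rapid_mult:
  assumes "rapid f" "\<And>x. cmod (m x) \<le> B * (1 + norm x) ^ M" shows "rapid (\<lambda>x. m x * f x)"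
  unfolding rapid_def
proof
  fix N
  obtain C where C: "\<And>x. (1 + norm x) ^ (N + M) * cmod (f x) \<le> C" using assms(1) unfolding rapid_def by metis
  have "(1 + norm x) ^ N * cmod (m x * f x) \<le> \<bar>B\<bar> * C" for x
  proof -
    have "cmod (m x) \<le> \<bar>B\<bar> * (1 + norm x) ^ M"
      by (rule order_trans[OF assms(2)], rule mult_right_mono) auto
    then have "(1 + norm x) ^ N * (cmod (m x) * cmod (f x)) \<le> (1 + norm x) ^ N * ((\<bar>B\<bar> * (1 + norm x) ^ M) * cmod (f x))"
      by (intro mult_left_mono mult_right_mono) auto
    also have "\<dots> = \<bar>B\<bar> * ((1 + norm x) ^ (N + M) * cmod (f x))" by (simp add: power_add)
    also have "\<dots> \<le> \<bar>B\<bar> * C" by (intro mult_left_mono C) simp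
    finally show ?thesis by (simp add: norm_mult)
  qed
  then show "\<exists>C. \<forall>x. (1 + norm x) ^ N * cmod (m x * f x) \<le> C" by blast
qed

lemma rapid_bounded_mult: "rapid f \<Longrightarrow> (\<And>x. cmod (m x) \<le> B) \<Longrightarrow> rapid (\<lambda>x. m x * f x)"
  using rapid_mult[of f m B 0] by simp

lemma schwartz_add:
  fixes f :: "real^'n::finite \<Rightarrow> complex"
  assumes "f \<in> schwartz" "g \<in> schwartz" shows "(\<lambda>x. f x + g x) \<in> schwartz"
    and "pderivative k (\<lambda>x. f x + g x) = (\<lambda>x. pderivative k f x + pderivative k g x)"
proof -
  have der: "pderivative k (\<lambda>x. f x + g x) = (\<lambda>x. pderivative k f x + pderivative k g x)"
    if fs: "f \<in> schwartz" and gs: "g \<in> schwartz" for f g :: "real^'n \<Rightarrow> complex" and k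
  proof
    fix x
    obtain f' where f': "(f has_derivative f') (at x)" "\<And>k. f' (axis k 1) = pderivative k f x"
      using schwartz_derivative_at[OF fs, of x] by blast
    obtain g' where g': "(g has_derivative g') (at x)" "\<And>k. g' (axis k 1) = pderivative k g x"
      using schwartz_derivative_at[OF gs, of x] by blast
    note d = f' g'
    show "pderivative k (\<lambda>x. f x + g x) x = pderivative k f x + pderivative k g x"
      using pderivative_eq[OF has_derivative_add[OF d(1,3)]] d by simp
  qed
  show "pderivative k (\<lambda>x. f x + g x) = (\<lambda>x. pderivative k f x + pderivative k g x)" by (rule der[OF assms])
  let ?C = "{\<lambda>x. f x + g x | f g. f \<in> (schwartz :: (real^'n \<Rightarrow> complex) set) \<and> g \<in> (schwartz :: (real^'n \<Rightarrow> complex) set)}"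
  show "(\<lambda>x. f x + g x) \<in> schwartz"
  proof (rule schwartz_coinduct[where C="?C"])
    show "pderivative k h \<in> ?C" if hC: "h \<in> ?C" for h k
    proof -
      obtain f g where h: "h = (\<lambda>x. f x + g x)" "f \<in> schwartz" "g \<in> schwartz" using hC by blast
      show ?thesis unfolding h(1) der[OF h(2,3)]
        using schwartz_pderivative[OF h(2), of k] schwartz_pderivative[OF h(3), of k] by blast
    qed
  qed (use assms in \<open>auto intro!: differentiable_add rapid_add intro: schwartz_differentiable schwartz_rapid\<close>)
qed

lemma schwartz_cmult:
  fixes f :: "real^'n::finite \<Rightarrow> complex"
  assumes "f \<in> schwartz" shows "(\<lambda>x. c * f x) \<in> schwartz"
    and "pderivative k (\<lambda>x. c * f x) = (\<lambda>x. c * pderivative k f x)"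
proof -
  have der: "pderivative k (\<lambda>x. c * f x) = (\<lambda>x. c * pderivative k f x)"
    if fs: "f \<in> schwartz" for f :: "real^'n \<Rightarrow> complex" and k
  proof
    fix x
    obtain f' where d: "(f has_derivative f') (at x)" "\<And>k. f' (axis k 1) = pderivative k f x"
      using schwartz_derivative_at[OF fs, of x] by blast
    show "pderivative k (\<lambda>x. c * f x) x = c * pderivative k f x"
      using pderivative_eq[OF has_derivative_mult_right[OF d(1)]] d by simp
  qed
  show "pderivative k (\<lambda>x. c * f x) = (\<lambda>x. c * pderivative k f x)" by (rule der[OF assms])
  let ?C = "{\<lambda>x. c * f x | f. f \<in> (schwartz :: (real^'n \<Rightarrow> complex) set)}"
  show "(\<lambda>x. c * f x) \<in> schwartz"
  proof (rule schwartz_coinduct[where C="?C"])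
    show "pderivative k h \<in> ?C" if hC: "h \<in> ?C" for h k
      using that der schwartz_pderivative by blast
    show "rapid h" if hC: "h \<in> ?C" for h
    proof -
      obtain f where f: "h = (\<lambda>x. c * f x)" "f \<in> schwartz" using hC by blast
      show ?thesis unfolding f(1) by (rule rapid_bounded_mult[OF schwartz_rapid[OF f(2)] order_refl])
    qed
    show "h differentiable (at x)" if hC: "h \<in> ?C" for h x
    proof -
      obtain f where f: "h = (\<lambda>x. c * f x)" "f \<in> schwartz" using hC by blast
      show ?thesis unfolding f(1) by (intro differentiable_mult differentiable_const schwartz_differentiable f)
    qed
  qed (use assms in blast)
qed

lemma schwartz_diff: "f \<in> schwartz \<Longrightarrow> g \<in> schwartz \<Longrightarrow> (\<lambda>x. f x - g x) \<in> schwartz"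
  using schwartz_add(1)[OF _ schwartz_cmult(1)[of g "-1"], of f] by simp

lemma schwartz_zero: "(\<lambda>x. 0) \<in> schwartz"
proof (rule schwartz_coinduct[where C="{\<lambda>x. 0}"])
  show "pderivative k g \<in> {\<lambda>x. 0}" if "g \<in> {\<lambda>x. 0}" for g :: "real^'n \<Rightarrow> complex" and k
    using that pderivative_eq[of "\<lambda>x. 0" "\<lambda>x. 0", OF has_derivative_const] by auto
qed (auto simp: rapid_def)

lemma schwartz_sum: "(\<And>i. i \<in> I \<Longrightarrow> f i \<in> schwartz) \<Longrightarrow> (\<lambda>x. \<Sum>i\<in>I. f i x) \<in> schwartz"
  by (induction I rule: infinite_finite_induct) (auto simp: schwartz_zero schwartz_add)

lemma has_derivative_coordinate: "((\<lambda>x::real^'n. complex_of_real (x $ k)) has_derivative (\<lambda>h. complex_of_real (h $ k))) (at x)"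
  by (intro bounded_linear_imp_has_derivative bounded_linear_compose[OF bounded_linear_of_real] bounded_linear_vec_nth)

text \<open>The products alone are not closed under derivatives; sums of a product and a Schwartz function are.\<close>

lemma schwartz_coordinate_mult:
  fixes f :: "real^'n::finite \<Rightarrow> complex"
  assumes "f \<in> schwartz" shows "(\<lambda>x. complex_of_real (x $ k) * f x) \<in> schwartz"
proof -
  have der: "pderivative l (\<lambda>x. g x + complex_of_real (x $ k) * f x)
      = (\<lambda>x. (pderivative l g x + (if k = l then 1 else 0) * f x) + complex_of_real (x $ k) * pderivative l f x)"
    if fs: "f \<in> schwartz" and gs: "g \<in> schwartz" for f g :: "real^'n \<Rightarrow> complex" and l
  proof
    fix x
    obtain f' where f': "(f has_derivative f') (at x)" "\<And>k. f' (axis k 1) = pderivative k f x"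
      using schwartz_derivative_at[OF fs, of x] by blast
    obtain g' where g': "(g has_derivative g') (at x)" "\<And>k. g' (axis k 1) = pderivative k g x"
      using schwartz_derivative_at[OF gs, of x] by blast
    note d = f' g'
    show "pderivative l (\<lambda>x. g x + complex_of_real (x $ k) * f x) x
      = (pderivative l g x + (if k = l then 1 else 0) * f x) + complex_of_real (x $ k) * pderivative l f x"
      using pderivative_eq[OF has_derivative_add[OF d(3) has_derivative_mult[OF has_derivative_coordinate d(1)]]] d
      by (simp add: axis_def)
  qed
  let ?C = "{\<lambda>x. g x + complex_of_real (x $ k) * f x | f g. f \<in> (schwartz :: (real^'n \<Rightarrow> complex) set) \<and> g \<in> schwartz}"
  show ?thesis
  proof (rule schwartz_coinduct[where C="?C"])
    show "(\<lambda>x. complex_of_real (x $ k) * f x) \<in> ?C"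
      using assms schwartz_zero by (intro CollectI exI[of _ f] exI[of _ "\<lambda>x. 0"]) auto
    show "pderivative l h \<in> ?C" if hC: "h \<in> ?C" for h l
    proof -
      obtain f g where h: "h = (\<lambda>x. g x + complex_of_real (x $ k) * f x)" "f \<in> schwartz" "g \<in> schwartz"
        using hC by blast
      have "(\<lambda>x. pderivative l g x + (if k = l then 1 else 0) * f x) \<in> schwartz"
        by (intro schwartz_add schwartz_cmult schwartz_pderivative h)
      moreover have "pderivative l f \<in> schwartz" by (rule schwartz_pderivative[OF h(2)])
      ultimately show ?thesis unfolding h(1) der[OF h(2,3)]
        by (intro CollectI exI[of _ "pderivative l f"] exI[of _ "\<lambda>x. pderivative l g x + (if k = l then 1 else 0) * f x"]) simp
    qed
    show "rapid h" if hC: "h \<in> ?C" for h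
    proof -
      obtain f g where h: "h = (\<lambda>x. g x + complex_of_real (x $ k) * f x)" "f \<in> schwartz" "g \<in> schwartz"
        using hC by blast
      have "cmod (complex_of_real (x $ k)) \<le> 1 * (1 + norm x) ^ 1" for x :: "real^'n"
        using component_le_norm_cart[of x k] by simp
      then show ?thesis unfolding h(1)
        by (intro rapid_add schwartz_rapid h rapid_mult[where B=1 and M=1])
    qed
    show "h differentiable (at x)" if hC: "h \<in> ?C" for h x
    proof -
      obtain f g where h: "h = (\<lambda>x. g x + complex_of_real (x $ k) * f x)" "f \<in> schwartz" "g \<in> schwartz"
        using hC by blast
      show ?thesis unfolding h(1)
        by (intro differentiable_add differentiable_mult schwartz_differentiable h differentiableI[OF has_derivative_coordinate])
    qed
  qed
qed

lemma schwartz_cnj: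
  fixes f :: "real^'n::finite \<Rightarrow> complex"
  assumes "f \<in> schwartz" shows "(\<lambda>x. cnj (f x)) \<in> schwartz"
proof -
  have d: "((\<lambda>x. cnj (f x)) has_derivative (\<lambda>h. cnj (f' h))) (at x)"
    if "(f has_derivative f') (at x)" for f f' and x :: "real^'n"
    using bounded_linear.has_derivative[OF bounded_linear_cnj that] .
  let ?C = "{\<lambda>x. cnj (f x) | f. f \<in> (schwartz :: (real^'n \<Rightarrow> complex) set)}"
  show ?thesis
  proof (rule schwartz_coinduct[where C="?C"])
    show "pderivative k h \<in> ?C" if hC: "h \<in> ?C" for h k
    proof -
      obtain f where f: "h = (\<lambda>x. cnj (f x))" "f \<in> schwartz" using hC by blast
      have "pderivative k h = (\<lambda>x. cnj (pderivative k f x))"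
      proof
        fix x
        obtain f' where "(f has_derivative f') (at x)" "\<And>k. f' (axis k 1) = pderivative k f x"
          using schwartz_derivative_at[OF f(2), of x] by blast
        then show "pderivative k h x = cnj (pderivative k f x)" unfolding f(1) by (simp add: pderivative_eq[OF d])
      qed
      then show ?thesis using schwartz_pderivative[OF f(2)] by blast
    qed
    show "rapid h" if hC: "h \<in> ?C" for h
    proof -
      obtain f where f: "h = (\<lambda>x. cnj (f x))" "f \<in> schwartz" using hC by blast
      show ?thesis using schwartz_rapid[OF f(2)] by (simp add: f(1) rapid_def)
    qed
    show "h differentiable (at x)" if hC: "h \<in> ?C" for h x
      using hC d schwartz_differentiable unfolding differentiable_def by blast
  qed (use assms in auto)
qed

lemma has_derivative_modulation:
  "((\<lambda>x. exp (\<i> * complex_of_real (x \<bullet> a))) has_derivative (\<lambda>h. \<i> * complex_of_real (h \<bullet> a) * exp (\<i> * complex_of_real (x \<bullet> a)))) (at x)"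
proof -
  have "((\<lambda>x. \<i> * complex_of_real (x \<bullet> a)) has_derivative (\<lambda>h. \<i> * complex_of_real (h \<bullet> a))) (at x)"
    by (intro bounded_linear_imp_has_derivative bounded_linear_compose[OF bounded_linear_mult_right]
        bounded_linear_compose[OF bounded_linear_of_real] bounded_linear_inner_left)
  moreover have "(exp has_derivative (*) (exp (\<i> * complex_of_real (x \<bullet> a)))) (at (\<i> * complex_of_real (x \<bullet> a)))"
    using DERIV_exp has_field_derivative_def by blast
  ultimately have "((\<lambda>x. exp (\<i> * complex_of_real (x \<bullet> a))) has_derivative
      (\<lambda>h. exp (\<i> * complex_of_real (x \<bullet> a)) * (\<i> * complex_of_real (h \<bullet> a)))) (at x)"
    by (rule has_derivative_compose)
  then show ?thesis by (simp add: mult.commute)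
qed

lemma schwartz_modulation:
  fixes f :: "real^'n::finite \<Rightarrow> complex"
  assumes "f \<in> schwartz" shows "(\<lambda>x. exp (\<i> * complex_of_real (x \<bullet> a)) * f x) \<in> schwartz"
    and "pderivative k (\<lambda>x. exp (\<i> * complex_of_real (x \<bullet> a)) * f x)
       = (\<lambda>x. exp (\<i> * complex_of_real (x \<bullet> a)) * (\<i> * complex_of_real (a $ k) * f x + pderivative k f x))"
proof -
  have der: "pderivative k (\<lambda>x. exp (\<i> * complex_of_real (x \<bullet> a)) * f x)
      = (\<lambda>x. exp (\<i> * complex_of_real (x \<bullet> a)) * (\<i> * complex_of_real (a $ k) * f x + pderivative k f x))"
    if fs: "f \<in> schwartz" for f :: "real^'n \<Rightarrow> complex" and k
  proof
    fix x
    obtain f' where d: "(f has_derivative f') (at x)" "\<And>k. f' (axis k 1) = pderivative k f x"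
      using schwartz_derivative_at[OF fs, of x] by blast
    show "pderivative k (\<lambda>x. exp (\<i> * complex_of_real (x \<bullet> a)) * f x) x
      = exp (\<i> * complex_of_real (x \<bullet> a)) * (\<i> * complex_of_real (a $ k) * f x + pderivative k f x)"
      using pderivative_eq[OF has_derivative_mult[OF has_derivative_modulation d(1)]] d
      by (simp add: inner_axis' algebra_simps)
  qed
  show "pderivative k (\<lambda>x. exp (\<i> * complex_of_real (x \<bullet> a)) * f x)
       = (\<lambda>x. exp (\<i> * complex_of_real (x \<bullet> a)) * (\<i> * complex_of_real (a $ k) * f x + pderivative k f x))"
    by (rule der[OF assms])
  let ?C = "{\<lambda>x. exp (\<i> * complex_of_real (x \<bullet> a)) * f x | f. f \<in> (schwartz :: (real^'n \<Rightarrow> complex) set)}"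
  show "(\<lambda>x. exp (\<i> * complex_of_real (x \<bullet> a)) * f x) \<in> schwartz"
  proof (rule schwartz_coinduct[where C="?C"])
    show "pderivative k h \<in> ?C" if hC: "h \<in> ?C" for h k
    proof -
      obtain f where f: "h = (\<lambda>x. exp (\<i> * complex_of_real (x \<bullet> a)) * f x)" "f \<in> schwartz" using hC by blast
      have "(\<lambda>x. \<i> * complex_of_real (a $ k) * f x + pderivative k f x) \<in> schwartz"
        by (intro schwartz_add schwartz_cmult schwartz_pderivative f)
      then show ?thesis unfolding f(1) der[OF f(2)]
        by (intro CollectI exI[of _ "\<lambda>x. \<i> * complex_of_real (a $ k) * f x + pderivative k f x"]) simp
    qed
    show "rapid h" if hC: "h \<in> ?C" for h
    proof -
      obtain f where f: "h = (\<lambda>x. exp (\<i> * complex_of_real (x \<bullet> a)) * f x)" "f \<in> schwartz" using hC by blast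
      show ?thesis unfolding f(1) by (rule rapid_bounded_mult[OF schwartz_rapid[OF f(2)], of _ 1]) simp
    qed
    show "h differentiable (at x)" if hC: "h \<in> ?C" for h x
    proof -
      obtain f where f: "h = (\<lambda>x. exp (\<i> * complex_of_real (x \<bullet> a)) * f x)" "f \<in> schwartz" using hC by blast
      show ?thesis unfolding f(1)
        by (intro differentiable_mult schwartz_differentiable f differentiableI[OF has_derivative_modulation])
    qed
  qed (use assms in blast)
qed

lemma schwartz_affine:
  fixes f :: "real^'n::finite \<Rightarrow> complex"
  assumes "f \<in> schwartz" "\<bar>r\<bar> = 1" shows "(\<lambda>x. f (r *\<^sub>R x + a)) \<in> schwartz"
    and "pderivative k (\<lambda>x. f (r *\<^sub>R x + a)) = (\<lambda>x. complex_of_real r * pderivative k f (r *\<^sub>R x + a))"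
proof -
  have der: "((\<lambda>x. f (r *\<^sub>R x + a)) has_derivative (\<lambda>h. f' (r *\<^sub>R h))) (at x)"
    if "(f has_derivative f') (at (r *\<^sub>R x + a))" for f f' and x :: "real^'n"
  proof -
    have "((\<lambda>x. r *\<^sub>R x + a) has_derivative (\<lambda>h. r *\<^sub>R h)) (at x)"
      by (auto intro!: derivative_eq_intros)
    from has_derivative_compose[OF this that] show ?thesis .
  qed
  have pder: "pderivative k (\<lambda>x. f (r *\<^sub>R x + a)) = (\<lambda>x. complex_of_real r * pderivative k f (r *\<^sub>R x + a))"
    if fs: "f \<in> schwartz" for f :: "real^'n \<Rightarrow> complex" and k
  proof
    fix x
    obtain f' where d: "(f has_derivative f') (at (r *\<^sub>R x + a))" "\<And>k. f' (axis k 1) = pderivative k f (r *\<^sub>R x + a)"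
      using schwartz_derivative_at[OF fs, of "r *\<^sub>R x + a"] by blast
    have "f' (r *\<^sub>R axis k 1) = r *\<^sub>R f' (axis k 1)"
      using d(1) by (simp add: has_derivative_linear linear_scale)
    then show "pderivative k (\<lambda>x. f (r *\<^sub>R x + a)) x = complex_of_real r * pderivative k f (r *\<^sub>R x + a)"
      using pderivative_eq[OF der[OF d(1)]] d by (simp add: scaleR_conv_of_real)
  qed
  show "pderivative k (\<lambda>x. f (r *\<^sub>R x + a)) = (\<lambda>x. complex_of_real r * pderivative k f (r *\<^sub>R x + a))"
    by (rule pder[OF assms(1)])
  let ?C = "{\<lambda>x. f (r *\<^sub>R x + a) | f. f \<in> (schwartz :: (real^'n \<Rightarrow> complex) set)}"
  show "(\<lambda>x. f (r *\<^sub>R x + a)) \<in> schwartz"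
  proof (rule schwartz_coinduct[where C="?C"])
    show "pderivative k h \<in> ?C" if hC: "h \<in> ?C" for h k
    proof -
      obtain f where f: "h = (\<lambda>x. f (r *\<^sub>R x + a))" "f \<in> schwartz" using hC by blast
      have "(\<lambda>x. complex_of_real r * pderivative k f x) \<in> schwartz"
        by (intro schwartz_cmult schwartz_pderivative f)
      then show ?thesis unfolding f(1) pder[OF f(2)]
        by (intro CollectI exI[of _ "\<lambda>x. complex_of_real r * pderivative k f x"]) simp
    qed
    show "rapid h" if hC: "h \<in> ?C" for h
      unfolding rapid_def
    proof
      fix N
      obtain f where f: "h = (\<lambda>x. f (r *\<^sub>R x + a))" "f \<in> schwartz" using hC by blast
      obtain C where C: "\<And>x. (1 + norm x) ^ N * cmod (f x) \<le> C"
        using schwartz_rapid[OF f(2)] unfolding rapid_def by metis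
      have "(1 + norm x) ^ N * cmod (h x) \<le> (1 + norm a) ^ N * C" for x
      proof -
        have "norm x = norm (r *\<^sub>R x)" using assms(2) by simp
        also have "\<dots> \<le> norm (r *\<^sub>R x + a) + norm a" using norm_triangle_ineq4[of "r *\<^sub>R x + a" a] by simp
        finally have "norm x \<le> norm (r *\<^sub>R x + a) + norm a" .
        then have "1 + norm x \<le> (1 + norm a) * (1 + norm (r *\<^sub>R x + a))"
        proof -
          have "0 \<le> norm a * norm (r *\<^sub>R x + a)" by simp
          moreover have "(1 + norm a) * (1 + norm (r *\<^sub>R x + a)) = 1 + norm a + norm (r *\<^sub>R x + a) + norm a * norm (r *\<^sub>R x + a)"
            by (simp only: distrib_left distrib_right mult_1 mult_1_right add.assoc)
          ultimately show ?thesis using \<open>norm x \<le> norm (r *\<^sub>R x + a) + norm a\<close> by linarith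
        qed
        then have "(1 + norm x) ^ N \<le> (1 + norm a) ^ N * (1 + norm (r *\<^sub>R x + a)) ^ N"
          by (metis power_mono power_mult_distrib add_nonneg_nonneg norm_ge_zero zero_le_one)
        then have "(1 + norm x) ^ N * cmod (h x) \<le> (1 + norm a) ^ N * ((1 + norm (r *\<^sub>R x + a)) ^ N * cmod (h x))"
          by (metis mult.assoc mult_right_mono norm_ge_zero)
        also have "\<dots> \<le> (1 + norm a) ^ N * C" using C f(1) by (intro mult_left_mono) auto
        finally show ?thesis .
      qed
      then show "\<exists>C. \<forall>x. (1 + norm x) ^ N * cmod (h x) \<le> C" by blast
    qed
    show "h differentiable (at x)" if hC: "h \<in> ?C" for h x
      using hC der schwartz_differentiable unfolding differentiable_def by blast
  qed (use assms in auto)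
qed

section \<open>Gaussians\<close>

lemma pderivative_add_at:
  assumes "f differentiable (at x)" "g differentiable (at x)"
  shows "pderivative k (\<lambda>x. f x + g x) x = pderivative k f x + pderivative k g x"
proof -
  obtain f' g' where d: "(f has_derivative f') (at x)" "(g has_derivative g') (at x)"
    using assms unfolding differentiable_def by blast
  show ?thesis using pderivative_eq[OF has_derivative_add[OF d]] pderivative_eq[OF d(1)] pderivative_eq[OF d(2)] by simp
qed

lemma pderivative_mult_at:
  assumes "f differentiable (at x)" "g differentiable (at x)"
  shows "pderivative k (\<lambda>x. f x * g x) x = f x * pderivative k g x + pderivative k f x * g x"
proof -
  obtain f' g' where d: "(f has_derivative f') (at x)" "(g has_derivative g') (at x)"
    using assms unfolding differentiable_def by blast
  show ?thesis using pderivative_eq[OF has_derivative_mult[OF d]] pderivative_eq[OF d(1)] pderivative_eq[OF d(2)] by simp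
qed

lemma pderivative_const: "pderivative k (\<lambda>x. c) x = 0"
  by (rule pderivative_eq[of "\<lambda>x. c" "\<lambda>h. 0", OF has_derivative_const])

lemma pderivative_coordinate: "pderivative k (\<lambda>x. complex_of_real (x $ l)) x = (if l = k then 1 else 0)"
  by (simp add: pderivative_eq[OF has_derivative_coordinate] axis_def)

lemma differentiable_coordinate: "(\<lambda>x::real^'n. complex_of_real (x $ k)) differentiable (at x)"
  by (rule differentiableI[OF has_derivative_coordinate])

text \<open>The parameters make the family closed under translations, dilations and products.\<close>

definition gaussian :: "real \<Rightarrow> real^'n \<Rightarrow> real \<Rightarrow> real^'n::finite \<Rightarrow> complex" where
  "gaussian c v d x = complex_of_real (exp (- c * (x \<bullet> x) + v \<bullet> x + d))"

text \<open>The polynomial multiples of a Gaussian; unlike the Gaussian alone they are closed under derivatives.\<close>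

inductive_set gauss_span :: "real \<Rightarrow> real^'n \<Rightarrow> real \<Rightarrow> (real^'n::finite \<Rightarrow> complex) set" for c v d where
  base: "gaussian c v d \<in> gauss_span c v d"
| coordinate: "f \<in> gauss_span c v d \<Longrightarrow> (\<lambda>x. complex_of_real (x $ k) * f x) \<in> gauss_span c v d"
| plus: "f \<in> gauss_span c v d \<Longrightarrow> g \<in> gauss_span c v d \<Longrightarrow> (\<lambda>x. f x + g x) \<in> gauss_span c v d"
| times: "f \<in> gauss_span c v d \<Longrightarrow> (\<lambda>x. a * f x) \<in> gauss_span c v d"

lemma has_derivative_gaussian:
  "(gaussian c v d has_derivative (\<lambda>h. complex_of_real ((- c * (2 * (x \<bullet> h)) + v \<bullet> h) * exp (- c * (x \<bullet> x) + v \<bullet> x + d)))) (at x)"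
proof -
  have "((\<lambda>x. exp (- c * (x \<bullet> x) + v \<bullet> x + d)) has_derivative (\<lambda>h. (- c * (2 * (x \<bullet> h)) + v \<bullet> h) * exp (- c * (x \<bullet> x) + v \<bullet> x + d))) (at x)"
    by (auto intro!: derivative_eq_intros simp: fun_eq_iff inner_commute algebra_simps)
  from bounded_linear.has_derivative[OF bounded_linear_of_real this]
  show ?thesis unfolding gaussian_def[abs_def] .
qed

lemma pderivative_gaussian:
  "pderivative k (gaussian c v d) = (\<lambda>x. complex_of_real (- 2 * c) * (complex_of_real (x $ k) * gaussian c v d x) + complex_of_real (v $ k) * gaussian c v d x)"
  by (rule ext) (simp add: pderivative_eq[OF has_derivative_gaussian] inner_axis gaussian_def algebra_simps)

lemma exp_ge_power: "0 \<le> t \<Longrightarrow> t ^ N \<le> fact N * exp (t::real)"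
proof -
  assume t: "0 \<le> t"
  have s: "(\<lambda>n. t ^ n / fact n) sums exp t"
    using exp_converges[of t] by (simp add: divide_inverse mult.commute)
  have "(\<Sum>n\<in>{N}. t ^ n / fact n) \<le> (\<Sum>n. t ^ n / fact n)"
    by (rule sum_le_suminf[OF sums_summable[OF s]]) (use t in auto)
  then have "t ^ N / fact N \<le> exp t" using sums_unique[OF s] by simp
  then show ?thesis by (simp add: field_simps)
qed

lemma rapid_gaussian: assumes "0 < c" shows "rapid (gaussian c v d)"
  unfolding rapid_def
proof
  fix N
  define b where "b = 1 + norm v"
  have "(1 + norm x) ^ N * cmod (gaussian c v d x) \<le> fact N * exp (1 + d + b\<^sup>2 / (4 * c))" for x
  proof -
    define r where "r = norm x"
    have r: "0 \<le> r" "x \<bullet> x = r\<^sup>2" "v \<bullet> x \<le> norm v * r"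
      using norm_cauchy_schwarz[of v x] by (auto simp: r_def power2_norm_eq_inner)
    have "0 \<le> (2 * c * r - b)\<^sup>2 / (4 * c)" using assms by simp
    then have q: "b * r - c * r\<^sup>2 \<le> b\<^sup>2 / (4 * c)" using assms by (simp add: power2_eq_square field_simps)
    have "(1 + r) ^ N * exp (- c * (x \<bullet> x) + v \<bullet> x + d) \<le> (fact N * exp (1 + r)) * exp (- c * r\<^sup>2 + norm v * r + d)"
      using r exp_ge_power[of "1 + r" N] by (intro mult_mono) auto
    also have "\<dots> = fact N * exp (1 + d + (b * r - c * r\<^sup>2))"
      by (simp add: b_def exp_add[symmetric] algebra_simps)
    also have "\<dots> \<le> fact N * exp (1 + d + b\<^sup>2 / (4 * c))" using q by simp
    finally show ?thesis by (simp add: r_def gaussian_def)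
  qed
  then show "\<exists>C. \<forall>x. (1 + norm x) ^ N * cmod (gaussian c v d x) \<le> C" by blast
qed

lemma gaussian_schwartz: assumes "0 < c" shows "gaussian c v d \<in> schwartz"
proof (rule schwartz_coinduct[where C="gauss_span c v d"])
  have diff: "g differentiable (at x)" if "g \<in> gauss_span c v d" for g x
    using that
  proof induction
    case base show ?case by (rule differentiableI[OF has_derivative_gaussian])
  qed (intro differentiable_mult differentiable_add differentiable_coordinate differentiable_const; assumption)+
  then show "\<And>g x. g \<in> gauss_span c v d \<Longrightarrow> g differentiable (at x)" .
  show "rapid g" if "g \<in> gauss_span c v d" for g
    using that
  proof induction
    case base show ?case by (rule rapid_gaussian[OF assms])
  next
    case (coordinate f k)
    have "cmod (complex_of_real (x $ k)) \<le> 1 * (1 + norm x) ^ 1" for x :: "real^'a"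
      using component_le_norm_cart[of x k] by simp
    then show ?case by (rule rapid_mult[OF coordinate(2)])
  next
    case (plus f g) then show ?case by (intro rapid_add)
  next
    case (times f a) show ?case by (rule rapid_bounded_mult[OF times(2) order_refl])
  qed
  show "pderivative k g \<in> gauss_span c v d" if "g \<in> gauss_span c v d" for g k
    using that
  proof induction
    case base show ?case unfolding pderivative_gaussian by (intro gauss_span.intros)
  next
    case (coordinate f l)
    have "pderivative k (\<lambda>x. complex_of_real (x $ l) * f x)
        = (\<lambda>x. complex_of_real (x $ l) * pderivative k f x + (if l = k then 1 else 0) * f x)"
      by (rule ext) (simp only: pderivative_mult_at[OF differentiable_coordinate diff[OF coordinate(1)]] pderivative_coordinate)
    then show ?case using coordinate by (simp only:) (intro gauss_span.intros)
  next
    case (plus f g)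
    have "pderivative k (\<lambda>x. f x + g x) = (\<lambda>x. pderivative k f x + pderivative k g x)"
      by (rule ext) (rule pderivative_add_at[OF diff[OF plus(1)] diff[OF plus(2)]])
    then show ?case using plus by (simp only:) (intro gauss_span.intros)
  next
    case (times f a)
    have "pderivative k (\<lambda>x. a * f x) = (\<lambda>x. a * pderivative k f x)"
      by (rule ext) (simp add: pderivative_mult_at[OF differentiable_const diff[OF times(1)]] pderivative_const)
    then show ?case using times by (simp only:) (intro gauss_span.intros)
  qed
qed (rule gauss_span.base)

section \<open>Integrals of Schwartz functions\<close>

lemma nn_integral_inverse_square: "(\<integral>\<^sup>+x. ennreal (inverse (1 + x\<^sup>2)) \<partial>lborel) < \<infinity>"
proof -
  have "integrable lborel (\<lambda>x::real. inverse (1 + x\<^sup>2))"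
    using integrable_inverse_1_plus_square by (simp add: set_integrable_def)
  from integrableD(2)[OF this] show ?thesis by (simp add: less_top)
qed

text \<open>The exponent makes this function smaller than the product of the one-dimensional integrable
  functions \<open>1 / (1 + x\<^sub>i\<^sup>2)\<close>.\<close>

definition weight :: "real^'n::finite \<Rightarrow> real" where
  "weight x = inverse ((1 + norm x) ^ (2 * CARD('n)))"

lemma weight_pos: "0 < weight x" and weight_le: "weight x \<le> 1"
proof -
  have "0 < 1 + norm x" by (simp add: add_pos_nonneg)
  then show "0 < weight x" by (simp add: weight_def)
  have "1 \<le> (1 + norm x) ^ (2 * CARD('a))" by simp
  then show "weight x \<le> 1" unfolding weight_def by (rule inverse_le_1_iff[THEN iffD2, OF disjI2])
qed

lemma weight_measurable [measurable]: "weight \<in> borel_measurable borel"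
  unfolding weight_def[abs_def] by measurable

lemma integrable_weight: "integrable lborel (weight :: real^'n::finite \<Rightarrow> real)"
proof (rule integrableI_bounded)
  show "(weight :: real^'n \<Rightarrow> real) \<in> borel_measurable lborel" by simp
  have "(\<integral>\<^sup>+x. ennreal (norm (weight (x :: real^'n))) \<partial>lborel)
      \<le> (\<integral>\<^sup>+x. (\<Prod>b\<in>Basis. ennreal (inverse (1 + ((x :: real^'n) \<bullet> b)\<^sup>2))) \<partial>lborel)"
  proof (rule nn_integral_mono)
    fix x :: "real^'n"
    have "(\<Prod>b\<in>Basis. 1 + (x \<bullet> b)\<^sup>2) \<le> (\<Prod>b\<in>(Basis :: (real^'n) set). (1 + norm x)\<^sup>2)"
    proof (rule prod_mono, intro conjI)
      fix b :: "real^'n" assume "b \<in> Basis"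
      then have "\<bar>x \<bullet> b\<bar> \<le> norm x" by (rule Basis_le_norm)
      then have "(x \<bullet> b)\<^sup>2 \<le> (norm x)\<^sup>2" by (metis abs_ge_zero power2_abs power_mono)
      moreover have "(1 + norm x)\<^sup>2 = 1 + 2 * norm x + (norm x)\<^sup>2" by (simp add: power2_sum)
      ultimately show "1 + (x \<bullet> b)\<^sup>2 \<le> (1 + norm x)\<^sup>2" using norm_ge_zero[of x] by linarith
    qed (simp add: add_nonneg_nonneg)
    also have "\<dots> = (1 + norm x) ^ (2 * CARD('n))" by (simp add: power_mult)
    finally have "weight x \<le> inverse (\<Prod>b\<in>Basis. 1 + (x \<bullet> b)\<^sup>2)"
      unfolding weight_def by (intro le_imp_inverse_le prod_pos) (auto simp: add_pos_nonneg)
    also have "\<dots> = (\<Prod>b\<in>Basis. inverse (1 + (x \<bullet> b)\<^sup>2))" by (simp add: prod_inversef[symmetric] o_def)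
    finally show "ennreal (norm (weight x)) \<le> (\<Prod>b\<in>Basis. ennreal (inverse (1 + (x \<bullet> b)\<^sup>2)))"
      using weight_pos[of x] by (subst prod_ennreal) (auto simp: add_nonneg_nonneg)
  qed
  also have "\<dots> = (\<Prod>b\<in>(Basis :: (real^'n) set). \<integral>\<^sup>+x. ennreal (inverse (1 + x\<^sup>2)) \<partial>lborel)"
    by (rule nn_integral_lborel_prod) auto
  also have "\<dots> < \<infinity>"
    using nn_integral_inverse_square by (simp add: power_less_top_ennreal)
  finally show "(\<integral>\<^sup>+x. ennreal (norm (weight (x :: real^'n))) \<partial>lborel) < \<infinity>" .
qed

lemma rapid_weight:
  fixes f :: "real^'n::finite \<Rightarrow> complex"
  assumes "rapid f" obtains C where "0 \<le> C" "\<And>x. cmod (f x) \<le> C * weight x"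
proof -
  obtain C where C: "\<And>x. (1 + norm x) ^ (2 * CARD('n)) * cmod (f x) \<le> C"
    using assms unfolding rapid_def by metis
  have "cmod (f x) \<le> C * weight x" for x
    using C[of x] by (simp add: weight_def field_simps add_pos_nonneg)
  moreover have "0 \<le> C" by (rule order_trans[OF _ C[of 0]]) simp
  ultimately show ?thesis using that by blast
qed

lemma rapid_integrable: assumes "rapid f" "f \<in> borel_measurable borel" shows "integrable lborel f"
proof -
  obtain C where C: "0 \<le> C" "\<And>x. cmod (f x) \<le> C * weight x" using rapid_weight[OF assms(1)] by blast
  show ?thesis
  proof (rule Bochner_Integration.integrable_bound)
    show "integrable lborel (\<lambda>x. C * weight x)" by (intro integrable_mult_right integrable_weight)
    show "AE x in lborel. norm (f x) \<le> norm (C * weight x)"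
      using C(2) by (intro AE_I2) (auto intro: order_trans[OF _ abs_ge_self])
  qed (use assms in simp)
qed

lemma schwartz_integrable: "f \<in> schwartz \<Longrightarrow> integrable lborel f"
  by (intro rapid_integrable schwartz_rapid schwartz_measurable)

lemma rapid_norm_bounded: assumes "rapid f" obtains C where "\<And>x. cmod (f x) \<le> C"
  using assms unfolding rapid_def by (metis mult_1 power_0)

lemma schwartz_sqint: assumes "f \<in> schwartz" shows "sqint f"
proof -
  obtain C where C: "\<And>x. cmod (f x) \<le> C" using rapid_norm_bounded[OF schwartz_rapid[OF assms]] by blast
  have "integrable lborel (\<lambda>x. (cmod (f x))\<^sup>2)"
  proof (rule Bochner_Integration.integrable_bound)
    show "integrable lborel (\<lambda>x. C * cmod (f x))" using schwartz_integrable[OF assms] by simp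
    show "(\<lambda>x. (cmod (f x))\<^sup>2) \<in> borel_measurable lborel" using schwartz_measurable[OF assms] by simp
    have "(cmod (f x))\<^sup>2 \<le> C * cmod (f x)" for x
      unfolding power2_eq_square by (intro mult_right_mono C) simp
    then show "AE x in lborel. norm ((cmod (f x))\<^sup>2) \<le> norm (C * cmod (f x))"
      by (intro AE_I2) (auto intro: order_trans[OF _ abs_ge_self])
  qed
  then show ?thesis using schwartz_measurable[OF assms] by (simp add: sqint_def)
qed

lemma integral_affine:
  fixes f :: "'a::euclidean_space \<Rightarrow> complex"
  assumes [measurable]: "f \<in> borel_measurable borel" and "c \<noteq> 0"
  shows "(LINT x|lborel. f x) = \<bar>c\<bar> ^ DIM('a) *\<^sub>R (LINT x|lborel. f (t + c *\<^sub>R x))"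
proof -
  have "(LINT x|lborel. f x) = (LINT x|density (distr lborel borel (\<lambda>x. t + c *\<^sub>R x)) (\<lambda>_. ennreal (\<bar>c\<bar> ^ DIM('a))). f x)"
    by (subst lborel_affine[OF \<open>c \<noteq> 0\<close>, of t]) simp
  also have "\<dots> = (LINT x|distr lborel borel (\<lambda>x. t + c *\<^sub>R x). \<bar>c\<bar> ^ DIM('a) *\<^sub>R f x)"
    by (subst integral_density) auto
  also have "\<dots> = (LINT x|lborel. \<bar>c\<bar> ^ DIM('a) *\<^sub>R f (t + c *\<^sub>R x))"
    by (subst integral_distr) auto
  finally show ?thesis by simp
qed

lemma integral_translate:
  fixes f :: "'a::euclidean_space \<Rightarrow> complex"
  shows "f \<in> borel_measurable borel \<Longrightarrow> (LINT x|lborel. f (t + x)) = (LINT x|lborel. f x)"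
  using integral_affine[of f 1 t] by simp

lemma integral_reflect:
  fixes f :: "'a::euclidean_space \<Rightarrow> complex"
  shows "f \<in> borel_measurable borel \<Longrightarrow> (LINT x|lborel. f (- x)) = (LINT x|lborel. f x)"
  using integral_affine[of f "-1" 0] by simp

text \<open>The difference quotients have integral \<open>0\<close> by translation invariance and are dominated by a multiple
  of \<open>weight\<close>.\<close>

lemma integral_pderivative:
  fixes f :: "real^'n::finite \<Rightarrow> complex"
  assumes f: "f \<in> schwartz" shows "(LINT x|lborel. pderivative k f x) = 0"
proof -
  note [measurable] = schwartz_measurable[OF f]
  have df: "pderivative k f \<in> schwartz" by (rule schwartz_pderivative[OF f])
  define h where "h n = 1 / real (Suc n)" for n
  have h: "0 < h n" "h n \<le> 1" for n by (auto simp: h_def)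
  have h0: "h \<longlonglongrightarrow> 0" unfolding h_def using LIMSEQ_inverse_real_of_nat by (simp add: inverse_eq_divide)
  obtain C where C: "\<And>x. (1 + norm x) ^ (2 * CARD('n)) * cmod (pderivative k f x) \<le> C"
    using schwartz_rapid[OF df] unfolding rapid_def by metis
  define D where "D = 2 ^ (2 * CARD('n)) * C"
  have line: "((\<lambda>t. f (x + t *\<^sub>R axis k 1)) has_derivative (\<lambda>s. s *\<^sub>R pderivative k f (x + t *\<^sub>R axis k 1))) (at t)" for x t
  proof -
    obtain f' where f': "(f has_derivative f') (at (x + t *\<^sub>R axis k 1))" "\<And>l. f' (axis l 1) = pderivative l f (x + t *\<^sub>R axis k 1)"
      using schwartz_derivative_at[OF f, of "x + t *\<^sub>R axis k 1"] by blast
    have "((\<lambda>t. x + t *\<^sub>R axis k 1) has_derivative (\<lambda>s. s *\<^sub>R axis k 1)) (at t)"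
      by (auto intro!: derivative_eq_intros)
    from has_derivative_compose[OF this f'(1)]
    show ?thesis using f' by (simp add: has_derivative_linear linear_scale)
  qed
  have D: "cmod (pderivative k f (x + t *\<^sub>R axis k 1)) \<le> D * weight x" if "\<bar>t\<bar> \<le> 1" for x t
  proof -
    define y where "y = x + t *\<^sub>R axis k 1"
    have "norm x \<le> norm y + norm (t *\<^sub>R axis k (1::real))" unfolding y_def using norm_triangle_ineq4[of "x + t *\<^sub>R axis k 1" "t *\<^sub>R axis k 1"] by simp
    also have "\<dots> \<le> norm y + 1" using that by simp
    finally have "1 + norm x \<le> 1 + (norm y + 1)" by simp
    also have "\<dots> \<le> 2 * (1 + norm y)" by simp
    finally have "1 + norm x \<le> 2 * (1 + norm y)" .
    then have "(1 + norm x) ^ (2 * CARD('n)) \<le> 2 ^ (2 * CARD('n)) * (1 + norm y) ^ (2 * CARD('n))"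
      by (subst power_mult_distrib[symmetric], intro power_mono) auto
    then have "(1 + norm x) ^ (2 * CARD('n)) * cmod (pderivative k f y)
        \<le> (2 ^ (2 * CARD('n)) * (1 + norm y) ^ (2 * CARD('n))) * cmod (pderivative k f y)"
      by (rule mult_right_mono) simp
    also have "\<dots> = 2 ^ (2 * CARD('n)) * ((1 + norm y) ^ (2 * CARD('n)) * cmod (pderivative k f y))" by simp
    also have "\<dots> \<le> D" unfolding D_def by (intro mult_left_mono C) simp
    finally show ?thesis by (simp add: weight_def field_simps add_pos_nonneg flip: y_def)
  qed
  define q where "q n x = (f (x + h n *\<^sub>R axis k 1) - f x) / complex_of_real (h n)" for n x
  have q_int: "(LINT x|lborel. q n x) = 0" for n
  proof -
    have s: "(\<lambda>x. f (x + h n *\<^sub>R axis k 1)) \<in> schwartz" using schwartz_affine(1)[OF f, of 1 "h n *\<^sub>R axis k 1"] by simp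
    have "(LINT x|lborel. f (x + h n *\<^sub>R axis k 1)) = (LINT x|lborel. f x)"
      using integral_translate[of f "h n *\<^sub>R axis k 1"] by (simp add: add.commute)
    then show ?thesis unfolding q_def using schwartz_integrable[OF s] schwartz_integrable[OF f] by simp
  qed
  have "(\<lambda>n. LINT x|lborel. q n x) \<longlonglongrightarrow> (LINT x|lborel. pderivative k f x)"
  proof (rule integral_dominated_convergence[where w="\<lambda>x. D * weight x"])
    show "pderivative k f \<in> borel_measurable lborel" using schwartz_measurable[OF df] by simp
    show "q n \<in> borel_measurable lborel" for n unfolding q_def by measurable
    show "integrable lborel (\<lambda>x::real^'n. D * weight x)" by (intro integrable_mult_right integrable_weight)
    show "AE x in lborel. (\<lambda>n. q n x) \<longlonglongrightarrow> pderivative k f x"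
    proof (rule AE_I2)
      fix x
      have "((\<lambda>t. norm (f (x + t *\<^sub>R axis k 1) - f x - t *\<^sub>R pderivative k f x) / norm t) \<longlongrightarrow> 0) (at 0)"
        using line[of x 0] by (simp add: has_derivative_at)
      then have "(\<lambda>n. norm (f (x + h n *\<^sub>R axis k 1) - f x - h n *\<^sub>R pderivative k f x) / norm (h n)) \<longlonglongrightarrow> 0"
        by (rule filterlim_compose[OF _ filterlim_atI[OF h0]]) (use h(1) in \<open>auto intro!: always_eventually simp: less_imp_neq[symmetric]\<close>)
      moreover have "norm (f (x + h n *\<^sub>R axis k 1) - f x - h n *\<^sub>R pderivative k f x) / norm (h n) = norm (q n x - pderivative k f x)" for n
      proof -
        have "q n x - pderivative k f x = (f (x + h n *\<^sub>R axis k 1) - f x - h n *\<^sub>R pderivative k f x) / complex_of_real (h n)"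
          using h(1)[of n] by (simp add: q_def diff_divide_distrib scaleR_conv_of_real)
        then show ?thesis by (simp add: norm_divide)
      qed
      ultimately have "(\<lambda>n. norm (q n x - pderivative k f x)) \<longlonglongrightarrow> 0" by simp
      then show "(\<lambda>n. q n x) \<longlonglongrightarrow> pderivative k f x"
        by (simp add: LIM_zero_cancel tendsto_norm_zero_iff)
    qed
    show "AE x in lborel. norm (q n x) \<le> D * weight x" for n
    proof (rule AE_I2)
      fix x
      have "norm (f (x + h n *\<^sub>R axis k 1) - f (x + 0 *\<^sub>R axis k 1)) \<le> (D * weight x) * norm (h n - 0)"
      proof (rule differentiable_bound[where S="{0..h n}" and f="\<lambda>t. f (x + t *\<^sub>R axis k 1)"])
        fix t assume t: "t \<in> {0..h n}"
        show "((\<lambda>t. f (x + t *\<^sub>R axis k 1)) has_derivative (\<lambda>s. s *\<^sub>R pderivative k f (x + t *\<^sub>R axis k 1))) (at t within {0..h n})"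
          using line by (rule has_derivative_at_withinI)
        show "onorm (\<lambda>s. s *\<^sub>R pderivative k f (x + t *\<^sub>R axis k 1)) \<le> D * weight x"
        proof (rule onorm_le)
          show "norm (s *\<^sub>R pderivative k f (x + t *\<^sub>R axis k 1)) \<le> D * weight x * norm s" for s
            using mult_left_mono[OF D[of t x], of "\<bar>s\<bar>"] t h(2)[of n] by (simp add: mult.commute)
        qed
      qed (use h[of n] in auto)
      then show "norm (q n x) \<le> D * weight x"
        using h(1)[of n] by (simp add: q_def norm_divide field_simps)
    qed
  qed
  then have "(\<lambda>n::nat. 0 :: complex) \<longlonglongrightarrow> (LINT x|lborel. pderivative k f x)" unfolding q_int .
  then show ?thesis by (simp add: LIMSEQ_const_iff)
qed

section \<open>Fourier transform of Schwartz functions\<close>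

definition wave :: "real^'n::finite \<Rightarrow> real^'n \<Rightarrow> complex" where
  "wave \<xi> x = exp (- \<i> * complex_of_real (x \<bullet> \<xi>))"

lemma fourier_wave: "fourier f \<xi> = (LINT x|lborel. wave \<xi> x * f x)"
  by (simp add: fourier_def wave_def)

lemma norm_wave [simp]: "cmod (wave \<xi> x) = 1"
  using norm_exp_i_times[of "- (x \<bullet> \<xi>)"] by (simp add: wave_def)

lemma wave_commute: "wave \<xi> x = wave x \<xi>"
  by (simp add: wave_def inner_commute)

lemma wave_add: "wave (\<xi> + \<eta>) x = wave \<xi> x * wave \<eta> x"
  by (simp add: wave_def inner_add_right ring_distribs exp_add exp_diff exp_minus divide_inverse)

lemma wave_measurable [measurable]: "(\<lambda>x. wave \<xi> x) \<in> borel_measurable borel" "(\<lambda>\<xi>. wave \<xi> x) \<in> borel_measurable borel"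
  unfolding wave_def by (intro borel_measurable_continuous_onI continuous_intros)+

lemma integrable_wave: "integrable lborel f \<Longrightarrow> integrable lborel (\<lambda>x. wave \<xi> x * f x)"
  by (rule Bochner_Integration.integrable_bound[of lborel f]) (auto simp: norm_mult)

lemma norm_fourier_le: "integrable lborel f \<Longrightarrow> cmod (fourier f \<xi>) \<le> (LINT x|lborel. cmod (f x))"
  unfolding fourier_wave
  by (rule order_trans[OF integral_norm_bound]) (simp add: norm_mult)

lemma fourier_add: "integrable lborel f \<Longrightarrow> integrable lborel g \<Longrightarrow> fourier (\<lambda>x. f x + g x) \<xi> = fourier f \<xi> + fourier g \<xi>"
  unfolding fourier_wave by (simp add: distrib_left integrable_wave)

lemma fourier_diff: "integrable lborel f \<Longrightarrow> integrable lborel g \<Longrightarrow> fourier (\<lambda>x. f x - g x) \<xi> = fourier f \<xi> - fourier g \<xi>"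
  unfolding fourier_wave by (simp add: right_diff_distrib integrable_wave)

lemma fourier_cmult: "fourier (\<lambda>x. c * f x) \<xi> = c * fourier f \<xi>"
  unfolding fourier_wave by (simp add: mult.left_commute)

lemma fourier_sum: "(\<And>i. i \<in> I \<Longrightarrow> integrable lborel (f i)) \<Longrightarrow> fourier (\<lambda>x. \<Sum>i\<in>I. f i x) \<xi> = (\<Sum>i\<in>I. fourier (f i) \<xi>)"
  unfolding fourier_wave by (simp add: sum_distrib_left integrable_wave)

lemma fourier_pderivative:
  assumes f: "f \<in> schwartz" shows "fourier (pderivative k f) \<xi> = \<i> * complex_of_real (\<xi> $ k) * fourier f \<xi>"
proof -
  have m: "exp (\<i> * complex_of_real (x \<bullet> (- \<xi>))) = wave \<xi> x" for x by (simp add: wave_def)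
  have df: "pderivative k f \<in> schwartz" by (rule schwartz_pderivative[OF f])
  have "0 = (LINT x|lborel. pderivative k (\<lambda>x. wave \<xi> x * f x) x)"
    using integral_pderivative[OF schwartz_modulation(1)[OF f, of "- \<xi>"], of k] unfolding m by simp
  also have "\<dots> = (LINT x|lborel. wave \<xi> x * (- (\<i> * complex_of_real (\<xi> $ k) * f x)) + wave \<xi> x * pderivative k f x)"
    using schwartz_modulation(2)[OF f, of k "- \<xi>"] unfolding m by (simp only:) (simp add: algebra_simps)
  also have "\<dots> = fourier (\<lambda>x. - (\<i> * complex_of_real (\<xi> $ k)) * f x) \<xi> + fourier (pderivative k f) \<xi>"
    using schwartz_integrable[OF f] schwartz_integrable[OF df] unfolding fourier_wave
    by (subst Bochner_Integration.integral_add[symmetric]) (auto intro!: integrable_wave integrable_mult_right)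
  finally show ?thesis unfolding fourier_cmult by (simp add: add_eq_0_iff2)
qed

text \<open>The second order Taylor remainder, from which the transform is differentiated directly.\<close>

lemma cmod_wave_remainder: "cmod (exp (- \<i> * complex_of_real a) - 1 + \<i> * complex_of_real a) \<le> a\<^sup>2"
proof -
  have "cmod (iexp (- a) - (\<Sum>k\<le>1. (\<i> * complex_of_real (- a)) ^ k / fact k)) \<le> \<bar>- a\<bar> ^ Suc 1 / fact (Suc 1)"
    by (rule iexp_approx1)
  then have "cmod (exp (- \<i> * complex_of_real a) - (1 - \<i> * complex_of_real a)) \<le> a\<^sup>2 / 2"
    by (simp add: power2_eq_square)
  also have "\<dots> \<le> a\<^sup>2" by simp
  finally show ?thesis by (simp add: algebra_simps)
qed

lemma has_derivative_fourier:
  assumes f: "f \<in> schwartz"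
  shows "(fourier f has_derivative (\<lambda>h. LINT x|lborel. wave \<xi> x * (- \<i> * complex_of_real (x \<bullet> h) * f x))) (at \<xi>)"
proof -
  note [measurable] = schwartz_measurable[OF f]
  have rap: "rapid (\<lambda>x. complex_of_real (norm x ^ m) * f x)" for m
  proof (rule rapid_mult[OF schwartz_rapid[OF f], of _ 1 m])
    show "cmod (complex_of_real (norm x ^ m)) \<le> 1 * (1 + norm x) ^ m" for x :: "real^'a"
      by (simp add: power_mono norm_power)
  qed
  have int_m: "integrable lborel (\<lambda>x. complex_of_real (norm x ^ m) * f x)" for m
    by (rule rapid_integrable[OF rap]) measurable
  then have int_norm: "integrable lborel (\<lambda>x. norm x ^ m * cmod (f x))" for m
    using integrable_norm[OF int_m[of m]] by (simp add: norm_mult norm_power)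
  have int1: "integrable lborel (\<lambda>x. wave \<xi> x * (- \<i> * complex_of_real (x \<bullet> h) * f x))" for h
  proof (rule integrable_wave, rule Bochner_Integration.integrable_bound)
    show "integrable lborel (\<lambda>x. norm h * (norm x ^ 1 * cmod (f x)))"
      by (intro integrable_mult_right int_norm)
    show "AE x in lborel. norm (- \<i> * complex_of_real (x \<bullet> h) * f x) \<le> norm (norm h * (norm x ^ 1 * cmod (f x)))"
    proof (rule AE_I2)
      fix x
      show "norm (- \<i> * complex_of_real (x \<bullet> h) * f x) \<le> norm (norm h * (norm x ^ 1 * cmod (f x)))"
        using mult_right_mono[OF Cauchy_Schwarz_ineq2[of x h], of "cmod (f x)"] by (simp add: norm_mult abs_mult algebra_simps)
    qed
  qed measurable
  define C2 where "C2 = (LINT x|lborel. norm x ^ 2 * cmod (f x))"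
  show ?thesis
  proof (rule has_derivativeI_sandwich[where e=1 and H="\<lambda>\<eta>. norm (\<eta> - \<xi>) * C2"])
    show "bounded_linear (\<lambda>h. LINT x|lborel. wave \<xi> x * (- \<i> * complex_of_real (x \<bullet> h) * f x))"
    proof (rule bounded_linear_intro[where K="LINT x|lborel. norm x ^ 1 * cmod (f x)"])
      fix h k :: "real^'a" and r :: real
      show "(LINT x|lborel. wave \<xi> x * (- \<i> * complex_of_real (x \<bullet> (h + k)) * f x))
        = (LINT x|lborel. wave \<xi> x * (- \<i> * complex_of_real (x \<bullet> h) * f x)) + (LINT x|lborel. wave \<xi> x * (- \<i> * complex_of_real (x \<bullet> k) * f x))"
        by (subst Bochner_Integration.integral_add[OF int1 int1, symmetric]) (simp add: inner_add algebra_simps)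
      have "(LINT x|lborel. wave \<xi> x * (- \<i> * complex_of_real (x \<bullet> (r *\<^sub>R h)) * f x))
        = (LINT x|lborel. complex_of_real r * (wave \<xi> x * (- \<i> * complex_of_real (x \<bullet> h) * f x)))"
        by (intro Bochner_Integration.integral_cong refl) (simp add: algebra_simps)
      then show "(LINT x|lborel. wave \<xi> x * (- \<i> * complex_of_real (x \<bullet> (r *\<^sub>R h)) * f x))
        = r *\<^sub>R (LINT x|lborel. wave \<xi> x * (- \<i> * complex_of_real (x \<bullet> h) * f x))"
        by (simp add: scaleR_conv_of_real)
      have "cmod (LINT x|lborel. wave \<xi> x * (- \<i> * complex_of_real (x \<bullet> h) * f x))
          \<le> (LINT x|lborel. cmod (wave \<xi> x * (- \<i> * complex_of_real (x \<bullet> h) * f x)))" by (rule integral_norm_bound)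
      also have "\<dots> \<le> (LINT x|lborel. norm h * (norm x ^ 1 * cmod (f x)))"
      proof (rule integral_mono)
        show "integrable lborel (\<lambda>x. cmod (wave \<xi> x * (- \<i> * complex_of_real (x \<bullet> h) * f x)))" by (rule integrable_norm[OF int1])
        show "integrable lborel (\<lambda>x. norm h * (norm x ^ 1 * cmod (f x)))" by (intro integrable_mult_right int_norm)
        show "cmod (wave \<xi> x * (- \<i> * complex_of_real (x \<bullet> h) * f x)) \<le> norm h * (norm x ^ 1 * cmod (f x))" for x
          using mult_right_mono[OF Cauchy_Schwarz_ineq2[of x h], of "cmod (f x)"] by (simp add: norm_mult algebra_simps)
      qed
      finally show "norm (LINT x|lborel. wave \<xi> x * (- \<i> * complex_of_real (x \<bullet> h) * f x))
        \<le> norm h * (LINT x|lborel. norm x ^ 1 * cmod (f x))" by simp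
    qed
    fix \<eta> :: "real^'a" assume "\<eta> \<noteq> \<xi>"
    define h where "h = \<eta> - \<xi>"
    have h: "h \<noteq> 0" "\<eta> = \<xi> + h" using \<open>\<eta> \<noteq> \<xi>\<close> by (auto simp: h_def)
    have "fourier f \<eta> - fourier f \<xi> - (LINT x|lborel. wave \<xi> x * (- \<i> * complex_of_real (x \<bullet> h) * f x))
        = (LINT x|lborel. wave \<eta> x * f x - wave \<xi> x * f x - wave \<xi> x * (- \<i> * complex_of_real (x \<bullet> h) * f x))"
      unfolding fourier_wave using schwartz_integrable[OF f] int1
      by (simp add: integrable_wave)
    also have "\<dots> = (LINT x|lborel. wave \<xi> x * ((wave h x - 1 + \<i> * complex_of_real (x \<bullet> h)) * f x))"
      unfolding h(2) by (intro Bochner_Integration.integral_cong refl)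
        (simp add: wave_add ring_distribs)
    finally have "cmod (fourier f \<eta> - fourier f \<xi> - (LINT x|lborel. wave \<xi> x * (- \<i> * complex_of_real (x \<bullet> h) * f x)))
        \<le> (LINT x|lborel. cmod (wave \<xi> x * ((wave h x - 1 + \<i> * complex_of_real (x \<bullet> h)) * f x)))"
      by (simp only: integral_norm_bound)
    also have "\<dots> \<le> (LINT x|lborel. (norm h)\<^sup>2 * (norm x ^ 2 * cmod (f x)))"
    proof (rule integral_mono_AE')
      show "integrable lborel (\<lambda>x. (norm h)\<^sup>2 * (norm x ^ 2 * cmod (f x)))" by (intro integrable_mult_right int_norm)
      have "cmod (wave h x - 1 + \<i> * complex_of_real (x \<bullet> h)) \<le> (norm h)\<^sup>2 * norm x ^ 2" for x
      proof -
        have "cmod (wave h x - 1 + \<i> * complex_of_real (x \<bullet> h)) \<le> (x \<bullet> h)\<^sup>2" unfolding wave_def by (rule cmod_wave_remainder)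
        also have "\<dots> = \<bar>x \<bullet> h\<bar>\<^sup>2" by simp
        also have "\<dots> \<le> (norm x * norm h)\<^sup>2" by (intro power_mono Cauchy_Schwarz_ineq2) simp
        finally show ?thesis by (simp add: power_mult_distrib mult.commute)
      qed
      then show "AE x in lborel. cmod (wave \<xi> x * ((wave h x - 1 + \<i> * complex_of_real (x \<bullet> h)) * f x)) \<le> (norm h)\<^sup>2 * (norm x ^ 2 * cmod (f x))"
        by (intro AE_I2) (simp add: norm_mult mult_right_mono flip: mult.assoc)
    qed simp
    also have "\<dots> = (norm h)\<^sup>2 * C2" by (simp add: C2_def)
    finally show "norm (fourier f \<eta> - fourier f \<xi> - (LINT x|lborel. wave \<xi> x * (- \<i> * complex_of_real (x \<bullet> (\<eta> - \<xi>)) * f x))) / norm (\<eta> - \<xi>) \<le> norm (\<eta> - \<xi>) * C2"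
      using h by (simp add: h_def[symmetric] divide_le_eq power2_eq_square algebra_simps)
  next
    have "((\<lambda>\<eta>. norm (\<eta> - \<xi>) * C2) \<longlongrightarrow> norm (\<xi> - \<xi>) * C2) (at \<xi>)" by (intro tendsto_intros)
    then show "((\<lambda>\<eta>. norm (\<eta> - \<xi>) * C2) \<longlongrightarrow> 0) (at \<xi>)" by simp
  qed simp
qed

lemma pderivative_fourier:
  assumes f: "f \<in> schwartz" shows "pderivative k (fourier f) = fourier (\<lambda>x. - \<i> * (complex_of_real (x $ k) * f x))"
  by (rule ext) (simp add: pderivative_eq[OF has_derivative_fourier[OF f]] inner_axis fourier_wave mult.assoc)

definition one_minus_laplacian :: "(real^'n::finite \<Rightarrow> complex) \<Rightarrow> real^'n \<Rightarrow> complex" where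
  "one_minus_laplacian f x = f x - (\<Sum>k\<in>UNIV. pderivative k (pderivative k f) x)"

lemma schwartz_one_minus_laplacian: "f \<in> schwartz \<Longrightarrow> one_minus_laplacian f \<in> schwartz"
  unfolding one_minus_laplacian_def[abs_def] by (intro schwartz_diff schwartz_sum schwartz_pderivative)

lemma sum_coordinate_squares: "(\<Sum>k\<in>UNIV. (x $ k)\<^sup>2) = (norm (x :: real^'n::finite))\<^sup>2"
  unfolding power2_norm_eq_inner by (simp add: inner_vec_def power2_eq_square)

lemma fourier_one_minus_laplacian:
  assumes f: "f \<in> schwartz" shows "fourier (one_minus_laplacian f) \<xi> = complex_of_real (1 + (norm \<xi>)\<^sup>2) * fourier f \<xi>"
proof -
  have d: "pderivative k (pderivative k f) \<in> schwartz" for k by (intro schwartz_pderivative f)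
  have "fourier (one_minus_laplacian f) \<xi> = fourier f \<xi> - (\<Sum>k\<in>UNIV. fourier (pderivative k (pderivative k f)) \<xi>)"
    unfolding one_minus_laplacian_def[abs_def] using schwartz_integrable[OF f] schwartz_integrable[OF d]
    by (simp add: fourier_diff fourier_sum)
  also have "\<dots> = fourier f \<xi> + complex_of_real (\<Sum>k\<in>UNIV. (\<xi> $ k)\<^sup>2) * fourier f \<xi>"
    by (simp add: fourier_pderivative f schwartz_pderivative sum_negf[symmetric] sum_distrib_right power2_eq_square mult.assoc[symmetric])
      (simp add: sum_negf algebra_simps)
  finally show ?thesis by (simp add: sum_coordinate_squares distrib_right)
qed

lemma fourier_one_minus_laplacian_power:
  assumes f: "f \<in> schwartz"
  shows "(one_minus_laplacian ^^ m) f \<in> schwartz" "fourier ((one_minus_laplacian ^^ m) f) \<xi> = complex_of_real ((1 + (norm \<xi>)\<^sup>2) ^ m) * fourier f \<xi>"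
proof -
  show s: "(one_minus_laplacian ^^ m) f \<in> schwartz" for m by (induction m) (simp_all add: f schwartz_one_minus_laplacian)
  show "fourier ((one_minus_laplacian ^^ m) f) \<xi> = complex_of_real ((1 + (norm \<xi>)\<^sup>2) ^ m) * fourier f \<xi>"
    by (induction m) (simp_all add: fourier_one_minus_laplacian[OF s] mult.assoc)
qed

lemma fourier_decay:
  assumes f: "f \<in> schwartz"
  shows "(1 + (norm \<xi>)\<^sup>2) ^ m * cmod (fourier f \<xi>) \<le> (LINT x|lborel. cmod ((one_minus_laplacian ^^ m) f x))"
proof -
  have "(1 + (norm \<xi>)\<^sup>2) ^ m * cmod (fourier f \<xi>) = cmod (fourier ((one_minus_laplacian ^^ m) f) \<xi>)"
    unfolding fourier_one_minus_laplacian_power(2)[OF f] norm_mult norm_of_real by simp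
  also have "\<dots> \<le> (LINT x|lborel. cmod ((one_minus_laplacian ^^ m) f x))"
    by (rule norm_fourier_le[OF schwartz_integrable[OF fourier_one_minus_laplacian_power(1)[OF f]]])
  finally show ?thesis .
qed

lemma one_plus_norm_le: "(1 + norm x) ^ N \<le> 2 ^ N * (1 + (norm x)\<^sup>2) ^ N"
proof -
  have "1 + norm x \<le> 2 * (1 + (norm x)\<^sup>2)"
    using sum_squares_bound[of 1 "norm x"] by (simp add: field_simps) (smt (verit) norm_ge_zero zero_le_power2)
  then have "(1 + norm x) ^ N \<le> (2 * (1 + (norm x)\<^sup>2)) ^ N" by (intro power_mono) auto
  then show ?thesis by (simp only: power_mult_distrib)
qed

text \<open>Derivatives of a transform are transforms of Schwartz functions, and its decay comes from
  transforming powers of \<open>1 - \<Delta>\<close>.\<close>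

lemma schwartz_fourier:
  assumes "f \<in> schwartz" shows "fourier f \<in> schwartz"
proof (rule schwartz_coinduct[where C="fourier ` schwartz"])
  show "g differentiable (at x)" if "g \<in> fourier ` schwartz" for g and x :: "real^'a"
    using that by (auto intro: differentiableI[OF has_derivative_fourier])
  show "pderivative k g \<in> fourier ` schwartz" if "g \<in> fourier ` schwartz" for g k
  proof -
    obtain f where f: "g = fourier f" "f \<in> schwartz" using \<open>g \<in> fourier ` schwartz\<close> by blast
    show ?thesis unfolding f(1) pderivative_fourier[OF f(2)]
      by (intro imageI schwartz_cmult schwartz_coordinate_mult f)
  qed
  show "rapid g" if "g \<in> fourier ` schwartz" for g
    unfolding rapid_def
  proof
    fix N
    obtain f where f: "g = fourier f" "f \<in> schwartz" using \<open>g \<in> fourier ` schwartz\<close> by blast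
    have "(1 + norm x) ^ N * cmod (g x) \<le> 2 ^ N * (LINT x|lborel. cmod ((one_minus_laplacian ^^ N) f x))" for x
    proof -
      have "(1 + norm x) ^ N * cmod (g x) \<le> (2 ^ N * (1 + (norm x)\<^sup>2) ^ N) * cmod (g x)"
        by (intro mult_right_mono one_plus_norm_le) simp
      also have "\<dots> = 2 ^ N * ((1 + (norm x)\<^sup>2) ^ N * cmod (g x))" by simp
      also have "\<dots> \<le> 2 ^ N * (LINT x|lborel. cmod ((one_minus_laplacian ^^ N) f x))"
        unfolding f(1) by (intro mult_left_mono fourier_decay f) simp
      finally show ?thesis .
    qed
    then show "\<exists>C. \<forall>x. (1 + norm x) ^ N * cmod (g x) \<le> C" by blast
  qed
qed (use assms in auto)

lemma fourier_swap:
  assumes f: "integrable lborel f" and g: "integrable lborel g"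
  shows "(LINT \<xi>|lborel. fourier f \<xi> * g \<xi>) = (LINT x|lborel. f x * fourier g x)"
proof -
  note [measurable] = borel_measurable_integrable[OF f] borel_measurable_integrable[OF g]
  have m: "(\<lambda>(x, \<xi>). wave \<xi> x * (f x * g \<xi>)) \<in> borel_measurable (lborel \<Otimes>\<^sub>M lborel)"
  proof -
    have "(\<lambda>z :: (real^'a) \<times> (real^'a). exp (- \<i> * complex_of_real (fst z \<bullet> snd z))) \<in> borel_measurable borel"
      by (intro borel_measurable_continuous_onI continuous_intros)
    then have [measurable]: "(\<lambda>z :: (real^'a) \<times> (real^'a). exp (- \<i> * complex_of_real (fst z \<bullet> snd z))) \<in> borel_measurable (lborel \<Otimes>\<^sub>M lborel)"
      by (simp add: lborel_prod)
    show ?thesis unfolding case_prod_beta wave_def by measurable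
  qed
  have "integrable (lborel \<Otimes>\<^sub>M lborel) (\<lambda>(x, \<xi>). wave \<xi> x * (f x * g \<xi>))"
  proof (rule lborel_pair.Fubini_integrable[OF m])
    have "(\<lambda>x. LINT y|lborel. norm (case (x, y) of (x, \<xi>) \<Rightarrow> wave \<xi> x * (f x * g \<xi>))) = (\<lambda>x. cmod (f x) * (LINT y|lborel. cmod (g y)))"
      by (simp add: norm_mult)
    then show "integrable lborel (\<lambda>x. LINT y|lborel. norm (case (x, y) of (x, \<xi>) \<Rightarrow> wave \<xi> x * (f x * g \<xi>)))"
      using f by simp
    have "integrable lborel (\<lambda>\<xi>. wave \<xi> x * (f x * g \<xi>))" for x
      by (rule Bochner_Integration.integrable_bound[of lborel "\<lambda>\<xi>. f x * g \<xi>"]) (use g in \<open>auto simp: norm_mult\<close>)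
    then show "AE x in lborel. integrable lborel (\<lambda>y. case (x, y) of (x, \<xi>) \<Rightarrow> wave \<xi> x * (f x * g \<xi>))"
      by simp
  qed
  from lborel_pair.Fubini_integral[OF this]
  have "(LINT \<xi>|lborel. LINT x|lborel. wave \<xi> x * (f x * g \<xi>)) = (LINT x|lborel. LINT \<xi>|lborel. wave \<xi> x * (f x * g \<xi>))" .
  moreover have "(LINT x|lborel. wave \<xi> x * (f x * g \<xi>)) = fourier f \<xi> * g \<xi>" for \<xi>
    unfolding fourier_wave by (simp add: mult.assoc[symmetric])
  moreover have "(LINT \<xi>|lborel. wave \<xi> x * (f x * g \<xi>)) = f x * fourier g x" for x
  proof -
    have "(LINT \<xi>|lborel. wave \<xi> x * (f x * g \<xi>)) = (LINT \<xi>|lborel. f x * (wave x \<xi> * g \<xi>))"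
      by (simp add: wave_commute[of _ x] mult.left_commute)
    then show ?thesis unfolding fourier_wave by simp
  qed
  ultimately show ?thesis by simp
qed

section \<open>Fourier inversion\<close>

definition std_gaussian :: "real^'n::finite \<Rightarrow> complex" where
  "std_gaussian = gaussian (1/2) 0 0"

lemma std_gaussian_eq: "std_gaussian x = complex_of_real (exp (- (norm x)\<^sup>2 / 2))"
  by (simp add: std_gaussian_def gaussian_def power2_norm_eq_inner)

lemma std_gaussian_schwartz: "std_gaussian \<in> schwartz"
  unfolding std_gaussian_def by (rule gaussian_schwartz) simp

text \<open>The factor that makes the Fourier transform isometric. It is kept as a constant of its own, of complex
  type, so that simplification does not expand the power.\<close>

definition fourier_const :: "'n::finite itself \<Rightarrow> complex" where "fourier_const _ = complex_of_real (sqrt (2 * pi) ^ CARD('n))"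

lemma fourier_const_nonzero: "fourier_const TYPE('n::finite) \<noteq> 0"
  by (simp add: fourier_const_def)

lemma cnj_fourier_const: "cnj (fourier_const TYPE('n::finite)) = fourier_const TYPE('n)"
  by (simp add: fourier_const_def)

lemma fourier_const_sq: "fourier_const TYPE('n::finite) * fourier_const TYPE('n) = (2 * complex_of_real pi) ^ CARD('n)"
proof -
  have "sqrt (2 * pi) ^ CARD('n) * sqrt (2 * pi) ^ CARD('n) = (2 * pi) ^ CARD('n)"
    by (simp only: power_mult_distrib[symmetric] real_sqrt_mult_self) simp
  then have "fourier_const TYPE('n) * fourier_const TYPE('n) = complex_of_real ((2 * pi) ^ CARD('n))"
    unfolding fourier_const_def by (simp only: of_real_mult[symmetric])
  then show ?thesis by simp
qed

lemma integral_std_gaussian: "(LINT x|lborel. std_gaussian (x :: real^'n::finite)) = fourier_const TYPE('n)"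
proof -
  have 1: "(\<integral>\<^sup>+t. ennreal (exp (- t\<^sup>2 / 2)) \<partial>lborel) = ennreal (sqrt (2 * pi))"
  proof -
    have "(\<integral>\<^sup>+t. ennreal (std_normal_density t) \<partial>lborel) = 1"
      using prob_space.emeasure_space_1[OF prob_space_normal_density[of 1 0]] by (simp add: emeasure_density)
    moreover have "ennreal (exp (- t\<^sup>2 / 2)) = ennreal (sqrt (2 * pi)) * ennreal (std_normal_density t)" for t
      by (simp add: std_normal_density_def flip: ennreal_mult)
    ultimately show ?thesis by (simp add: nn_integral_cmult)
  qed
  have "(\<integral>\<^sup>+x. ennreal (exp (- (norm (x :: real^'n))\<^sup>2 / 2)) \<partial>lborel)
      = (\<integral>\<^sup>+x. (\<Prod>b\<in>Basis. ennreal (exp (- ((x :: real^'n) \<bullet> b)\<^sup>2 / 2))) \<partial>lborel)"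
  proof (rule nn_integral_cong)
    fix x :: "real^'n"
    have "(norm x)\<^sup>2 = (\<Sum>b\<in>Basis. (x \<bullet> b)\<^sup>2)"
      unfolding power2_norm_eq_inner by (subst euclidean_inner) (simp add: power2_eq_square)
    then have "exp (- (norm x)\<^sup>2 / 2) = (\<Prod>b\<in>Basis. exp (- (x \<bullet> b)\<^sup>2 / 2))"
      by (simp add: exp_sum[symmetric] sum_negf sum_divide_distrib)
    then show "ennreal (exp (- (norm x)\<^sup>2 / 2)) = (\<Prod>b\<in>Basis. ennreal (exp (- (x \<bullet> b)\<^sup>2 / 2)))"
      by (simp add: prod_ennreal)
  qed
  also have "\<dots> = (\<Prod>b\<in>(Basis :: (real^'n) set). \<integral>\<^sup>+t. ennreal (exp (- t\<^sup>2 / 2)) \<partial>lborel)"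
    by (rule nn_integral_lborel_prod) auto
  also have "\<dots> = ennreal (sqrt (2 * pi) ^ CARD('n))"
    unfolding 1 by (simp add: ennreal_power)
  finally have "(LINT x|lborel. exp (- (norm (x :: real^'n))\<^sup>2 / 2)) = sqrt (2 * pi) ^ CARD('n)"
    by (subst integral_eq_nn_integral) auto
  then show ?thesis unfolding std_gaussian_eq fourier_const_def by (simp add: integral_complex_of_real)
qed

lemma linear_partials:
  fixes f' :: "real^'n::finite \<Rightarrow> complex"
  assumes "linear f'" shows "f' h = (\<Sum>k\<in>UNIV. (h $ k) *\<^sub>R f' (axis k 1))"
proof -
  have "h = (\<Sum>k\<in>UNIV. (h $ k) *\<^sub>R axis k 1)"
    using basis_expansion[of h] by (simp add: scalar_mult_eq_scaleR)
  then have "f' h = f' (\<Sum>k\<in>UNIV. (h $ k) *\<^sub>R axis k 1)" by simp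
  then show ?thesis using assms by (simp add: linear_sum linear_scale)
qed

text \<open>The transform satisfies the same first order differential equations as the Gaussian itself, so its
  quotient by the Gaussian is constant; the constant is the value at the origin.\<close>

lemma fourier_std_gaussian: "fourier std_gaussian \<xi> = fourier_const TYPE('n) * std_gaussian (\<xi> :: real^'n::finite)"
proof -
  \<comment> \<open>the second factor is the reciprocal of the Gaussian\<close>
  define q where "q \<xi> = fourier std_gaussian \<xi> * gaussian (- 1/2) 0 0 \<xi>" for \<xi> :: "real^'n"
  have pg: "pderivative k (fourier std_gaussian) \<xi> = - (complex_of_real (\<xi> $ k) * fourier std_gaussian \<xi>)" for k and \<xi> :: "real^'n"
  proof -
    have "pderivative k std_gaussian = (\<lambda>x. - 1 * (complex_of_real (x $ k) * std_gaussian (x :: real^'n)))"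
      unfolding std_gaussian_def pderivative_gaussian by simp
    then have "\<i> * complex_of_real (\<xi> $ k) * fourier std_gaussian \<xi> = - 1 * fourier (\<lambda>x. complex_of_real (x $ k) * std_gaussian x) \<xi>"
      using fourier_pderivative[OF std_gaussian_schwartz, of k \<xi>] fourier_cmult[of "-1"] by metis
    moreover have "pderivative k (fourier std_gaussian) \<xi> = - \<i> * fourier (\<lambda>x. complex_of_real (x $ k) * std_gaussian x) \<xi>"
      unfolding pderivative_fourier[OF std_gaussian_schwartz] by (rule fourier_cmult)
    ultimately have "pderivative k (fourier std_gaussian) \<xi> = \<i> * (\<i> * complex_of_real (\<xi> $ k) * fourier std_gaussian \<xi>)" by simp
    then show ?thesis by (simp add: mult.assoc[symmetric])
  qed
  have qd: "(q has_derivative (\<lambda>h. 0)) (at \<xi>)" for \<xi>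
  proof -
    have d1: "fourier std_gaussian differentiable (at \<xi>)" by (rule schwartz_differentiable[OF schwartz_fourier[OF std_gaussian_schwartz]])
    have d2: "gaussian (- 1/2) 0 0 differentiable (at \<xi>)" by (rule differentiableI[OF has_derivative_gaussian])
    have "q differentiable (at \<xi>)" unfolding q_def by (intro differentiable_mult d1 d2)
    then obtain q' where q': "(q has_derivative q') (at \<xi>)" unfolding differentiable_def by blast
    have "q' (axis k 1) = 0" for k
    proof -
      have "q' (axis k 1) = pderivative k q \<xi>" using pderivative_eq[OF q'] by simp
      also have "\<dots> = fourier std_gaussian \<xi> * pderivative k (gaussian (- 1/2) 0 0) \<xi> + pderivative k (fourier std_gaussian) \<xi> * gaussian (- 1/2) 0 0 \<xi>"
        unfolding q_def by (rule pderivative_mult_at[OF d1 d2])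
      also have "\<dots> = 0" unfolding pg pderivative_gaussian by simp
      finally show ?thesis .
    qed
    then have "q' h = 0" for h
      using linear_partials[OF has_derivative_linear[OF q'], of h] by simp
    then have "q' = (\<lambda>h. 0)" by auto
    with q' show ?thesis by simp
  qed
  then obtain c where c: "\<And>\<xi>. q \<xi> = c"
    using has_derivative_zero_constant[of UNIV q] by auto
  have "c = fourier_const TYPE('n)"
    using c[of 0] integral_std_gaussian[where 'n='n] by (simp add: q_def gaussian_def fourier_wave wave_def)
  moreover have "gaussian (- 1/2) 0 0 \<xi> * std_gaussian \<xi> = 1"
    by (simp add: std_gaussian_def gaussian_def flip: of_real_mult exp_add)
  moreover have "fourier std_gaussian \<xi> * (gaussian (- 1/2) 0 0 \<xi> * std_gaussian \<xi>) = q \<xi> * std_gaussian \<xi>"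
    by (simp only: q_def mult.assoc)
  ultimately show ?thesis by (simp add: c)
qed

text \<open>Fourier inversion at the origin: integrate the transform against ever wider Gaussians, move the
  transform to the Gaussian by \<open>fourier_swap\<close>, and pass to the limit on both sides.\<close>

lemma integral_fourier:
  fixes f :: "real^'n::finite \<Rightarrow> complex"
  assumes f: "f \<in> schwartz" shows "(LINT \<xi>|lborel. fourier f \<xi>) = (2 * complex_of_real pi) ^ CARD('n) * f 0"
proof -
  note [measurable] = schwartz_measurable[OF f] schwartz_measurable[OF std_gaussian_schwartz]
    schwartz_measurable[OF schwartz_fourier[OF f]]
  define g where "g = fourier_const TYPE('n)"
  have g2: "g * g = (2 * complex_of_real pi) ^ CARD('n)"
    unfolding g_def by (rule fourier_const_sq)
  define h where "h n = 1 / real (Suc n)" for n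
  have h: "0 < h n" "h n \<le> 1" for n by (auto simp: h_def)
  have h0: "h \<longlonglongrightarrow> 0" unfolding h_def using LIMSEQ_inverse_real_of_nat by (simp add: inverse_eq_divide)
  have std_gaussian_int: "integrable lborel (std_gaussian :: real^'n \<Rightarrow> complex)" by (rule schwartz_integrable[OF std_gaussian_schwartz])
  have scaled: "(\<lambda>\<xi>::real^'n. std_gaussian (h n *\<^sub>R \<xi>)) = gaussian ((h n)\<^sup>2 / 2) 0 0" for n
    by (rule ext) (simp add: std_gaussian_def gaussian_def power2_eq_square)
  have sint: "integrable lborel (\<lambda>\<xi>::real^'n. std_gaussian (h n *\<^sub>R \<xi>))" for n
    unfolding scaled by (rule schwartz_integrable[OF gaussian_schwartz]) (use h(1)[of n] in simp)
  have eq: "(LINT \<xi>|lborel. fourier f \<xi> * std_gaussian (h n *\<^sub>R \<xi>)) = (LINT z|lborel. f (h n *\<^sub>R z) * (g * std_gaussian z))" for n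
  proof -
    have F: "h n ^ CARD('n) *\<^sub>R fourier (\<lambda>\<xi>. std_gaussian (h n *\<^sub>R \<xi>)) (h n *\<^sub>R z) = g * std_gaussian z" for z :: "real^'n"
    proof -
      have "fourier std_gaussian z = \<bar>h n\<bar> ^ DIM(real^'n) *\<^sub>R (LINT x|lborel. wave z (0 + h n *\<^sub>R x) * std_gaussian (0 + h n *\<^sub>R x))"
        unfolding fourier_wave by (rule integral_affine) (use h(1)[of n] in auto)
      then show ?thesis using h(1)[of n] fourier_std_gaussian[of z] by (simp add: fourier_wave wave_def g_def)
    qed
    have "(LINT \<xi>|lborel. fourier f \<xi> * std_gaussian (h n *\<^sub>R \<xi>)) = (LINT x|lborel. f x * fourier (\<lambda>\<xi>. std_gaussian (h n *\<^sub>R \<xi>)) x)"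
      by (rule fourier_swap[OF schwartz_integrable[OF f] sint])
    also have "\<dots> = \<bar>h n\<bar> ^ DIM(real^'n) *\<^sub>R (LINT z|lborel. f (0 + h n *\<^sub>R z) * fourier (\<lambda>\<xi>. std_gaussian (h n *\<^sub>R \<xi>)) (0 + h n *\<^sub>R z))"
    proof (rule integral_affine)
      have "fourier (\<lambda>\<xi>::real^'n. std_gaussian (h n *\<^sub>R \<xi>)) \<in> schwartz"
        unfolding scaled by (intro schwartz_fourier gaussian_schwartz) (use h(1)[of n] in simp)
      from schwartz_measurable[OF this] show "(\<lambda>x. f x * fourier (\<lambda>\<xi>. std_gaussian (h n *\<^sub>R \<xi>)) x) \<in> borel_measurable borel" by measurable
    qed (use h(1)[of n] in simp)
    also have "\<dots> = (LINT z|lborel. f (h n *\<^sub>R z) * (h n ^ CARD('n) *\<^sub>R fourier (\<lambda>\<xi>. std_gaussian (h n *\<^sub>R \<xi>)) (h n *\<^sub>R z)))"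
      using h(1)[of n] by (simp add: abs_of_pos)
    finally show ?thesis unfolding F .
  qed
  have lim1: "(\<lambda>n. LINT \<xi>|lborel. fourier f \<xi> * std_gaussian (h n *\<^sub>R \<xi>)) \<longlonglongrightarrow> (LINT \<xi>|lborel. fourier f \<xi>)"
  proof (rule integral_dominated_convergence[where w="\<lambda>\<xi>. cmod (fourier f \<xi>)"])
    show "integrable lborel (\<lambda>\<xi>. cmod (fourier f \<xi>))"
      by (intro integrable_norm schwartz_integrable schwartz_fourier f)
    have "(\<lambda>n. fourier f \<xi> * std_gaussian (h n *\<^sub>R \<xi>)) \<longlonglongrightarrow> fourier f \<xi> * std_gaussian (0 *\<^sub>R \<xi>)" for \<xi>
      unfolding std_gaussian_eq by (intro tendsto_intros h0) simp
    then show "AE \<xi> in lborel. (\<lambda>n. fourier f \<xi> * std_gaussian (h n *\<^sub>R \<xi>)) \<longlonglongrightarrow> fourier f \<xi>"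
      by (simp add: std_gaussian_eq)
    show "AE \<xi> in lborel. norm (fourier f \<xi> * std_gaussian (h n *\<^sub>R \<xi>)) \<le> cmod (fourier f \<xi>)" for n
      by (intro AE_I2) (simp add: norm_mult std_gaussian_eq mult_left_le)
  qed measurable
  have lim2: "(\<lambda>n. LINT z|lborel. f (h n *\<^sub>R z) * (g * std_gaussian z)) \<longlonglongrightarrow> (LINT z|lborel. f 0 * (g * std_gaussian (z :: real^'n)))"
  proof -
    obtain C where C: "\<And>x. cmod (f x) \<le> C" using rapid_norm_bounded[OF schwartz_rapid[OF f]] by blast
    show ?thesis
    proof (rule integral_dominated_convergence[where w="\<lambda>z::real^'n. C * cmod (g * std_gaussian z)"])
      show "integrable lborel (\<lambda>z::real^'n. C * cmod (g * std_gaussian z))"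
        by (intro integrable_mult_right integrable_norm std_gaussian_int)
      show "AE z in lborel. norm (f (h n *\<^sub>R z) * (g * std_gaussian z)) \<le> C * cmod (g * std_gaussian z)" for n
      proof (rule AE_I2)
        fix z
        have "norm (f (h n *\<^sub>R z) * (g * std_gaussian z)) = cmod (f (h n *\<^sub>R z)) * cmod (g * std_gaussian z)" by (rule norm_mult)
        also have "\<dots> \<le> C * cmod (g * std_gaussian z)" by (rule mult_right_mono[OF C]) simp
        finally show "norm (f (h n *\<^sub>R z) * (g * std_gaussian z)) \<le> C * cmod (g * std_gaussian z)" .
      qed
      have "isCont f 0" using schwartz_continuous[OF f] by (simp add: continuous_on_eq_continuous_at)
      then have lim: "(\<lambda>n. f (h n *\<^sub>R z)) \<longlonglongrightarrow> f 0" for z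
        by (rule isCont_tendsto_compose) (use tendsto_scaleR[OF h0 tendsto_const, of z] in simp)
      show "AE z in lborel. (\<lambda>n. f (h n *\<^sub>R z) * (g * std_gaussian z)) \<longlonglongrightarrow> f 0 * (g * std_gaussian z)"
        by (rule AE_I2, rule tendsto_mult[OF lim tendsto_const])
    qed measurable
  qed
  have "(LINT z|lborel. f 0 * (g * std_gaussian (z :: real^'n))) = f 0 * (g * g)"
    using integral_std_gaussian[where 'n='n] by (simp add: g_def)
  moreover have "(LINT \<xi>|lborel. fourier f \<xi>) = (LINT z|lborel. f 0 * (g * std_gaussian (z :: real^'n)))"
    by (rule LIMSEQ_unique[OF lim1[unfolded eq] lim2])
  ultimately show ?thesis unfolding g2 by simp
qed

lemma fourier_translate:
  assumes "f \<in> borel_measurable borel" shows "fourier (\<lambda>x. f (x + a)) \<xi> = wave (- a) \<xi> * fourier f \<xi>"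
proof -
  have "fourier f \<xi> = (LINT x|lborel. wave \<xi> (a + x) * f (a + x))"
    unfolding fourier_wave using assms by (intro integral_translate[symmetric]) measurable
  also have "\<dots> = (LINT x|lborel. wave a \<xi> * (wave \<xi> x * f (x + a)))"
    by (intro Bochner_Integration.integral_cong refl) (simp add: wave_commute[of \<xi>] wave_add add.commute[of a] mult_ac)
  also have "\<dots> = wave a \<xi> * fourier (\<lambda>x. f (x + a)) \<xi>" by (simp add: fourier_wave)
  finally have "wave (- a) \<xi> * fourier f \<xi> = (wave (- a) \<xi> * wave a \<xi>) * fourier (\<lambda>x. f (x + a)) \<xi>" by simp
  moreover have "wave (- a) \<xi> * wave a \<xi> = 1" unfolding wave_add[symmetric] by (simp add: wave_def)
  ultimately show ?thesis by simp
qed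

text \<open>Inversion at \<open>x\<close> is inversion at the origin for a translate.\<close>

lemma inv_fourier_fourier:
  fixes f :: "real^'n::finite \<Rightarrow> complex"
  assumes f: "f \<in> schwartz" shows "inv_fourier (fourier f) = f"
proof
  fix x
  have s: "(\<lambda>y. f (y + x)) \<in> schwartz" using schwartz_affine(1)[OF f, of 1 x] by simp
  have e: "exp (\<i> * complex_of_real (x \<bullet> \<xi>)) = wave (- x) \<xi>" for \<xi> by (simp add: wave_def inner_commute)
  have "(LINT \<xi>|lborel. exp (\<i> * complex_of_real (x \<bullet> \<xi>)) * fourier f \<xi>) = (LINT \<xi>|lborel. fourier (\<lambda>y. f (y + x)) \<xi>)"
    unfolding e fourier_translate[OF schwartz_measurable[OF f]] ..
  also have "\<dots> = (2 * complex_of_real pi) ^ CARD('n) * f x"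
    using integral_fourier[OF s] by simp
  finally show "inv_fourier (fourier f) x = f x" by (simp add: inv_fourier_def)
qed

lemma inv_fourier_eq: "inv_fourier f x = fourier f (- x) / (2 * complex_of_real pi) ^ CARD('n)"
  for x :: "real^'n::finite"
  by (simp add: inv_fourier_def fourier_def inner_commute)

lemma schwartz_inv_fourier:
  fixes f :: "real^'n::finite \<Rightarrow> complex"
  assumes f: "f \<in> schwartz" shows "inv_fourier f \<in> schwartz"
proof -
  have "(\<lambda>x. (1 / (2 * complex_of_real pi) ^ CARD('n)) * fourier f ((-1) *\<^sub>R x + 0)) \<in> schwartz"
    by (intro schwartz_cmult(1) schwartz_affine(1) schwartz_fourier f) simp
  moreover have "inv_fourier f = (\<lambda>x. (1 / (2 * complex_of_real pi) ^ CARD('n)) * fourier f ((-1) *\<^sub>R x + 0))"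
    by (rule ext) (simp add: inv_fourier_eq)
  ultimately show ?thesis by simp
qed

lemma fourier_inv_fourier:
  fixes f :: "real^'n::finite \<Rightarrow> complex"
  assumes f: "f \<in> schwartz" shows "fourier (inv_fourier f) = f"
proof
  fix \<xi> :: "real^'n"
  note [measurable] = schwartz_measurable[OF schwartz_fourier[OF f]]
  have "fourier (inv_fourier f) \<xi> = (LINT x|lborel. wave (- \<xi>) (- x) * fourier f (- x)) / (2 * complex_of_real pi) ^ CARD('n)"
    unfolding fourier_wave[of "inv_fourier f"] by (simp add: inv_fourier_eq wave_def)
  also have "\<dots> = (LINT x|lborel. wave (- \<xi>) x * fourier f x) / (2 * complex_of_real pi) ^ CARD('n)"
    by (subst integral_reflect) simp_all
  also have "\<dots> = inv_fourier (fourier f) \<xi>"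
    by (simp add: inv_fourier_def wave_def inner_commute)
  finally show "fourier (inv_fourier f) \<xi> = f \<xi>" by (simp add: inv_fourier_fourier[OF f])
qed

lemma cnj_fourier:
  fixes f :: "real^'n::finite \<Rightarrow> complex"
  shows "cnj (fourier f \<xi>) = (2 * complex_of_real pi) ^ CARD('n) * inv_fourier (\<lambda>x. cnj (f x)) \<xi>"
proof -
  have "cnj (fourier f \<xi>) = (LINT x|lborel. cnj (wave \<xi> x * f x))"
    unfolding fourier_wave by (rule Bochner_Integration.integral_cnj[symmetric])
  also have "\<dots> = (LINT x|lborel. exp (\<i> * complex_of_real (\<xi> \<bullet> x)) * cnj (f x))"
    by (simp add: wave_def exp_cnj inner_commute)
  finally show ?thesis by (simp add: inv_fourier_def)
qed

lemma plancherel_schwartz: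
  fixes f g :: "real^'n::finite \<Rightarrow> complex"
  assumes f: "f \<in> schwartz" and g: "g \<in> schwartz"
  shows "(LINT \<xi>|lborel. fourier f \<xi> * cnj (fourier g \<xi>)) = (2 * complex_of_real pi) ^ CARD('n) * (LINT x|lborel. f x * cnj (g x))"
proof -
  have cg: "(\<lambda>x. cnj (g x)) \<in> schwartz" by (rule schwartz_cnj[OF g])
  define c where "c = (2 * complex_of_real pi) ^ CARD('n)"
  have "(LINT \<xi>|lborel. fourier f \<xi> * cnj (fourier g \<xi>))
      = (LINT \<xi>|lborel. c * (fourier f \<xi> * inv_fourier (\<lambda>x. cnj (g x)) \<xi>))"
    unfolding cnj_fourier c_def[symmetric] by (intro Bochner_Integration.integral_cong refl mult.left_commute)
  also have "\<dots> = c * (LINT \<xi>|lborel. fourier f \<xi> * inv_fourier (\<lambda>x. cnj (g x)) \<xi>)" by simp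
  also have "(LINT \<xi>|lborel. fourier f \<xi> * inv_fourier (\<lambda>x. cnj (g x)) \<xi>) = (LINT x|lborel. f x * cnj (g x))"
    by (subst fourier_swap[OF schwartz_integrable[OF f] schwartz_integrable[OF schwartz_inv_fourier[OF cg]]])
      (simp add: fourier_inv_fourier[OF cg])
  finally show ?thesis unfolding c_def .
qed

section \<open>Separation of functions by Schwartz functions\<close>

text \<open>The measures whose densities are the positive and the negative part of \<open>g\<close> agree on boxes, and these
  generate the Borel sets.\<close>

lemma zero_of_box_integrals_real:
  fixes g :: "'a::euclidean_space \<Rightarrow> real"
  assumes g: "integrable lborel g" and box: "\<And>a b. (LINT x|lborel. indicator (box a b) x * g x) = 0"
  shows "AE x in lborel. g x = 0"
proof -
  note [measurable] = borel_measurable_integrable[OF g]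
  have int: "integrable lborel (\<lambda>x. indicator A x * f x)" if "integrable lborel f" "A \<in> sets borel" for f :: "'a \<Rightarrow> real" and A
    using integrable_mult_indicator[OF _ that(1), of A] that(2) by simp
  have gp: "integrable lborel (\<lambda>x. max 0 (g x))" and gm: "integrable lborel (\<lambda>x. max 0 (- g x))"
    using g by (auto intro: integrable_max)
  have dens: "emeasure (density lborel (\<lambda>x. ennreal (f x))) A = ennreal (LINT x|lborel. indicator A x * max 0 (f x))"
    if "integrable lborel (\<lambda>x. max 0 (f x))" "f \<in> borel_measurable borel" "A \<in> sets borel" for f :: "'a \<Rightarrow> real" and A
  proof -
    have "emeasure (density lborel (\<lambda>x. ennreal (f x))) A = (\<integral>\<^sup>+x. ennreal (indicator A x * max 0 (f x)) \<partial>lborel)"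
      using that(2,3) by (subst emeasure_density) (auto intro!: nn_integral_cong simp: indicator_def max_def ennreal_neg)
    also have "\<dots> = ennreal (LINT x|lborel. indicator A x * max 0 (f x))"
      by (rule nn_integral_eq_integral) (use int[OF that(1,3)] in \<open>auto simp: indicator_def\<close>)
    finally show ?thesis .
  qed
  have "density lborel (\<lambda>x. ennreal (g x)) = density lborel (\<lambda>x. ennreal (- g x))"
  proof (rule measure_eqI_generator_eq[where E="range (\<lambda>(a, b). box a b)" and \<Omega>=UNIV and A="\<lambda>i::nat. box (- (real i *\<^sub>R One)) (real i *\<^sub>R One)"])
    show "Int_stable (range (\<lambda>(a, b). box a b :: 'a set))"
      by (auto simp: Int_stable_def box_Int_box)
    show "sets (density lborel (\<lambda>x. ennreal (g x))) = sigma_sets UNIV (range (\<lambda>(a, b). box a b))"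
      "sets (density lborel (\<lambda>x. ennreal (- g x))) = sigma_sets UNIV (range (\<lambda>(a, b). box a b))"
      by (simp_all add: borel_eq_box)
    show "(\<Union>i. box (- (real i *\<^sub>R One)) (real i *\<^sub>R One)) = (UNIV :: 'a set)"
      unfolding UN_box_eq_UNIV by auto
    show "emeasure (density lborel (\<lambda>x. ennreal (g x))) (box (- (real i *\<^sub>R One)) (real i *\<^sub>R One)) \<noteq> \<infinity>" for i
      by (subst dens[OF gp]) auto
    show "emeasure (density lborel (\<lambda>x. ennreal (g x))) X = emeasure (density lborel (\<lambda>x. ennreal (- g x))) X"
      if X: "X \<in> range (\<lambda>(a, b). box a b)" for X
    proof -
      obtain a b where ab: "X = box a b" using X by auto
      have "(LINT x|lborel. indicator (box a b) x * max 0 (g x)) - (LINT x|lborel. indicator (box a b) x * max 0 (- g x))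
         = (LINT x|lborel. indicator (box a b) x * max 0 (g x) - indicator (box a b) x * max 0 (- g x))"
        by (rule Bochner_Integration.integral_diff[symmetric]) (intro int gp gm; simp)+
      also have "\<dots> = (LINT x|lborel. indicator (box a b) x * g x)"
        by (intro Bochner_Integration.integral_cong refl) (auto simp: max_def)
      finally show ?thesis unfolding ab box by (subst dens[OF gp], simp_all, subst dens[OF gm], simp_all)
    qed
  qed auto
  then have "AE x in lborel. ennreal (g x) = ennreal (- g x)"
    by (rule sigma_finite_measure.density_unique[OF sigma_finite_lborel, rotated 2]) auto
  then show ?thesis
  proof eventually_elim
    case (elim x)
    show "g x = 0"
    proof (rule ccontr)
      assume "g x \<noteq> 0"
      then consider "0 < g x" | "0 < - g x" by linarith
      then show False
      proof cases
        case 1 then show False using elim by (simp add: ennreal_neg)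
      next
        case 2 then show False using elim by (simp add: ennreal_neg eq_commute[of 0])
      qed
    qed
  qed
qed

lemma zero_of_box_integrals:
  fixes g :: "'a::euclidean_space \<Rightarrow> complex"
  assumes g: "integrable lborel g" and box: "\<And>a b. (LINT x|lborel. indicator (box a b) x *\<^sub>R g x) = 0"
  shows "AE x in lborel. g x = 0"
proof -
  have i: "integrable lborel (\<lambda>x. indicator (box a b) x *\<^sub>R g x)" for a b
    by (rule integrable_mult_indicator) (use g in auto)
  have "(LINT x|lborel. indicator (box a b) x * Re (g x)) = 0" for a b
    using integral_Re[OF i, of a b] box[of a b] by simp
  then have 1: "AE x in lborel. Re (g x) = 0" by (intro zero_of_box_integrals_real integrable_Re g)
  have "(LINT x|lborel. indicator (box a b) x * Im (g x)) = 0" for a b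
    using integral_Im[OF i, of a b] box[of a b] by simp
  then have "AE x in lborel. Im (g x) = 0" by (intro zero_of_box_integrals_real integrable_Im g)
  with 1 show ?thesis by eventually_elim (simp add: complex_eq_iff)
qed

lemma AE_not_box_boundary: "AE x in lborel. x \<notin> cbox a b - box (a :: 'a::euclidean_space) b"
proof -
  have "cbox a b - box a b \<in> null_sets lborel"
    using negligible_frontier_interval[of a b] by (simp add: negligible_iff_null_sets null_sets_completion_iff)
  then show ?thesis by (rule AE_not_in)
qed

text \<open>Multiplication by a Gaussian makes \<open>h\<close> integrable. The product has vanishing convolutions with all
  narrow Gaussians, because a product of two Gaussians is a Gaussian; averaging these convolutions over
  a box and letting the width tend to zero shows that its integral over the box vanishes.\<close>

lemma schwartz_separates:
  fixes h :: "real^'n::finite \<Rightarrow> complex"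
  assumes [measurable]: "h \<in> borel_measurable borel"
    and int: "\<And>\<phi>. \<phi> \<in> schwartz \<Longrightarrow> integrable lborel (\<lambda>x. h x * \<phi> x)"
    and zero: "\<And>\<phi>. \<phi> \<in> schwartz \<Longrightarrow> (LINT x|lborel. h x * \<phi> x) = 0"
  shows "AE x in lborel. h x = 0"
proof -
  note [measurable] = schwartz_measurable[OF std_gaussian_schwartz]
  \<comment> \<open>an integrable function with the same zeros as \<open>h\<close>\<close>
  define h1 where "h1 x = h x * std_gaussian x" for x
  have h1: "integrable lborel h1" unfolding h1_def by (rule int[OF std_gaussian_schwartz])
  note [measurable] = borel_measurable_integrable[OF h1]
  have std_gaussian_int: "integrable lborel (std_gaussian :: real^'n \<Rightarrow> complex)" by (rule schwartz_integrable[OF std_gaussian_schwartz])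
  define r where "r n = 1 / real (Suc n)" for n
  have r: "0 < r n" for n by (auto simp: r_def)
  have r0: "r \<longlonglongrightarrow> 0" unfolding r_def using LIMSEQ_inverse_real_of_nat by (simp add: inverse_eq_divide)
  have conv: "(LINT x|lborel. h1 x * std_gaussian ((x - y) /\<^sub>R r n)) = 0" for y n
  proof -
    define c where "c = 1 / 2 + 1 / (2 * (r n)\<^sup>2)"
    define d where "d = - ((norm y)\<^sup>2 / (2 * (r n)\<^sup>2))"
    have "std_gaussian x * std_gaussian ((x - y) /\<^sub>R r n) = gaussian c ((1 / (r n)\<^sup>2) *\<^sub>R y) d x" for x
    proof -
      have "(norm ((x - y) /\<^sub>R r n))\<^sup>2 = (x \<bullet> x - 2 * (y \<bullet> x) + (norm y)\<^sup>2) / (r n)\<^sup>2"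
        using r[of n] by (simp add: power_mult_distrib power2_norm_eq_inner inner_diff inner_commute divide_inverse power_inverse)
      then have "- (norm x)\<^sup>2 / 2 + - (norm ((x - y) /\<^sub>R r n))\<^sup>2 / 2 = - c * (x \<bullet> x) + ((1 / (r n)\<^sup>2) *\<^sub>R y) \<bullet> x + d"
        unfolding \<open>(norm ((x - y) /\<^sub>R r n))\<^sup>2 = _\<close> c_def d_def
        using r[of n] by (simp add: power2_norm_eq_inner[of x] field_simps)
      then show ?thesis by (simp only: std_gaussian_eq gaussian_def of_real_mult[symmetric] exp_add[symmetric])
    qed
    then have "(\<lambda>x. h1 x * std_gaussian ((x - y) /\<^sub>R r n)) = (\<lambda>x. h x * gaussian c ((1 / (r n)\<^sup>2) *\<^sub>R y) d x)"
      by (simp add: h1_def mult.assoc)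
    moreover have "0 < c" using r[of n] by (simp add: c_def add_pos_pos)
    ultimately show ?thesis using zero[OF gaussian_schwartz] by simp
  qed
  have "(LINT x|lborel. indicator (box a b) x *\<^sub>R h1 x) = 0" for a b
  proof -
    \<comment> \<open>the smoothed indicator function of the box, which converges off its boundary\<close>
    define G where "G n x = (LINT z|lborel. indicator (box a b) (x + r n *\<^sub>R z) *\<^sub>R std_gaussian z)" for n and x :: "real^'n"
    have meas_pair: "(\<lambda>(x, z). indicator (box a b) (x + r n *\<^sub>R z) *\<^sub>R std_gaussian z) \<in> borel_measurable (lborel \<Otimes>\<^sub>M lborel)" for n
    proof -
      have "(\<lambda>p :: (real^'n) \<times> (real^'n). fst p + r n *\<^sub>R snd p) \<in> borel_measurable borel"
        by (intro borel_measurable_continuous_onI continuous_intros)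
      then have [measurable]: "(\<lambda>p :: (real^'n) \<times> (real^'n). fst p + r n *\<^sub>R snd p) \<in> lborel \<Otimes>\<^sub>M lborel \<rightarrow>\<^sub>M borel"
        by (simp add: lborel_prod)
      have [measurable]: "(\<lambda>p :: (real^'n) \<times> (real^'n). indicator (box a b) (fst p + r n *\<^sub>R snd p) :: real) \<in> borel_measurable (lborel \<Otimes>\<^sub>M lborel)"
        by (rule measurable_compose[of _ _ borel]) auto
      show ?thesis unfolding case_prod_beta by measurable
    qed
    have G_meas [measurable]: "G n \<in> borel_measurable borel" for n
      unfolding G_def using lborel.borel_measurable_lebesgue_integral[OF meas_pair[of n]] by simp
    have G_bound: "cmod (G n x) \<le> (LINT z|lborel. cmod (std_gaussian (z :: real^'n)))" for n x
      unfolding G_def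
      by (rule order_trans[OF integral_norm_bound], rule integral_mono_AE')
        (use integrable_norm[OF std_gaussian_int] in \<open>auto simp: indicator_def\<close>)
    have G_zero: "(LINT x|lborel. h1 x * G n x) = 0" for n
    proof -
      define f where "f x y = h1 x * (indicator (box a b) y *\<^sub>R std_gaussian ((x - y) /\<^sub>R r n))" for x y :: "real^'n"
      have f_meas: "case_prod f \<in> borel_measurable (lborel \<Otimes>\<^sub>M lborel)"
      proof -
        have "(\<lambda>p :: (real^'n) \<times> (real^'n). (fst p - snd p) /\<^sub>R r n) \<in> borel_measurable borel"
          by (intro borel_measurable_continuous_onI continuous_intros)
        then have [measurable]: "(\<lambda>p :: (real^'n) \<times> (real^'n). (fst p - snd p) /\<^sub>R r n) \<in> lborel \<Otimes>\<^sub>M lborel \<rightarrow>\<^sub>M borel"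
          by (simp add: lborel_prod)
        have [measurable]: "(\<lambda>p :: (real^'n) \<times> (real^'n). std_gaussian ((fst p - snd p) /\<^sub>R r n)) \<in> borel_measurable (lborel \<Otimes>\<^sub>M lborel)"
          by (rule measurable_compose[of _ _ borel]) measurable
        show ?thesis unfolding f_def case_prod_beta by measurable
      qed
      have bnd: "cmod (f x y) \<le> cmod (h1 x) * indicator (box a b) y" for x y
        by (simp add: f_def norm_mult std_gaussian_eq indicator_def mult_left_le)
      have box_int: "integrable lborel (indicator (box a b) :: real^'n \<Rightarrow> real)"
        using emeasure_bounded_finite[OF bounded_box, of a b] by simp
      have f_int: "integrable lborel (f x)" for x
        by (rule Bochner_Integration.integrable_bound[of lborel "\<lambda>y. cmod (h1 x) * indicator (box a b) y"])
          (use box_int bnd f_meas in \<open>auto simp: measurable_compose_Pair1\<close>)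
      have "integrable (lborel \<Otimes>\<^sub>M lborel) (case_prod f)"
      proof (rule lborel_pair.Fubini_integrable[OF f_meas])
        show "integrable lborel (\<lambda>x. LINT y|lborel. norm (case (x, y) of (x, y) \<Rightarrow> f x y))"
        proof (rule Bochner_Integration.integrable_bound)
          show "integrable lborel (\<lambda>x. cmod (h1 x) * (LINT y|lborel. indicator (box a b) (y :: real^'n)))"
            by (intro integrable_mult_left integrable_norm h1)
          have "(\<lambda>(x, y). norm (f x y)) \<in> borel_measurable (lborel \<Otimes>\<^sub>M lborel)"
            using measurable_compose[OF f_meas borel_measurable_norm] by (simp add: case_prod_beta')
          from lborel.borel_measurable_lebesgue_integral[OF this]
          show "(\<lambda>x. LINT y|lborel. norm (case (x, y) of (x, y) \<Rightarrow> f x y)) \<in> borel_measurable lborel" by simp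
          show "AE x in lborel. norm (LINT y|lborel. norm (case (x, y) of (x, y) \<Rightarrow> f x y))
              \<le> norm (cmod (h1 x) * (LINT y|lborel. indicator (box a b) (y :: real^'n)))"
          proof (rule AE_I2)
            fix x
            have "(LINT y|lborel. norm (f x y)) \<le> (LINT y|lborel. cmod (h1 x) * indicator (box a b) y)"
              by (rule integral_mono[OF integrable_norm[OF f_int]]) (use box_int bnd in auto)
            then show "norm (LINT y|lborel. norm (case (x, y) of (x, y) \<Rightarrow> f x y))
              \<le> norm (cmod (h1 x) * (LINT y|lborel. indicator (box a b) (y :: real^'n)))"
              by (simp add: abs_of_nonneg integral_nonneg)
          qed
        qed
      qed (use f_int in simp)
      from lborel_pair.Fubini_integral[OF this]
      have "(LINT y|lborel. LINT x|lborel. f x y) = (LINT x|lborel. LINT y|lborel. f x y)" .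
      moreover have "(LINT x|lborel. f x y) = 0" for y
      proof -
        have "(LINT x|lborel. f x y) = (LINT x|lborel. indicator (box a b) y *\<^sub>R (h1 x * std_gaussian ((x - y) /\<^sub>R r n)))"
          by (simp add: f_def)
        then show ?thesis using conv[where y=y and n=n] by simp
      qed
      moreover have "(LINT y|lborel. f x y) = complex_of_real (r n ^ CARD('n)) * (h1 x * G n x)" for x
      proof -
        have "(LINT y|lborel. indicator (box a b) y *\<^sub>R std_gaussian ((x - y) /\<^sub>R r n))
          = \<bar>r n\<bar> ^ DIM(real^'n) *\<^sub>R (LINT z|lborel. indicator (box a b) (x + r n *\<^sub>R z) *\<^sub>R std_gaussian ((x - (x + r n *\<^sub>R z)) /\<^sub>R r n))"
          by (rule integral_affine) (use r[of n] in auto)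
        also have "\<dots> = r n ^ CARD('n) *\<^sub>R G n x"
          using r[of n] by (simp add: G_def std_gaussian_eq)
        finally show ?thesis by (simp add: f_def scaleR_conv_of_real)
      qed
      ultimately have "complex_of_real (r n ^ CARD('n)) * (LINT x|lborel. h1 x * G n x) = 0" by simp
      then show ?thesis using r[of n] by simp
    qed
    define \<gamma> where "\<gamma> = fourier_const TYPE('n)"
    have \<gamma>: "\<gamma> \<noteq> 0" "(LINT z|lborel. std_gaussian (z :: real^'n)) = \<gamma>" using integral_std_gaussian[where 'n='n] by (auto simp: \<gamma>_def fourier_const_nonzero)
    have "(\<lambda>n. LINT x|lborel. h1 x * G n x) \<longlonglongrightarrow> (LINT x|lborel. h1 x * (indicator (box a b) x *\<^sub>R \<gamma>))"
    proof (rule integral_dominated_convergence[where w="\<lambda>x. cmod (h1 x) * (LINT z|lborel. cmod (std_gaussian (z :: real^'n)))"])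
      show "integrable lborel (\<lambda>x. cmod (h1 x) * (LINT z|lborel. cmod (std_gaussian (z :: real^'n))))"
        by (intro integrable_mult_left integrable_norm h1)
      show "AE x in lborel. norm (h1 x * G n x) \<le> cmod (h1 x) * (LINT z|lborel. cmod (std_gaussian (z :: real^'n)))" for n
        by (rule AE_I2) (simp add: norm_mult mult_left_mono G_bound)
      show "AE x in lborel. (\<lambda>n. h1 x * G n x) \<longlonglongrightarrow> h1 x * (indicator (box a b) x *\<^sub>R \<gamma>)"
        using AE_not_box_boundary[of a b]
      proof eventually_elim
        case (elim x)
        have ind: "(\<lambda>n. indicator (box a b) (x + r n *\<^sub>R z) :: real) \<longlonglongrightarrow> indicator (box a b) x" for z
        proof -
          have lim: "(\<lambda>n. x + r n *\<^sub>R z) \<longlonglongrightarrow> x" using tendsto_add[OF tendsto_const tendsto_scaleR[OF r0 tendsto_const], of x z] by simp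
          show ?thesis
          proof (cases "x \<in> box a b")
            case True
            then have "\<forall>\<^sub>F n in sequentially. x + r n *\<^sub>R z \<in> box a b" by (rule topological_tendstoD[OF lim open_box])
            then have "\<forall>\<^sub>F n in sequentially. indicator (box a b) (x + r n *\<^sub>R z) = (1 :: real)" by eventually_elim simp
            then show ?thesis using True by (simp add: tendsto_eventually)
          next
            case False
            then have "x \<in> - cbox a b" using elim by auto
            then have "\<forall>\<^sub>F n in sequentially. x + r n *\<^sub>R z \<in> - cbox a b" by (rule topological_tendstoD[OF lim, rotated]) auto
            then have "\<forall>\<^sub>F n in sequentially. indicator (box a b) (x + r n *\<^sub>R z) = (0 :: real)"
              by eventually_elim (use box_subset_cbox[of a b] in \<open>auto simp: indicator_def\<close>)
            then show ?thesis using False by (simp add: tendsto_eventually)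
          qed
        qed
        have "(\<lambda>n. G n x) \<longlonglongrightarrow> (LINT z|lborel. indicator (box a b) x *\<^sub>R std_gaussian (z :: real^'n))"
          unfolding G_def
        proof (rule integral_dominated_convergence[where w="\<lambda>z. cmod (std_gaussian (z :: real^'n))"])
          show "AE z in lborel. (\<lambda>n. indicator (box a b) (x + r n *\<^sub>R z) *\<^sub>R std_gaussian z) \<longlonglongrightarrow> indicator (box a b) x *\<^sub>R std_gaussian z"
            by (rule AE_I2, rule tendsto_scaleR[OF ind tendsto_const])
          show "AE z in lborel. norm (indicator (box a b) (x + r n *\<^sub>R z) *\<^sub>R std_gaussian z) \<le> cmod (std_gaussian z)" for n
            by (rule AE_I2) (simp add: indicator_def)
          show "(\<lambda>z. indicator (box a b) (x + r n *\<^sub>R z) *\<^sub>R std_gaussian z) \<in> borel_measurable lborel" for n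
            by measurable
        qed (use integrable_norm[OF std_gaussian_int] in auto)
        then have "(\<lambda>n. G n x) \<longlonglongrightarrow> indicator (box a b) x *\<^sub>R \<gamma>" by (simp add: \<gamma>)
        then show ?case by (rule tendsto_mult[OF tendsto_const])
      qed
    qed measurable
    then have "(\<lambda>n::nat. 0 :: complex) \<longlonglongrightarrow> (LINT x|lborel. h1 x * (indicator (box a b) x *\<^sub>R \<gamma>))" unfolding G_zero .
    then have "(LINT x|lborel. h1 x * (indicator (box a b) x *\<^sub>R \<gamma>)) = 0" by (simp add: LIMSEQ_const_iff)
    moreover have "(LINT x|lborel. h1 x * (indicator (box a b) x *\<^sub>R \<gamma>)) = (LINT x|lborel. (indicator (box a b) x *\<^sub>R h1 x) * \<gamma>)"
      by (intro Bochner_Integration.integral_cong refl) simp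
    ultimately have "(LINT x|lborel. indicator (box a b) x *\<^sub>R h1 x) * \<gamma> = 0"
      by (simp only: integral_mult_left_zero)
    then show ?thesis using \<gamma>(1) by (simp only: mult_eq_0_iff) blast
  qed
  then have "AE x in lborel. h1 x = 0" by (rule zero_of_box_integrals[OF h1])
  then show ?thesis by eventually_elim (simp add: h1_def std_gaussian_eq)
qed

section \<open>The unitary Fourier transform\<close>

text \<open>The complex inner product, of which \<open>\<bullet>\<close> is the real part.\<close>

definition cinner :: "'a::euclidean_space l2 \<Rightarrow> 'a l2 \<Rightarrow> complex" where
  "cinner u v = (LINT x|lborel. fn u x * cnj (fn v x))"

lemma cinner_integrable: "sqint f \<Longrightarrow> sqint g \<Longrightarrow> integrable lborel (\<lambda>x. f x * cnj (g x))"
  by (intro sqint_mult_integrable sqint_cnj)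

lemma cinner_eq: "cinner u v = Complex (u \<bullet> v) (u \<bullet> imul v)"
proof (rule complex_eqI)
  have i: "integrable lborel (\<lambda>x. fn u x * cnj (fn v x))" by (intro cinner_integrable) simp_all
  show "Re (cinner u v) = Re (Complex (u \<bullet> v) (u \<bullet> imul v))"
    unfolding cinner_def integral_Re[OF i, symmetric] by (simp add: inner_l2_def inner_complex_def)
  have "AE x in lborel. Im (fn u x * cnj (fn v x)) = fn u x \<bullet> fn (imul v) x"
    using fn_mul[OF bmult_const, of \<i> v] by eventually_elim (simp add: inner_complex_def algebra_simps)
  then show "Im (cinner u v) = Im (Complex (u \<bullet> v) (u \<bullet> imul v))"
    unfolding cinner_def integral_Im[OF i, symmetric] complex.sel inner_l2_def
    by (intro integral_cong_AE) simp_all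
qed

lemma cinner_cls:
  assumes "sqint f" "sqint g" shows "cinner (cls f) (cls g) = (LINT x|lborel. f x * cnj (g x))"
proof -
  note [measurable] = sqint_meas[OF assms(1)] sqint_meas[OF assms(2)]
  show ?thesis unfolding cinner_def
    by (rule integral_cong_AE, measurable, use fn_cls[OF assms(1)] fn_cls[OF assms(2)] in eventually_elim, simp)
qed

definition schwartz_l2 :: "(real^'n::finite) l2 set" where "schwartz_l2 = cls ` schwartz"

lemma cls_cmul: assumes "sqint f" shows "cls (\<lambda>x. c * f x) = mul (\<lambda>x. c) (cls f)"
  by (rule l2_eqI, use fn_cls[OF sqint_cmul[OF assms], of c] fn_mul[OF bmult_const, of c "cls f"] fn_cls[OF assms]
      in eventually_elim, simp)

lemma mul_of_real: "mul (\<lambda>x. complex_of_real r) u = r *\<^sub>R u"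
  by (rule l2_eqI, use fn_mul[OF bmult_const, of "complex_of_real r" u] fn_scaleR[of r u]
      in eventually_elim, simp add: scaleR_conv_of_real)

lemma subspace_schwartz_l2: "subspace schwartz_l2"
proof (rule subspaceI)
  show "0 \<in> schwartz_l2" unfolding schwartz_l2_def zero_l2_def by (intro imageI schwartz_zero)
  show "u + v \<in> schwartz_l2" if "u \<in> schwartz_l2" "v \<in> schwartz_l2" for u v :: "(real^'a) l2"
    using that unfolding schwartz_l2_def
    by (auto simp: cls_add[symmetric] schwartz_sqint intro!: imageI schwartz_add)
  show "r *\<^sub>R u \<in> schwartz_l2" if "u \<in> schwartz_l2" for u :: "(real^'a) l2" and r
    using that unfolding schwartz_l2_def
    by (auto simp: mul_of_real[symmetric] cls_cmul[symmetric] schwartz_sqint intro!: imageI schwartz_cmult)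
qed

lemma imul_schwartz_l2: "v \<in> schwartz_l2 \<Longrightarrow> imul v \<in> schwartz_l2"
  unfolding schwartz_l2_def by (auto simp: cls_cmul[symmetric] schwartz_sqint intro!: imageI schwartz_cmult)

lemma schwartz_l2_total:
  assumes "\<And>v. v \<in> schwartz_l2 \<Longrightarrow> z \<bullet> v = 0" shows "z = 0"
proof -
  have "(LINT x|lborel. fn z x * \<phi> x) = 0" if "\<phi> \<in> schwartz" for \<phi>
  proof -
    have c: "(\<lambda>x. cnj (\<phi> x)) \<in> schwartz" by (rule schwartz_cnj[OF that])
    then have v: "cls (\<lambda>x. cnj (\<phi> x)) \<in> schwartz_l2" by (simp add: schwartz_l2_def)
    have "cinner z (cls (\<lambda>x. cnj (\<phi> x))) = 0"
      using assms[OF v] assms[OF imul_schwartz_l2[OF v]] by (simp add: cinner_eq complex_eq_iff)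
    then show ?thesis using cinner_cls[OF sqint_fn schwartz_sqint[OF c], of z] by simp
  qed
  then have "AE x in lborel. fn z x = 0"
    by (intro schwartz_separates) (simp_all add: sqint_mult_integrable schwartz_sqint)
  then have "AE x in lborel. fn z x = fn 0 x" using fn_zero[where 'a="real^'a"] by eventually_elim simp
  then show ?thesis by (rule l2_eqI)
qed

definition fourier_l2 :: "(real^'n::finite) l2 \<Rightarrow> (real^'n) l2" where
  "fourier_l2 v = cls (\<lambda>\<xi>. inverse (fourier_const TYPE('n)) * fourier (fn v) \<xi>)"

definition inv_fourier_l2 :: "(real^'n::finite) l2 \<Rightarrow> (real^'n) l2" where
  "inv_fourier_l2 v = cls (\<lambda>\<xi>. fourier_const TYPE('n) * inv_fourier (fn v) \<xi>)"

lemma inv_fourier_cmult: "inv_fourier (\<lambda>\<xi>. c * f \<xi>) x = c * inv_fourier f x"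
  by (simp add: inv_fourier_eq fourier_cmult)

lemma fourier_cls: assumes "\<phi> \<in> schwartz" shows "fourier (fn (cls \<phi>)) = fourier \<phi>"
proof
  fix \<xi>
  note [measurable] = schwartz_measurable[OF assms]
  show "fourier (fn (cls \<phi>)) \<xi> = fourier \<phi> \<xi>" unfolding fourier_wave
    by (rule integral_cong_AE, measurable, use fn_cls[OF schwartz_sqint[OF assms]] in eventually_elim, simp)
qed

lemma fourier_l2_cls:
  fixes \<phi> :: "real^'n::finite \<Rightarrow> complex"
  assumes "\<phi> \<in> schwartz"
  shows "fourier_l2 (cls \<phi>) = cls (\<lambda>\<xi>. inverse (fourier_const TYPE('n)) * fourier \<phi> \<xi>)"
    and "(\<lambda>\<xi>. inverse (fourier_const TYPE('n)) * fourier \<phi> \<xi>) \<in> schwartz"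
  by (simp_all add: fourier_l2_def fourier_cls assms schwartz_cmult schwartz_fourier)

lemma inv_fourier_l2_cls:
  fixes \<phi> :: "real^'n::finite \<Rightarrow> complex"
  assumes "\<phi> \<in> schwartz"
  shows "inv_fourier_l2 (cls \<phi>) = cls (\<lambda>\<xi>. fourier_const TYPE('n) * inv_fourier \<phi> \<xi>)"
    and "(\<lambda>\<xi>. fourier_const TYPE('n) * inv_fourier \<phi> \<xi>) \<in> schwartz"
proof -
  have "inv_fourier (fn (cls \<phi>)) = inv_fourier \<phi>"
    by (rule ext) (simp add: inv_fourier_eq fourier_cls assms)
  then show "inv_fourier_l2 (cls \<phi>) = cls (\<lambda>\<xi>. fourier_const TYPE('n) * inv_fourier \<phi> \<xi>)"
    by (simp add: inv_fourier_l2_def)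
qed (simp add: assms schwartz_cmult schwartz_inv_fourier)

lemma fourier_l2_in: "v \<in> schwartz_l2 \<Longrightarrow> fourier_l2 v \<in> schwartz_l2"
  unfolding schwartz_l2_def using fourier_l2_cls by auto

lemma fourier_l2_inverse:
  assumes "v \<in> schwartz_l2" shows "inv_fourier_l2 (fourier_l2 v) = v" "fourier_l2 (inv_fourier_l2 v) = v"
proof -
  obtain \<phi> :: "real^'a \<Rightarrow> complex" where \<phi>: "v = cls \<phi>" "\<phi> \<in> schwartz" using assms unfolding schwartz_l2_def by blast
  have c: "fourier_const TYPE('a) \<noteq> 0" by (rule fourier_const_nonzero)
  have "inv_fourier (\<lambda>\<xi>. inverse (fourier_const TYPE('a)) * fourier \<phi> \<xi>) = (\<lambda>x. inverse (fourier_const TYPE('a)) * \<phi> x)"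
    by (rule ext) (simp add: inv_fourier_cmult inv_fourier_fourier[OF \<phi>(2)])
  then show "inv_fourier_l2 (fourier_l2 v) = v"
    using c unfolding \<phi>(1) fourier_l2_cls(1)[OF \<phi>(2)] inv_fourier_l2_cls(1)[OF fourier_l2_cls(2)[OF \<phi>(2)]]
    by (simp add: mult.assoc[symmetric])
  have "fourier (\<lambda>\<xi>. fourier_const TYPE('a) * inv_fourier \<phi> \<xi>) = (\<lambda>x. fourier_const TYPE('a) * \<phi> x)"
    using fourier_inv_fourier[OF \<phi>(2)] by (auto simp: fourier_cmult fun_eq_iff)
  then show "fourier_l2 (inv_fourier_l2 v) = v"
    using c unfolding \<phi>(1) inv_fourier_l2_cls(1)[OF \<phi>(2)] fourier_l2_cls(1)[OF inv_fourier_l2_cls(2)[OF \<phi>(2)]]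
    by (simp add: mult.assoc[symmetric])
qed

lemma inv_fourier_l2_in: "v \<in> schwartz_l2 \<Longrightarrow> inv_fourier_l2 v \<in> schwartz_l2"
  unfolding schwartz_l2_def using inv_fourier_l2_cls by auto

lemma fourier_l2_linear:
  assumes "v \<in> schwartz_l2"
  shows "w \<in> schwartz_l2 \<Longrightarrow> fourier_l2 (v + w) = fourier_l2 v + fourier_l2 w"
    and "fourier_l2 (mul (\<lambda>x. c) v) = mul (\<lambda>x. c) (fourier_l2 v)"
proof -
  obtain \<phi> :: "real^'a \<Rightarrow> complex" where \<phi>: "v = cls \<phi>" "\<phi> \<in> schwartz" using assms unfolding schwartz_l2_def by blast
  show "fourier_l2 (v + w) = fourier_l2 v + fourier_l2 w" if w: "w \<in> schwartz_l2"
  proof -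
    obtain \<psi> :: "real^'a \<Rightarrow> complex" where \<psi>: "w = cls \<psi>" "\<psi> \<in> schwartz" using w unfolding schwartz_l2_def by blast
    have "v + w = cls (\<lambda>x. \<phi> x + \<psi> x)" unfolding \<phi>(1) \<psi>(1) by (simp add: cls_add schwartz_sqint \<phi> \<psi>)
    then have "fourier_l2 (v + w) = cls (\<lambda>\<xi>. inverse (fourier_const TYPE('a)) * fourier \<phi> \<xi> + inverse (fourier_const TYPE('a)) * fourier \<psi> \<xi>)"
      by (simp add: fourier_l2_cls schwartz_add \<phi>(2) \<psi>(2) fourier_add schwartz_integrable distrib_left)
    then show ?thesis unfolding \<phi>(1) \<psi>(1) fourier_l2_cls(1)[OF \<phi>(2)] fourier_l2_cls(1)[OF \<psi>(2)]
      by (simp add: cls_add schwartz_sqint fourier_l2_cls(2)[OF \<phi>(2)] fourier_l2_cls(2)[OF \<psi>(2)])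
  qed
  have "mul (\<lambda>x. c) v = cls (\<lambda>x. c * \<phi> x)" unfolding \<phi>(1) by (simp add: cls_cmul schwartz_sqint \<phi>)
  then show "fourier_l2 (mul (\<lambda>x. c) v) = mul (\<lambda>x. c) (fourier_l2 v)"
    unfolding \<phi>(1) by (simp add: fourier_l2_cls schwartz_cmult \<phi>(2) fourier_cmult mult.left_commute[of _ c]
      cls_cmul[OF schwartz_sqint[OF fourier_l2_cls(2)[OF \<phi>(2)]], symmetric])
qed

lemma fourier_l2_norm:
  assumes "v \<in> schwartz_l2" shows "norm (fourier_l2 v) = norm v"
proof -
  obtain \<phi> :: "real^'a \<Rightarrow> complex" where \<phi>: "v = cls \<phi>" "\<phi> \<in> schwartz" using assms unfolding schwartz_l2_def by blast
  define c where "c = fourier_const TYPE('a)"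
  have c: "c \<noteq> 0" "c * c = (2 * complex_of_real pi) ^ CARD('a)" "cnj c = c"
    using fourier_const_nonzero[where 'n='a] fourier_const_sq[where 'n='a] cnj_fourier_const[where 'n='a] by (auto simp: c_def)
  have "cinner (fourier_l2 v) (fourier_l2 v) = (LINT \<xi>|lborel. (inverse c * fourier \<phi> \<xi>) * cnj (inverse c * fourier \<phi> \<xi>))"
    unfolding \<phi>(1) fourier_l2_cls(1)[OF \<phi>(2)] using schwartz_sqint[OF fourier_l2_cls(2)[OF \<phi>(2)]]
    by (subst cinner_cls) (simp_all add: c_def)
  also have "\<dots> = (LINT \<xi>|lborel. inverse (c * c) * (fourier \<phi> \<xi> * cnj (fourier \<phi> \<xi>)))"
    by (intro Bochner_Integration.integral_cong refl) (simp add: c(3) mult_ac)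
  also have "\<dots> = inverse (c * c) * (c * c * (LINT x|lborel. \<phi> x * cnj (\<phi> x)))"
    using plancherel_schwartz[OF \<phi>(2) \<phi>(2)] unfolding c(2)[symmetric] by simp
  also have "\<dots> = cinner v v" unfolding \<phi>(1) using c(1) by (simp add: field_simps cinner_cls schwartz_sqint \<phi>(2))
  finally have "fourier_l2 v \<bullet> fourier_l2 v = v \<bullet> v" by (simp add: cinner_eq)
  then show ?thesis by (simp add: norm_eq_sqrt_inner)
qed

lemma inv_fourier_l2_linear:
  assumes "v \<in> schwartz_l2"
  shows "w \<in> schwartz_l2 \<Longrightarrow> inv_fourier_l2 (v + w) = inv_fourier_l2 v + inv_fourier_l2 w"
    and "inv_fourier_l2 (mul (\<lambda>x. c) v) = mul (\<lambda>x. c) (inv_fourier_l2 v)"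
    and "norm (inv_fourier_l2 v) = norm v"
proof -
  note i = inv_fourier_l2_in[OF assms]
  show "inv_fourier_l2 (v + w) = inv_fourier_l2 v + inv_fourier_l2 w" if w: "w \<in> schwartz_l2"
  proof -
    note j = inv_fourier_l2_in[OF w]
    have "v + w = fourier_l2 (inv_fourier_l2 v + inv_fourier_l2 w)"
      using fourier_l2_linear(1)[OF i j] fourier_l2_inverse(2)[OF assms] fourier_l2_inverse(2)[OF w] by simp
    then show ?thesis using fourier_l2_inverse(1)[OF subspace_add[OF subspace_schwartz_l2 i j]] by simp
  qed
  obtain \<phi> :: "real^'a \<Rightarrow> complex" where \<phi>: "inv_fourier_l2 v = cls \<phi>" "\<phi> \<in> schwartz" using i unfolding schwartz_l2_def by blast
  have m: "mul (\<lambda>x. c) (inv_fourier_l2 v) \<in> schwartz_l2"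
    unfolding \<phi>(1) schwartz_l2_def using \<phi>(2) by (auto simp: cls_cmul[symmetric] schwartz_sqint intro!: imageI schwartz_cmult)
  have "mul (\<lambda>x. c) v = fourier_l2 (mul (\<lambda>x. c) (inv_fourier_l2 v))"
    using fourier_l2_linear(2)[OF i] fourier_l2_inverse(2)[OF assms] by simp
  then show "inv_fourier_l2 (mul (\<lambda>x. c) v) = mul (\<lambda>x. c) (inv_fourier_l2 v)"
    using fourier_l2_inverse(1)[OF m] by simp
  show "norm (inv_fourier_l2 v) = norm v"
    using fourier_l2_norm[OF i] fourier_l2_inverse(2)[OF assms] by simp
qed

text \<open>An isometry \<open>G\<close> of the classes of Schwartz functions is extended through its adjoint, which is defined
  weakly on the whole space.\<close>

lemma extend_isometry:
  fixes G :: "(real^'n::finite) l2 \<Rightarrow> (real^'n) l2"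
  assumes add: "\<And>v w. v \<in> schwartz_l2 \<Longrightarrow> w \<in> schwartz_l2 \<Longrightarrow> G (v + w) = G v + G w"
    and mul: "\<And>v c. v \<in> schwartz_l2 \<Longrightarrow> G (mul (\<lambda>x. c) v) = mul (\<lambda>x. c) (G v)"
    and nrm: "\<And>v. v \<in> schwartz_l2 \<Longrightarrow> norm (G v) = norm v"
  shows "\<exists>T. (\<forall>u. \<forall>v\<in>schwartz_l2. ap T u \<bullet> v = u \<bullet> G v) \<and> (\<forall>u. norm (ap T u) \<le> norm u)"
proof -
  obtain T where T: "\<And>u v. v \<in> schwartz_l2 \<Longrightarrow> ap T u \<bullet> v = u \<bullet> G v" "\<And>u. norm (ap T u) \<le> 1 * norm u"
  proof (rule bop_of_form[where V=schwartz_l2 and b="\<lambda>u v. u \<bullet> G v" and c=1])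
    show "subspace (schwartz_l2 :: (real^'n) l2 set)" by (rule subspace_schwartz_l2)
    show "z = 0" if "\<And>v. v \<in> schwartz_l2 \<Longrightarrow> z \<bullet> v = 0" for z :: "(real^'n) l2" using that by (rule schwartz_l2_total)
    show "u \<bullet> G (r *\<^sub>R v) = r * (u \<bullet> G v)" if "v \<in> schwartz_l2" for u r v
      using mul[OF that, of "complex_of_real r"] by (simp add: mul_of_real)
    show "imul u \<bullet> G (imul v) = u \<bullet> G v" if "v \<in> schwartz_l2" for u v
      unfolding mul[OF that] by (rule imul_inner_imul)
    show "\<bar>u \<bullet> G v\<bar> \<le> 1 * norm u * norm v" if "v \<in> schwartz_l2" for u v
      using Cauchy_Schwarz_ineq2[of u "G v"] nrm[OF that] by simp
  qed (auto simp: imul_schwartz_l2 inner_add add)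
  then show ?thesis by auto
qed

text \<open>The unitary inverse Fourier transform, from functions of the frequency to functions of the position,
  obtained as the adjoint of the normalised transform on Schwartz functions. Its inverse
  \<open>to_freq\<close> is the unitary Fourier transform.\<close>

definition to_space :: "(real^'n::finite) bop" where
  "to_space = (SOME T. (\<forall>u. \<forall>v\<in>schwartz_l2. ap T u \<bullet> v = u \<bullet> fourier_l2 v) \<and> (\<forall>u. norm (ap T u) \<le> norm u))"

definition to_freq :: "(real^'n::finite) bop" where
  "to_freq = (SOME T. (\<forall>u. \<forall>v\<in>schwartz_l2. ap T u \<bullet> v = u \<bullet> inv_fourier_l2 v) \<and> (\<forall>u. norm (ap T u) \<le> norm u))"

lemma to_space: "v \<in> schwartz_l2 \<Longrightarrow> ap to_space u \<bullet> v = u \<bullet> fourier_l2 v" "norm (ap to_space u) \<le> norm u"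
  using someI_ex[OF extend_isometry[of fourier_l2, OF fourier_l2_linear fourier_l2_norm]] unfolding to_space_def by auto

lemma to_freq: "v \<in> schwartz_l2 \<Longrightarrow> ap to_freq u \<bullet> v = u \<bullet> inv_fourier_l2 v" "norm (ap to_freq u) \<le> norm u"
  using someI_ex[OF extend_isometry[of inv_fourier_l2, OF inv_fourier_l2_linear]] unfolding to_freq_def by auto

lemma schwartz_l2_eqI: "(\<And>v. v \<in> schwartz_l2 \<Longrightarrow> z \<bullet> v = w \<bullet> v) \<Longrightarrow> z = w"
  using schwartz_l2_total[of "z - w"] by (simp add: inner_diff_left)

lemma to_space_to_freq: "to_space * to_freq = 1" and to_freq_to_space: "to_freq * to_space = 1"
  by (rule bop_eqI, rule schwartz_l2_eqI, simp add: to_space(1) to_freq(1) fourier_l2_in inv_fourier_l2_in fourier_l2_inverse)+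

lemma to_space_norm: "norm (ap to_space u) = norm u"
proof (rule antisym)
  show "norm (ap to_space u) \<le> norm u" by (rule to_space(2))
  have "u = ap to_freq (ap to_space u)" using to_freq_to_space by (metis ap_times ap_one)
  then show "norm u \<le> norm (ap to_space u)" by (metis to_freq(2))
qed

lemma to_space_inner: "ap to_space u \<bullet> ap to_space v = u \<bullet> v"
proof -
  have "(norm (ap to_space (u + v)))\<^sup>2 = (norm (u + v))\<^sup>2" by (simp only: to_space_norm)
  moreover have "(norm (ap to_space u))\<^sup>2 = (norm u)\<^sup>2" "(norm (ap to_space v))\<^sup>2 = (norm v)\<^sup>2" by (simp_all only: to_space_norm)
  ultimately show ?thesis
    unfolding power2_norm_eq_inner ap_add inner_add_left inner_add_right
    by (simp add: inner_commute)
qed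

lemma adj_to_space: "adj to_space = to_freq"
proof (rule adj_unique)
  show "ap to_freq u \<bullet> v = u \<bullet> ap to_space v" for u v
    using to_space_inner[of "ap to_freq u" v] to_space_to_freq by (metis ap_times ap_one)
qed

lemma adj_to_freq: "adj to_freq = to_space"
  using adj_to_space adj_adj by metis

lemma to_space_cinner: "cinner (ap to_space u) (ap to_space v) = cinner u v"
  by (simp add: cinner_eq to_space_inner flip: ap_imul)

text \<open>The link with the distributional inverse transform, which is defined by transposition.\<close>

lemma to_space_schwartz:
  fixes \<phi> :: "real^'n::finite \<Rightarrow> complex"
  assumes \<phi>: "\<phi> \<in> schwartz"
  shows "(LINT x|lborel. fn (ap to_space u) x * \<phi> x) = fourier_const TYPE('n) * (LINT \<xi>|lborel. fn u \<xi> * inv_fourier \<phi> \<xi>)"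
proof -
  define c where "c = fourier_const TYPE('n)"
  have c: "c \<noteq> 0" "c * c = (2 * complex_of_real pi) ^ CARD('n)" "cnj c = c"
    using fourier_const_nonzero[where 'n='n] fourier_const_sq[where 'n='n] cnj_fourier_const[where 'n='n] by (auto simp: c_def)
  \<comment> \<open>the bilinear pairing with \<open>\<phi>\<close> is the inner product with its conjugate\<close>
  define \<psi> where "\<psi> x = cnj (\<phi> x)" for x
  have \<psi>: "\<psi> \<in> schwartz" unfolding \<psi>_def by (rule schwartz_cnj[OF \<phi>])
  then have v: "cls \<psi> \<in> schwartz_l2" by (simp add: schwartz_l2_def)
  have "(LINT x|lborel. fn (ap to_space u) x * \<phi> x) = cinner (ap to_space u) (cls \<psi>)"
    using cinner_cls[OF sqint_fn schwartz_sqint[OF \<psi>], of "ap to_space u"] by (simp add: \<psi>_def)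
  also have "\<dots> = cinner u (fourier_l2 (cls \<psi>))"
    using to_space(1)[OF v] to_space(1)[OF imul_schwartz_l2[OF v]] fourier_l2_linear(2)[OF v] by (simp add: cinner_eq)
  also have "\<dots> = (LINT \<xi>|lborel. fn u \<xi> * cnj (inverse (fourier_const TYPE('n)) * fourier \<psi> \<xi>))"
    unfolding fourier_l2_cls(1)[OF \<psi>] using cinner_cls[OF sqint_fn schwartz_sqint[OF fourier_l2_cls(2)[OF \<psi>]], of u] by simp
  also have "\<dots> = (LINT \<xi>|lborel. c * (fn u \<xi> * inv_fourier \<phi> \<xi>))"
  proof (intro Bochner_Integration.integral_cong refl)
    fix \<xi> :: "real^'n"
    have "cnj (fourier \<psi> \<xi>) = (c * c) * inv_fourier \<phi> \<xi>" unfolding cnj_fourier c(2) by (simp add: \<psi>_def)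
    then show "fn u \<xi> * cnj (inverse (fourier_const TYPE('n)) * fourier \<psi> \<xi>) = c * (fn u \<xi> * inv_fourier \<phi> \<xi>)"
      using c(1,3) by (simp add: c_def[symmetric] field_simps)
  qed
  finally show ?thesis by (simp add: c_def)
qed

section \<open>Multiplication operators and their commutators with derivatives\<close>

text \<open>The translation by \<open>h\<close> in frequency coordinates, that is the multiplication by
  \<open>exp (\<i> h \<bullet> \<xi>)\<close>.\<close>

definition translation :: "real^'n::finite \<Rightarrow> (real^'n) bop" where
  "translation h = mop (\<lambda>\<xi>. wave (- h) \<xi>)"

lemma bmult_wave: "bmult (\<lambda>\<xi>. wave h \<xi>)"
  by (rule bmultI[of _ 1]) simp_all

lemma AE_translate:
  assumes "AE x in lborel. P x" shows "AE x in lborel. P (x + h :: 'a::euclidean_space)"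
proof -
  have "AE x in distr lborel borel ((+) h). P x"
    using assms unfolding lborel_distr_plus .
  then have "AE x in lborel. P (h + x)"
    by (rule AE_distrD[rotated]) simp
  then show ?thesis by (simp add: add.commute)
qed

lemma integrable_translate:
  fixes f :: "'a::euclidean_space \<Rightarrow> complex"
  assumes "integrable lborel f" shows "integrable lborel (\<lambda>x. f (x + h))"
proof -
  have "integrable (distr lborel borel ((+) h)) f" using assms unfolding lborel_distr_plus .
  then have "integrable lborel (\<lambda>x. f (h + x))" by (rule integrable_distr[rotated]) simp
  then show ?thesis by (simp add: add.commute)
qed

text \<open>Both sides are tested against Schwartz functions, to which \<open>to_space\<close> is related by duality.\<close>

lemma translation_eq:
  fixes v :: "(real^'n::finite) l2"
  shows "AE x in lborel. fn (ap to_space (ap (translation h) v)) x = fn (ap to_space v) (x + h)"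
proof -
  define p where "p = fn (ap to_space (ap (translation h) v))"
  define q where "q x = fn (ap to_space v) (x + h)" for x
  have [measurable]: "p \<in> borel_measurable borel" "q \<in> borel_measurable borel"
    unfolding p_def q_def by measurable
  have *: "integrable lborel (\<lambda>x. q x * \<phi> x)" "(LINT x|lborel. p x * \<phi> x) = (LINT x|lborel. q x * \<phi> x)"
    if \<phi>: "\<phi> \<in> schwartz" for \<phi> :: "real^'n \<Rightarrow> complex"
  proof -
    note [measurable] = schwartz_measurable[OF \<phi>]
    have \<psi>: "(\<lambda>x. \<phi> (x + - h)) \<in> schwartz" using schwartz_affine(1)[OF \<phi>, of 1 "- h"] by simp
    have i: "integrable lborel (\<lambda>x. fn (ap to_space v) x * \<phi> (x + - h))"
      by (intro sqint_mult_integrable sqint_fn schwartz_sqint[OF \<psi>])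
    show "integrable lborel (\<lambda>x. q x * \<phi> x)" using integrable_translate[OF i, of h] by (simp add: q_def)
    note [measurable] = schwartz_measurable[OF schwartz_inv_fourier[OF \<phi>]] schwartz_measurable[OF schwartz_inv_fourier[OF \<psi>]]
    have e: "inv_fourier (\<lambda>x. \<phi> (x + - h)) \<xi> = wave (- h) \<xi> * inv_fourier \<phi> \<xi>" for \<xi>
      using fourier_translate[of \<phi> "- h" "- \<xi>"] by (simp add: inv_fourier_eq) (simp add: wave_def)
    have "(LINT x|lborel. p x * \<phi> x) = fourier_const TYPE('n) * (LINT \<xi>|lborel. fn (ap (translation h) v) \<xi> * inv_fourier \<phi> \<xi>)"
      unfolding p_def by (rule to_space_schwartz[OF \<phi>])
    also have "(LINT \<xi>|lborel. fn (ap (translation h) v) \<xi> * inv_fourier \<phi> \<xi>) = (LINT \<xi>|lborel. fn v \<xi> * inv_fourier (\<lambda>x. \<phi> (x + - h)) \<xi>)"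
    proof (rule integral_cong_AE)
      show "AE \<xi> in lborel. fn (ap (translation h) v) \<xi> * inv_fourier \<phi> \<xi> = fn v \<xi> * inv_fourier (\<lambda>x. \<phi> (x + - h)) \<xi>"
        unfolding translation_def ap_mop[OF bmult_wave] using fn_mul[OF bmult_wave, of "- h" v]
        by eventually_elim (simp only: e mult_ac)
    qed measurable
    also have "fourier_const TYPE('n) * (LINT \<xi>|lborel. fn v \<xi> * inv_fourier (\<lambda>x. \<phi> (x + - h)) \<xi>) = (LINT x|lborel. fn (ap to_space v) x * \<phi> (x + - h))"
      by (rule to_space_schwartz[OF \<psi>, symmetric])
    also have "\<dots> = (LINT x|lborel. fn (ap to_space v) (h + x) * \<phi> (h + x + - h))"
      by (rule integral_translate[symmetric]) measurable
    finally show "(LINT x|lborel. p x * \<phi> x) = (LINT x|lborel. q x * \<phi> x)"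
      by (simp add: q_def add.commute)
  qed
  have "AE x in lborel. p x - q x = 0"
  proof (rule schwartz_separates)
    show "(\<lambda>x. p x - q x) \<in> borel_measurable borel" by measurable
    fix \<phi> :: "real^'n \<Rightarrow> complex" assume \<phi>: "\<phi> \<in> schwartz"
    have p: "integrable lborel (\<lambda>x. p x * \<phi> x)"
      unfolding p_def by (intro sqint_mult_integrable sqint_fn schwartz_sqint \<phi>)
    show "integrable lborel (\<lambda>x. (p x - q x) * \<phi> x)"
      using p *(1)[OF \<phi>] by (simp add: left_diff_distrib)
    show "(LINT x|lborel. (p x - q x) * \<phi> x) = 0"
      using p *[OF \<phi>] by (simp add: left_diff_distrib)
  qed
  then show ?thesis unfolding p_def q_def by eventually_elim simp
qed

text \<open>The multiplication by \<open>f\<close> in the position variable, in frequency coordinates.\<close>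

definition mult_by :: "(real^'n::finite \<Rightarrow> real) \<Rightarrow> (real^'n) bop" where
  "mult_by f = to_freq * rop f * to_space"

lemma to_space_mult_by: "ap to_space (ap (mult_by f) u) = ap (rop f) (ap to_space u)"
proof -
  have "to_space * mult_by f = rop f * to_space" unfolding mult_by_def by (simp add: mult.assoc[symmetric] to_space_to_freq)
  then show ?thesis by (metis ap_times)
qed

lemma to_space_inject: "ap to_space u = ap to_space v \<Longrightarrow> u = v"
  using to_freq_to_space by (metis ap_times ap_one)

lemma mult_by_times: "rmult f \<Longrightarrow> rmult g \<Longrightarrow> mult_by f * mult_by g = mult_by (\<lambda>x. f x * g x)"
  by (rule bop_eqI, rule to_space_inject) (simp only: to_space_mult_by ap_times rop_times[symmetric])

lemma mult_by_add: "rmult f \<Longrightarrow> rmult g \<Longrightarrow> mult_by f + mult_by g = mult_by (\<lambda>x. f x + g x)"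
  unfolding mult_by_def by (simp only: distrib_left distrib_right rop_plus[symmetric])

lemma adj_mult_by: "rmult f \<Longrightarrow> adj (mult_by f) = mult_by f"
  by (simp add: mult_by_def adj_times adj_to_space adj_to_freq adj_mop mult.assoc)

lemma mult_by_norm:
  assumes "rmult f" "\<And>x. \<bar>f x\<bar> \<le> c" "0 \<le> c" shows "norm (ap (mult_by f) u) \<le> c * norm u"
proof -
  have "norm (ap (mult_by f) u) = norm (ap (rop f) (ap to_space u))" by (metis to_space_norm to_space_mult_by)
  also have "\<dots> \<le> c * norm u" using rop_norm[OF assms, of "ap to_space u"] by (simp add: to_space_norm)
  finally show ?thesis .
qed

lemma rmult_translate: assumes f: "rmult f" shows "rmult (\<lambda>x. f (x + h))"
proof -
  obtain c where c: "\<And>x. cmod (complex_of_real (f x)) \<le> c" using bmultE[OF f] by blast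
  show ?thesis
    by (rule bmultI[of _ c], rule measurable_compose[OF _ bmult_meas[OF f]]) (use c in auto)
qed

lemma translation_mult_by:
  assumes f: "rmult f"
  shows "ap (translation h) (ap (mult_by f) u) = ap (mult_by (\<lambda>x. f (x + h))) (ap (translation h) u)"
proof (rule to_space_inject, rule l2_eqI)
  note g = rmult_translate[OF f, of h]
  show "AE x in lborel. fn (ap to_space (ap (translation h) (ap (mult_by f) u))) x = fn (ap to_space (ap (mult_by (\<lambda>x. f (x + h))) (ap (translation h) u))) x"
    unfolding to_space_mult_by ap_mop[OF g]
    using translation_eq[of h "ap (mult_by f) u"] fn_mul[OF g, of "ap to_space (ap (translation h) u)"] translation_eq[of h u]
      AE_translate[OF fn_mul[OF f, of "ap to_space u"], of h]
    by eventually_elim (simp add: to_space_mult_by ap_mop[OF f])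
qed

text \<open>The symbol of \<open>(1 - \<Delta>)\<^sup>-\<^sup>1\<^sup>/\<^sup>2\<close>.\<close>

definition inv_bracket :: "real^'n::finite \<Rightarrow> real" where
  "inv_bracket \<xi> = 1 / sqrt (1 + (norm \<xi>)\<^sup>2)"

lemma inv_bracket_measurable [measurable]: "inv_bracket \<in> borel_measurable borel"
  unfolding inv_bracket_def by measurable

lemma inv_bracket_bounds: "0 < inv_bracket \<xi>" "inv_bracket \<xi> \<le> 1"
  by (simp_all add: inv_bracket_def add_pos_nonneg)

lemma inv_bracket_sq: "(inv_bracket \<xi>)\<^sup>2 * (1 + (norm \<xi>)\<^sup>2) = 1"
proof -
  have "0 < 1 + (norm \<xi>)\<^sup>2" by (simp add: add_pos_nonneg)
  then show ?thesis by (simp add: inv_bracket_def power_divide)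
qed

lemma inv_bracket_component: "\<bar>\<xi> $ k * inv_bracket \<xi>\<bar> \<le> 1"
proof -
  have "(\<xi> $ k)\<^sup>2 \<le> 1 + (norm \<xi>)\<^sup>2"
    using power_mono[OF component_le_norm_cart[of \<xi> k], of 2] by simp
  then have "(\<xi> $ k * inv_bracket \<xi>)\<^sup>2 \<le> (inv_bracket \<xi>)\<^sup>2 * (1 + (norm \<xi>)\<^sup>2)"
    by (simp add: power_mult_distrib mult.commute mult_left_mono)
  then have "\<bar>\<xi> $ k * inv_bracket \<xi>\<bar>\<^sup>2 \<le> 1\<^sup>2" by (simp add: inv_bracket_sq)
  then show ?thesis by (rule power2_le_imp_le) simp
qed

interpretation cay: cayley inv_bracket
  by unfold_locales (simp_all add: inv_bracket_bounds)

text \<open>The Bessel potential \<open>J = (1 - \<Delta>)\<^sup>-\<^sup>1\<^sup>/\<^sup>2\<close>.\<close>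

abbreviation Bessel :: "(real^'n::finite) bop" where "Bessel \<equiv> rop inv_bracket"

text \<open>The bounded operator \<open>\<partial>\<^sub>k J\<close>.\<close>

definition DJ :: "'n \<Rightarrow> (real^'n::finite) bop" where
  "DJ k = mop (\<lambda>\<xi>. \<i> * complex_of_real (\<xi> $ k * inv_bracket \<xi>))"

text \<open>Up to a factor \<open>\<i>\<close> the Riesz transform; the symbol of the projection \<open>P\<close> is the product of two of
  these. The value at the origin, which is a null set, is \<open>0\<close>.\<close>

definition riesz :: "'n \<Rightarrow> (real^'n::finite) bop" where
  "riesz k = rop (\<lambda>\<xi>. \<xi> $ k / norm \<xi>)"

lemma bmult_DJ: "bmult (\<lambda>\<xi>. \<i> * complex_of_real (\<xi> $ k * inv_bracket (\<xi> :: real^'n::finite)))"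
  by (rule bmultI[of _ 1]) (use inv_bracket_component in \<open>auto simp: norm_mult simp del: of_real_mult\<close>)

lemma rmult_inv_bracket: "rmult inv_bracket" by (rule cay.rmult_j)

lemma rmult_riesz: "rmult (\<lambda>\<xi>. \<xi> $ k / norm (\<xi> :: real^'n::finite))"
proof (rule rmultI[of _ 1])
  show "\<bar>\<xi> $ k / norm \<xi>\<bar> \<le> 1" for \<xi> :: "real^'n"
    using component_le_norm_cart[of \<xi> k] by (simp add: divide_le_eq_1)
qed measurable

text \<open>The symbol of the difference quotient in direction \<open>k\<close> with step \<open>h\<close>, composed with the Bessel
  potential; as \<open>h\<close> tends to \<open>0\<close> it converges to the symbol of \<open>\<partial>\<^sub>k J\<close>.\<close>

definition deriv_quot :: "'n \<Rightarrow> real \<Rightarrow> real^'n::finite \<Rightarrow> complex" where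
  "deriv_quot k h \<xi> = (wave (- (h *\<^sub>R axis k 1)) \<xi> - 1) / complex_of_real h * complex_of_real (inv_bracket \<xi>)"

lemma wave_axis: "wave (- (h *\<^sub>R axis k 1)) \<xi> = exp (\<i> * complex_of_real (h * \<xi> $ k))"
  by (simp add: wave_def inner_axis)

lemma norm_exp_sub_one: "cmod (exp (\<i> * complex_of_real a) - 1) \<le> \<bar>a\<bar>"
  using iexp_approx1[of a 0] by simp

lemma deriv_quot_bound: "cmod (deriv_quot k h \<xi>) \<le> 1"
proof (cases "h = 0")
  case False
  have "cmod (deriv_quot k h \<xi>) \<le> \<bar>h * \<xi> $ k\<bar> / \<bar>h\<bar> * inv_bracket \<xi>"
    unfolding deriv_quot_def wave_axis norm_mult norm_divide norm_of_real using inv_bracket_bounds(1)[of \<xi>] norm_exp_sub_one[of "h * \<xi> $ k"]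
    by (simp add: divide_right_mono)
  also have "\<dots> = \<bar>\<xi> $ k * inv_bracket \<xi>\<bar>" using False inv_bracket_bounds(1)[of \<xi>] by (simp add: abs_mult)
  finally show ?thesis using inv_bracket_component[of \<xi> k] by linarith
qed (simp add: deriv_quot_def)

lemma bmult_deriv_quot: "bmult (deriv_quot k h)"
proof (rule bmultI[OF _ deriv_quot_bound])
  show "deriv_quot k h \<in> borel_measurable borel" unfolding deriv_quot_def by measurable
qed

lemma deriv_quot_tendsto: "(\<lambda>n. deriv_quot k (1 / real (Suc n)) \<xi>) \<longlonglongrightarrow> \<i> * complex_of_real (\<xi> $ k * inv_bracket \<xi>)"
proof -
  have "((\<lambda>z. exp (\<i> * (z * complex_of_real (\<xi> $ k)))) has_field_derivative \<i> * complex_of_real (\<xi> $ k)) (at 0)"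
    by (auto intro!: derivative_eq_intros)
  then have d: "((\<lambda>z. (exp (\<i> * (z * complex_of_real (\<xi> $ k))) - 1) / z) \<longlongrightarrow> \<i> * complex_of_real (\<xi> $ k)) (at 0)"
    by (simp add: has_field_derivative_def DERIV_def[unfolded has_field_derivative_def])
  have "filterlim (\<lambda>n. complex_of_real (1 / real (Suc n))) (at 0) sequentially"
  proof (rule filterlim_atI)
    show "(\<lambda>n. complex_of_real (1 / real (Suc n))) \<longlonglongrightarrow> 0"
      using tendsto_of_real[OF LIMSEQ_inverse_real_of_nat, where 'a=complex] by (simp add: inverse_eq_divide)
    have "complex_of_real (1 / real (Suc n)) \<noteq> 0" for n by (simp only: of_real_eq_0_iff) simp
    then show "\<forall>\<^sub>F n in sequentially. complex_of_real (1 / real (Suc n)) \<noteq> 0"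
      by (rule always_eventually[OF allI])
  qed
  from filterlim_compose[OF d this]
  have "(\<lambda>n. (exp (\<i> * (complex_of_real (1 / real (Suc n)) * complex_of_real (\<xi> $ k))) - 1) / complex_of_real (1 / real (Suc n)) * complex_of_real (inv_bracket \<xi>))
     \<longlonglongrightarrow> \<i> * complex_of_real (\<xi> $ k) * complex_of_real (inv_bracket \<xi>)"
    by (intro tendsto_mult tendsto_const)
  then show ?thesis unfolding deriv_quot_def wave_axis by (simp only: of_real_mult mult.assoc)
qed

lemma ap_deriv_quot:
  "ap (mop (deriv_quot k h)) u = (1 / h) *\<^sub>R (ap (translation (h *\<^sub>R axis k 1)) (ap Bessel u) - ap Bessel u)"
proof -
  define v where "v = ap Bessel u"
  define t where "t = ap (translation (h *\<^sub>R axis k 1)) v"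
  have v: "AE x in lborel. fn v x = complex_of_real (inv_bracket x) * fn u x"
    unfolding v_def ap_mop[OF rmult_inv_bracket] by (rule fn_mul[OF rmult_inv_bracket])
  have t: "AE x in lborel. fn t x = wave (- (h *\<^sub>R axis k 1)) x * fn v x"
    unfolding t_def translation_def ap_mop[OF bmult_wave] by (rule fn_mul[OF bmult_wave])
  have "AE x in lborel. fn (mul (deriv_quot k h) u) x = fn ((1 / h) *\<^sub>R (t - v)) x"
    using fn_mul[OF bmult_deriv_quot, of k h u] fn_scaleR[of "1/h" "t - v"] fn_diff[of t v] v t
  proof eventually_elim
    case (elim x)
    show ?case unfolding elim deriv_quot_def by (simp add: scaleR_conv_of_real divide_inverse algebra_simps)
  qed
  then show ?thesis unfolding ap_mop[OF bmult_deriv_quot] t_def v_def by (rule l2_eqI)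
qed

definition diff_deriv_quot :: "'n \<Rightarrow> real \<Rightarrow> (real^'n::finite \<Rightarrow> real) \<Rightarrow> real^'n \<Rightarrow> real" where
  "diff_deriv_quot k h f x = (f (x + h *\<^sub>R axis k 1) - f x) / h"

lemma rmult_diff_deriv_quot: "rmult f \<Longrightarrow> rmult (diff_deriv_quot k h f)"
  using bmult_mult[OF bmult_diff[OF rmult_translate[of f "h *\<^sub>R axis k 1"], of "\<lambda>x. complex_of_real (f x)"] bmult_const, of "complex_of_real (1 / h)"]
  by (simp add: diff_deriv_quot_def[abs_def])

lemma mult_by_diff_deriv_quot:
  assumes "rmult f"
  shows "ap (mult_by (diff_deriv_quot k h f)) u = (1 / h) *\<^sub>R (ap (mult_by (\<lambda>x. f (x + h *\<^sub>R axis k 1))) u - ap (mult_by f) u)"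
proof (rule to_space_inject)
  note g = rmult_translate[OF assms, of "h *\<^sub>R axis k 1"]
  define p where "p = ap (rop (\<lambda>x. f (x + h *\<^sub>R axis k 1))) (ap to_space u)"
  define q where "q = ap (rop f) (ap to_space u)"
  have e: "ap to_space ((1 / h) *\<^sub>R (ap (mult_by (\<lambda>x. f (x + h *\<^sub>R axis k 1))) u - ap (mult_by f) u)) = (1 / h) *\<^sub>R (p - q)"
    unfolding ap_scaleR ap_diff to_space_mult_by p_def q_def ..
  have p: "AE x in lborel. fn p x = complex_of_real (f (x + h *\<^sub>R axis k 1)) * fn (ap to_space u) x"
    unfolding p_def ap_mop[OF g] by (rule fn_mul[OF g])
  have q: "AE x in lborel. fn q x = complex_of_real (f x) * fn (ap to_space u) x"
    unfolding q_def ap_mop[OF assms] by (rule fn_mul[OF assms])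
  have "AE x in lborel. fn (mul (\<lambda>x. complex_of_real (diff_deriv_quot k h f x)) (ap to_space u)) x = fn ((1 / h) *\<^sub>R (p - q)) x"
    using fn_mul[OF rmult_diff_deriv_quot[OF assms], of k h "ap to_space u"] fn_scaleR[of "1/h" "p - q"] fn_diff[of p q] p q
  proof eventually_elim
    case (elim x)
    show ?case unfolding elim by (simp add: diff_deriv_quot_def scaleR_conv_of_real divide_inverse algebra_simps)
  qed
  then show "ap to_space (ap (mult_by (diff_deriv_quot k h f)) u) = ap to_space ((1 / h) *\<^sub>R (ap (mult_by (\<lambda>x. f (x + h *\<^sub>R axis k 1))) u - ap (mult_by f) u))"
    unfolding e to_space_mult_by ap_mop[OF rmult_diff_deriv_quot[OF assms]] by (rule l2_eqI)
qed

lemma translation_J: "ap (translation h) (ap Bessel u) = ap Bessel (ap (translation h) u)"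
  unfolding translation_def using mop_commute[OF bmult_wave rmult_inv_bracket] by (metis ap_times)

text \<open>The discrete product rule: the commutator of a difference quotient with the multiplication by \<open>f\<close> is
  the multiplication by the difference quotient of \<open>f\<close>, applied after a translation.\<close>

lemma commutator_deriv_quot:
  assumes f: "rmult f"
  shows "ap (mop (deriv_quot k h)) (ap (mult_by f) (ap Bessel u)) - ap Bessel (ap (mult_by f) (ap (mop (deriv_quot k h)) u))
    = ap Bessel (ap (mult_by (diff_deriv_quot k h f)) (ap (translation (h *\<^sub>R axis k 1)) (ap Bessel u)))"
  unfolding ap_deriv_quot mult_by_diff_deriv_quot[OF f] translation_J[of _ "ap (mult_by f) (ap Bessel u)"] translation_mult_by[OF f]
  by (simp add: ap_scaleR ap_diff scaleR_diff_right)

lemma translation_norm: "norm (ap (translation h) u) \<le> norm u"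
  unfolding translation_def using norm_mul_le[OF bmult_wave, of "- h" 1 u] by (simp add: ap_mop[OF bmult_wave])

lemma translation_tendsto: "(\<lambda>n. ap (translation ((1 / real (Suc n)) *\<^sub>R axis k 1)) u) \<longlonglongrightarrow> u"
proof -
  have "(\<lambda>n. ap (mop (\<lambda>\<xi>. wave (- ((1 / real (Suc n)) *\<^sub>R axis k 1)) \<xi>)) u) \<longlonglongrightarrow> ap (mop (\<lambda>\<xi>. 1)) u"
  proof (rule mop_tendsto[where c=1])
    show "(\<lambda>n. wave (- ((1 / real (Suc n)) *\<^sub>R axis k 1)) \<xi>) \<longlonglongrightarrow> 1" for \<xi> :: "real^'a"
    proof -
      have "(\<lambda>n. exp (\<i> * complex_of_real (inverse (real (Suc n)) * \<xi> $ k))) \<longlonglongrightarrow> exp (\<i> * complex_of_real (0 * \<xi> $ k))"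
        by (intro tendsto_intros LIMSEQ_inverse_real_of_nat)
      then show ?thesis by (simp add: wave_axis inverse_eq_divide)
    qed
  qed (simp_all add: bmult_wave)
  then show ?thesis by (simp add: translation_def mop_one)
qed

definition bdd_lip :: "('a::metric_space \<Rightarrow> real) \<Rightarrow> bool" where
  "bdd_lip f \<longleftrightarrow> (\<exists>B. \<forall>x y. \<bar>f x\<bar> \<le> B \<and> \<bar>f x - f y\<bar> \<le> B * dist x y)"

lemma bdd_lipE:
  assumes "bdd_lip f" obtains B where "0 \<le> B" "\<And>x. \<bar>f x\<bar> \<le> B" "\<And>x y. \<bar>f x - f y\<bar> \<le> B * dist x y"
proof -
  obtain B where "\<And>x y. \<bar>f x\<bar> \<le> B \<and> \<bar>f x - f y\<bar> \<le> B * dist x y" using assms unfolding bdd_lip_def by blast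
  then have B: "\<bar>f x\<bar> \<le> B" "\<bar>f x - f y\<bar> \<le> B * dist x y" for x y by auto
  have "0 \<le> B" using B(1)[of undefined] by linarith
  then show ?thesis using B that by blast
qed

lemma bdd_lip_continuous: assumes "bdd_lip f" shows "continuous_on UNIV f"
proof -
  obtain B where "0 \<le> B" and B: "\<And>x. \<bar>f x\<bar> \<le> B" "\<And>x y. \<bar>f x - f y\<bar> \<le> B * dist x y"
    using bdd_lipE[OF assms] by blast
  have "B-lipschitz_on UNIV f" by (rule lipschitz_onI[OF _ \<open>0 \<le> B\<close>]) (use B in \<open>simp add: dist_real_def\<close>)
  then show ?thesis by (rule lipschitz_on_continuous_on)
qed

lemma bdd_lip_rmult: assumes "bdd_lip f" shows "rmult f"
proof -
  obtain B where "\<And>x. \<bar>f x\<bar> \<le> B" using assms unfolding bdd_lip_def by blast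
  then show ?thesis by (rule rmultI[OF borel_measurable_continuous_onI[OF bdd_lip_continuous[OF assms]]])
qed

lemma diff_deriv_quot_bound:
  assumes "\<And>x y. \<bar>f x - f y\<bar> \<le> B * dist x y" "0 \<le> B" shows "\<bar>diff_deriv_quot k h f x\<bar> \<le> B"
proof (cases "h = 0")
  case False
  have "\<bar>f (x + h *\<^sub>R axis k 1) - f x\<bar> \<le> B * \<bar>h\<bar>"
    using assms(1)[of "x + h *\<^sub>R axis k 1" x] by (simp add: dist_norm)
  then show ?thesis using False by (simp add: diff_deriv_quot_def divide_le_eq)
qed (simp add: diff_deriv_quot_def assms)

text \<open>The difference quotients of \<open>f\<close> are bounded by its Lipschitz constant, so \<open>commutator_deriv_quot\<close> bounds the
  form of the commutator by the right-hand side that \<open>factor_both\<close> asks for.\<close>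

theorem lipschitz_commutator:
  assumes "bdd_lip f" obtains C where "DJ k * mult_by f * Bessel - Bessel * mult_by f * DJ k = Bessel * C * Bessel"
proof -
  obtain B where "0 \<le> B" and B: "\<And>x. \<bar>f x\<bar> \<le> B" "\<And>x y. \<bar>f x - f y\<bar> \<le> B * dist x y"
    using bdd_lipE[OF assms] by blast
  note f = bdd_lip_rmult[OF assms]
  define h where "h n = 1 / real (Suc n)" for n
  define T where "T = DJ k * mult_by f * Bessel - Bessel * mult_by f * DJ k"
  have q: "(\<lambda>n. ap (mop (deriv_quot k (h n))) u) \<longlonglongrightarrow> ap (DJ k) u" for u
    unfolding h_def DJ_def by (rule mop_tendsto[OF bmult_deriv_quot deriv_quot_bound bmult_DJ deriv_quot_tendsto])
  have T: "(\<lambda>n. ap Bessel (ap (mult_by (diff_deriv_quot k (h n) f)) (ap (translation (h n *\<^sub>R axis k 1)) (ap Bessel u)))) \<longlonglongrightarrow> ap T u" for u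
    unfolding commutator_deriv_quot[OF f, symmetric] T_def ap_minus ap_times
    by (intro tendsto_diff q bounded_linear.tendsto[OF bounded_linear_ap])
  obtain C where "T = Bessel * C * Bessel"
  proof (rule factor_both[OF rmult_inv_bracket])
    show "inv_bracket \<xi> \<noteq> 0" for \<xi> :: "real^'a" using inv_bracket_bounds(1)[of \<xi>] by simp
    show "0 \<le> B" by fact
    fix u v :: "(real^'a) l2"
    show "\<bar>ap T u \<bullet> v\<bar> \<le> B * norm (ap Bessel u) * norm (ap Bessel v)"
    proof (rule tendsto_upperbound)
      show "(\<lambda>n. \<bar>ap Bessel (ap (mult_by (diff_deriv_quot k (h n) f)) (ap (translation (h n *\<^sub>R axis k 1)) (ap Bessel u))) \<bullet> v\<bar>) \<longlonglongrightarrow> \<bar>ap T u \<bullet> v\<bar>"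
        by (intro tendsto_rabs tendsto_inner T tendsto_const)
      have "\<bar>ap Bessel (ap (mult_by (diff_deriv_quot k (h n) f)) (ap (translation (h n *\<^sub>R axis k 1)) (ap Bessel u))) \<bullet> v\<bar> \<le> B * norm (ap Bessel u) * norm (ap Bessel v)" for n
      proof -
        define w where "w = ap (translation (h n *\<^sub>R axis k 1)) (ap Bessel u)"
        have "\<bar>ap Bessel (ap (mult_by (diff_deriv_quot k (h n) f)) w) \<bullet> v\<bar> \<le> norm (ap (mult_by (diff_deriv_quot k (h n) f)) w) * norm (ap Bessel v)"
          unfolding rop_inner[OF rmult_inv_bracket] by (rule Cauchy_Schwarz_ineq2)
        also have "\<dots> \<le> (B * norm (ap Bessel u)) * norm (ap Bessel v)"
        proof (rule mult_right_mono)
          have "norm (ap (mult_by (diff_deriv_quot k (h n) f)) w) \<le> B * norm w"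
            by (rule mult_by_norm[OF rmult_diff_deriv_quot[OF f] diff_deriv_quot_bound[OF B(2) \<open>0 \<le> B\<close>] \<open>0 \<le> B\<close>])
          also have "\<dots> \<le> B * norm (ap Bessel u)"
            unfolding w_def by (rule mult_left_mono[OF translation_norm \<open>0 \<le> B\<close>])
          finally show "norm (ap (mult_by (diff_deriv_quot k (h n) f)) w) \<le> B * norm (ap Bessel u)" .
        qed simp
        finally show ?thesis unfolding w_def .
      qed
      then show "\<forall>\<^sub>F n in sequentially. \<bar>ap Bessel (ap (mult_by (diff_deriv_quot k (h n) f)) (ap (translation (h n *\<^sub>R axis k 1)) (ap Bessel u))) \<bullet> v\<bar> \<le> B * norm (ap Bessel u) * norm (ap Bessel v)"
        by (rule always_eventually[OF allI])
    qed simp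
  qed blast
  then show ?thesis using that unfolding T_def by blast
qed

text \<open>If the difference quotients converge, the operator \<open>C\<close> of \<open>lipschitz_commutator\<close> is identified as
  the multiplication by the derivative.\<close>

theorem differentiable_commutator:
  assumes "bdd_lip f" and d: "\<And>x. (\<lambda>n. diff_deriv_quot k (1 / real (Suc n)) f x) \<longlonglongrightarrow> g x" and g: "rmult g"
  shows "DJ k * mult_by f * Bessel - Bessel * mult_by f * DJ k = Bessel * mult_by g * Bessel"
proof (rule bop_eqI)
  fix u
  obtain B where "0 \<le> B" and B: "\<And>x. \<bar>f x\<bar> \<le> B" "\<And>x y. \<bar>f x - f y\<bar> \<le> B * dist x y"
    using bdd_lipE[OF assms(1)] by blast
  note f = bdd_lip_rmult[OF assms(1)]
  define h where "h n = 1 / real (Suc n)" for n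
  have q: "(\<lambda>n. ap (mop (deriv_quot k (h n))) u) \<longlonglongrightarrow> ap (DJ k) u" for u
    unfolding h_def DJ_def by (rule mop_tendsto[OF bmult_deriv_quot deriv_quot_bound bmult_DJ deriv_quot_tendsto])
  have T: "(\<lambda>n. ap Bessel (ap (mult_by (diff_deriv_quot k (h n) f)) (ap (translation (h n *\<^sub>R axis k 1)) (ap Bessel u)))) \<longlonglongrightarrow> ap (DJ k * mult_by f * Bessel - Bessel * mult_by f * DJ k) u"
    unfolding commutator_deriv_quot[OF f, symmetric] ap_minus ap_times
    by (intro tendsto_diff q bounded_linear.tendsto[OF bounded_linear_ap])
  have m: "(\<lambda>n. ap (mult_by (diff_deriv_quot k (h n) f)) w) \<longlonglongrightarrow> ap (mult_by g) w" for w
    unfolding mult_by_def ap_times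
  proof (rule bounded_linear.tendsto[OF bounded_linear_ap], rule mop_tendsto[OF rmult_diff_deriv_quot[OF f] _ g])
    show "cmod (complex_of_real (diff_deriv_quot k (h n) f x)) \<le> B" for n x
      using diff_deriv_quot_bound[OF B(2) \<open>0 \<le> B\<close>, of k "h n" x] by simp
    show "(\<lambda>n. complex_of_real (diff_deriv_quot k (h n) f x)) \<longlonglongrightarrow> complex_of_real (g x)" for x
      unfolding h_def by (intro tendsto_of_real d)
  qed
  have z: "(\<lambda>n. ap (mult_by (diff_deriv_quot k (h n) f)) (ap (translation (h n *\<^sub>R axis k 1)) w - w)) \<longlonglongrightarrow> 0" for w
  proof (rule tendsto_norm_zero_cancel, rule tendsto_sandwich[OF _ _ tendsto_const])
    show "\<forall>\<^sub>F n in sequentially. 0 \<le> norm (ap (mult_by (diff_deriv_quot k (h n) f)) (ap (translation (h n *\<^sub>R axis k 1)) w - w))"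
      by simp
    have "norm (ap (mult_by (diff_deriv_quot k (h n) f)) (ap (translation (h n *\<^sub>R axis k 1)) w - w)) \<le> B * norm (ap (translation (h n *\<^sub>R axis k 1)) w - w)" for n
      by (rule mult_by_norm[OF rmult_diff_deriv_quot[OF f] diff_deriv_quot_bound[OF B(2) \<open>0 \<le> B\<close>] \<open>0 \<le> B\<close>])
    then show "\<forall>\<^sub>F n in sequentially. norm (ap (mult_by (diff_deriv_quot k (h n) f)) (ap (translation (h n *\<^sub>R axis k 1)) w - w)) \<le> B * norm (ap (translation (h n *\<^sub>R axis k 1)) w - w)"
      by (rule always_eventually[OF allI])
    have "(\<lambda>n. B * norm (ap (translation (h n *\<^sub>R axis k 1)) w - w)) \<longlonglongrightarrow> B * norm (w - w)"
      unfolding h_def by (intro tendsto_intros translation_tendsto)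
    then show "(\<lambda>n. B * norm (ap (translation (h n *\<^sub>R axis k 1)) w - w)) \<longlonglongrightarrow> 0" by simp
  qed
  have "(\<lambda>n. ap (mult_by (diff_deriv_quot k (h n) f)) (ap (translation (h n *\<^sub>R axis k 1)) w)) \<longlonglongrightarrow> ap (mult_by g) w" for w
    using tendsto_add[OF z[of w] m[of w]] by (simp add: ap_diff)
  then have "(\<lambda>n. ap Bessel (ap (mult_by (diff_deriv_quot k (h n) f)) (ap (translation (h n *\<^sub>R axis k 1)) (ap Bessel u)))) \<longlonglongrightarrow> ap (Bessel * mult_by g * Bessel) u"
    unfolding ap_times by (rule bounded_linear.tendsto[OF bounded_linear_ap])
  then show "ap (DJ k * mult_by f * Bessel - Bessel * mult_by f * DJ k) u = ap (Bessel * mult_by g * Bessel) u"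
    using T LIMSEQ_unique by blast
qed

lemma mat_nth: "mat c $ i $ j = (if i = j then c else 0)"
  by (simp add: mat_def)

lemma mat_mult_left [simp]: "(mat c ** X) $ i $ j = (c::'b::semiring_1) * X $ i $ j"
  by (simp add: matrix_matrix_mult_def mat_def if_distrib if_distribR cong: if_cong)

lemma mat_mult_right [simp]: "(X ** mat c) $ i $ j = X $ i $ j * (c::'b::semiring_1)"
  by (simp add: matrix_matrix_mult_def mat_def if_distrib if_distribR cong: if_cong)

lemma matrix_add_rdistrib': "(A + B) ** C = A ** C + B ** (C :: 'b::ring_1^'n^'n)"
  by (simp add: vec_eq_iff matrix_matrix_mult_def sum.distrib distrib_right)

lemma matrix_diff_rdistrib': "(A - B) ** C = A ** C - B ** (C :: 'b::ring_1^'n^'n)"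
  by (simp add: vec_eq_iff matrix_matrix_mult_def sum_subtractf left_diff_distrib)

lemma matrix_diff_ldistrib': "C ** (A - B) = C ** A - C ** (B :: 'b::ring_1^'n^'n)"
  by (simp add: vec_eq_iff matrix_matrix_mult_def sum_subtractf right_diff_distrib)

lemma matrix_minus_left': "(- A) ** C = - (A ** (C :: 'b::ring_1^'n^'n))"
  by (simp add: vec_eq_iff matrix_matrix_mult_def sum_negf)

lemma matrix_minus_right': "C ** (- A) = - (C ** (A :: 'b::ring_1^'n^'n))"
  by (simp add: vec_eq_iff matrix_matrix_mult_def sum_negf)

lemmas matrix_distribs = matrix_add_ldistrib matrix_add_rdistrib' matrix_diff_rdistrib' matrix_diff_ldistrib'
  matrix_minus_left' matrix_minus_right'
lemmas matrix_ring_simps = matrix_distribs matrix_mul_assoc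

text \<open>The algebra of the decoupling. The intended meaning is \<open>J = (1 - \<Delta>)\<^sup>-\<^sup>1\<^sup>/\<^sup>2\<close>, \<open>R k = \<partial>\<^sub>k J\<close>,
  \<open>\<rho> k\<close> the multiplier \<open>\<xi>\<^sub>k / |\<xi>|\<close>, \<open>\<mu>\<close> and \<open>la\<close> the multiplications by the Lame parameters,
  \<open>b = \<nabla>\<mu>\<close> and \<open>a = b / (la + \<mu>)\<close>; the relation \<open>b_split\<close> is the definition of \<open>a\<close>, multiplied
  out. The commutator relations say that, modulo \<open>J C J\<close>, multiplications commute with derivatives.\<close>

locale elastic_ring =
  fixes J :: "'b::ring_1" and R \<rho> :: "'n::finite \<Rightarrow> 'b" and \<mu> la :: 'b and a b :: "'n \<Rightarrow> 'b"
  assumes J_cancel_left: "J * X = 0 \<Longrightarrow> X = 0" and J_cancel_right: "X * J = 0 \<Longrightarrow> X = 0"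
    and R_J: "R i * J = J * R i" and R_R: "R i * R j = R j * R i"
    and rho_J: "\<rho> i * J = J * \<rho> i" and rho_R: "\<rho> i * R j = R j * \<rho> i"
    and rho_R_swap: "\<rho> i * R j = \<rho> j * R i"
    and sum_R: "(\<Sum>k\<in>UNIV. R k * R k) = J * J - 1"
    and sum_rho: "(\<Sum>k\<in>UNIV. \<rho> k * \<rho> k) = 1"
    and comm_mu: "R k * \<mu> * J - J * \<mu> * R k = J * b k * J"
    and comm_lam: "\<exists>c. R k * la * J - J * la * R k = J * c * J"
    and comm_b: "\<exists>c. R k * b m * J - J * b m * R k = J * c * J"
    and comm_a: "\<exists>c. R k * a m * J - J * a m * R k = J * c * J"
    and comm_fa: "\<exists>c. R k * ((la + 2 * \<mu>) * a m) * J - J * ((la + 2 * \<mu>) * a m) * R k = J * c * J"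
    and b_split: "b m + a m * \<mu> = (la + 2 * \<mu>) * a m"
    and lyapunov: "\<exists>W. J * J * W + W * J * J = J * V * J"
begin

lemma cancel_left: "J * X = J * Y \<Longrightarrow> X = Y"
  using J_cancel_left[of "X - Y"] by (simp add: right_diff_distrib)

lemma cancel_right: "X * J = Y * J \<Longrightarrow> X = Y"
  using J_cancel_right[of "X - Y"] by (simp add: left_diff_distrib)

text \<open>The projections \<open>P\<close> and \<open>S\<close>, and the normalised elasticity operator \<open>J A J\<close> with its three
  terms.\<close>

definition "Pm = (\<chi> i l. \<rho> i * \<rho> l)"
definition "Sm = mat 1 - Pm"
definition "t = (\<Sum>k\<in>UNIV. R k * \<mu> * R k)"
definition "Qm = (\<chi> i l. R l * \<mu> * R i)"
definition "Lm = (\<chi> i l. R i * la * R l)"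
definition "Am = mat t + Qm + Lm"

text \<open>Choices of the commutators whose existence is assumed.\<close>

definition "cb = (\<chi> k m. SOME c. R k * b m * J - J * b m * R k = J * c * J)"
definition "cla = (\<lambda>k. SOME c. R k * la * J - J * la * R k = J * c * J)"
definition "ca = (\<chi> k m. SOME c. R k * a m * J - J * a m * R k = J * c * J)"
definition "cfa = (\<chi> k m. SOME c. R k * ((la + 2 * \<mu>) * a m) * J - J * ((la + 2 * \<mu>) * a m) * R k = J * c * J)"

lemma ca: "R k * a m * J - J * a m * R k = J * ca $ k $ m * J"
  using someI_ex[OF comm_a[of k m]] by (simp add: ca_def)
lemma cb: "R k * b m * J - J * b m * R k = J * cb $ k $ m * J"
  using someI_ex[OF comm_b[of k m]] by (simp add: cb_def)
lemma cla: "R k * la * J - J * la * R k = J * cla k * J"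
  using someI_ex[OF comm_lam[of k]] by (simp add: cla_def)
lemma cfa: "R k * ((la + 2 * \<mu>) * a m) * J - J * ((la + 2 * \<mu>) * a m) * R k = J * cfa $ k $ m * J"
  using someI_ex[OF comm_fa[of k m]] by (simp add: cfa_def)

text \<open>Right-hand side and solution of the Lyapunov equation for the correction \<open>W\<close>; the form of \<open>V\<close> is
  explained by \<open>JVJ\<close>.\<close>

definition "V = (\<chi> j m. 2 * J * ca $ j $ m * J
  + 2 * (\<Sum>k\<in>UNIV. R k * ca $ k $ m * R j - R k * ca $ j $ m * R k + R j * ca $ k $ m * R k))"
definition "W = (\<chi> j m. SOME W. J * J * W + W * J * J = J * V $ j $ m * J)"

lemma W: "J * J * W $ j $ m + W $ j $ m * J * J = J * V $ j $ m * J"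
  using someI_ex[OF lyapunov[of "V $ j $ m"]] by (simp add: W_def)

lemma sum_R_left: "(\<Sum>k\<in>UNIV. R k * (R k * X)) = J * (J * X) - X"
  using sum_R by (simp add: sum_distrib_right[symmetric] mult.assoc[symmetric] left_diff_distrib)

lemma sum_R_right: "(\<Sum>k\<in>UNIV. X * (R k * R k)) = X * (J * J) - X"
  using sum_R by (simp add: sum_distrib_left[symmetric] right_diff_distrib)

text \<open>The commutator \<open>J R a - a R J\<close> contains one \<open>J\<close> only. To extract the second one, insert
  \<open>1 = J\<^sup>2 - \<Sum>\<^sub>k R\<^sub>k\<^sup>2\<close>: the term with \<open>J\<^sup>2\<close> gives the first summand of \<open>V\<close>, and the terms with \<open>R\<^sub>k\<close>
  are rearranged so that each contains one commutator of \<open>a\<close>.\<close>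

lemma JVJ: "J * V $ j $ m * J = 2 * (J * R j * a m - a m * R j * J)"
proof -
  have *: "J * (R k * ca $ k' $ m * R l) * J = R k * (R k' * a m * J - J * a m * R k') * R l" for k k' l
    unfolding ca by (simp add: mult.assoc R_J) (simp add: mult.assoc[symmetric] R_J)
  have "J * (\<Sum>k\<in>UNIV. R k * ca $ k $ m * R j - R k * ca $ j $ m * R k + R j * ca $ k $ m * R k) * J
     = (\<Sum>k\<in>UNIV. R k * (R k * a m * J - J * a m * R k) * R j
          - R k * (R j * a m * J - J * a m * R j) * R k + R j * (R k * a m * J - J * a m * R k) * R k)"
    by (simp add: sum_distrib_left sum_distrib_right distrib_left distrib_right
        right_diff_distrib left_diff_distrib sum.distrib sum_subtractf * )
  also have "\<dots> = (\<Sum>k\<in>UNIV. R k * (R k * (a m * J * R j)) - R j * J * a m * (R k * R k))"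
  proof (intro sum.cong refl)
    fix k
    have 1: "R k * (R j * X) = R j * (R k * X)" for X by (simp add: mult.assoc[symmetric] R_R)
    have 2: "R k * (J * X) = J * (R k * X)" for k X by (simp add: mult.assoc[symmetric] R_J)
    show "R k * (R k * a m * J - J * a m * R k) * R j
          - R k * (R j * a m * J - J * a m * R j) * R k + R j * (R k * a m * J - J * a m * R k) * R k
        = R k * (R k * (a m * J * R j)) - R j * J * a m * (R k * R k)"
      by (simp add: algebra_simps 1 2 R_R[of k j])
  qed
  also have "\<dots> = J * (J * (a m * J * R j)) - a m * J * R j - (R j * J * a m * (J * J) - R j * J * a m)"
    unfolding sum_subtractf sum_R_left sum_R_right ..
  finally have s: "J * (\<Sum>k\<in>UNIV. R k * ca $ k $ m * R j - R k * ca $ j $ m * R k + R j * ca $ k $ m * R k) * J = \<dots>" .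
  have 1: "J * (J * ca $ j $ m * J) * J = J * (R j * a m * J - J * a m * R j) * J"
    unfolding ca by simp
  have "J * V $ j $ m * J = 2 * (J * (J * ca $ j $ m * J) * J) + 2 * (J * (\<Sum>k\<in>UNIV. R k * ca $ k $ m * R j - R k * ca $ j $ m * R k + R j * ca $ k $ m * R k) * J)"
    unfolding V_def by (simp add: algebra_simps mult_2 mult_2_right)
  also have "\<dots> = 2 * (J * R j * a m - a m * R j * J)"
    unfolding 1 s
    by (simp add: algebra_simps R_J)
  finally show ?thesis .
qed

text \<open>The two quantisations of the same symbol, with the coefficient \<open>a\<close> on the left and on the right. The
  correction \<open>W\<close> makes them intertwined by \<open>J\<close>.\<close>

definition "k1 = (\<chi> j m. - 2 * (a m * R j) - W $ j $ m * J)"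
definition "k2 = (\<chi> j m. - 2 * (R j * a m) + J * W $ j $ m)"

lemma k1_J: "k1 ** mat J = mat J ** k2"
  using W unfolding JVJ k1_def k2_def
  by (simp add: vec_eq_iff algebra_simps mult_2)

lemma Sm_nth: "Sm $ m $ l = (if m = l then 1 else 0) - \<rho> m * \<rho> l"
  by (simp add: Sm_def Pm_def mat_nth)

text \<open>The divergence of a field in the range of \<open>S\<close> vanishes.\<close>

lemma sum_R_Sm: "(\<Sum>m\<in>UNIV. R m * Sm $ m $ l) = 0"
proof -
  have "R m * (\<rho> m * \<rho> l) = \<rho> m * \<rho> m * R l" for m
    by (metis mult.assoc rho_R rho_R_swap)
  then have "(\<Sum>m\<in>UNIV. R m * (\<rho> m * \<rho> l)) = R l"
    by (simp add: sum_distrib_right[symmetric] sum_rho)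
  moreover have "(\<Sum>m\<in>UNIV. R m * (if m = l then 1 else 0)) = R l"
    by (simp add: if_distrib cong: if_cong)
  ultimately show ?thesis
    by (simp add: Sm_nth right_diff_distrib sum_subtractf)
qed

lemma Sm_J: "Sm ** mat J = mat J ** Sm"
  by (simp add: vec_eq_iff Sm_nth algebra_simps rho_J) (metis mult.assoc rho_J)

lemma Pm_J: "Pm ** mat J = mat J ** Pm"
  by (simp add: vec_eq_iff Pm_def) (metis mult.assoc rho_J)

lemma Pm_Pm: "Pm ** Pm = Pm"
proof -
  have "(\<Sum>k\<in>UNIV. \<rho> i * \<rho> k * (\<rho> k * \<rho> j)) = \<rho> i * (\<Sum>k\<in>UNIV. \<rho> k * \<rho> k) * \<rho> j" for i j
    by (simp add: sum_distrib_left sum_distrib_right mult.assoc)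
  then show ?thesis by (simp add: vec_eq_iff matrix_matrix_mult_def Pm_def sum_rho)
qed

lemma mu_R: "J * \<mu> * R k = R k * \<mu> * J - J * b k * J"
  using comm_mu[of k] by (simp add: algebra_simps)

lemma R_mu_J: "R k * \<mu> * J = J * \<mu> * R k + J * b k * J"
  by (simp add: mu_R)

definition "bR = (\<chi> j m. b m * R j)"
definition "Rb = (\<chi> j m. R j * b m)"

lemma Lm_Sm: "Lm ** Sm = 0"
proof -
  have "(\<Sum>k\<in>UNIV. R i * la * R k * Sm $ k $ j) = R i * la * (\<Sum>k\<in>UNIV. R k * Sm $ k $ j)" for i j
    by (simp add: sum_distrib_left mult.assoc)
  then show ?thesis by (simp add: vec_eq_iff matrix_matrix_mult_def Lm_def sum_R_Sm)
qed

text \<open>In \<open>\<Sum>\<^sub>m R\<^sub>m \<mu> R\<^sub>j S\<^sub>m\<^sub>l\<close> the derivative \<open>R\<^sub>m\<close> is commuted past \<open>\<mu>\<close> and produces a vanishing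
  divergence, so that only the commutator \<open>b\<^sub>m\<close> remains.\<close>

lemma Qm_Sm: "Qm ** Sm = mat J ** bR ** Sm"
proof -
  have "(\<Sum>m\<in>UNIV. R m * \<mu> * R j * Sm $ m $ l) = (\<Sum>m\<in>UNIV. J * (b m * R j) * Sm $ m $ l)" for j l
  proof (rule cancel_right)
    have S: "Sm $ m $ l * J = J * Sm $ m $ l" for m
      using Sm_J by (simp add: vec_eq_iff)
    have "(\<Sum>m\<in>UNIV. R m * \<mu> * R j * Sm $ m $ l) * J = (\<Sum>m\<in>UNIV. (R m * \<mu> * J) * (R j * Sm $ m $ l))"
      by (simp add: sum_distrib_right mult.assoc S) (simp add: mult.assoc[symmetric] R_J)
    also have "\<dots> = (\<Sum>m\<in>UNIV. J * \<mu> * R m * (R j * Sm $ m $ l) + J * b m * J * (R j * Sm $ m $ l))"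
      unfolding R_mu_J distrib_right ..
    also have "\<dots> = J * \<mu> * R j * (\<Sum>m\<in>UNIV. R m * Sm $ m $ l) + (\<Sum>m\<in>UNIV. J * (b m * R j) * Sm $ m $ l) * J"
    proof -
      have "R m * (R j * Sm $ m $ l) = R j * (R m * Sm $ m $ l)" for m
        by (simp add: mult.assoc[symmetric] R_R)
      moreover have "J * (R j * Sm $ m $ l) = R j * Sm $ m $ l * J" for m
        by (metis mult.assoc R_J S)
      ultimately have "J * \<mu> * R m * (R j * Sm $ m $ l) + J * b m * J * (R j * Sm $ m $ l)
          = J * \<mu> * R j * (R m * Sm $ m $ l) + J * (b m * R j) * Sm $ m $ l * J" for m
        by (simp add: mult.assoc)
      then show ?thesis
        by (simp add: sum.distrib sum_distrib_left sum_distrib_right)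
    qed
    finally show "(\<Sum>m\<in>UNIV. R m * \<mu> * R j * Sm $ m $ l) * J = (\<Sum>m\<in>UNIV. J * (b m * R j) * Sm $ m $ l) * J"
      by (simp add: sum_R_Sm)
  qed
  then show ?thesis
    by (simp add: vec_eq_iff matrix_matrix_mult_def[of _ Sm] Qm_def bR_def)
qed

lemma Pm_t: "Pm ** mat t = Pm ** Qm"
proof -
  have 1: "\<rho> i * \<rho> m * (R k * \<mu> * R k) = \<rho> i * \<rho> k * (R m * \<mu> * R k)" for i m k
    by (metis mult.assoc rho_R_swap)
  have "(Pm ** Qm) $ i $ m = (\<Sum>k\<in>UNIV. \<rho> i * \<rho> k * (R m * \<mu> * R k))" for i m
    by (simp add: matrix_matrix_mult_def Pm_def Qm_def)
  moreover have "(Pm ** mat t) $ i $ m = (\<Sum>k\<in>UNIV. \<rho> i * \<rho> k * (R m * \<mu> * R k))" for i m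
    by (simp add: Pm_def t_def sum_distrib_left 1)
  ultimately show ?thesis
    by (simp add: vec_eq_iff)
qed

lemma Am_Sm: "Am ** Sm = mat t ** Sm + mat J ** bR ** Sm"
  by (simp add: Am_def matrix_add_rdistrib' Qm_Sm Lm_Sm)

text \<open>The off-diagonal block is of first order: it contains the derivative \<open>b\<close> of \<open>\<mu>\<close> and one factor \<open>J\<close>.\<close>

lemma Pm_Am_Sm: "Pm ** Am ** Sm = Pm ** mat J ** bR ** Sm + Pm ** mat J ** bR ** Sm"
proof -
  have "Pm ** mat t ** Sm = Pm ** (Qm ** Sm)"
    by (simp only: Pm_t matrix_mul_assoc)
  then have 1: "Pm ** mat t ** Sm = Pm ** mat J ** bR ** Sm"
    by (simp only: Qm_Sm matrix_mul_assoc)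
  have "Pm ** Am ** Sm = Pm ** (Am ** Sm)"
    by (simp only: matrix_mul_assoc)
  then show ?thesis
    by (simp only: Am_Sm matrix_add_ldistrib matrix_mul_assoc 1)
qed

lemma J_bR: "mat J ** bR = Rb ** mat J - mat J ** cb ** mat J"
  using cb by (simp add: vec_eq_iff bR_def Rb_def algebra_simps)

text \<open>The lower order terms of \<open>t = \<Sum>\<^sub>k R\<^sub>k \<mu> R\<^sub>k\<close>, when it is compared with \<open>-\<mu>\<close> from the left and
  from the right; \<open>R_t\<close> and \<open>t_R\<close> are the forms in which the comparison is used.\<close>

definition "z = J * \<mu> - (\<Sum>k\<in>UNIV. R k * b k)"
definition "y = \<mu> * J + (\<Sum>k\<in>UNIV. b k * R k)"

lemma J_t: "J * t = - (\<mu> * J) + J * z * J"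
proof -
  have "J * (R k * \<mu> * R k) = R k * (R k * (\<mu> * J)) - J * (R k * b k) * J" for k
  proof -
    have "J * (R k * \<mu> * R k) = R k * (J * \<mu> * R k)"
      by (simp add: mult.assoc[symmetric] R_J)
    also have "\<dots> = R k * (R k * (\<mu> * J)) - R k * J * b k * J"
      unfolding mu_R by (simp add: right_diff_distrib mult.assoc)
    finally show ?thesis by (simp add: R_J mult.assoc)
  qed
  then have "J * t = (\<Sum>k\<in>UNIV. R k * (R k * (\<mu> * J)) - J * (R k * b k) * J)"
    by (simp add: t_def sum_distrib_left)
  also have "\<dots> = J * (J * (\<mu> * J)) - \<mu> * J - J * (\<Sum>k\<in>UNIV. R k * b k) * J"
    unfolding sum_subtractf sum_R_left by (simp add: sum_distrib_left sum_distrib_right)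
  finally show ?thesis by (simp add: z_def algebra_simps)
qed

lemma R_t: "R j * t = - (\<mu> * R j) + (R j * z - b j) * J"
proof (rule cancel_left)
  have "J * (R j * t) = R j * (J * t)" by (simp add: mult.assoc[symmetric] R_J)
  also have "\<dots> = - (J * \<mu> * R j + J * b j * J) + J * R j * z * J"
    unfolding J_t mu_R by (simp add: algebra_simps) (simp add: mult.assoc[symmetric] R_J)
  finally show "J * (R j * t) = J * (- (\<mu> * R j) + (R j * z - b j) * J)"
    by (simp add: algebra_simps)
qed

lemma t_J: "t * J = - (J * \<mu>) + J * y * J"
proof -
  have "R k * \<mu> * R k * J = J * \<mu> * (R k * R k) + J * (b k * R k) * J" for k
  proof -
    have "R k * \<mu> * R k * J = R k * \<mu> * J * R k"
      by (simp add: mult.assoc R_J)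
    also have "\<dots> = J * \<mu> * (R k * R k) + J * b k * J * R k"
      unfolding R_mu_J by (simp add: algebra_simps)
    finally show ?thesis by (simp add: R_J mult.assoc)
  qed
  then have "t * J = (\<Sum>k\<in>UNIV. J * \<mu> * (R k * R k) + J * (b k * R k) * J)"
    by (simp add: t_def sum_distrib_right)
  also have "\<dots> = J * \<mu> * (J * J) - J * \<mu> + J * (\<Sum>k\<in>UNIV. b k * R k) * J"
    unfolding sum.distrib sum_R_right by (simp add: sum_distrib_left sum_distrib_right)
  finally show ?thesis by (simp add: y_def algebra_simps)
qed

lemma t_R: "t * R j = - (R j * \<mu>) + J * (b j + y * R j)"
proof (rule cancel_right)
  have "t * R j * J = t * J * R j" by (simp add: mult.assoc R_J)
  also have "\<dots> = - (R j * \<mu> * J - J * b j * J) + J * y * R j * J"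
    unfolding t_J mu_R[symmetric] by (simp add: algebra_simps R_J)
  finally show "t * R j * J = (- (R j * \<mu>) + J * (b j + y * R j)) * J"
    by (simp add: algebra_simps)
qed

lemma R_la_J: "R k * la * J = J * la * R k + J * cla k * J"
  using cla[of k] by (simp add: diff_eq_eq algebra_simps)

lemma left_ideal: "(\<And>i j. \<exists>x. X $ i $ j = J * x) \<Longrightarrow> \<exists>Y. X = mat J ** Y"
proof -
  assume "\<And>i j. \<exists>x. X $ i $ j = J * x"
  then obtain f where "\<And>i j. X $ i $ j = J * f i j" by metis
  then show ?thesis by (intro exI[of _ "\<chi> i j. f i j"]) (simp add: vec_eq_iff)
qed

lemma Am_J: "\<exists>Y. Am ** mat J = mat J ** Y"
proof (rule left_ideal)
  fix i j
  have "R j * \<mu> * R i * J = R j * \<mu> * J * R i" "R i * la * R j * J = R i * la * J * R j"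
    by (simp_all add: mult.assoc R_J)
  then have "R j * \<mu> * R i * J = J * (\<mu> * R j * R i + b j * J * R i)"
      "R i * la * R j * J = J * (la * R i * R j + cla i * J * R j)"
    unfolding R_mu_J R_la_J by (simp_all add: algebra_simps)
  moreover have "t * J = J * (y * J - \<mu>)" by (simp add: t_J algebra_simps)
  ultimately have "(Am ** mat J) $ i $ j = J * ((if i = j then y * J - \<mu> else 0)
     + (\<mu> * R j * R i + b j * J * R i) + (la * R i * R j + cla i * J * R j))"
    by (simp add: Am_def mat_nth Qm_def Lm_def distrib_left distrib_right)
  then show "\<exists>x. (Am ** mat J) $ i $ j = J * x" ..
qed

text \<open>Principal parts: \<open>Ra\<close> and \<open>aR\<close> belong to \<open>k2\<close> and \<open>k1\<close>, and the others arise from them by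
  composition with the operator \<open>A\<close> on the range of \<open>P\<close> (factor \<open>la + 2 \<mu>\<close>) and of \<open>S\<close> (factor
  \<open>\<mu>\<close>).\<close>

definition "Ra = (\<chi> j m. R j * a m)"
definition "aR = (\<chi> j m. a m * R j)"
definition "Rfa = (\<chi> j m. R j * ((la + 2 * \<mu>) * a m))"
definition "faR = (\<chi> j m. ((la + 2 * \<mu>) * a m) * R j)"
definition "amuR = (\<chi> j m. a m * \<mu> * R j)"

lemma k1_eq: "k1 = - (aR + aR) - W ** mat J"
  by (simp add: vec_eq_iff k1_def aR_def mult_2 distrib_right)

lemma k2_eq: "k2 = - (Ra + Ra) + mat J ** W"
  by (simp add: vec_eq_iff k2_def Ra_def mult_2 distrib_right)

lemma Pm_Ra: "Pm ** Ra = Ra"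
proof -
  have "\<rho> i * \<rho> k * (R k * a j) = \<rho> k * \<rho> k * (R i * a j)" for i k j
    by (metis mult.assoc rho_R rho_R_swap)
  then have "(\<Sum>k\<in>UNIV. \<rho> i * \<rho> k * (R k * a j)) = (\<Sum>k\<in>UNIV. \<rho> k * \<rho> k) * (R i * a j)" for i j
    unfolding sum_distrib_right by (intro sum.cong refl)
  then show ?thesis
    by (simp add: vec_eq_iff matrix_matrix_mult_def Pm_def Ra_def sum_rho)
qed

text \<open>On gradients the operator \<open>A\<close> acts like \<open>-(la + 2 \<mu>)\<close>, up to a term that contains \<open>J\<close> on the
  left.\<close>

lemma Am_Ra: "\<exists>Y. Am ** Ra = - Rfa + mat J ** Y"
proof -
  have "(Am ** Ra) $ j $ m = t * R j * a m + t * R j * a m + R j * la * (J * J * a m - a m)" for j m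
  proof -
    have "(Qm ** Ra) $ j $ m = t * R j * a m"
    proof -
      have "R i * \<mu> * R j * (R i * a m) = R i * \<mu> * R i * R j * a m" for i
        by (metis mult.assoc R_R)
      then show ?thesis
        by (simp add: matrix_matrix_mult_def Qm_def Ra_def t_def sum_distrib_right)
    qed
    moreover have "(Lm ** Ra) $ j $ m = R j * la * (\<Sum>k\<in>UNIV. R k * (R k * a m))"
      by (simp add: matrix_matrix_mult_def Lm_def Ra_def sum_distrib_left mult.assoc)
    ultimately show ?thesis
      unfolding sum_R_left
      by (simp add: Am_def matrix_add_rdistrib' Ra_def mult.assoc)
  qed
  moreover have "R j * la * (J * J * a m) = J * ((la * R j + cla j * J) * J * a m)" for j m
  proof -
    have "R j * la * (J * J * a m) = R j * la * J * (J * a m)" by (simp add: mult.assoc)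
    also have "\<dots> = (J * la * R j + J * cla j * J) * (J * a m)"
      unfolding R_la_J ..
    finally show ?thesis by (simp add: algebra_simps)
  qed
  ultimately have "(Am ** Ra + Rfa) $ j $ m
     = J * ((b j + y * R j) * a m + (b j + y * R j) * a m + (la * R j + cla j * J) * J * a m)" for j m
    by (simp add: t_R Rfa_def algebra_simps mult_2)
  then have "\<exists>Y. Am ** Ra + Rfa = mat J ** Y"
    by (intro left_ideal) blast
  then obtain Y where "Am ** Ra + Rfa = mat J ** Y" ..
  then show ?thesis by (intro exI[of _ Y]) (simp add: eq_neg_iff_add_eq_0 algebra_simps)
qed

lemma aR_t: "\<exists>Y. aR ** mat t = - amuR + Y ** mat J"
proof
  show "aR ** mat t = - amuR + (\<chi> j m. a m * (R j * z - b j)) ** mat J"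
    by (simp add: vec_eq_iff aR_def amuR_def mult.assoc R_t algebra_simps)
qed

lemma Rfa_J: "Rfa ** mat J = mat J ** faR + mat J ** cfa ** mat J"
  using cfa by (simp add: vec_eq_iff Rfa_def faR_def algebra_simps)

lemma bR_split: "bR + amuR = faR"
  using b_split by (simp add: vec_eq_iff bR_def amuR_def faR_def distrib_right[symmetric])

text \<open>The block \<open>K\<^sub>P\<^sub>S\<close> in coordinates, as an operator from \<open>H\<^sup>-\<^sup>1\<close> to \<open>H\<^sup>0\<close> (\<open>K1\<close>) and from \<open>H\<^sup>0\<close> to \<open>H\<^sup>1\<close>
  (\<open>K2\<close>).\<close>

definition "K1 = Pm ** k1 ** Sm"
definition "K2 = Pm ** k2 ** Sm"

lemma K1_J: "K1 ** mat J = mat J ** K2"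
  unfolding K1_def K2_def
  by (metis Pm_J Sm_J k1_J matrix_mul_assoc)

lemma K1_Am_Sm: "\<exists>Y. k1 ** Sm ** Am ** Sm = (amuR + amuR) ** Sm + Y ** mat J"
proof -
  obtain Y1 where Y1: "aR ** mat t = - amuR + Y1 ** mat J" using aR_t by blast
  have Jt: "mat J ** mat t = (- mat \<mu> + mat (J * z)) ** mat J"
    by (simp add: vec_eq_iff mat_nth J_t algebra_simps)
  define G where "G = Rb - mat J ** cb"
  have G: "mat J ** bR = G ** mat J" by (simp add: J_bR G_def matrix_diff_rdistrib')
  have k1t: "k1 ** mat t = amuR + amuR + (- (Y1 + Y1) - W ** (- mat \<mu> + mat (J * z))) ** mat J"
  proof -
    have "k1 ** mat t = - (aR ** mat t + aR ** mat t) - W ** (mat J ** mat t)"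
      by (simp add: k1_eq matrix_ring_simps matrix_add_rdistrib' )
    then show ?thesis unfolding Y1 Jt
      by (simp add: matrix_ring_simps)
  qed
  have "Sm ** Am ** Sm = Am ** Sm - Pm ** Am ** Sm"
    by (simp add: Sm_def matrix_ring_simps)
  also have "\<dots> = mat t ** Sm + G ** mat J ** Sm - (Pm ** (G ** mat J) ** Sm + Pm ** (G ** mat J) ** Sm)"
    unfolding Pm_Am_Sm unfolding Am_Sm G[symmetric] by (simp add: matrix_mul_assoc)
  also have "\<dots> = mat t ** Sm + (G ** Sm - Pm ** G ** Sm - Pm ** G ** Sm) ** mat J"
    by (simp add: matrix_distribs matrix_mul_assoc[symmetric] Sm_J)
  finally have "k1 ** (Sm ** Am ** Sm) = k1 ** mat t ** Sm + k1 ** (G ** Sm - Pm ** G ** Sm - Pm ** G ** Sm) ** mat J"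
    by (simp add: matrix_add_ldistrib matrix_mul_assoc)
  also have "\<dots> = (amuR + amuR) ** Sm + ((- (Y1 + Y1) - W ** (- mat \<mu> + mat (J * z))) ** Sm
        + k1 ** (G ** Sm - Pm ** G ** Sm - Pm ** G ** Sm)) ** mat J"
    unfolding k1t by (simp add: matrix_distribs matrix_mul_assoc[symmetric] Sm_J)
  finally show ?thesis by (metis matrix_mul_assoc)
qed

lemma Am_K2: "\<exists>Y. Am ** Pm ** k2 ** mat J = mat J ** (faR + faR) + mat J ** Y ** mat J"
proof -
  obtain Y1 where Y1: "Am ** Ra = - Rfa + mat J ** Y1" using Am_Ra by blast
  obtain Y2 where Y2: "Am ** mat J = mat J ** Y2" using Am_J by blast
  have "Pm ** k2 = - (Ra + Ra) + mat J ** Pm ** W"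
    by (simp add: k2_eq matrix_ring_simps Pm_Ra Pm_J[symmetric])
  then have "Am ** Pm ** k2 = - (Am ** Ra + Am ** Ra) + Am ** mat J ** Pm ** W"
    by (simp add: matrix_mul_assoc[symmetric]) (simp add: matrix_ring_simps)
  also have "\<dots> = Rfa + Rfa + mat J ** (Y2 ** Pm ** W - Y1 - Y1)"
    unfolding Y1 Y2 by (simp add: matrix_ring_simps)
  finally have "Am ** Pm ** k2 ** mat J = Rfa ** mat J + Rfa ** mat J + mat J ** (Y2 ** Pm ** W - Y1 - Y1) ** mat J"
    by (simp add: matrix_ring_simps)
  also have "\<dots> = mat J ** (faR + faR) + mat J ** (Y2 ** Pm ** W - Y1 - Y1 + cfa + cfa) ** mat J"
    unfolding Rfa_J by (simp add: matrix_ring_simps)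
  finally show ?thesis ..
qed

text \<open>The three terms have the principal parts \<open>2 b\<close>, \<open>2 a \<mu>\<close> and \<open>2 (la + 2 \<mu>) a\<close> in front of \<open>R\<close>, the
  last one with a minus sign; they cancel because \<open>b + a \<mu> = (la + 2 \<mu>) a\<close>. What remains has a factor
  \<open>J\<close> on either side.\<close>

theorem decoupling:
  "\<exists>B. Pm ** Am ** Sm + mat J ** K1 ** Am ** Sm - Pm ** Am ** K2 ** mat J = mat J ** B ** mat J"
proof -
  obtain Y1 where Y1: "k1 ** Sm ** Am ** Sm = (amuR + amuR) ** Sm + Y1 ** mat J" using K1_Am_Sm by blast
  obtain Y2 where Y2: "Am ** Pm ** k2 ** mat J = mat J ** (faR + faR) + mat J ** Y2 ** mat J" using Am_K2 by blast
  have 1: "mat J ** K1 ** Am ** Sm = mat J ** Pm ** (amuR + amuR) ** Sm + mat J ** Pm ** Y1 ** mat J"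
  proof -
    have "mat J ** K1 ** Am ** Sm = mat J ** Pm ** (k1 ** Sm ** Am ** Sm)"
      by (simp add: K1_def matrix_mul_assoc)
    then show ?thesis unfolding Y1 by (simp add: matrix_ring_simps)
  qed
  have "Pm ** Am ** K2 ** mat J = Pm ** (Am ** Pm ** k2 ** mat J) ** Sm"
    unfolding K2_def matrix_mul_assoc[symmetric] Sm_J ..
  also have "\<dots> = mat J ** Pm ** (faR + faR) ** Sm + mat J ** (Pm ** Y2 ** Sm) ** mat J"
    unfolding Y2 matrix_distribs
    by (simp add: matrix_mul_assoc Pm_J) (simp add: matrix_mul_assoc[symmetric] Sm_J)
  finally have 2: "Pm ** Am ** K2 ** mat J = \<dots>" .
  have 3: "Pm ** Am ** Sm = mat J ** Pm ** (bR + bR) ** Sm"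
    by (simp add: Pm_Am_Sm matrix_ring_simps Pm_J)
  have "Pm ** Am ** Sm + mat J ** K1 ** Am ** Sm - Pm ** Am ** K2 ** mat J
      = mat J ** Pm ** ((bR + amuR - faR) + (bR + amuR - faR)) ** Sm + mat J ** (Pm ** Y1 - Pm ** Y2 ** Sm) ** mat J"
    unfolding 1 2 3 by (simp add: matrix_ring_simps)
  also have "\<dots> = mat J ** (Pm ** Y1 - Pm ** Y2 ** Sm) ** mat J"
    unfolding bR_split by (simp add: vec_eq_iff matrix_matrix_mult_def)
  finally show ?thesis by (rule exI)
qed

lemma mat_J_J: "mat (J * J) = mat J ** (mat J :: 'b^'n^'n)"
  by (simp add: vec_eq_iff mat_nth)

text \<open>The mapping property from \<open>H\<^sup>1\<close> to \<open>H\<^sup>2\<close>, for which the coefficient \<open>a\<close> is moved back from the right to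
  the left at the cost of a commutator.\<close>

lemma K1_smoothing: "\<exists>X. K1 ** mat (J * J) = mat (J * J) ** X"
proof -
  \<comment> \<open>\<open>k2\<close> with the coefficient moved to the left of \<open>R\<close>\<close>
  define Z where "Z = - (aR + aR) - (ca ** mat J + ca ** mat J) + W ** mat J"
  have RaJ: "Ra ** mat J = mat J ** (aR + ca ** mat J)"
    using ca by (simp add: vec_eq_iff Ra_def aR_def diff_eq_eq algebra_simps)
  have k2J: "k2 ** mat J = mat J ** Z"
    unfolding k2_eq Z_def matrix_distribs RaJ by (simp add: matrix_ring_simps)
  have "K1 ** mat (J * J) = mat J ** K2 ** mat J"
    by (simp only: mat_J_J matrix_mul_assoc K1_J)
  also have "\<dots> = mat J ** Pm ** (k2 ** mat J) ** Sm"
    by (simp only: K2_def matrix_mul_assoc[symmetric] Sm_J)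
  also have "\<dots> = mat J ** (Pm ** mat J) ** Z ** Sm"
    by (simp only: k2J matrix_mul_assoc)
  also have "\<dots> = mat (J * J) ** (Pm ** Z ** Sm)"
    by (simp only: Pm_J mat_J_J matrix_mul_assoc)
  finally show ?thesis by (rule exI)
qed

text \<open>The mapping property that is turned into that of the adjoint block.\<close>

lemma K2_smoothing: "\<exists>X. mat (J * J) ** K2 = X ** mat (J * J)"
proof -
  \<comment> \<open>\<open>k1\<close> with the coefficient moved to the right of \<open>R\<close>\<close>
  define Z where "Z = - (Ra + Ra) + (mat J ** ca + mat J ** ca) - mat J ** W"
  have JaR: "mat J ** aR = (Ra - mat J ** ca) ** mat J"
    using ca by (simp add: vec_eq_iff Ra_def aR_def diff_eq_eq algebra_simps)
  have Jk1: "mat J ** k1 = Z ** mat J"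
    unfolding k1_eq Z_def matrix_distribs JaR by (simp add: matrix_ring_simps)
  have "mat (J * J) ** K2 = mat J ** (mat J ** K2)"
    by (simp only: mat_J_J matrix_mul_assoc)
  also have "\<dots> = mat J ** Pm ** k1 ** (Sm ** mat J)"
    by (simp only: K1_J[symmetric]) (simp only: K1_def matrix_mul_assoc)
  also have "\<dots> = Pm ** (mat J ** k1) ** mat J ** Sm"
    by (simp only: Sm_J Pm_J[symmetric] matrix_mul_assoc)
  also have "\<dots> = Pm ** Z ** (mat J ** (mat J ** Sm))"
    by (simp only: Jk1 matrix_mul_assoc)
  also have "\<dots> = Pm ** Z ** Sm ** mat (J * J)"
    unfolding mat_J_J by (simp only: Sm_J[symmetric] matrix_mul_assoc)
  finally show ?thesis by (rule exI)
qed

end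

section \<open>The Lame operator as a matrix of bounded operators\<close>

lemma bdd_lipI:
  assumes "\<And>x. \<bar>f x\<bar> \<le> A" "\<And>x y. \<bar>f x - f y\<bar> \<le> B * dist x y" shows "bdd_lip f"
  unfolding bdd_lip_def
proof (intro exI[of _ "max A B"] allI conjI)
  show "\<bar>f x\<bar> \<le> max A B" for x using assms(1)[of x] by simp
  show "\<bar>f x - f y\<bar> \<le> max A B * dist x y" for x y
    using assms(2)[of x y] mult_right_mono[OF max.cobounded2[of B A] zero_le_dist[of x y]] by linarith
qed

lemma bdd_lip_add: assumes "bdd_lip f" "bdd_lip g" shows "bdd_lip (\<lambda>x. f x + g x)"
proof -
  obtain A where A: "0 \<le> A" "\<And>x. \<bar>f x\<bar> \<le> A" "\<And>x y. \<bar>f x - f y\<bar> \<le> A * dist x y" using bdd_lipE[OF assms(1)] by blast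
  obtain B where B: "0 \<le> B" "\<And>x. \<bar>g x\<bar> \<le> B" "\<And>x y. \<bar>g x - g y\<bar> \<le> B * dist x y" using bdd_lipE[OF assms(2)] by blast
  show ?thesis
  proof (rule bdd_lipI)
    show "\<bar>f x + g x\<bar> \<le> A + B" for x using A(2)[of x] B(2)[of x] by linarith
    show "\<bar>f x + g x - (f y + g y)\<bar> \<le> (A + B) * dist x y" for x y
      using A(3)[of x y] B(3)[of x y] by (simp add: distrib_right)
  qed
qed

lemma bdd_lip_mult: assumes "bdd_lip f" "bdd_lip g" shows "bdd_lip (\<lambda>x. f x * g x)"
proof -
  obtain A where A: "0 \<le> A" "\<And>x. \<bar>f x\<bar> \<le> A" "\<And>x y. \<bar>f x - f y\<bar> \<le> A * dist x y" using bdd_lipE[OF assms(1)] by blast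
  obtain B where B: "0 \<le> B" "\<And>x. \<bar>g x\<bar> \<le> B" "\<And>x y. \<bar>g x - g y\<bar> \<le> B * dist x y" using bdd_lipE[OF assms(2)] by blast
  show ?thesis
  proof (rule bdd_lipI)
    show "\<bar>f x * g x\<bar> \<le> A * B" for x unfolding abs_mult by (intro mult_mono A B) auto
    fix x y
    have "f x * g x - f y * g y = f x * (g x - g y) + (f x - f y) * g y" by (simp add: algebra_simps)
    then have "\<bar>f x * g x - f y * g y\<bar> \<le> \<bar>f x\<bar> * \<bar>g x - g y\<bar> + \<bar>f x - f y\<bar> * \<bar>g y\<bar>"
      by (metis abs_mult abs_triangle_ineq)
    also have "\<dots> \<le> A * (B * dist x y) + A * dist x y * B"
      by (intro add_mono mult_mono A B) (use A(1) in auto)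
    finally show "\<bar>f x * g x - f y * g y\<bar> \<le> (2 * A * B) * dist x y" by simp
  qed
qed

lemma bdd_lip_inverse: assumes "bdd_lip f" "0 < c" "\<And>x. c \<le> \<bar>f x\<bar>" shows "bdd_lip (\<lambda>x. 1 / f x)"
proof -
  obtain A where A: "0 \<le> A" "\<And>x. \<bar>f x\<bar> \<le> A" "\<And>x y. \<bar>f x - f y\<bar> \<le> A * dist x y" using bdd_lipE[OF assms(1)] by blast
  have nz: "f x \<noteq> 0" for x using assms(2) assms(3)[of x] by auto
  show ?thesis
  proof (rule bdd_lipI)
    show "\<bar>1 / f x\<bar> \<le> 1 / c" for x using assms(2) assms(3)[of x] by (simp add: frac_le)
    fix x y
    have "1 / f x - 1 / f y = (f y - f x) / (f x * f y)" using nz[of x] nz[of y] by (simp add: field_simps)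
    then have "\<bar>1 / f x - 1 / f y\<bar> = \<bar>f x - f y\<bar> / (\<bar>f x\<bar> * \<bar>f y\<bar>)" by (simp add: abs_mult abs_minus_commute)
    also have "\<dots> \<le> (A * dist x y) / (c * c)"
      by (intro frac_le mult_mono A assms) (use assms(2) A(1) in auto)
    finally show "\<bar>1 / f x - 1 / f y\<bar> \<le> (A / (c * c)) * dist x y" by simp
  qed
qed

text \<open>The bounded gradient makes \<open>m\<close> Lipschitz by the mean value inequality.\<close>

lemma C11_gradient:
  fixes m :: "real^'n::finite \<Rightarrow> real"
  assumes "C11 m"
  obtains g where "bdd_lip m" "\<And>k. bdd_lip (\<lambda>x. g x $ k)"
    "\<And>k x. (\<lambda>n. diff_deriv_quot k (1 / real (Suc n)) m x) \<longlonglongrightarrow> g x $ k"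
proof -
  obtain g L where bm: "bounded (range m)" and d: "\<And>x. GDERIV m x :> g x" and bg: "bounded (range g)"
    and L: "L-lipschitz_on UNIV g" using assms unfolding C11_def by blast
  obtain A where A: "\<And>x. \<bar>m x\<bar> \<le> A" using bm unfolding bounded_iff by auto
  obtain G where G: "\<And>x. norm (g x) \<le> G" using bg unfolding bounded_iff by auto
  have der: "(m has_derivative (\<lambda>h. h \<bullet> g x)) (at x)" for x using d[of x] by (simp add: gderiv_def)
  have on: "onorm (\<lambda>h. h \<bullet> g x) \<le> G" for x
  proof (rule onorm_bound)
    show "0 \<le> G" using norm_ge_zero[of "g undefined"] G[of undefined] by linarith
    show "norm (h \<bullet> g x) \<le> G * norm h" for h
      using Cauchy_Schwarz_ineq2[of h "g x"] mult_left_mono[OF G[of x] norm_ge_zero[of h]] by (simp add: mult.commute)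
  qed
  have "bdd_lip m"
  proof (rule bdd_lipI[OF A])
    fix x y
    have "norm (m x - m y) \<le> G * norm (x - y)"
      by (rule differentiable_bound[where S=UNIV and f'="\<lambda>x h. h \<bullet> g x"]) (use der on in auto)
    then show "\<bar>m x - m y\<bar> \<le> G * dist x y" by (simp add: dist_norm)
  qed
  moreover have "bdd_lip (\<lambda>x. g x $ k)" for k
  proof (rule bdd_lipI)
    show "\<bar>g x $ k\<bar> \<le> G" for x using component_le_norm_cart[of "g x" k] G[of x] by linarith
    show "\<bar>g x $ k - g y $ k\<bar> \<le> L * dist x y" for x y
      using component_le_norm_cart[of "g x - g y" k] lipschitz_onD[OF L, of x y] by (simp add: dist_norm)
  qed
  moreover have "(\<lambda>n. diff_deriv_quot k (1 / real (Suc n)) m x) \<longlonglongrightarrow> g x $ k" for k x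
  proof -
    have "((\<lambda>t. x + t *\<^sub>R axis k 1) has_derivative (\<lambda>t. t *\<^sub>R axis k 1)) (at 0)"
      by (auto intro!: derivative_eq_intros)
    from has_derivative_compose[OF this, of m "\<lambda>h. h \<bullet> g x"] der[of x]
    have "((\<lambda>t. m (x + t *\<^sub>R axis k 1)) has_derivative (\<lambda>t. t *\<^sub>R axis k 1 \<bullet> g x)) (at 0)" by simp
    moreover have "(\<lambda>t. t *\<^sub>R axis k 1 \<bullet> g x) = (*) (g x $ k)"
      by (simp add: fun_eq_iff inner_axis' mult.commute)
    ultimately have "((\<lambda>t. m (x + t *\<^sub>R axis k 1)) has_field_derivative g x $ k) (at 0)"
      by (simp add: has_field_derivative_def)
    then have lim: "((\<lambda>t. diff_deriv_quot k t m x) \<longlongrightarrow> g x $ k) (at 0)" by (simp add: DERIV_def diff_deriv_quot_def)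
    show ?thesis
    proof (rule filterlim_compose[OF lim], rule filterlim_atI)
      show "(\<lambda>n. 1 / real (Suc n)) \<longlonglongrightarrow> 0" using LIMSEQ_inverse_real_of_nat by (simp add: inverse_eq_divide)
    qed simp
  qed
  ultimately show ?thesis using that by blast
qed

definition adj_mat :: "'a::euclidean_space bop ^'n^'n \<Rightarrow> 'a bop ^'n^'n" where
  "adj_mat X = (\<chi> i j. adj (X $ j $ i))"

lemma adj_mat_nth [simp]: "adj_mat X $ i $ j = adj (X $ j $ i)"
  by (simp add: adj_mat_def)

lemma adj_mat_mult: "adj_mat (X ** Y) = adj_mat Y ** (adj_mat X :: 'a::euclidean_space bop ^'n::finite^'n)"
  by (simp add: vec_eq_iff matrix_matrix_mult_def adj_sum adj_times)

lemma adj_mat_add: "adj_mat (X + Y) = adj_mat X + adj_mat Y" and adj_mat_diff: "adj_mat (X - Y) = adj_mat X - adj_mat Y"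
  and adj_mat_minus: "adj_mat (- X) = - adj_mat X"
  by (simp_all add: vec_eq_iff adj_plus adj_minus adj_uminus)

lemma adj_mat_adj_mat [simp]: "adj_mat (adj_mat X) = X"
  by (simp add: vec_eq_iff)

lemma adj_mat_mat: "adj_mat (mat T) = mat (adj T)"
  by (simp add: vec_eq_iff mat_nth)

text \<open>The gradient \<open>g\<close> of \<open>mu\<close> enters as a limit of difference quotients, the form in which
  \<open>differentiable_commutator\<close> uses it.\<close>

locale lame =
  fixes mu lam :: "real^'n::finite \<Rightarrow> real" and g :: "real^'n \<Rightarrow> real^'n" and c :: real
  assumes bdd_lip_mu: "bdd_lip mu" and bdd_lip_lam: "bdd_lip lam" and bdd_lip_g: "\<And>k. bdd_lip (\<lambda>x. g x $ k)"
    and gradient: "\<And>k x. (\<lambda>n. diff_deriv_quot k (1 / real (Suc n)) mu x) \<longlonglongrightarrow> g x $ k"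
    and c_pos: "0 < c" and lower: "\<And>x. c \<le> \<bar>lam x + mu x\<bar>"
begin

definition "aa m x = g x $ m * (1 / (lam x + mu x))"

lemma bdd_lip_aa: "bdd_lip (aa m)"
  unfolding aa_def by (intro bdd_lip_mult bdd_lip_g bdd_lip_inverse[OF _ c_pos lower] bdd_lip_add bdd_lip_lam bdd_lip_mu)

lemma bdd_lip_la: "bdd_lip (\<lambda>x. lam x + mu x + mu x)"
  by (intro bdd_lip_add bdd_lip_lam bdd_lip_mu)

lemmas rmults = bdd_lip_rmult[OF bdd_lip_mu] bdd_lip_rmult[OF bdd_lip_lam] bdd_lip_rmult[OF bdd_lip_g] bdd_lip_rmult[OF bdd_lip_aa] bdd_lip_rmult[OF bdd_lip_la]

lemma lame_modulus: "mult_by lam + 2 * mult_by mu = mult_by (\<lambda>x. lam x + mu x + mu x)"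
proof -
  have "mult_by lam + 2 * mult_by mu = mult_by lam + mult_by mu + mult_by mu" by (simp add: mult_2)
  also have "\<dots> = mult_by (\<lambda>x. lam x + mu x + mu x)" by (simp only: mult_by_add rmults rmult_intros)
  finally show ?thesis .
qed

text \<open>The identity \<open>sum_rho\<close> holds only almost everywhere, because the symbols vanish at the origin. The
  commutator relation for \<open>\<mu>\<close> is the one that needs a differentiable function; Lipschitz functions
  suffice for the others.\<close>

sublocale elastic_ring "Bessel :: (real^'n) bop" DJ riesz "mult_by mu" "mult_by lam" "\<lambda>m. mult_by (aa m)" "\<lambda>m. mult_by (\<lambda>x. g x $ m)"
proof
  have nz: "inv_bracket \<xi> \<noteq> 0" for \<xi> :: "real^'n" using inv_bracket_bounds(1)[of \<xi>] by simp
  show "Bessel * X = 0 \<Longrightarrow> X = 0" "X * Bessel = 0 \<Longrightarrow> X = 0" for X :: "(real^'n) bop"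
    using rop_cancel_left[OF rmult_inv_bracket nz] rop_cancel_right[OF rmult_inv_bracket nz] by blast+
  show "DJ i * Bessel = Bessel * DJ i" "DJ i * DJ j = DJ j * DJ i" "riesz i * Bessel = Bessel * riesz i" "riesz i * DJ j = DJ j * riesz i" for i j :: 'n
    unfolding DJ_def riesz_def by (rule mop_commute bmult_DJ rmult_inv_bracket rmult_riesz)+
  show "riesz i * DJ j = riesz j * DJ i" for i j :: 'n
    unfolding DJ_def riesz_def mop_times[OF rmult_riesz bmult_DJ] by (simp add: mult_ac)
  have "(\<Sum>k\<in>UNIV. DJ k * DJ k) = mop (\<lambda>\<xi> :: real^'n. \<Sum>k\<in>UNIV. (\<i> * complex_of_real (\<xi> $ k * inv_bracket \<xi>)) * (\<i> * complex_of_real (\<xi> $ k * inv_bracket \<xi>)))"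
    unfolding DJ_def mop_times[OF bmult_DJ bmult_DJ] by (rule mop_sum(2)) (simp_all add: bmult_mult bmult_DJ del: of_real_mult)
  also have "\<dots> = rop (\<lambda>\<xi>. inv_bracket \<xi> * inv_bracket \<xi> - 1)"
  proof (rule arg_cong[of _ _ mop], rule ext)
    fix \<xi> :: "real^'n"
    have "(\<Sum>k\<in>UNIV. (\<xi> $ k)\<^sup>2) = (norm \<xi>)\<^sup>2" by (simp add: norm_vec_def L2_set_def sum_nonneg)
    then have "(\<Sum>k\<in>UNIV. (\<xi> $ k * inv_bracket \<xi>)\<^sup>2) = (inv_bracket \<xi>)\<^sup>2 * (norm \<xi>)\<^sup>2"
      by (simp add: power_mult_distrib sum_distrib_right[symmetric])
    also have "\<dots> = 1 - inv_bracket \<xi> * inv_bracket \<xi>" using inv_bracket_sq[of \<xi>] by (simp add: algebra_simps power2_eq_square)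
    finally have "(\<Sum>k\<in>UNIV. - (\<xi> $ k * inv_bracket \<xi>)\<^sup>2) = inv_bracket \<xi> * inv_bracket \<xi> - 1" by (simp add: sum_negf)
    moreover have "(\<i> * complex_of_real a) * (\<i> * complex_of_real a) = complex_of_real (- a\<^sup>2)" for a
      by (simp add: power2_eq_square algebra_simps)
    ultimately show "(\<Sum>k\<in>UNIV. (\<i> * complex_of_real (\<xi> $ k * inv_bracket \<xi>)) * (\<i> * complex_of_real (\<xi> $ k * inv_bracket \<xi>))) = complex_of_real (inv_bracket \<xi> * inv_bracket \<xi> - 1)"
      by (simp only: of_real_sum[symmetric])
  qed
  also have "\<dots> = Bessel * Bessel - 1"
    unfolding rop_times[OF rmult_inv_bracket rmult_inv_bracket] rop_one[symmetric]
    by (rule rop_minus[symmetric]) (intro rmult_intros rmult_inv_bracket)+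
  finally show "(\<Sum>k\<in>UNIV. DJ k * DJ k) = Bessel * (Bessel :: (real^'n) bop) - 1" .
  have s: "bmult (\<lambda>\<xi>. \<Sum>k\<in>UNIV. complex_of_real (\<xi> $ k / norm \<xi> * (\<xi> $ k / norm (\<xi> :: real^'n))))"
    by (rule mop_sum(1)) (simp_all only: finite rmult_intros rmult_riesz)
  have "(\<Sum>k\<in>UNIV. riesz k * riesz k) = mop (\<lambda>\<xi> :: real^'n. \<Sum>k\<in>UNIV. complex_of_real (\<xi> $ k / norm \<xi> * (\<xi> $ k / norm \<xi>)))"
    unfolding riesz_def rop_times[OF rmult_riesz rmult_riesz] by (rule mop_sum(2)) (simp_all only: finite rmult_intros rmult_riesz)
  also have "\<dots> = mop (\<lambda>\<xi>. 1)"
  proof (rule mop_cong_AE[OF s bmult_const])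
    have "AE \<xi> in lborel. \<xi> \<noteq> (0 :: real^'n)"
      using AE_not_in[of "{0 :: real^'n}" lborel] by (simp add: null_sets_def)
    then show "AE \<xi> in lborel. (\<Sum>k\<in>UNIV. complex_of_real (\<xi> $ k / norm \<xi> * (\<xi> $ k / norm (\<xi> :: real^'n)))) = 1"
    proof eventually_elim
      case (elim \<xi>)
      have "(\<Sum>k\<in>UNIV. (\<xi> $ k)\<^sup>2) = (norm \<xi>)\<^sup>2" by (simp add: norm_vec_def L2_set_def sum_nonneg)
      then have "(\<Sum>k\<in>UNIV. \<xi> $ k / norm \<xi> * (\<xi> $ k / norm \<xi>)) = 1"
        using elim by (simp add: power2_eq_square[symmetric] power_divide sum_divide_distrib[symmetric])
      then show ?case by (simp only: of_real_sum[symmetric] of_real_1)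
    qed
  qed
  finally show "(\<Sum>k\<in>UNIV. riesz k * riesz k) = (1 :: (real^'n) bop)" by (simp add: mop_one)
  show "DJ k * mult_by mu * Bessel - Bessel * mult_by mu * DJ k = Bessel * mult_by (\<lambda>x. g x $ k) * Bessel" for k
    by (rule differentiable_commutator[OF bdd_lip_mu gradient rmults(3)])
  show "\<exists>C. DJ k * mult_by lam * Bessel - Bessel * mult_by lam * DJ k = Bessel * C * Bessel" for k
    using lipschitz_commutator[OF bdd_lip_lam, of k] by blast
  show "\<exists>C. DJ k * mult_by (\<lambda>x. g x $ m) * Bessel - Bessel * mult_by (\<lambda>x. g x $ m) * DJ k = Bessel * C * Bessel" for k m
    using lipschitz_commutator[OF bdd_lip_g, of k m] by blast
  show "\<exists>C. DJ k * mult_by (aa m) * Bessel - Bessel * mult_by (aa m) * DJ k = Bessel * C * Bessel" for k m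
    using lipschitz_commutator[OF bdd_lip_aa, of k m] by blast
  have fa: "(mult_by lam + 2 * mult_by mu) * mult_by (aa m) = mult_by (\<lambda>x. (lam x + mu x + mu x) * aa m x)" for m
    unfolding lame_modulus by (intro mult_by_times rmults)
  show "\<exists>C. DJ k * ((mult_by lam + 2 * mult_by mu) * mult_by (aa m)) * Bessel - Bessel * ((mult_by lam + 2 * mult_by mu) * mult_by (aa m)) * DJ k = Bessel * C * Bessel" for k m
    unfolding fa using lipschitz_commutator[OF bdd_lip_mult[OF bdd_lip_la bdd_lip_aa], of k m] by blast
  show "mult_by (\<lambda>x. g x $ m) + mult_by (aa m) * mult_by mu = (mult_by lam + 2 * mult_by mu) * mult_by (aa m)" for m
  proof -
    have "mult_by (\<lambda>x. g x $ m) + mult_by (aa m) * mult_by mu = mult_by (\<lambda>x. g x $ m + aa m x * mu x)"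
      by (simp only: mult_by_times mult_by_add rmults rmult_intros)
    moreover have "g x $ m + aa m x * mu x = (lam x + mu x + mu x) * aa m x" for x
    proof -
      have "lam x + mu x \<noteq> 0" using c_pos lower[of x] by auto
      then have "g x $ m = (lam x + mu x) * aa m x" by (simp add: aa_def)
      then show ?thesis by (simp add: algebra_simps)
    qed
    ultimately show ?thesis unfolding fa by simp
  qed
  show "\<exists>W. Bessel * Bessel * W + W * Bessel * Bessel = Bessel * V * Bessel" for V :: "(real^'n) bop"
  proof -
    obtain C where "0 \<le> C" "\<And>u. norm (ap V u) \<le> C * norm u" using ap_bound[of V] by blast
    then show ?thesis using cay.lyapunov[of C V] unfolding cay.J_def by blast
  qed
qed

end

subsection \<open>The second coupling by duality\<close>

lemma adj_DJ: "adj (DJ k) = - DJ k"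
  unfolding DJ_def adj_mop[OF bmult_DJ] mop_uminus[OF bmult_DJ] by simp

lemma adj_riesz: "adj (riesz k) = riesz k"
  unfolding riesz_def adj_mop[OF rmult_riesz] by simp

lemma adj_Bessel: "adj Bessel = Bessel"
  unfolding adj_mop[OF rmult_inv_bracket] by simp

context lame
begin

lemma adj_mat_Pm: "adj_mat Pm = Pm" and adj_mat_Sm: "adj_mat Sm = Sm"
proof -
  show p: "adj_mat Pm = Pm" by (simp add: vec_eq_iff Pm_def adj_times adj_riesz)
  show "adj_mat Sm = Sm" by (simp add: Sm_def adj_mat_diff p adj_mat_mat)
qed

lemma adj_mat_Am: "adj_mat Am = Am"
proof -
  have "adj t = t"
    unfolding t_def adj_sum adj_times adj_mult_by[OF rmults(1)] adj_DJ by (simp add: mult.assoc)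
  then show ?thesis
    unfolding Am_def adj_mat_add adj_mat_mat
    by (simp add: vec_eq_iff Qm_def Lm_def adj_times adj_mult_by[OF rmults(1)] adj_mult_by[OF rmults(2)] adj_DJ mult.assoc)
qed

lemma Pm_Sm: "Pm ** Sm = 0" and Sm_Pm: "Sm ** Pm = 0" and Sm_Sm: "Sm ** Sm = Sm"
  by (simp_all add: Sm_def matrix_distribs Pm_Pm)

text \<open>The block \<open>K\<^sub>S\<^sub>P\<close>. The adjoint of an operator from \<open>H\<^sup>0\<close> to \<open>H\<^sup>1\<close> maps \<open>H\<^sup>-\<^sup>1\<close> to \<open>H\<^sup>0\<close>, so \<open>K1\<close> and
  \<open>K2\<close> exchange their roles. \<open>T1\<close> and \<open>T2\<close> are the full operator \<open>K\<close> on \<open>H\<^sup>-\<^sup>1\<close> and on \<open>H\<^sup>0\<close>.\<close>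

definition "N1 = - adj_mat K2"
definition "N2 = - adj_mat K1"
definition "T1 = K1 + N1"
definition "T2 = K2 + N2"

lemma N1_J: "N1 ** mat Bessel = mat Bessel ** N2"
proof -
  have "adj_mat (K1 ** mat Bessel) = adj_mat (mat Bessel ** K2)" by (simp only: K1_J)
  then show ?thesis by (simp add: N1_def N2_def adj_mat_mult adj_mat_mat adj_Bessel matrix_distribs)
qed

lemma T1_J: "T1 ** mat Bessel = mat Bessel ** T2"
  by (simp add: T1_def T2_def matrix_distribs K1_J N1_J)

lemma K_absorb: "Pm ** K1 = K1" "K1 ** Sm = K1" "Pm ** K2 = K2" "K2 ** Sm = K2"
  "Sm ** K1 = 0" "K1 ** Pm = 0" "Sm ** K2 = 0" "K2 ** Pm = 0"
  unfolding K1_def K2_def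
  by (simp_all add: matrix_mul_assoc Pm_Pm Sm_Pm) (simp_all add: matrix_mul_assoc[symmetric] Sm_Sm Sm_Pm)

lemma L_absorb: "Sm ** N1 = N1" "N1 ** Pm = N1" "Sm ** N2 = N2" "N2 ** Pm = N2"
  "Pm ** N1 = 0" "N1 ** Sm = 0" "Pm ** N2 = 0" "N2 ** Sm = 0"
proof -
  have a: "Sm ** adj_mat K = adj_mat (K ** Sm)" "adj_mat K ** Pm = adj_mat (Pm ** K)" "Pm ** adj_mat K = adj_mat (K ** Pm)" "adj_mat K ** Sm = adj_mat (Sm ** K)" for K
    by (simp_all add: adj_mat_mult adj_mat_Pm adj_mat_Sm)
  have z: "adj_mat 0 = (0 :: (real^'n) bop^'n^'n)" by (simp add: vec_eq_iff)
  show "Sm ** N1 = N1" "N1 ** Pm = N1" "Sm ** N2 = N2" "N2 ** Pm = N2"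
    "Pm ** N1 = 0" "N1 ** Sm = 0" "Pm ** N2 = 0" "N2 ** Sm = 0"
    by (simp_all add: N1_def N2_def matrix_distribs a K_absorb z)
qed

lemma Pm_plus_Sm: "Pm + Sm = mat 1"
  by (simp add: Sm_def)

lemma split_right: "X = X ** Pm + X ** Sm"
  by (simp only: matrix_add_ldistrib[symmetric] Pm_plus_Sm matrix_mul_rid)

lemma Pm_Am_Sm_J: "\<exists>Y. Pm ** Am ** Sm = Y ** mat Bessel"
proof
  define G where "G = Rb - mat Bessel ** cb"
  have "mat Bessel ** bR = G ** mat Bessel" by (simp add: J_bR G_def matrix_diff_rdistrib')
  then have "Pm ** mat Bessel ** bR ** Sm = Pm ** (G ** mat Bessel) ** Sm" by (simp only: matrix_mul_assoc[symmetric])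
  also have "\<dots> = Pm ** G ** (Sm ** mat Bessel)" by (simp only: matrix_mul_assoc[symmetric] Sm_J)
  also have "\<dots> = Pm ** G ** Sm ** mat Bessel" by (simp only: matrix_mul_assoc)
  finally show "Pm ** Am ** Sm = (Pm ** G ** Sm + Pm ** G ** Sm) ** mat Bessel"
    by (simp add: Pm_Am_Sm matrix_distribs)
qed

text \<open>The other off-diagonal block is the adjoint of the first one.\<close>

lemma Sm_Am_Pm_J: "\<exists>Y. Sm ** Am ** Pm = Y ** mat Bessel"
proof
  define Z where "Z = Sm ** adj_mat bR ** Pm"
  have "adj_mat (Pm ** mat Bessel ** bR ** Sm) = Sm ** adj_mat bR ** (mat Bessel ** Pm)"
    by (simp add: adj_mat_mult adj_mat_Pm adj_mat_Sm adj_mat_mat adj_Bessel matrix_mul_assoc)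
  also have "\<dots> = Z ** mat Bessel" unfolding Pm_J[symmetric] Z_def by (simp add: matrix_mul_assoc)
  finally have "adj_mat (Pm ** Am ** Sm) = Z ** mat Bessel + Z ** mat Bessel"
    unfolding Pm_Am_Sm adj_mat_add by simp
  then show "Sm ** Am ** Pm = (Z + Z) ** mat Bessel"
    by (simp add: adj_mat_mult adj_mat_Pm adj_mat_Sm adj_mat_Am matrix_distribs matrix_mul_assoc)
qed

text \<open>The identity \<open>decoupling\<close> together with the term \<open>K\<^sub>P\<^sub>S A P\<close>, which is an admissible error since
  \<open>K\<^sub>P\<^sub>S\<close> has order \<open>-1\<close> and the off-diagonal block \<open>S A P\<close> has order \<open>1\<close>.\<close>

theorem Pm_error: "\<exists>B. Pm ** Am + mat Bessel ** Pm ** T1 ** Am = Pm ** Am ** Pm ** (mat 1 + T2 ** mat Bessel) + mat Bessel ** B ** mat Bessel"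
proof -
  obtain B where B: "Pm ** Am ** Sm + mat Bessel ** K1 ** Am ** Sm - Pm ** Am ** K2 ** mat Bessel = mat Bessel ** B ** mat Bessel"
    using decoupling by blast
  obtain Y where Y: "Sm ** Am ** Pm = Y ** mat Bessel" using Sm_Am_Pm_J by blast
  have 1: "Pm ** T1 = K1" "Pm ** T2 = K2" by (simp_all add: T1_def T2_def matrix_distribs K_absorb L_absorb)
  have "mat Bessel ** K1 ** Am ** Pm = mat Bessel ** (K1 ** Sm) ** Am ** Pm" by (simp only: K_absorb)
  also have "\<dots> = mat Bessel ** K1 ** (Sm ** Am ** Pm)" by (simp only: matrix_mul_assoc)
  finally have 2: "mat Bessel ** K1 ** Am ** Pm = mat Bessel ** (K1 ** Y) ** mat Bessel" by (simp only: Y matrix_mul_assoc)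
  have "mat Bessel ** Pm ** T1 ** Am = mat Bessel ** (Pm ** T1) ** Am" by (simp only: matrix_mul_assoc)
  then have 3: "mat Bessel ** Pm ** T1 ** Am = mat Bessel ** K1 ** Am ** Pm + mat Bessel ** K1 ** Am ** Sm"
    unfolding 1 using split_right by metis
  have "Pm ** Am ** Pm ** (mat 1 + T2 ** mat Bessel) = Pm ** Am ** Pm + Pm ** Am ** (Pm ** T2) ** mat Bessel"
    by (simp only: matrix_add_ldistrib matrix_mul_rid matrix_mul_assoc)
  then have 4: "Pm ** Am ** Pm ** (mat 1 + T2 ** mat Bessel) = Pm ** Am ** Pm + Pm ** Am ** K2 ** mat Bessel"
    by (simp only: 1)
  have 5: "Pm ** Am = Pm ** Am ** Pm + Pm ** Am ** Sm" by (rule split_right)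
  show ?thesis
  proof
    show "Pm ** Am + mat Bessel ** Pm ** T1 ** Am = Pm ** Am ** Pm ** (mat 1 + T2 ** mat Bessel) + mat Bessel ** (B + K1 ** Y) ** mat Bessel"
      unfolding 3 4 2 unfolding matrix_add_ldistrib matrix_add_rdistrib' B[symmetric]
      by (subst 5) (simp add: algebra_simps)
  qed
qed

text \<open>The adjoint of \<open>decoupling\<close>, together with the term \<open>K\<^sub>S\<^sub>P A S\<close>.\<close>

theorem Sm_error: "\<exists>B. Sm ** Am + mat Bessel ** Sm ** T1 ** Am = Sm ** Am ** Sm ** (mat 1 + T2 ** mat Bessel) + mat Bessel ** B ** mat Bessel"
proof -
  obtain B where B: "Pm ** Am ** Sm + mat Bessel ** K1 ** Am ** Sm - Pm ** Am ** K2 ** mat Bessel = mat Bessel ** B ** mat Bessel"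
    using decoupling by blast
  have "Sm ** Am ** Pm - Sm ** Am ** N2 ** mat Bessel + mat Bessel ** N1 ** Am ** Pm = adj_mat (Pm ** Am ** Sm + mat Bessel ** K1 ** Am ** Sm - Pm ** Am ** K2 ** mat Bessel)"
    unfolding adj_mat_add adj_mat_diff adj_mat_mult adj_mat_Pm adj_mat_Sm adj_mat_Am adj_mat_mat adj_Bessel N1_def N2_def
    by (simp add: matrix_distribs matrix_mul_assoc)
  also have "\<dots> = mat Bessel ** adj_mat B ** mat Bessel"
    unfolding B adj_mat_mult adj_mat_mat adj_Bessel by (simp add: matrix_mul_assoc)
  finally have B': "Sm ** Am ** Pm - Sm ** Am ** N2 ** mat Bessel + mat Bessel ** N1 ** Am ** Pm = mat Bessel ** adj_mat B ** mat Bessel" .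
  obtain Y where Y: "Pm ** Am ** Sm = Y ** mat Bessel" using Pm_Am_Sm_J by blast
  have 1: "Sm ** T1 = N1" "Sm ** T2 = N2" by (simp_all add: T1_def T2_def matrix_distribs K_absorb L_absorb)
  have "mat Bessel ** N1 ** Am ** Sm = mat Bessel ** (N1 ** Pm) ** Am ** Sm" by (simp only: L_absorb)
  also have "\<dots> = mat Bessel ** N1 ** (Pm ** Am ** Sm)" by (simp only: matrix_mul_assoc)
  finally have 2: "mat Bessel ** N1 ** Am ** Sm = mat Bessel ** (N1 ** Y) ** mat Bessel" by (simp only: Y matrix_mul_assoc)
  have "mat Bessel ** Sm ** T1 ** Am = mat Bessel ** (Sm ** T1) ** Am" by (simp only: matrix_mul_assoc)
  then have 3: "mat Bessel ** Sm ** T1 ** Am = mat Bessel ** N1 ** Am ** Pm + mat Bessel ** N1 ** Am ** Sm"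
    unfolding 1 using split_right by metis
  have "Sm ** Am ** Sm ** (mat 1 + T2 ** mat Bessel) = Sm ** Am ** Sm + Sm ** Am ** (Sm ** T2) ** mat Bessel"
    by (simp only: matrix_add_ldistrib matrix_mul_rid matrix_mul_assoc)
  then have 4: "Sm ** Am ** Sm ** (mat 1 + T2 ** mat Bessel) = Sm ** Am ** Sm + Sm ** Am ** N2 ** mat Bessel"
    by (simp only: 1)
  have 5: "Sm ** Am = Sm ** Am ** Pm + Sm ** Am ** Sm" by (rule split_right)
  show ?thesis
  proof
    show "Sm ** Am + mat Bessel ** Sm ** T1 ** Am = Sm ** Am ** Sm ** (mat 1 + T2 ** mat Bessel) + mat Bessel ** (adj_mat B + N1 ** Y) ** mat Bessel"
      unfolding 3 4 2 unfolding matrix_add_ldistrib matrix_add_rdistrib' B'[symmetric]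
      by (subst 5) (simp add: algebra_simps)
  qed
qed

theorem T1_smoothing: "\<exists>X. T1 ** mat (Bessel * Bessel) = mat (Bessel * Bessel) ** X"
proof -
  obtain X where X: "K1 ** mat (Bessel * Bessel) = mat (Bessel * Bessel) ** X" using K1_smoothing by blast
  obtain Y where Y: "mat (Bessel * Bessel) ** K2 = Y ** mat (Bessel * Bessel)" using K2_smoothing by blast
  have "adj_mat K2 ** mat (Bessel * Bessel) = mat (Bessel * Bessel) ** adj_mat Y"
    using arg_cong[OF Y, of adj_mat] by (simp only: adj_mat_mult adj_mat_mat adj_times adj_Bessel)
  then have "T1 ** mat (Bessel * Bessel) = mat (Bessel * Bessel) ** (X - adj_mat Y)"
    by (simp add: T1_def N1_def matrix_distribs X)
  then show ?thesis by blast
qed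

lemma T_diagonal: "Pm ** T1 ** Pm = 0" "Sm ** T1 ** Sm = 0"
  by (simp_all add: T1_def matrix_distribs K_absorb L_absorb)

lemma T_adjoint: "adj_mat (mat Bessel ** Sm ** T2 ** Pm) = - (mat Bessel ** Pm ** T2 ** Sm)"
proof -
  have "mat Bessel ** Sm ** T2 ** Pm = N1 ** mat Bessel"
    by (simp add: T2_def matrix_distribs matrix_mul_assoc[symmetric] K_absorb L_absorb N1_J)
  moreover have "mat Bessel ** Pm ** T2 ** Sm = mat Bessel ** K2"
    by (simp add: T2_def matrix_distribs matrix_mul_assoc[symmetric] K_absorb L_absorb)
  ultimately show ?thesis
    by (simp add: N1_def adj_mat_mult adj_mat_minus adj_mat_mat adj_Bessel matrix_distribs)
qed

end

section \<open>Sobolev spaces in Fourier coordinates\<close>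

subsection \<open>Schwartz seminorms\<close>

text \<open>The supremum that defines \<open>schwartz_norm\<close> is over a bounded set, since there are finitely many lists
  of bounded length over a finite type.\<close>

lemma schwartz_norm_upper:
  fixes \<phi> :: "real^'n::finite \<Rightarrow> complex"
  assumes \<phi>: "\<phi> \<in> schwartz" and ks: "length ks \<le> N"
  shows "(1 + norm x) ^ N * cmod (pderivatives ks \<phi> x) \<le> schwartz_norm N \<phi>"
proof -
  define S where "S = (\<lambda>(ks, x). (1 + norm x) ^ N * cmod (pderivatives ks \<phi> x)) ` ({ks. length ks \<le> N} \<times> UNIV)"
  have "\<exists>C. \<forall>x. (1 + norm x) ^ N * cmod (pderivatives ks \<phi> x) \<le> C" for ks
    using \<phi> unfolding schwartz_iff rapid_def by blast
  then obtain C where C: "\<And>ks x. (1 + norm x) ^ N * cmod (pderivatives ks \<phi> x) \<le> C ks" by metis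
  have fin: "finite {ks :: 'n list. length ks \<le> N}"
    using finite_lists_length_le[of "UNIV :: 'n set" N] by simp
  have "bdd_above S"
  proof (rule bdd_aboveI)
    fix y assume "y \<in> S"
    then obtain ks x where y: "length ks \<le> N" "y = (1 + norm x) ^ N * cmod (pderivatives ks \<phi> x)" unfolding S_def by auto
    then have "y \<le> C ks" using C by simp
    also have "\<dots> \<le> Max (C ` {ks. length ks \<le> N})" by (rule Max_ge) (use fin y in auto)
    finally show "y \<le> Max (C ` {ks. length ks \<le> N})" .
  qed
  moreover have "(1 + norm x) ^ N * cmod (pderivatives ks \<phi> x) \<in> S"
    unfolding S_def by (rule image_eqI[of _ _ "(ks, x)"]) (use ks in auto)
  ultimately have "(1 + norm x) ^ N * cmod (pderivatives ks \<phi> x) \<le> Sup S" by (intro cSup_upper)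
  then show ?thesis by (simp add: schwartz_norm_def S_def)
qed

lemma schwartz_norm_nonneg: "\<phi> \<in> schwartz \<Longrightarrow> 0 \<le> schwartz_norm N \<phi>"
  using schwartz_norm_upper[of \<phi> "[]" N 0] by (simp add: order_trans[OF norm_ge_zero])

lemma schwartz_norm_sq_integral:
  fixes \<phi> :: "real^'n::finite \<Rightarrow> complex"
  assumes \<phi>: "\<phi> \<in> schwartz" and ks: "length ks \<le> 1"
  shows "(LINT x|lborel. (cmod (pderivatives ks \<phi> x))\<^sup>2) \<le> (schwartz_norm (2 * CARD('n)) \<phi>)\<^sup>2 * (LINT x|lborel. weight (x :: real^'n))"
proof -
  define M where "M = schwartz_norm (2 * CARD('n)) \<phi>"
  have c: "1 \<le> 2 * CARD('n)" by simp
  have M: "cmod (pderivatives ks \<phi> x) \<le> M * weight x" for x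
  proof -
    have "0 < (1 + norm x) ^ (2 * CARD('n))" by (simp add: add_pos_nonneg)
    moreover have "(1 + norm x) ^ (2 * CARD('n)) * cmod (pderivatives ks \<phi> x) \<le> M"
      unfolding M_def by (rule schwartz_norm_upper[OF \<phi> order_trans[OF ks c]])
    ultimately show ?thesis unfolding weight_def by (simp add: field_simps)
  qed
  have le: "(cmod (pderivatives ks \<phi> x))\<^sup>2 \<le> M\<^sup>2 * weight x" for x
  proof -
    have "(cmod (pderivatives ks \<phi> x))\<^sup>2 \<le> (M * weight x)\<^sup>2" by (rule power_mono[OF M]) simp
    also have "\<dots> = M\<^sup>2 * weight x * weight x" by (simp add: power2_eq_square)
    also have "\<dots> \<le> M\<^sup>2 * weight x * 1" using weight_pos[of x] weight_le[of x] by (intro mult_left_mono) auto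
    finally show ?thesis by simp
  qed
  have d: "pderivatives ks \<phi> \<in> schwartz"
  proof (cases ks)
    case (Cons k ls)
    then have "ls = []" using ks by simp
    then show ?thesis using Cons schwartz_pderivative[OF \<phi>, of k] by (simp add: pderivatives_def)
  qed (use \<phi> in \<open>simp add: pderivatives_def\<close>)
  have "(LINT x|lborel. (cmod (pderivatives ks \<phi> x))\<^sup>2) \<le> (LINT x|lborel. M\<^sup>2 * weight (x :: real^'n))"
    by (rule integral_mono) (use schwartz_sqint[OF d] le in \<open>auto simp: sqint_def intro: integrable_weight\<close>)
  then show ?thesis by (simp add: M_def)
qed

subsection \<open>Weighted functions\<close>

lemma inv_bracket_powr_pos: "0 < inv_bracket \<xi> powr s"
  using inv_bracket_bounds(1)[of \<xi>] by simp

lemma inv_bracket_powr_one: "inv_bracket \<xi> powr 1 = inv_bracket \<xi>" and inv_bracket_nonzero: "inv_bracket \<xi> \<noteq> 0"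
  using inv_bracket_bounds(1)[of \<xi>] by simp_all

lemma inv_bracket_powr_Suc: "inv_bracket \<xi> powr (s + 1) = inv_bracket \<xi> powr s * inv_bracket \<xi>"
  unfolding powr_add inv_bracket_powr_one ..

text \<open>For negative \<open>s\<close> the power grows, but for \<open>s \<ge> -1\<close> at most linearly. This is the reason for the
  assumption \<open>-1 \<le> s\<close> from here on: the product with a Schwartz function is controlled by its
  coordinate multiples.\<close>

lemma inv_bracket_powr_le: "-1 \<le> s \<Longrightarrow> (inv_bracket \<xi> powr s)\<^sup>2 \<le> 1 + (\<Sum>k\<in>UNIV. (\<xi> $ k)\<^sup>2)"
proof -
  assume s: "-1 \<le> s"
  have "inv_bracket \<xi> powr s \<le> inv_bracket \<xi> powr (-1)" using powr_mono'[OF s] inv_bracket_bounds[of \<xi>] by simp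
  also have "\<dots> = inverse (inv_bracket \<xi>)" using inv_bracket_bounds[of \<xi>] by (simp add: powr_minus)
  finally have "(inv_bracket \<xi> powr s)\<^sup>2 \<le> (inverse (inv_bracket \<xi>))\<^sup>2" by (rule power_mono) simp
  also have "\<dots> = 1 + (norm \<xi>)\<^sup>2"
  proof -
    have "(inv_bracket \<xi>)\<^sup>2 \<noteq> 0" using inv_bracket_bounds(1)[of \<xi>] by simp
    then show ?thesis using inv_bracket_sq[of \<xi>] by (simp add: field_simps)
  qed
  also have "(norm \<xi>)\<^sup>2 = (\<Sum>k\<in>UNIV. (\<xi> $ k)\<^sup>2)" by (simp add: norm_vec_def L2_set_def sum_nonneg)
  finally show ?thesis .
qed

lemma inv_bracket_powr_sq: "(1 + (norm \<xi>)\<^sup>2) powr s * (inv_bracket \<xi> powr s)\<^sup>2 = 1"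
proof -
  have p: "0 < 1 + (norm \<xi>)\<^sup>2" by (simp add: add_pos_nonneg)
  have "(inv_bracket \<xi> powr s)\<^sup>2 = (inv_bracket \<xi>)\<^sup>2 powr s"
    using inv_bracket_bounds(1)[of \<xi>] by (simp add: power2_eq_square powr_mult)
  then have "(1 + (norm \<xi>)\<^sup>2) powr s * (inv_bracket \<xi> powr s)\<^sup>2 = ((1 + (norm \<xi>)\<^sup>2) * (inv_bracket \<xi>)\<^sup>2) powr s"
    using p by (simp add: powr_mult)
  then show ?thesis using inv_bracket_sq[of \<xi>] by (simp add: mult.commute)
qed

definition weighted :: "real \<Rightarrow> (real^'n::finite \<Rightarrow> complex) \<Rightarrow> real^'n \<Rightarrow> complex" where
  "weighted s f \<xi> = complex_of_real (inv_bracket \<xi> powr s) * f \<xi>"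

lemma weighted_measurable [measurable]: "f \<in> borel_measurable borel \<Longrightarrow> weighted s f \<in> borel_measurable borel"
  unfolding weighted_def[abs_def] by measurable

lemma weighted_schwartz_bound:
  assumes "-1 \<le> s" shows "(cmod (weighted s \<psi> \<xi>))\<^sup>2 \<le> (cmod (\<psi> \<xi>))\<^sup>2 + (\<Sum>k\<in>UNIV. (cmod (complex_of_real (\<xi> $ k) * \<psi> \<xi>))\<^sup>2)"
proof -
  have "(cmod (weighted s \<psi> \<xi>))\<^sup>2 = (inv_bracket \<xi> powr s)\<^sup>2 * (cmod (\<psi> \<xi>))\<^sup>2" by (simp add: weighted_def norm_mult power_mult_distrib)
  also have "\<dots> \<le> (1 + (\<Sum>k\<in>UNIV. (\<xi> $ k)\<^sup>2)) * (cmod (\<psi> \<xi>))\<^sup>2" by (rule mult_right_mono[OF inv_bracket_powr_le[OF assms]]) simp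
  finally show ?thesis by (simp add: distrib_right sum_distrib_right norm_mult power_mult_distrib)
qed

text \<open>The second bound is stated with coordinate multiples because these are the transforms of first
  derivatives, if \<open>\<psi>\<close> is a transform.\<close>

lemma weighted_schwartz_sqint:
  fixes \<psi> :: "real^'n::finite \<Rightarrow> complex"
  assumes s: "-1 \<le> s" and \<psi>: "\<psi> \<in> schwartz"
  shows "sqint (weighted s \<psi>)"
    and "(LINT \<xi>|lborel. (cmod (weighted s \<psi> \<xi>))\<^sup>2) \<le> (LINT \<xi>|lborel. (cmod (\<psi> \<xi>))\<^sup>2) + (\<Sum>k\<in>UNIV. LINT \<xi>|lborel. (cmod (complex_of_real (\<xi> $ k) * \<psi> \<xi>))\<^sup>2)"
proof -
  note [measurable] = schwartz_measurable[OF \<psi>]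
  have i: "integrable lborel (\<lambda>\<xi>. (cmod (\<psi> \<xi>))\<^sup>2)" "integrable lborel (\<lambda>\<xi>. (cmod (complex_of_real (\<xi> $ k) * \<psi> \<xi>))\<^sup>2)" for k
    using schwartz_sqint[OF \<psi>] schwartz_sqint[OF schwartz_coordinate_mult[OF \<psi>]] by (simp_all add: sqint_def)
  then have b: "integrable lborel (\<lambda>\<xi>. (cmod (\<psi> \<xi>))\<^sup>2 + (\<Sum>k\<in>UNIV. (cmod (complex_of_real (\<xi> $ k) * \<psi> \<xi>))\<^sup>2))"
    by (intro Bochner_Integration.integrable_add Bochner_Integration.integrable_sum)
  have w: "integrable lborel (\<lambda>\<xi>. (cmod (weighted s \<psi> \<xi>))\<^sup>2)"
  proof (rule Bochner_Integration.integrable_bound[OF b])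
    show "AE \<xi> in lborel. norm ((cmod (weighted s \<psi> \<xi>))\<^sup>2) \<le> norm ((cmod (\<psi> \<xi>))\<^sup>2 + (\<Sum>k\<in>UNIV. (cmod (complex_of_real (\<xi> $ k) * \<psi> \<xi>))\<^sup>2))"
      using weighted_schwartz_bound[OF s, of \<psi>] by (intro AE_I2) (simp add: sum_nonneg)
  qed measurable
  then show "sqint (weighted s \<psi>)" by (simp add: sqint_def)
  have "(LINT \<xi>|lborel. (cmod (weighted s \<psi> \<xi>))\<^sup>2) \<le> (LINT \<xi>|lborel. (cmod (\<psi> \<xi>))\<^sup>2 + (\<Sum>k\<in>UNIV. (cmod (complex_of_real (\<xi> $ k) * \<psi> \<xi>))\<^sup>2))"
    by (rule integral_mono[OF w b weighted_schwartz_bound[OF s]])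
  also have "\<dots> = (LINT \<xi>|lborel. (cmod (\<psi> \<xi>))\<^sup>2) + (\<Sum>k\<in>UNIV. LINT \<xi>|lborel. (cmod (complex_of_real (\<xi> $ k) * \<psi> \<xi>))\<^sup>2)"
    using i by (subst Bochner_Integration.integral_add) (auto intro!: Bochner_Integration.integral_sum)
  finally show "(LINT \<xi>|lborel. (cmod (weighted s \<psi> \<xi>))\<^sup>2) \<le> (LINT \<xi>|lborel. (cmod (\<psi> \<xi>))\<^sup>2) + (\<Sum>k\<in>UNIV. LINT \<xi>|lborel. (cmod (complex_of_real (\<xi> $ k) * \<psi> \<xi>))\<^sup>2)" .
qed

lemma weighted_pair: "weighted s f \<xi> * g \<xi> = f \<xi> * weighted s g \<xi>"
  by (simp add: weighted_def)

lemma weighted_integrable: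
  assumes "-1 \<le> s" "\<psi> \<in> schwartz" shows "integrable lborel (\<lambda>\<xi>. weighted s (fn u) \<xi> * \<psi> \<xi>)"
  unfolding weighted_pair by (intro sqint_mult_integrable sqint_fn weighted_schwartz_sqint assms)

lemma inv_fourier_add:
  "f \<in> schwartz \<Longrightarrow> g \<in> schwartz \<Longrightarrow> inv_fourier (\<lambda>x. f x + g x) \<xi> = inv_fourier f \<xi> + inv_fourier g \<xi>"
  by (simp add: inv_fourier_eq fourier_add schwartz_integrable add_divide_distrib)

lemma inv_fourier_pderivative:
  "f \<in> schwartz \<Longrightarrow> inv_fourier (pderivative k f) \<xi> = - (\<i> * complex_of_real (\<xi> $ k)) * inv_fourier f \<xi>"
  by (simp add: inv_fourier_eq fourier_pderivative)

text \<open>The parametrisation of the scalar \<open>H\<^sup>s\<close> by \<open>L\<^sup>2\<close>: the distribution \<open>J\<^sup>s u\<close>, with \<open>u\<close> given by its Fourier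
  transform.\<close>

definition sob_distr :: "real \<Rightarrow> (real^'n::finite) l2 \<Rightarrow> 'n distr" where
  "sob_distr s u = distr_inv_fourier (distr_of (weighted s (fn u)))"

lemma sob_distr_eq:
  "sob_distr s u \<phi> = (if \<phi> \<in> schwartz then LINT \<xi>|lborel. weighted s (fn u) \<xi> * inv_fourier \<phi> \<xi> else 0)"
  by (simp add: sob_distr_def distr_inv_fourier_def distr_of_def schwartz_inv_fourier)

lemma mul_const: "mul (\<lambda>x. c) u = Re c *\<^sub>R u + Im c *\<^sub>R imul u"
proof (rule l2_eqI)
  show "AE x in lborel. fn (mul (\<lambda>x. c) u) x = fn (Re c *\<^sub>R u + Im c *\<^sub>R imul u) x"
    using fn_mul[OF bmult_const, of c u] fn_add[of "Re c *\<^sub>R u" "Im c *\<^sub>R imul u"] fn_scaleR[of "Re c" u]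
      fn_scaleR[of "Im c" "imul u"] fn_mul[OF bmult_const, of \<i> u]
    by eventually_elim (simp add: scaleR_conv_of_real complex_eq_iff)
qed

lemma ap_mul_const: "ap T (mul (\<lambda>x. c) u) = mul (\<lambda>x. c) (ap T u)"
  unfolding mul_const[of c] by (simp add: ap_add ap_scaleR ap_imul)

text \<open>The complex inequality follows from the real one for a multiple of \<open>v\<close> that makes the inner product
  real.\<close>

lemma cinner_bound: "cmod (cinner u v) \<le> norm u * norm v"
proof -
  have "(cinner u v) = (LINT x|lborel. fn u x * cnj (fn v x))" by (rule cinner_def)
  define w where "w = mul (\<lambda>x. cinner u v) v"
  have 1: "u \<bullet> w = (cmod (cinner u v))\<^sup>2"
    unfolding w_def mul_const[of "cinner u v"] by (simp only: inner_add_right inner_scaleR_right cmod_power2) (simp add: cinner_eq power2_eq_square)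
  have "norm w \<le> cmod (cinner u v) * norm v" unfolding w_def by (rule norm_mul_le[OF bmult_const]) auto
  then have "(cmod (cinner u v))\<^sup>2 \<le> norm u * (cmod (cinner u v) * norm v)"
    using Cauchy_Schwarz_ineq2[of u w] mult_left_mono[of "norm w" _ "norm u"] unfolding 1 by fastforce
  then show ?thesis by (cases "cinner u v = 0") (auto simp: power2_eq_square algebra_simps)
qed

lemma represents_sob_distr:
  assumes "-1 \<le> s" shows "represents (weighted s (fn u)) (distr_fourier (sob_distr s u))"
  unfolding represents_def
proof (intro conjI ballI)
  fix \<phi> :: "real^'a \<Rightarrow> complex" assume \<phi>: "\<phi> \<in> schwartz"
  show "integrable lborel (\<lambda>\<xi>. weighted s (fn u) \<xi> * \<phi> \<xi>)" by (rule weighted_integrable[OF assms \<phi>])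
  show "distr_fourier (sob_distr s u) \<phi> = (LINT \<xi>|lborel. weighted s (fn u) \<xi> * \<phi> \<xi>)"
    by (simp add: distr_fourier_def \<phi> sob_distr_eq schwartz_fourier inv_fourier_fourier)
qed measurable

lemma represents_unique:
  assumes "represents f T" "represents g T" shows "AE x in lborel. f x = g x"
proof -
  have [measurable]: "f \<in> borel_measurable borel" "g \<in> borel_measurable borel"
    using assms by (auto simp: represents_def)
  have "AE x in lborel. f x - g x = 0"
    by (rule schwartz_separates) (use assms in \<open>auto simp: represents_def left_diff_distrib\<close>)
  then show ?thesis by eventually_elim simp
qed

lemma density_of_AE:
  assumes "represents f T"
  shows "AE x in lborel. density_of T x = f x" "density_of T \<in> borel_measurable borel"
proof -
  have r: "represents (density_of T) T" unfolding density_of_def using assms by (rule someI[where P="\<lambda>f. represents f T"])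
  show "AE x in lborel. density_of T x = f x" by (rule represents_unique[OF r assms])
  show "density_of T \<in> borel_measurable borel" using r by (simp add: represents_def)
qed

lemma fourier_density_sob_distr:
  assumes "-1 \<le> s"
  shows "AE \<xi> in lborel. fourier_density (sob_distr s u) \<xi> = weighted s (fn u) \<xi>" "fourier_density (sob_distr s u) \<in> borel_measurable borel"
  unfolding fourier_density_def using density_of_AE[OF represents_sob_distr[OF assms]] by auto

lemma distr_of_cong:
  assumes "AE x in lborel. f x = g x" "f \<in> borel_measurable borel" "g \<in> borel_measurable borel"
  shows "distr_of f = distr_of g"
proof
  fix \<phi> :: "real^'a \<Rightarrow> complex"
  show "distr_of f \<phi> = distr_of g \<phi>"
  proof (cases "\<phi> \<in> schwartz")
    case True
    note [measurable] = schwartz_measurable[OF True] assms(2,3)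
    have "(LINT x|lborel. f x * \<phi> x) = (LINT x|lborel. g x * \<phi> x)"
      by (rule integral_cong_AE, measurable, use assms(1) in eventually_elim, simp)
    then show ?thesis by (simp add: distr_of_def)
  qed (simp add: distr_of_def)
qed

lemma sob_distr_cong:
  assumes "AE \<xi> in lborel. f \<xi> = weighted s (fn u) \<xi>" "f \<in> borel_measurable borel"
  shows "distr_inv_fourier (distr_of f) = sob_distr s u"
  unfolding sob_distr_def by (rule arg_cong[OF distr_of_cong[OF assms(1,2)]]) measurable

lemma integral_parseval_inv:
  assumes \<phi>: "\<phi> \<in> schwartz"
  shows "(LINT \<xi>|lborel. (cmod (inv_fourier \<phi> \<xi>))\<^sup>2) \<le> (LINT x|lborel. (cmod (\<phi> x))\<^sup>2)"
proof -
  define \<psi> where "\<psi> = inv_fourier \<phi>"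
  have \<psi>: "\<psi> \<in> schwartz" "fourier \<psi> = \<phi>" unfolding \<psi>_def by (rule schwartz_inv_fourier[OF \<phi>], rule fourier_inv_fourier[OF \<phi>])
  have sq: "(LINT x|lborel. f x * cnj (f x)) = complex_of_real (LINT x|lborel. (cmod (f x))\<^sup>2)" for f :: "real^'a \<Rightarrow> complex"
    by (simp add: complex_norm_square[symmetric] flip: of_real_power)
  have "complex_of_real (LINT x|lborel. (cmod (\<phi> x))\<^sup>2) = (2 * complex_of_real pi) ^ CARD('a) * complex_of_real (LINT x|lborel. (cmod (\<psi> x))\<^sup>2)"
    using plancherel_schwartz[OF \<psi>(1) \<psi>(1)] unfolding \<psi>(2) sq .
  also have "\<dots> = complex_of_real ((2 * pi) ^ CARD('a) * (LINT x|lborel. (cmod (\<psi> x))\<^sup>2))" by simp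
  finally have "(LINT x|lborel. (cmod (\<phi> x))\<^sup>2) = (2 * pi) ^ CARD('a) * (LINT x|lborel. (cmod (\<psi> x))\<^sup>2)"
    by (simp only: of_real_eq_iff)
  moreover have "1 \<le> (2 * pi) ^ CARD('a)" using pi_ge_two by (intro one_le_power) linarith
  ultimately show ?thesis
    using mult_right_mono[of 1 "(2 * pi) ^ CARD('a)" "LINT x|lborel. (cmod (\<psi> x))\<^sup>2"] by (simp add: \<psi>_def)
qed

text \<open>By the Cauchy-Schwarz inequality and the Plancherel theorem, the value at \<open>\<phi>\<close> is bounded by the
  \<open>L\<^sup>2\<close> norms of \<open>\<phi>\<close> and its first derivatives, and these by a Schwartz seminorm, since \<open>weight\<close> is
  integrable.\<close>

lemma tempered_sob_distr:
  fixes u :: "(real^'n::finite) l2"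
  assumes s: "-1 \<le> s" shows "tempered (sob_distr s u)"
  unfolding tempered_def
proof (intro conjI allI ballI impI)
  show "sob_distr s u \<phi> = 0" if "\<phi> \<notin> schwartz" for \<phi> using that by (simp add: sob_distr_eq)
  show "sob_distr s u (\<lambda>x. \<phi> x + \<psi> x) = sob_distr s u \<phi> + sob_distr s u \<psi>" if "\<phi> \<in> schwartz" "\<psi> \<in> schwartz" for \<phi> \<psi>
    using that weighted_integrable[OF s schwartz_inv_fourier[OF that(1)], of u] weighted_integrable[OF s schwartz_inv_fourier[OF that(2)], of u]
    by (simp add: sob_distr_eq schwartz_add inv_fourier_add distrib_left)
  show "sob_distr s u (\<lambda>x. c * \<phi> x) = c * sob_distr s u \<phi>" if "\<phi> \<in> schwartz" for c \<phi>
    using that by (simp add: sob_distr_eq schwartz_cmult inv_fourier_cmult mult.left_commute[of _ c])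
  define N where "N = 2 * CARD('n)"
  define W where "W = (LINT x|lborel. weight (x :: real^'n))"
  define D where "D = sqrt ((1 + real CARD('n)) * W)"
  have "cmod (sob_distr s u \<phi>) \<le> (norm u * D) * schwartz_norm N \<phi>" if \<phi>: "\<phi> \<in> schwartz" for \<phi>
  proof -
    define \<psi> where "\<psi> = inv_fourier \<phi>"
    have \<psi>: "\<psi> \<in> schwartz" unfolding \<psi>_def by (rule schwartz_inv_fourier[OF \<phi>])
    define v where "v = cls (weighted s \<psi>)"
    note wq = weighted_schwartz_sqint[OF s \<psi>]
    define v' where "v' = cls (\<lambda>\<xi>. cnj (weighted s \<psi> \<xi>))"
    have "sob_distr s u \<phi> = (LINT \<xi>|lborel. fn u \<xi> * weighted s \<psi> \<xi>)" by (simp add: sob_distr_eq \<phi> weighted_pair \<psi>_def)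
    also have "\<dots> = cinner u v'"
      unfolding v'_def using cinner_cls[OF sqint_fn sqint_cnj[OF wq(1)], of u] by simp
    finally have "cmod (sob_distr s u \<phi>) = cmod (cinner u v')" by simp
    also have "\<dots> \<le> norm u * norm v'" by (rule cinner_bound)
    also have "norm v' \<le> D * schwartz_norm N \<phi>"
    proof (rule power2_le_imp_le)
      have W0: "0 \<le> W" unfolding W_def by (intro integral_nonneg_AE AE_I2 less_imp_le weight_pos)
      have k: "(LINT \<xi>|lborel. (cmod (complex_of_real (\<xi> $ k) * \<psi> \<xi>))\<^sup>2) \<le> (schwartz_norm N \<phi>)\<^sup>2 * W" for k
      proof -
        have "cmod (complex_of_real (\<xi> $ k) * \<psi> \<xi>) = cmod (inv_fourier (pderivative k \<phi>) \<xi>)" for \<xi>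
          by (simp add: inv_fourier_pderivative \<phi> \<psi>_def norm_mult)
        then have "(LINT \<xi>|lborel. (cmod (complex_of_real (\<xi> $ k) * \<psi> \<xi>))\<^sup>2) = (LINT \<xi>|lborel. (cmod (inv_fourier (pderivative k \<phi>) \<xi>))\<^sup>2)"
          by (simp only:)
        also have "\<dots> \<le> (LINT x|lborel. (cmod (pderivative k \<phi> x))\<^sup>2)" by (rule integral_parseval_inv[OF schwartz_pderivative[OF \<phi>]])
        also have "\<dots> \<le> (schwartz_norm N \<phi>)\<^sup>2 * W"
          using schwartz_norm_sq_integral[OF \<phi>, of "[k]"] by (simp add: pderivatives_def N_def W_def)
        finally show ?thesis .
      qed
      have "(norm v')\<^sup>2 = (LINT \<xi>|lborel. (cmod (weighted s \<psi> \<xi>))\<^sup>2)"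
        unfolding v'_def norm_cls_sq[OF sqint_cnj[OF wq(1)]] by simp
      also have "\<dots> \<le> (LINT \<xi>|lborel. (cmod (\<psi> \<xi>))\<^sup>2) + (\<Sum>k\<in>UNIV. LINT \<xi>|lborel. (cmod (complex_of_real (\<xi> $ k) * \<psi> \<xi>))\<^sup>2)"
        by (rule wq(2))
      also have "\<dots> \<le> (schwartz_norm N \<phi>)\<^sup>2 * W + (\<Sum>k\<in>(UNIV :: 'n set). (schwartz_norm N \<phi>)\<^sup>2 * W)"
      proof (intro add_mono sum_mono k)
        show "(LINT \<xi>|lborel. (cmod (\<psi> \<xi>))\<^sup>2) \<le> (schwartz_norm N \<phi>)\<^sup>2 * W"
          using order_trans[OF integral_parseval_inv[OF \<phi>] schwartz_norm_sq_integral[OF \<phi>, of "[]", unfolded pderivatives_def foldr.simps id_apply]]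
          by (simp add: \<psi>_def N_def W_def)
      qed
      also have "\<dots> = (D * schwartz_norm N \<phi>)\<^sup>2"
        using W0 by (simp add: D_def power_mult_distrib algebra_simps)
      finally show "(norm v')\<^sup>2 \<le> (D * schwartz_norm N \<phi>)\<^sup>2" .
      show "0 \<le> D * schwartz_norm N \<phi>" using W0 schwartz_norm_nonneg[OF \<phi>] by (simp add: D_def)
    qed
    finally show ?thesis by (simp add: mult_left_mono mult.assoc)
  qed
  then show "\<exists>C N. \<forall>\<phi>\<in>schwartz. cmod (sob_distr s u \<phi>) \<le> C * schwartz_norm N \<phi>" by blast
qed

lemma sob_distr_add: assumes "-1 \<le> s" shows "sob_distr s (u + v) = sob_distr s u + sob_distr s v"
proof
  fix \<phi> :: "real^'a \<Rightarrow> complex"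
  show "sob_distr s (u + v) \<phi> = (sob_distr s u + sob_distr s v) \<phi>"
  proof (cases "\<phi> \<in> schwartz")
    case True
    note [measurable] = schwartz_measurable[OF schwartz_inv_fourier[OF True]]
    have "(LINT \<xi>|lborel. weighted s (fn (u + v)) \<xi> * inv_fourier \<phi> \<xi>) = (LINT \<xi>|lborel. weighted s (fn u) \<xi> * inv_fourier \<phi> \<xi> + weighted s (fn v) \<xi> * inv_fourier \<phi> \<xi>)"
      by (rule integral_cong_AE, measurable, use fn_add[of u v] in eventually_elim, simp add: weighted_def algebra_simps)
    also have "\<dots> = (LINT \<xi>|lborel. weighted s (fn u) \<xi> * inv_fourier \<phi> \<xi>) + (LINT \<xi>|lborel. weighted s (fn v) \<xi> * inv_fourier \<phi> \<xi>)"
      by (intro Bochner_Integration.integral_add weighted_integrable assms schwartz_inv_fourier True)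
    finally show ?thesis by (simp add: sob_distr_eq True)
  qed (simp add: sob_distr_eq)
qed

lemma sob_distr_cmul: "sob_distr s (mul (\<lambda>x. c) u) \<phi> = c * sob_distr s u \<phi>"
proof (cases "\<phi> \<in> schwartz")
  case True
  note [measurable] = schwartz_measurable[OF schwartz_inv_fourier[OF True]]
  have "(LINT \<xi>|lborel. weighted s (fn (mul (\<lambda>x. c) u)) \<xi> * inv_fourier \<phi> \<xi>) = (LINT \<xi>|lborel. c * (weighted s (fn u) \<xi> * inv_fourier \<phi> \<xi>))"
    by (rule integral_cong_AE, measurable, use fn_mul[OF bmult_const, of c u] in eventually_elim, simp add: weighted_def)
  then show ?thesis by (simp add: sob_distr_eq True)
qed (simp add: sob_distr_eq)

lemma sob_distr_minus: "sob_distr s (- u) = - sob_distr s u"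
  by (rule ext) (simp add: sob_distr_cmul mul_minus_one[symmetric])

lemma sob_distr_diff: "-1 \<le> s \<Longrightarrow> sob_distr s (u - v) = sob_distr s u - sob_distr s v"
  using sob_distr_add[of s u "- v"] by (simp add: sob_distr_minus)

lemma sob_distr_zero [simp]: "sob_distr s 0 = 0"
proof
  show "sob_distr s 0 \<phi> = 0 \<phi>" for \<phi> :: "real^'a \<Rightarrow> complex" using sob_distr_cmul[of s 0 0 \<phi>] by (simp add: mul_const[of 0])
qed

lemma sob_distr_sum: "-1 \<le> s \<Longrightarrow> sob_distr s (sum u I) = (\<Sum>i\<in>I. sob_distr s (u i))"
  by (induction I rule: infinite_finite_induct) (auto simp: sob_distr_add)

lemma sob_distr_rop: "sob_distr s (ap (rop (\<lambda>\<xi>. inv_bracket \<xi> powr t)) u) = sob_distr (s + t) u" if "0 \<le> t"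
proof -
  have m: "rmult (\<lambda>\<xi>::real^'n::finite. inv_bracket \<xi> powr t)" by (rule cay.rmult_powr[OF that])
  show ?thesis unfolding sob_distr_def
  proof (rule arg_cong[OF distr_of_cong])
    show "AE \<xi> in lborel. weighted s (fn (ap (rop (\<lambda>\<xi>. inv_bracket \<xi> powr t)) u)) \<xi> = weighted (s + t) (fn u) \<xi>"
      unfolding ap_mop[OF m] using fn_mul[OF m, of u]
      by eventually_elim (simp add: weighted_def powr_add)
  qed measurable
qed

lemma sob_distr_J: "sob_distr s (ap Bessel u) = sob_distr (s + 1) u"
  using sob_distr_rop[of 1 s u] unfolding inv_bracket_powr_one by simp

lemma distr_deriv_sob_distr: "distr_deriv k (sob_distr (s + 1) u) = sob_distr s (ap (DJ k) u)"
proof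
  fix \<phi> :: "real^'a \<Rightarrow> complex"
  show "distr_deriv k (sob_distr (s + 1) u) \<phi> = sob_distr s (ap (DJ k) u) \<phi>"
  proof (cases "\<phi> \<in> schwartz")
    case True
    note [measurable] = schwartz_measurable[OF schwartz_inv_fourier[OF True]] schwartz_measurable[OF schwartz_inv_fourier[OF schwartz_pderivative[OF True]]]
    have "(LINT \<xi>|lborel. weighted s (fn (ap (DJ k) u)) \<xi> * inv_fourier \<phi> \<xi>) = (LINT \<xi>|lborel. - (weighted (s + 1) (fn u) \<xi> * inv_fourier (pderivative k \<phi>) \<xi>))"
    proof (rule integral_cong_AE)
      show "AE \<xi> in lborel. weighted s (fn (ap (DJ k) u)) \<xi> * inv_fourier \<phi> \<xi> = - (weighted (s + 1) (fn u) \<xi> * inv_fourier (pderivative k \<phi>) \<xi>)"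
        unfolding DJ_def ap_mop[OF bmult_DJ] using fn_mul[OF bmult_DJ, of k u]
        by eventually_elim (simp add: weighted_def inv_bracket_powr_Suc inv_fourier_pderivative True mult_ac)
    qed measurable
    then show ?thesis by (simp add: distr_deriv_def sob_distr_eq True schwartz_pderivative)
  qed (simp add: distr_deriv_def sob_distr_eq)
qed

text \<open>For \<open>s = 0\<close> the distribution is a function, up to normalisation the unitary inverse transform of \<open>u\<close>.\<close>

lemma represents_sob_distr_0: "represents (\<lambda>x. inverse (fourier_const TYPE('n)) * fn (ap to_space u) x) (sob_distr 0 (u :: (real^'n::finite) l2))"
  unfolding represents_def
proof (intro conjI ballI)
  fix \<phi> :: "real^'n \<Rightarrow> complex" assume \<phi>: "\<phi> \<in> schwartz"
  have "integrable lborel (\<lambda>x. inverse (fourier_const TYPE('n)) * (fn (ap to_space u) x * \<phi> x))"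
    by (intro integrable_mult_right sqint_mult_integrable sqint_fn schwartz_sqint \<phi>)
  then show "integrable lborel (\<lambda>x. inverse (fourier_const TYPE('n)) * fn (ap to_space u) x * \<phi> x)" by (simp add: mult.assoc)
  have "weighted 0 (fn u) = fn u" by (simp add: weighted_def fun_eq_iff inv_bracket_nonzero)
  then show "sob_distr 0 u \<phi> = (LINT x|lborel. inverse (fourier_const TYPE('n)) * fn (ap to_space u) x * \<phi> x)"
    using to_space_schwartz[OF \<phi>, of u] fourier_const_nonzero[where 'n='n] by (simp add: sob_distr_eq \<phi> mult.assoc)
qed measurable

lemma represents_distr_of:
  assumes "represents f T" "\<And>\<phi>. \<phi> \<notin> schwartz \<Longrightarrow> T \<phi> = 0" shows "T = distr_of f"
  using assms by (auto simp: represents_def distr_of_def fun_eq_iff)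

lemma sob_distr_0_distr_of: "sob_distr 0 u = distr_of (\<lambda>x. inverse (fourier_const TYPE('n)) * fn (ap to_space u) x)" for u :: "(real^'n::finite) l2"
  by (rule represents_distr_of[OF represents_sob_distr_0]) (simp add: sob_distr_eq)

lemma distr_mult_sob_distr_0:
  fixes u :: "(real^'n::finite) l2"
  assumes f: "rmult f" shows "distr_mult f (sob_distr 0 u) = sob_distr 0 (ap (mult_by f) u)"
proof -
  have m: "density_of (sob_distr 0 u) \<in> borel_measurable borel" by (rule density_of_AE(2)[OF represents_sob_distr_0])
  show ?thesis unfolding distr_mult_def sob_distr_0_distr_of[of "ap (mult_by f) u"]
  proof (rule distr_of_cong)
    show "AE x in lborel. complex_of_real (f x) * density_of (sob_distr 0 u) x = inverse (fourier_const TYPE('n)) * fn (ap to_space (ap (mult_by f) u)) x"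
      unfolding to_space_mult_by ap_mop[OF f] using density_of_AE(1)[OF represents_sob_distr_0[of u]] fn_mul[OF f, of "ap to_space u"]
      by eventually_elim simp
    show "(\<lambda>x. complex_of_real (f x) * density_of (sob_distr 0 u) x) \<in> borel_measurable borel"
      by (rule borel_measurable_times[OF bmult_meas[OF f] m])
    show "(\<lambda>x. inverse (fourier_const TYPE('n)) * fn (ap to_space (ap (mult_by f) u)) x) \<in> borel_measurable borel"
      by (rule borel_measurable_times[OF borel_measurable_const fn_measurable])
  qed
qed

section \<open>Vector fields and the correction operator\<close>

definition ap_mat :: "'a::euclidean_space bop ^'n^'n \<Rightarrow> 'a l2 ^'n \<Rightarrow> 'a l2 ^'n::finite" where
  "ap_mat X u = (\<chi> i. \<Sum>j\<in>UNIV. ap (X $ i $ j) (u $ j))"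

lemma ap_mat_nth [simp]: "ap_mat X u $ i = (\<Sum>j\<in>UNIV. ap (X $ i $ j) (u $ j))"
  by (simp add: ap_mat_def)

lemma ap_sum_right: "ap T (sum u I) = (\<Sum>i\<in>I. ap T (u i))"
  by (rule linear_sum[OF bounded_linear.linear[OF bounded_linear_ap]])

lemma ap_mat_times: "ap_mat (X ** Y) u = ap_mat X (ap_mat Y u)"
  unfolding vec_eq_iff
proof
  fix i
  have "ap_mat (X ** Y) u $ i = (\<Sum>j\<in>UNIV. \<Sum>k\<in>UNIV. ap (X $ i $ k) (ap (Y $ k $ j) (u $ j)))"
    by (simp add: matrix_matrix_mult_def ap_sum)
  also have "\<dots> = (\<Sum>k\<in>UNIV. \<Sum>j\<in>UNIV. ap (X $ i $ k) (ap (Y $ k $ j) (u $ j)))" by (rule sum.swap)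
  finally show "ap_mat (X ** Y) u $ i = ap_mat X (ap_mat Y u) $ i" by (simp add: ap_sum_right)
qed

lemma ap_mat_plus: "ap_mat (X + Y) u = ap_mat X u + ap_mat Y u" and ap_mat_diff: "ap_mat (X - Y) u = ap_mat X u - ap_mat Y u"
  and ap_mat_minus: "ap_mat (- X) u = - ap_mat X u" and ap_mat_zero: "ap_mat 0 u = 0"
  by (simp_all add: vec_eq_iff sum.distrib sum_subtractf sum_negf)

lemma ap_mat_mat: "ap_mat (mat T) u = (\<chi> i. ap T (u $ i))"
  unfolding vec_eq_iff
proof
  fix i
  have "ap_mat (mat T) u $ i = (\<Sum>j\<in>UNIV. if i = j then ap T (u $ j) else 0)"
    unfolding ap_mat_nth by (rule sum.cong) (auto simp: mat_nth)
  then show "ap_mat (mat T) u $ i = (\<chi> i. ap T (u $ i)) $ i" by (simp del: ap_mat_nth)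
qed

lemma ap_mat_add: "ap_mat X (u + v) = ap_mat X u + ap_mat X v"
  by (simp add: vec_eq_iff ap_add sum.distrib)

definition cmul_vec :: "complex \<Rightarrow> 'a::euclidean_space l2 ^'n \<Rightarrow> 'a l2 ^'n::finite" where
  "cmul_vec c u = (\<chi> i. mul (\<lambda>x. c) (u $ i))"

lemma mul_sum: "bmult m \<Longrightarrow> mul m (sum u I) = (\<Sum>i\<in>I. mul m (u i))"
  using ap_sum_right[of "mop m" u I] by (simp add: ap_mop)

lemma ap_mat_cmul_vec: "ap_mat X (cmul_vec c u) = cmul_vec c (ap_mat X u)"
  by (simp add: vec_eq_iff cmul_vec_def ap_mul_const mul_sum)

lemma ap_mat_bound:
  fixes X :: "'a::euclidean_space bop ^'n^'n::finite"
  obtains C where "0 \<le> C" "\<And>u. norm (ap_mat X u) \<le> C * norm u"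
proof -
  have "\<forall>i j. \<exists>c. 0 \<le> c \<and> (\<forall>u. norm (ap (X $ i $ j) u) \<le> c * norm u)"
    using ap_bound by metis
  then obtain c where c: "\<And>i j. 0 \<le> c i j" "\<And>i j u. norm (ap (X $ i $ j) u) \<le> c i j * norm u" by metis
  show ?thesis
  proof (rule that)
    show "0 \<le> (\<Sum>i\<in>UNIV. \<Sum>j\<in>UNIV. c i j)" by (intro sum_nonneg c)
    fix u :: "'a l2 ^'n"
    have "norm (ap_mat X u) \<le> (\<Sum>i\<in>UNIV. norm (ap_mat X u $ i))" unfolding norm_vec_def by (rule L2_set_le_sum) simp
    also have "\<dots> \<le> (\<Sum>i\<in>UNIV. \<Sum>j\<in>UNIV. c i j * norm u)"
    proof (rule sum_mono)
      fix i
      have "norm (ap_mat X u $ i) \<le> (\<Sum>j\<in>UNIV. norm (ap (X $ i $ j) (u $ j)))" unfolding ap_mat_nth by (rule norm_sum)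
      also have "\<dots> \<le> (\<Sum>j\<in>UNIV. c i j * norm u)"
        by (intro sum_mono order_trans[OF c(2)] mult_left_mono Finite_Cartesian_Product.norm_nth_le c(1))
      finally show "norm (ap_mat X u $ i) \<le> (\<Sum>j\<in>UNIV. c i j * norm u)" .
    qed
    finally show "norm (ap_mat X u) \<le> (\<Sum>i\<in>UNIV. \<Sum>j\<in>UNIV. c i j) * norm u" by (simp add: sum_distrib_right)
  qed
qed

text \<open>The isometric parametrisation of \<open>H\<^sup>s\<close> by vector fields in \<open>L\<^sup>2\<close>.\<close>

definition Phi :: "real \<Rightarrow> (real^'n::finite) l2 ^'n \<Rightarrow> 'n distr ^'n" where
  "Phi s u = (\<chi> i. sob_distr s (u $ i))"

lemma Phi_nth [simp]: "Phi s u $ i = sob_distr s (u $ i)"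
  by (simp add: Phi_def)

lemma Phi_add: "-1 \<le> s \<Longrightarrow> Phi s (u + v) = Phi s u + Phi s v"
  by (simp add: vec_eq_iff sob_distr_add)

lemma Phi_diff: "-1 \<le> s \<Longrightarrow> Phi s (u - v) = Phi s u - Phi s v"
  by (simp add: vec_eq_iff sob_distr_diff)

lemma Phi_minus: "Phi s (- u) = - Phi s u"
  by (simp add: vec_eq_iff sob_distr_minus)

lemma Phi_zero: "Phi s 0 = 0"
  by (simp add: vec_eq_iff)

lemma Phi_scale: "distr_scale c (Phi s u) = Phi s (cmul_vec c u)"
  by (simp add: vec_eq_iff distr_scale_def cmul_vec_def sob_distr_cmul fun_eq_iff)

lemma Phi_J: "Phi s (ap_mat (mat Bessel) u) = Phi (s + 1) u"
  by (simp add: vec_eq_iff ap_mat_mat sob_distr_J)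

lemma Phi_powr: "0 \<le> t \<Longrightarrow> Phi s (ap_mat (mat (rop (\<lambda>\<xi>. inv_bracket \<xi> powr t))) u) = Phi (s + t) u"
  by (simp add: vec_eq_iff ap_mat_mat sob_distr_rop)

lemma norm_vec_sq: "norm u = sqrt (\<Sum>i\<in>UNIV. (norm (u $ i))\<^sup>2)"
  by (simp add: norm_vec_def L2_set_def)

lemma weighted_norm_sq: "(1 + (norm \<xi>)\<^sup>2) powr s * (cmod (weighted s f \<xi>))\<^sup>2 = (cmod (f \<xi>))\<^sup>2"
proof -
  have "(1 + (norm \<xi>)\<^sup>2) powr s * (cmod (weighted s f \<xi>))\<^sup>2 = ((1 + (norm \<xi>)\<^sup>2) powr s * (inv_bracket \<xi> powr s)\<^sup>2) * (cmod (f \<xi>))\<^sup>2"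
    by (simp add: weighted_def norm_mult power_mult_distrib mult.assoc)
  then show ?thesis by (simp add: inv_bracket_powr_sq)
qed

lemma Sobolev_norm_Phi: "-1 \<le> s \<Longrightarrow> Sobolev_norm s (Phi s u) = norm u"
proof -
  assume s: "-1 \<le> s"
  have "(LINT \<xi>|lborel. (1 + (norm \<xi>)\<^sup>2) powr s * (cmod (fourier_density (sob_distr s (u $ i)) \<xi>))\<^sup>2) = (norm (u $ i))\<^sup>2" for i
  proof -
    note [measurable] = fourier_density_sob_distr(2)[OF s, of "u $ i"]
    show ?thesis unfolding norm_l2_sq
      by (rule integral_cong_AE, measurable, use fourier_density_sob_distr(1)[OF s, of "u $ i"] in eventually_elim, simp only: weighted_norm_sq)
  qed
  then show ?thesis by (simp add: Sobolev_norm_def norm_vec_sq)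
qed

text \<open>The representing function of the Fourier transform, multiplied by \<open>(1 + |\<xi>|\<^sup>2)\<^sup>s\<^sup>/\<^sup>2\<close>, is square
  integrable, and the distribution is recovered from it by Fourier inversion of test functions.\<close>

lemma Sobolev_eq: assumes s: "-1 \<le> s" shows "Sobolev s = range (Phi s :: (real^'n::finite) l2 ^'n \<Rightarrow> _)"
proof
  show "range (Phi s) \<subseteq> (Sobolev s :: ('n distr ^'n) set)"
  proof
    fix w :: "'n distr ^'n" assume "w \<in> range (Phi s)"
    then obtain u where w: "w = Phi s u" by blast
    have "integrable lborel (\<lambda>\<xi>. (1 + (norm \<xi>)\<^sup>2) powr s * (cmod (weighted s (fn (u $ i)) \<xi>))\<^sup>2)" for i
      unfolding weighted_norm_sq using sqint_fn[of "u $ i"] by (simp add: sqint_def)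
    then show "w \<in> Sobolev s"
      unfolding Sobolev_def w using tempered_sob_distr[OF s] represents_sob_distr[OF s] by auto
  qed
  show "(Sobolev s :: ('n distr ^'n) set) \<subseteq> range (Phi s)"
  proof
    fix w :: "'n distr ^'n" assume w: "w \<in> Sobolev s"
    then have t: "tempered (w $ i)" and "\<exists>g. represents g (distr_fourier (w $ i)) \<and>
        integrable lborel (\<lambda>\<xi>. (1 + (norm \<xi>)\<^sup>2) powr s * (cmod (g \<xi>))\<^sup>2)" for i
      unfolding Sobolev_def by auto
    then have "\<forall>i. \<exists>g. represents g (distr_fourier (w $ i)) \<and>
        integrable lborel (\<lambda>\<xi>. (1 + (norm \<xi>)\<^sup>2) powr s * (cmod (g \<xi>))\<^sup>2)" by blast
    from choice[OF this] obtain g where g: "\<And>i. represents (g i) (distr_fourier (w $ i))"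
      and int: "\<And>i. integrable lborel (\<lambda>\<xi>. (1 + (norm \<xi>)\<^sup>2) powr s * (cmod (g i \<xi>))\<^sup>2)" by blast
    have meas [measurable]: "g i \<in> borel_measurable borel" for i using g[of i] by (simp add: represents_def)
      \<comment> \<open>the coordinate of the \<open>i\<close>-th component: its transform divided by the weight\<close>
  define h where "h i = weighted (- s) (g i)" for i
    have h: "weighted s (h i) = g i" for i
    proof
      fix \<xi> :: "real^'n"
      have "inv_bracket \<xi> powr s * inv_bracket \<xi> powr (- s) = 1" using inv_bracket_powr_pos[of \<xi> s] by (simp add: powr_minus)
      then have "complex_of_real (inv_bracket \<xi> powr s) * complex_of_real (inv_bracket \<xi> powr (- s)) = 1"
        unfolding of_real_mult[symmetric] by simp
      then show "weighted s (h i) \<xi> = g i \<xi>" unfolding h_def weighted_def by (simp only: mult.assoc[symmetric] mult_1)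
    qed
    have "sqint (h i)" for i
    proof -
      have "(1 + (norm \<xi>)\<^sup>2) powr s * (cmod (g i \<xi>))\<^sup>2 = (cmod (h i \<xi>))\<^sup>2" for \<xi>
        using weighted_norm_sq[of \<xi> s "h i"] unfolding h .
      then show ?thesis using int[of i] unfolding sqint_def h_def by (simp add: weighted_measurable)
    qed
    note hq = this
    define u where "u = (\<chi> i. cls (h i))"
    have "w $ i = sob_distr s (u $ i)" for i
    proof
      fix \<phi> :: "real^'n \<Rightarrow> complex"
      show "(w $ i) \<phi> = sob_distr s (u $ i) \<phi>"
      proof (cases "\<phi> \<in> schwartz")
        case True
        note i = schwartz_inv_fourier[OF True]
        note [measurable] = schwartz_measurable[OF i]
        have "(w $ i) \<phi> = distr_fourier (w $ i) (inv_fourier \<phi>)"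
          by (simp add: distr_fourier_def i fourier_inv_fourier True)
        also have "\<dots> = (LINT \<xi>|lborel. weighted s (h i) \<xi> * inv_fourier \<phi> \<xi>)"
          using g[of i] i unfolding h represents_def by blast
        also have "\<dots> = (LINT \<xi>|lborel. weighted s (fn (u $ i)) \<xi> * inv_fourier \<phi> \<xi>)"
        proof (rule integral_cong_AE)
          show "AE \<xi> in lborel. weighted s (h i) \<xi> * inv_fourier \<phi> \<xi> = weighted s (fn (u $ i)) \<xi> * inv_fourier \<phi> \<xi>"
            using fn_cls[OF hq[of i]] by eventually_elim (simp add: u_def weighted_def)
        qed (use meas in \<open>simp_all add: h\<close>)
        finally show ?thesis by (simp add: sob_distr_eq True)
      qed (use t[of i] in \<open>simp add: tempered_def sob_distr_eq\<close>)
    qed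
    then have "w = Phi s u" by (simp add: vec_eq_iff)
    then show "w \<in> range (Phi s)" by blast
  qed
qed

lemma inj_Phi: assumes "-1 \<le> s" shows "inj (Phi s :: (real^'n::finite) l2 ^'n \<Rightarrow> _)"
proof (rule injI)
  fix u v :: "(real^'n) l2 ^'n"
  assume "Phi s u = Phi s v"
  then have "Phi s (u - v) = Phi s 0" using assms by (simp add: Phi_diff Phi_zero)
  from arg_cong[OF this, of "Sobolev_norm s"]
  show "u = v" by (simp add: Sobolev_norm_Phi[OF assms])
qed

lemma norm_fourier_const: "0 < cmod (fourier_const TYPE('n::finite))"
  using fourier_const_nonzero[where 'n='n] by simp

lemma L2_eq: "L2 = range (Phi 0 :: (real^'n::finite) l2 ^'n \<Rightarrow> _)"
proof
  show "range (Phi 0) \<subseteq> (L2 :: ('n distr ^'n) set)"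
  proof
    fix w :: "'n distr ^'n" assume "w \<in> range (Phi 0)"
    then obtain u where w: "w = Phi 0 u" by blast
    have "sqint (\<lambda>x. inverse (fourier_const TYPE('n)) * fn (ap to_space (u $ i)) x)" for i by (intro sqint_cmul sqint_fn)
    then show "w \<in> L2" unfolding L2_def mem_Collect_eq w Phi_nth sob_distr_0_distr_of sqint_def measurable_lborel2 by blast
  qed
  show "(L2 :: ('n distr ^'n) set) \<subseteq> range (Phi 0)"
  proof
    fix w :: "'n distr ^'n" assume "w \<in> L2"
    then have "\<forall>i. \<exists>f. sqint f \<and> w $ i = distr_of f"
      unfolding L2_def mem_Collect_eq sqint_def measurable_lborel2 by blast
    from choice[OF this] obtain f where f: "\<And>i. sqint (f i)" "\<And>i. w $ i = distr_of (f i)" by blast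
    define u where "u = (\<chi> i. ap to_freq (mul (\<lambda>x. fourier_const TYPE('n)) (cls (f i))))"
    have "w $ i = sob_distr 0 (u $ i)" for i
      unfolding f(2) sob_distr_0_distr_of
    proof (rule distr_of_cong)
      have U: "ap to_space (u $ i) = mul (\<lambda>x. fourier_const TYPE('n)) (cls (f i))"
        using to_space_to_freq unfolding u_def vec_lambda_beta by (metis ap_times ap_one)
      show "AE x in lborel. f i x = inverse (fourier_const TYPE('n)) * fn (ap to_space (u $ i)) x"
        unfolding U using fn_mul[OF bmult_const, of "fourier_const TYPE('n)" "cls (f i)"] fn_cls[OF f(1)[of i]]
        by eventually_elim (simp add: fourier_const_nonzero)
      show "f i \<in> borel_measurable borel" by (rule sqint_meas[OF f(1)])
      show "(\<lambda>x. inverse (fourier_const TYPE('n)) * fn (ap to_space (u $ i)) x) \<in> borel_measurable borel" by measurable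
    qed
    then have "w = Phi 0 u" by (simp add: vec_eq_iff)
    then show "w \<in> range (Phi 0)" by blast
  qed
qed

lemma L2_inner_Phi:
  fixes u v :: "(real^'n::finite) l2 ^'n"
  shows "L2_inner (Phi 0 u) (Phi 0 v) = inverse (fourier_const TYPE('n) * fourier_const TYPE('n)) * (\<Sum>i\<in>UNIV. cinner (u $ i) (v $ i))"
proof -
  have "(LINT x|lborel. density_of (sob_distr 0 y) x * cnj (density_of (sob_distr 0 z) x)) = inverse (fourier_const TYPE('n) * fourier_const TYPE('n)) * cinner y z" for y z :: "(real^'n) l2"
  proof -
    note d = density_of_AE[OF represents_sob_distr_0[of y]] density_of_AE[OF represents_sob_distr_0[of z]]
    note [measurable] = d(2,4)
    have "(LINT x|lborel. density_of (sob_distr 0 y) x * cnj (density_of (sob_distr 0 z) x))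
        = (LINT x|lborel. inverse (fourier_const TYPE('n) * fourier_const TYPE('n)) * (fn (ap to_space y) x * cnj (fn (ap to_space z) x)))"
      by (rule integral_cong_AE, measurable, use d(1,3) in eventually_elim, simp add: cnj_fourier_const)
    then show ?thesis using to_space_cinner[of y z] by (simp add: cinner_def)
  qed
  then show ?thesis by (simp add: L2_inner_def sum_distrib_left)
qed

lemma L2_norm_Phi:
  fixes u :: "(real^'n::finite) l2 ^'n"
  shows "L2_norm (Phi 0 u) = inverse (cmod (fourier_const TYPE('n))) * norm u"
proof -
  define k where "k = inverse (cmod (fourier_const TYPE('n)))"
  have k: "0 < k" using norm_fourier_const[where 'n='n] by (simp add: k_def)
  have "(LINT x|lborel. (cmod (density_of (sob_distr 0 y) x))\<^sup>2) = k\<^sup>2 * (norm y)\<^sup>2" for y :: "(real^'n) l2"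
  proof -
    note d = density_of_AE[OF represents_sob_distr_0[of y]]
    note [measurable] = d(2)
    have "(LINT x|lborel. (cmod (density_of (sob_distr 0 y) x))\<^sup>2) = (LINT x|lborel. k\<^sup>2 * (cmod (fn (ap to_space y) x))\<^sup>2)"
      by (rule integral_cong_AE, measurable, use d(1) in eventually_elim, simp add: k_def norm_mult norm_inverse power_mult_distrib)
    also have "\<dots> = k\<^sup>2 * (norm (ap to_space y))\<^sup>2" by (simp add: norm_l2_sq)
    finally show ?thesis by (simp add: to_space_norm)
  qed
  then show ?thesis using k
    by (simp add: L2_norm_def norm_vec_sq sum_distrib_left[symmetric] real_sqrt_mult k_def[symmetric])
qed

text \<open>In coordinates a bounded operator between Sobolev spaces is a matrix of bounded operators.\<close>

lemma bounded_operator_Sobolev: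
  fixes X :: "(real^'n::finite) bop ^'n^'n"
  assumes "-1 \<le> s" "-1 \<le> t" and T: "\<And>u. T (Phi s u) = Phi t (ap_mat X u)"
  shows "bounded_operator (Sobolev s) (Sobolev_norm s) (Sobolev t) (Sobolev_norm t) T"
proof -
  obtain C where "\<And>u. norm (ap_mat X u) \<le> C * norm u" using ap_mat_bound[of X] by blast
  then show ?thesis
    unfolding bounded_operator_def Sobolev_eq[OF assms(1)] Sobolev_eq[OF assms(2)]
    by (auto simp: T Phi_add[symmetric] ap_mat_add Phi_scale ap_mat_cmul_vec Sobolev_norm_Phi assms simp del: ap_mat_nth)
qed

lemma bounded_operator_L2:
  fixes X :: "(real^'n::finite) bop ^'n^'n"
  assumes T: "\<And>u. T (Phi 0 u) = Phi 0 (ap_mat X u)"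
  shows "bounded_operator L2 L2_norm L2 L2_norm T"
proof -
  obtain C where C: "\<And>u. norm (ap_mat X u) \<le> C * norm u" using ap_mat_bound[of X] by blast
  have "L2_norm (Phi 0 (ap_mat X u)) \<le> C * L2_norm (Phi 0 u)" for u
    unfolding L2_norm_Phi using mult_left_mono[OF C[of u], of "inverse (cmod (fourier_const TYPE('n)))"] by (simp add: mult.left_commute)
  then show ?thesis
    unfolding bounded_operator_def L2_eq
    by (auto simp: T Phi_add[symmetric] ap_mat_add Phi_scale ap_mat_cmul_vec)
qed

lemma cinner_sum:
  assumes "adj_mat X = Y"
  shows "(\<Sum>i\<in>UNIV. cinner (ap_mat X u $ i) (v $ i)) = (\<Sum>i\<in>UNIV. cinner (u $ i) (ap_mat Y v $ i))"
proof -
  have r: "(\<Sum>i\<in>UNIV. ap_mat X u $ i \<bullet> v $ i) = (\<Sum>i\<in>UNIV. u $ i \<bullet> ap_mat Y v $ i)" for v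
  proof -
    have "(\<Sum>i\<in>UNIV. ap_mat X u $ i \<bullet> v $ i) = (\<Sum>i\<in>UNIV. \<Sum>j\<in>UNIV. u $ j \<bullet> ap (adj (X $ i $ j)) (v $ i))"
      by (simp add: inner_sum_left adj')
    also have "\<dots> = (\<Sum>j\<in>UNIV. \<Sum>i\<in>UNIV. u $ j \<bullet> ap (adj (X $ i $ j)) (v $ i))" by (rule sum.swap)
    finally show ?thesis by (simp add: assms[symmetric] inner_sum_right)
  qed
  have i: "imul (ap_mat Y v $ i) = ap_mat Y (cmul_vec \<i> v) $ i" for i
    unfolding ap_mat_cmul_vec by (simp add: cmul_vec_def)
  show ?thesis
    using r[of v] r[of "cmul_vec \<i> v"]
    unfolding cinner_eq i by (simp add: complex_eq_iff Re_sum Im_sum cmul_vec_def del: ap_mat_nth)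
qed

lemma fn_sum: "finite I \<Longrightarrow> AE x in lborel. fn (sum u I) x = (\<Sum>i\<in>I. fn (u i) x)"
proof (induction I rule: finite_induct)
  case (insert i I)
  show ?case using insert(3) fn_add[of "u i" "sum u I"] by eventually_elim (simp add: insert)
qed (use fn_zero in simp)

context lame
begin

lemma proj_P_Phi: assumes s: "-1 \<le> s" shows "proj_P (Phi s u) = Phi s (ap_mat Pm u)"
  unfolding vec_eq_iff
proof
  fix i
  define m where "m l \<xi> = complex_of_real (\<xi> $ i / norm \<xi> * (\<xi> $ l / norm \<xi>))" for l and \<xi> :: "real^'n"
  have m: "bmult (m l)" for l unfolding m_def by (intro rmult_intros rmult_riesz)
  have Pm: "Pm $ i $ l = mop (m l)" for l
    by (simp only: Pm_def riesz_def m_def[abs_def] rop_times rmult_riesz vec_lambda_beta)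
  define f where "f \<xi> = (\<Sum>l\<in>UNIV. m l \<xi> * fourier_density (sob_distr s (u $ l)) \<xi>)" for \<xi>
  have e: "((\<chi> i l. complex_of_real (\<xi> $ i * \<xi> $ l / (norm \<xi>)\<^sup>2)) *v (\<chi> l. fourier_density (Phi s u $ l) \<xi>)) $ i = f \<xi>" for \<xi> :: "real^'n"
    by (simp add: f_def m_def matrix_vector_mult_def power2_eq_square)
  have "distr_inv_fourier (distr_of f) = sob_distr s (ap_mat Pm u $ i)"
  proof (rule sob_distr_cong)
    have a: "AE \<xi> in lborel. \<forall>l. fourier_density (sob_distr s (u $ l)) \<xi> = weighted s (fn (u $ l)) \<xi>"
      by (intro AE_all_countable[THEN iffD2] allI fourier_density_sob_distr(1)[OF s])
    have b: "AE \<xi> in lborel. \<forall>l. fn (mul (m l) (u $ l)) \<xi> = m l \<xi> * fn (u $ l) \<xi>"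
      by (intro AE_all_countable[THEN iffD2] allI fn_mul m)
    show "AE \<xi> in lborel. f \<xi> = weighted s (fn (ap_mat Pm u $ i)) \<xi>"
      unfolding ap_mat_nth Pm ap_mop[OF m] using a b fn_sum[OF finite[of UNIV], of "\<lambda>l. mul (m l) (u $ l)"]
      by eventually_elim (simp add: f_def weighted_def sum_distrib_left mult.left_commute)
    note [measurable] = fourier_density_sob_distr(2)[OF s] bmult_meas[OF m]
    show "f \<in> borel_measurable borel" unfolding f_def[abs_def] by measurable
  qed
  then show "proj_P (Phi s u) $ i = Phi s (ap_mat Pm u) $ i"
    unfolding proj_P_def fourier_multiplier_def vec_lambda_beta e unfolding Phi_nth .
qed

lemma proj_S_Phi: assumes s: "-1 \<le> s" shows "proj_S (Phi s u) = Phi s (ap_mat Sm u)"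
proof -
  have "ap_mat Sm u = u - ap_mat Pm u"
    unfolding Sm_def ap_mat_diff ap_mat_mat by simp
  then show ?thesis by (simp add: proj_S_def proj_P_Phi s Phi_diff)
qed

text \<open>In coordinates each derivative becomes \<open>\<partial>\<^sub>k J\<close> and lowers the Sobolev exponent by one.\<close>

lemma elasticity_Phi: "elasticity mu lam (Phi 1 u) = Phi (-1) (ap_mat Am u)"
  unfolding vec_eq_iff
proof
  fix i
  have d1: "distr_deriv k (sob_distr 1 y) = sob_distr 0 (ap (DJ k) y)" "distr_deriv k (sob_distr 0 y) = sob_distr (-1) (ap (DJ k) y)" for k y
    using distr_deriv_sob_distr[of k 0 y] distr_deriv_sob_distr[of k "-1" y] by simp_all
  have a: "sob_distr 0 y + sob_distr 0 z = sob_distr 0 (y + z)" "sob_distr (-1) y + sob_distr (-1) z = sob_distr (-1) (y + z)" for y z :: "(real^'n) l2"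
    by (simp_all add: sob_distr_add)
  have "elasticity mu lam (Phi 1 u) $ i = sob_distr (-1) (\<Sum>k\<in>UNIV. ap (DJ k) (ap (mult_by mu) (ap (DJ k) (u $ i) + ap (DJ i) (u $ k))) + ap (DJ i) (ap (mult_by lam) (ap (DJ k) (u $ k))))"
    by (simp add: elasticity_def d1 a distr_mult_sob_distr_0 rmults sob_distr_sum)
  also have "(\<Sum>k\<in>UNIV. ap (DJ k) (ap (mult_by mu) (ap (DJ k) (u $ i) + ap (DJ i) (u $ k))) + ap (DJ i) (ap (mult_by lam) (ap (DJ k) (u $ k)))) = ap_mat Am u $ i"
  proof -
    have "ap_mat (mat t) u $ i = (\<Sum>k\<in>UNIV. ap (DJ k) (ap (mult_by mu) (ap (DJ k) (u $ i))))"
      by (simp only: ap_mat_mat vec_lambda_beta t_def ap_sum ap_times)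
    moreover have "ap_mat Am u $ i = ap_mat (mat t) u $ i + ap_mat Qm u $ i + ap_mat Lm u $ i"
      unfolding Am_def ap_mat_plus by simp
    ultimately show ?thesis
      by (simp add: Qm_def Lm_def ap_add sum.distrib)
  qed
  finally show "elasticity mu lam (Phi 1 u) $ i = Phi (-1) (ap_mat Am u) $ i" by simp
qed

text \<open>The operator \<open>K\<close> is defined on \<open>H\<^sup>-\<^sup>1\<close>, the largest of its domains, by \<open>T1\<close>.\<close>

definition K_op :: "'n distr ^'n \<Rightarrow> 'n distr ^'n" where
  "K_op w = Phi 0 (ap_mat T1 (inv (Phi (-1)) w))"

lemma K_op_Phi: "K_op (Phi (-1) u) = Phi 0 (ap_mat T1 u)"
  by (simp add: K_op_def inv_f_f inj_Phi)

lemma K_op_Phi_0: "K_op (Phi 0 u) = Phi 1 (ap_mat T2 u)"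
proof -
  have "K_op (Phi 0 u) = K_op (Phi (-1) (ap_mat (mat Bessel) u))" by (simp add: Phi_J)
  also have "\<dots> = Phi 0 (ap_mat (mat Bessel) (ap_mat T2 u))" by (simp only: K_op_Phi ap_mat_times[symmetric] T1_J)
  finally show ?thesis by (simp add: Phi_J)
qed

lemma K_op_Phi_1: "K_op (Phi 1 u) = Phi 1 (ap_mat (T2 ** mat Bessel) u)"
  using K_op_Phi_0[of "ap_mat (mat Bessel) u"] by (simp add: Phi_J ap_mat_times)

text \<open>The exponents \<open>s = -1\<close> and \<open>s = 1\<close> are boundedness of \<open>T1\<close> and \<open>T1_smoothing\<close>; interpolation between
  them is applied to each matrix entry.\<close>

lemma K_op_order:
  assumes "-1 \<le> s" "s \<le> 1"
  shows "bounded_operator (Sobolev s) (Sobolev_norm s) (Sobolev (s + 1)) (Sobolev_norm (s + 1)) K_op"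
proof -
  obtain X where X: "T1 ** mat (Bessel * Bessel) = mat (Bessel * Bessel) ** X" using T1_smoothing by blast
  define p :: "(real^'n) bop" where "p = cay.Jp (s + 1)"
  have "\<exists>Z. T1 $ i $ j * p = p * Z" for i j
  proof -
    have "T1 $ i $ j * (cay.J * cay.J) = cay.J * cay.J * X $ i $ j"
      using X by (simp add: vec_eq_iff cay.J_def)
    then show ?thesis using cay.interpolation[of "T1 $ i $ j" "X $ i $ j" "s + 1"] assms unfolding p_def by auto
  qed
  then obtain z where z: "\<And>i j. T1 $ i $ j * p = p * z i j" by metis
  define Z where "Z = (\<chi> i j. z i j)"
  have Z: "T1 ** mat p = mat p ** Z" by (simp add: vec_eq_iff Z_def z)
  have w: "Phi t (ap_mat (mat p) u) = Phi (t + (s + 1)) u" for t and u :: "(real^'n) l2 ^'n"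
    unfolding p_def cay.Jp_def using assms by (intro Phi_powr) simp
  have "K_op (Phi s u) = Phi (s + 1) (ap_mat Z u)" for u
  proof -
    have "K_op (Phi s u) = K_op (Phi (-1) (ap_mat (mat p) u))" by (simp add: w)
    also have "\<dots> = Phi 0 (ap_mat (mat p) (ap_mat Z u))" by (simp only: K_op_Phi ap_mat_times[symmetric] Z)
    finally show ?thesis by (simp add: w)
  qed
  then show ?thesis using assms by (intro bounded_operator_Sobolev) auto
qed

text \<open>Errors of the form \<open>J B J\<close> are bounded on \<open>L\<^sup>2\<close>, because \<open>H\<^sup>1\<close> and \<open>H\<^sup>-\<^sup>1\<close> are \<open>J L\<^sup>2\<close> and
  \<open>J\<^sup>-\<^sup>1 L\<^sup>2\<close>.\<close>

lemma L2_remainder: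
  "\<exists>R. bounded_operator L2 L2_norm L2 L2_norm R \<and> (\<forall>u. R (Phi 1 u) = Phi (-1) (ap_mat (mat Bessel ** B ** mat Bessel) u))"
proof (intro exI conjI allI)
  define R where "R w = Phi 0 (ap_mat B (inv (Phi 0) w))" for w
  have R: "R (Phi 0 u) = Phi 0 (ap_mat B u)" for u by (simp add: R_def inv_f_f inj_Phi)
  then show "bounded_operator L2 L2_norm L2 L2_norm R" by (rule bounded_operator_L2)
  show "R (Phi 1 u) = Phi (-1) (ap_mat (mat Bessel ** B ** mat Bessel) u)" for u
    using R[of "ap_mat (mat Bessel) u"] by (simp add: Phi_J ap_mat_times)
qed

theorem K_op_decouples:
  "\<exists>RP RS. bounded_operator L2 L2_norm L2 L2_norm RP \<and> bounded_operator L2 L2_norm L2 L2_norm RS \<and>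
    (\<forall>w\<in>Sobolev 1.
       proj_P (elasticity mu lam w + K_op (elasticity mu lam w)) = elasticity_PP mu lam (w + K_op w) + RP w \<and>
       proj_S (elasticity mu lam w + K_op (elasticity mu lam w)) = elasticity_SS mu lam (w + K_op w) + RS w)"
proof -
  obtain BP where BP: "Pm ** Am + mat Bessel ** Pm ** T1 ** Am = Pm ** Am ** Pm ** (mat 1 + T2 ** mat Bessel) + mat Bessel ** BP ** mat Bessel"
    using Pm_error by blast
  obtain BS where BS: "Sm ** Am + mat Bessel ** Sm ** T1 ** Am = Sm ** Am ** Sm ** (mat 1 + T2 ** mat Bessel) + mat Bessel ** BS ** mat Bessel"
    using Sm_error by blast
  obtain RP where RP: "bounded_operator L2 L2_norm L2 L2_norm RP" "\<And>u. RP (Phi 1 u) = Phi (-1) (ap_mat (mat Bessel ** BP ** mat Bessel) u)"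
    using L2_remainder by blast
  obtain RS where RS: "bounded_operator L2 L2_norm L2 L2_norm RS" "\<And>u. RS (Phi 1 u) = Phi (-1) (ap_mat (mat Bessel ** BS ** mat Bessel) u)"
    using L2_remainder by blast
  have 1: "elasticity mu lam (Phi 1 u) + K_op (elasticity mu lam (Phi 1 u)) = Phi (-1) (ap_mat (Am + mat Bessel ** T1 ** Am) u)" for u
  proof -
    have "Phi 0 (ap_mat T1 (ap_mat Am u)) = Phi (-1) (ap_mat (mat Bessel ** T1 ** Am) u)"
      using Phi_J[of "-1" "ap_mat T1 (ap_mat Am u)"] by (simp add: ap_mat_times)
    then show ?thesis by (simp only: elasticity_Phi K_op_Phi ap_mat_plus Phi_add order_refl)
  qed
  have 2: "Phi 1 u + K_op (Phi 1 u) = Phi 1 (ap_mat (mat 1 + T2 ** mat Bessel) u)" for u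
    by (simp add: K_op_Phi_1 ap_mat_plus ap_mat_mat Phi_add)
  have "proj_P (elasticity mu lam w + K_op (elasticity mu lam w)) = elasticity_PP mu lam (w + K_op w) + RP w \<and>
       proj_S (elasticity mu lam w + K_op (elasticity mu lam w)) = elasticity_SS mu lam (w + K_op w) + RS w"
    if "w \<in> Sobolev 1" for w
  proof -
    have "w \<in> range (Phi 1)" using that by (simp add: Sobolev_eq)
    then obtain u where w: "w = Phi 1 u" by blast
    have "Pm ** (Am + mat Bessel ** T1 ** Am) = Pm ** Am + mat Bessel ** Pm ** T1 ** Am"
      by (simp add: matrix_distribs matrix_mul_assoc Pm_J)
    then have P: "proj_P (elasticity mu lam w + K_op (elasticity mu lam w)) = Phi (-1) (ap_mat (Pm ** Am + mat Bessel ** Pm ** T1 ** Am) u)"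
      unfolding w 1 by (simp add: proj_P_Phi flip: ap_mat_times)
    have "Sm ** (Am + mat Bessel ** T1 ** Am) = Sm ** Am + mat Bessel ** Sm ** T1 ** Am"
      by (simp add: matrix_distribs matrix_mul_assoc Sm_J)
    then have S: "proj_S (elasticity mu lam w + K_op (elasticity mu lam w)) = Phi (-1) (ap_mat (Sm ** Am + mat Bessel ** Sm ** T1 ** Am) u)"
      unfolding w 1 by (simp add: proj_S_Phi flip: ap_mat_times)
    have PP: "elasticity_PP mu lam (w + K_op w) = Phi (-1) (ap_mat (Pm ** Am ** Pm ** (mat 1 + T2 ** mat Bessel)) u)"
      unfolding w 2 elasticity_PP_def by (simp add: proj_P_Phi elasticity_Phi ap_mat_times)
    have SS: "elasticity_SS mu lam (w + K_op w) = Phi (-1) (ap_mat (Sm ** Am ** Sm ** (mat 1 + T2 ** mat Bessel)) u)"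
      unfolding w 2 elasticity_SS_def by (simp add: proj_S_Phi elasticity_Phi ap_mat_times)
    show ?thesis
      unfolding P S PP SS unfolding w RP(2) RS(2) BP BS by (simp only: ap_mat_plus Phi_add order_refl)
  qed
  then show ?thesis using RP(1) RS(1) by blast
qed

lemma K_op_diagonal:
  assumes "w \<in> Sobolev (-1)" shows "proj_P (K_op (proj_P w)) = 0" "proj_S (K_op (proj_S w)) = 0"
proof -
  have "w \<in> range (Phi (-1))" using assms by (simp add: Sobolev_eq)
  then obtain u where w: "w = Phi (-1) u" by blast
  show "proj_P (K_op (proj_P w)) = 0"
    unfolding w by (simp add: proj_P_Phi K_op_Phi T_diagonal ap_mat_zero Phi_zero matrix_mul_assoc flip: ap_mat_times)
  show "proj_S (K_op (proj_S w)) = 0"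
    unfolding w by (simp add: proj_S_Phi K_op_Phi T_diagonal ap_mat_zero Phi_zero matrix_mul_assoc flip: ap_mat_times)
qed

lemma K_op_adjoint: "is_L2_adjoint (\<lambda>w. - proj_P (K_op (proj_S w))) (\<lambda>w. proj_S (K_op (proj_P w)))"
proof -
  define X where "X = mat Bessel ** Sm ** T2 ** Pm"
  define Y where "Y = - (mat Bessel ** Pm ** T2 ** Sm)"
  have XY: "adj_mat X = Y" unfolding X_def Y_def by (rule T_adjoint)
  have X: "proj_S (K_op (proj_P (Phi 0 u))) = Phi 0 (ap_mat X u)" for u
  proof -
    have "proj_S (K_op (proj_P (Phi 0 u))) = Phi 1 (ap_mat Sm (ap_mat T2 (ap_mat Pm u)))"
      by (simp add: proj_P_Phi proj_S_Phi K_op_Phi_0)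
    also have "\<dots> = Phi 0 (ap_mat (mat Bessel) (ap_mat Sm (ap_mat T2 (ap_mat Pm u))))" by (simp add: Phi_J)
    finally show ?thesis by (simp only: X_def ap_mat_times)
  qed
  have Y: "- proj_P (K_op (proj_S (Phi 0 u))) = Phi 0 (ap_mat Y u)" for u
  proof -
    have "proj_P (K_op (proj_S (Phi 0 u))) = Phi 1 (ap_mat Pm (ap_mat T2 (ap_mat Sm u)))"
      by (simp add: proj_P_Phi proj_S_Phi K_op_Phi_0)
    also have "\<dots> = Phi 0 (ap_mat (mat Bessel) (ap_mat Pm (ap_mat T2 (ap_mat Sm u))))" by (simp add: Phi_J)
    finally show ?thesis by (simp only: Y_def ap_mat_minus Phi_minus ap_mat_times)
  qed
  show ?thesis
    unfolding is_L2_adjoint_def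
  proof (intro conjI ballI)
    show "bounded_operator L2 L2_norm L2 L2_norm (\<lambda>w. - proj_P (K_op (proj_S w)))" by (rule bounded_operator_L2[OF Y])
    show "bounded_operator L2 L2_norm L2 L2_norm (\<lambda>w. proj_S (K_op (proj_P w)))" by (rule bounded_operator_L2[OF X])
    fix v w :: "'n distr ^'n" assume "v \<in> L2" "w \<in> L2"
    then obtain a b where ab: "v = Phi 0 a" "w = Phi 0 b" unfolding L2_eq by blast
    show "L2_inner (proj_S (K_op (proj_P v))) w = L2_inner v (- proj_P (K_op (proj_S w)))"
      unfolding ab X Y L2_inner_Phi cinner_sum[OF XY] ..
  qed
qed

end

theorem lemma1:
  fixes mu lam :: "real^'n::finite \<Rightarrow> real"
  assumes "C11 mu" and "C11 lam"
    and "\<exists>c>0. \<forall>x. c \<le> \<bar>lam x + mu x\<bar>"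
  shows "\<exists>K :: 'n distr ^ 'n \<Rightarrow> 'n distr ^ 'n.
    (\<forall>s. -1 \<le> s \<and> s \<le> 1 \<longrightarrow>
       bounded_operator (Sobolev s) (Sobolev_norm s) (Sobolev (s + 1)) (Sobolev_norm (s + 1)) K) \<and>
    (\<exists>R\<^sub>P R\<^sub>S.
       bounded_operator L2 L2_norm L2 L2_norm R\<^sub>P \<and>
       bounded_operator L2 L2_norm L2 L2_norm R\<^sub>S \<and>
       (\<forall>w\<in>Sobolev 1.
          proj_P (elasticity mu lam w + K (elasticity mu lam w))
            = elasticity_PP mu lam (w + K w) + R\<^sub>P w \<and>
          proj_S (elasticity mu lam w + K (elasticity mu lam w))
            = elasticity_SS mu lam (w + K w) + R\<^sub>S w)) \<and>
    (\<forall>w\<in>Sobolev (-1). proj_P (K (proj_P w)) = 0 \<and> proj_S (K (proj_S w)) = 0) \<and>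
    is_L2_adjoint (\<lambda>w. - proj_P (K (proj_S w))) (\<lambda>w. proj_S (K (proj_P w)))"
proof -
  obtain g where g: "bdd_lip mu" "\<And>k. bdd_lip (\<lambda>x. g x $ k)" "\<And>k x. (\<lambda>n. diff_deriv_quot k (1 / real (Suc n)) mu x) \<longlonglongrightarrow> g x $ k"
    using C11_gradient[OF assms(1)] by blast
  have lam: "bdd_lip lam" using C11_gradient[OF assms(2)] by blast
  obtain c where c: "0 < c" "\<And>x. c \<le> \<bar>lam x + mu x\<bar>" using assms(3) by blast
  interpret lame mu lam g c by unfold_locales (use g lam c in auto)
  show ?thesis
    by (intro exI[of _ K_op] conjI allI impI ballI K_op_decouples K_op_adjoint K_op_diagonal) (use K_op_order in auto)
qed

end
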